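(* Let $m\ge 1$ be a fixed integer, let $T_N$ ($N\ge 1$) be the $mN\times mN$ random block Toeplitz band matrices with $m\times m$ blocks and bandwidth $b_N$ described in the context (with $A_{-s}=A_s^T$, the independence and moment conditions, $b_N\to\infty$ and $b_N=o(N)$), and set $X_N=\frac{T_N}{\sqrt{2mb_N}}$. Then the eigenvalue distribution $\mu_{X_N}$ converges weakly, as $N\to\infty$, to the measure $f_m(x)\,dx$, where $$f_m(x)=\frac{1}{\sqrt m}\sum_{j=0}^{m-1}\psi_j^2(\sqrt m\,x),\qquad \psi_j(x)=\frac{e^{-x^2/4}H_j(x)}{\sqrt{\sqrt{2\pi}\,j!}},\qquad H_j(x)=(-1)^j e^{x^2/2}\frac{d^j}{dx^j}e^{-x^2/2}.$$ Moreover, if $\sum_{N=1}^{\infty}b_N^{-2}<\infty$, then the convergence is almost sure, i.e. almost surely the (random) empirical eigenvalue distribution of $X_N$ converges weakly to $f_m(x)\,dx$ as $N\to\infty$.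
   Context: Model. For every $m\ge 1$ and $N\ge1$ let $T_N=(A_{i-j})_{i,j=1}^N$ be a block Toeplitz matrix, where the $A_s=(a_{ij}(s))_{i,j=1}^m$, $-(N-1)\le s\le N-1$, are $m\times m$ matrices of real random variables with $A_{-s}=(A_s)^T$ for all $s$ (so $T_N$ is a real symmetric $mN\times mN$ matrix; in particular $A_0$ is symmetric). The dependence of the entries on $m$ and $N$ is suppressed in the notation; for fixed $m$ all the matrices $T_N$, $N\ge1$, are defined on a common probability space. Band condition: $(b_N)$ is a sequence of positive integers with $b_N\to\infty$ and $b_N=o(N)$ as $N\to\infty$, and $A_s=0$ whenever $|s|>b_N$. Independence: for each $N$, the random variables $a_{ij}(s)$ with $1\le s\le \min(b_N,N-1)$, $1\le i,j\le m$, together with $a_{ij}(0)$, $1\le i\le j\le m$, are mutually independent. Moments: for all $|s|\le \min(b_N,N-1)$ and $1\le i,j\le m$, $\mathbb{E}[a_{ij}(s)]=0$ and $\mathbb{E}[|a_{ij}(s)|^2]=1$. For every positive integer $k$, the supremum $C_{k,m}$ of $\mathbb{E}[|a_{ij}(s)|^k]$ over all $N\ge1$, $-(N-1)\le s\le N-1$ and $1\le i,j\le m$ is finite, and $\sup_{m}C_{k,m}<\infty$. Eigenvalue distribution. For a real symmetric or complex Hermitian $n\times n$ random matrix $A$ on a probability space $(\Omega,P)$ with real eigenvalues $\lambda_1(\omega),\dots,\lambda_n(\omega)$, its empirical eigenvalue distribution is the random measure $\frac1n\sum_{j=1}^n\delta_{\lambda_j(\omega)}$, and its eigenvalue distribution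 is the averaged measure $\mu_A=\frac1n\int_\Omega\sum_{j=1}^n\delta_{\lambda_j(\omega)}\,dP(\omega)$. *)

theory Defs
  imports
    "HOL-Probability.Probability"
    "HOL-Library.Landau_Symbols"
    "Jordan_Normal_Form.Char_Poly"
begin

text \<open>
  Eigenvalues are counted with multiplicity.  For a real symmetric matrix the characteristic
  polynomial splits over the reals and algebraic and geometric multiplicities agree, so the list
  below then has length \<open>dim_row A\<close>.
\<close>

definition eigenvalue_list :: "real mat \<Rightarrow> real list" where
  "eigenvalue_list A = sorted_list_of_multiset (proots (char_poly A))"

text \<open>
  The push-forward of the uniform distribution on the indices \<open>0, \<dots>, n - 1\<close> under
  \<open>j \<mapsto> \<lambda>\<^sub>j\<close>, that is, \<open>(1 / n) \<Sum>\<^sub>j \<delta>(\<lambda>\<^sub>j)\<close>.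
\<close>

definition empirical_eigenvalue_distribution :: "real mat \<Rightarrow> real measure" where
  "empirical_eigenvalue_distribution A =
     distr (uniform_count_measure {..<dim_row A}) borel (\<lambda>j. eigenvalue_list A ! j)"

text \<open>
  The monadic \<open>bind\<close> of measures is the mixture
  \<open>B \<mapsto> \<integral> empirical_eigenvalue_distribution (X \<omega>) B dM(\<omega>)\<close>.
\<close>

definition eigenvalue_distribution :: "'a measure \<Rightarrow> ('a \<Rightarrow> real mat) \<Rightarrow> real measure" where
  "eigenvalue_distribution M X = bind M (\<lambda>\<omega>. empirical_eigenvalue_distribution (X \<omega>))"

text \<open>
  Indices of blocks and of entries start at \<open>0\<close>: row \<open>p < m * N\<close> lies in block row \<open>p div m\<close>, at
  position \<open>p mod m\<close> inside that block.
\<close>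

definition block_toeplitz :: "nat \<Rightarrow> nat \<Rightarrow> (int \<Rightarrow> real mat) \<Rightarrow> real mat" where
  "block_toeplitz m N B =
     mat (m * N) (m * N)
       (\<lambda>(p, q). B (int (p div m) - int (q div m)) $$ (p mod m, q mod m))"

definition moment_sup ::
  "'a measure \<Rightarrow> nat \<Rightarrow> (nat \<Rightarrow> int \<Rightarrow> 'a \<Rightarrow> real mat) \<Rightarrow> nat \<Rightarrow> ennreal"
where
  "moment_sup M m A k =
     (\<Squnion>(N, s, i, j)\<in>{(N, s, i, j). 1 \<le> N \<and> \<bar>s\<bar> \<le> int N - 1 \<and> i < m \<and> j < m}.
        \<integral>\<^sup>+\<omega>. ennreal (\<bar>A N s \<omega> $$ (i, j)\<bar> ^ k) \<partial>M)"

text \<open>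
  The block \<open>A N s \<omega>\<close> is the value at \<open>\<omega>\<close> of the block \<open>A\<^sub>s\<close> of the matrix \<open>T\<^sub>N\<close>; only the
  indices \<open>\<bar>s\<bar> \<le> N - 1\<close> are meaningful.  Integrability in \<open>centered\<close> follows from \<open>moments\<close>.
\<close>

locale random_block_toeplitz_band = prob_space M
  for M :: "'a measure" +
  fixes m :: nat
    and b :: "nat \<Rightarrow> nat"
    and A :: "nat \<Rightarrow> int \<Rightarrow> 'a \<Rightarrow> real mat"
  assumes block_carrier:
      "\<lbrakk>1 \<le> N; \<bar>s\<bar> \<le> int N - 1; \<omega> \<in> space M\<rbrakk> \<Longrightarrow> A N s \<omega> \<in> carrier_mat m m"
    and entry_measurable:
      "\<lbrakk>1 \<le> N; \<bar>s\<bar> \<le> int N - 1; i < m; j < m\<rbrakk> \<Longrightarrow>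
         random_variable borel (\<lambda>\<omega>. A N s \<omega> $$ (i, j))"
    and block_transpose:
      "\<lbrakk>1 \<le> N; \<bar>s\<bar> \<le> int N - 1; \<omega> \<in> space M\<rbrakk> \<Longrightarrow>
         A N (- s) \<omega> = transpose_mat (A N s \<omega>)"
    and bandwidth_pos: "1 \<le> N \<Longrightarrow> 1 \<le> b N"
    and bandwidth_at_top: "filterlim b at_top sequentially"
    and bandwidth_small: "(\<lambda>N. real (b N)) \<in> o(\<lambda>N. real N)"
    and band:
      "\<lbrakk>1 \<le> N; \<bar>s\<bar> \<le> int N - 1; int (b N) < \<bar>s\<bar>; \<omega> \<in> space M\<rbrakk> \<Longrightarrow>
         A N s \<omega> = 0\<^sub>m m m"
    and independent:
      "1 \<le> N \<Longrightarrow>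
         indep_vars (\<lambda>_. borel) (\<lambda>(s, i, j) \<omega>. A N s \<omega> $$ (i, j))
           ({(s, i, j). 1 \<le> s \<and> s \<le> min (int (b N)) (int N - 1) \<and> i < m \<and> j < m} \<union>
            {(s, i, j). s = 0 \<and> i \<le> j \<and> j < m})"
    and centered:
      "\<lbrakk>1 \<le> N; \<bar>s\<bar> \<le> min (int (b N)) (int N - 1); i < m; j < m\<rbrakk> \<Longrightarrow>
         expectation (\<lambda>\<omega>. A N s \<omega> $$ (i, j)) = 0"
    and unit_variance:
      "\<lbrakk>1 \<le> N; \<bar>s\<bar> \<le> min (int (b N)) (int N - 1); i < m; j < m\<rbrakk> \<Longrightarrow>
         expectation (\<lambda>\<omega>. \<bar>A N s \<omega> $$ (i, j)\<bar>\<^sup>2) = 1"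
    and moments: "1 \<le> k \<Longrightarrow> moment_sup M m A k < \<top>"

definition normalized_block_toeplitz ::
  "nat \<Rightarrow> (nat \<Rightarrow> nat) \<Rightarrow> (nat \<Rightarrow> int \<Rightarrow> 'a \<Rightarrow> real mat) \<Rightarrow> nat \<Rightarrow> 'a \<Rightarrow> real mat"
where
  "normalized_block_toeplitz m b A N \<omega> =
     (1 / sqrt (2 * real m * real (b N))) \<cdot>\<^sub>m block_toeplitz m N (\<lambda>s. A N s \<omega>)"

definition hermite :: "nat \<Rightarrow> real \<Rightarrow> real" where
  "hermite j x = (- 1) ^ j * exp (x\<^sup>2 / 2) * (deriv ^^ j) (\<lambda>t. exp (- t\<^sup>2 / 2)) x"

definition hermite_function :: "nat \<Rightarrow> real \<Rightarrow> real" where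
  "hermite_function j x = exp (- x\<^sup>2 / 4) * hermite j x / sqrt (sqrt (2 * pi) * fact j)"

definition limit_density :: "nat \<Rightarrow> real \<Rightarrow> real" where
  "limit_density m x =
     (1 / sqrt (real m)) * (\<Sum>j<m. (hermite_function j (sqrt (real m) * x))\<^sup>2)"

definition limit_distribution :: "nat \<Rightarrow> real measure" where
  "limit_distribution m = density lborel (\<lambda>x. ennreal (limit_density m x))"

end

theory Submission
  imports Defs "Jordan_Normal_Form.Schur_Decomposition"
begin

text \<open>
  Both convergence statements are proved through moments and Levy's continuity theorem. Away from
  the \<open>O(b\<^sub>N)\<close> block rows near the boundary, the diagonal blocks of \<open>X\<^sub>N\<^sup>k\<close> are the averages over
  \<open>\<theta>\<close> of \<open>h(\<theta>)\<^sup>k\<close>, where \<open>h(\<theta>) = (2 m b\<^sub>N)\<^bsup>-1/2\<^esup> \<Sum>\<^sub>s A\<^sub>s e\<^bsup>is\<theta>\<^esup>\<close> is the symbol. Unless \<open>e\<^bsup>2i\<theta>\<^esup> = 1\<close>, the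
  Hermitian \<open>m \<times> m\<close> matrix \<open>h(\<theta>)\<close> is in the limit a Gaussian unitary ensemble of variance \<open>1 / m\<close>,
  because its mixed moments satisfy Wick's rule up to \<open>o(1)\<close>. So the limiting moments are those of
  this ensemble.

  The moments of the ensemble are computed without its eigenvalue density. Applying Wick's rule,
  that is, Gaussian integration by parts, to the elementary symmetric polynomials of the numbers
  \<open>1 / (u - \<lambda>\<^sub>i)\<close>, \<open>\<lambda>\<^sub>i\<close> the eigenvalues, yields a finite system of differential equations in \<open>u\<close> for
  their expectations, which determines the expected trace of the resolvent; the Hermite kernel
  gives the same moments.

  For the almost sure statement, an Efron--Stein type inequality bounds the eighth central moment of
  the \<open>k\<close>-th empirical moment by \<open>O(b\<^sub>N\<^bsup>-2\<^esup>)\<close>, which is summable by assumption.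
\<close>

subsection \<open>Polynomial functions in finitely many variables\<close>

text \<open>The obstacle in the limit ensemble is that integration by parts applied to the trace of
  the resolvent R yields the product of tr R and tr R^2, whose expectation is a new unknown. On the
  elementary symmetric polynomials e_r the Laplacian becomes linear: it sends e_r to e_r'' - 2 r
  e_{r+1}', the prime being d/du. The computation takes place in power series in 1 / u whose
  coefficients are polynomials in the matrix entries, so it needs neither convergence in u nor the
  eigenvalues, and the limit functional only has to be known on monomials.

  The distribution of the entries disappears by counting. A word of n centered independent letters
  has nonzero mean only if it has at most n / 2 distinct letters, and the defect of Wick's rule for
  n + 1 letters needs at most \<open>n div 2\<close> of them, which leaves a factor of order
  b^{-1/2}.

  The order eight has this reason: increments are controlled through the largest squared variable,
  bounded by the square root of a sum of fourth powers. This costs the square root of the number of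
  variables, so each power of the squared gradient gains only b^{-1/2}; four powers, that is an
  eighth moment, give b^{-2}.\<close>

fun dmono :: "'v \<Rightarrow> 'v list \<Rightarrow> ('v \<Rightarrow> 'a::comm_ring_1) \<Rightarrow> 'a" where
  "dmono v [] x = 0"
| "dmono v (a # w) x = (if a = v then prod_list (map x w) else 0) + x a * dmono v w x"

text \<open>A relation instead of an operator: over an arbitrary commutative ring a polynomial
  function need not determine its formal derivative, so \<open>f\<close> and \<open>f'\<close> have
  to share one expansion \<open>cs\<close> into words. Nothing is required of \<open>f' v\<close>
  for \<open>v\<close> outside \<open>J\<close>.\<close>

definition has_pderiv ::
  "'v set \<Rightarrow> (('v \<Rightarrow> 'a::comm_ring_1) \<Rightarrow> 'a) \<Rightarrow> ('v \<Rightarrow> ('v \<Rightarrow> 'a) \<Rightarrow> 'a) \<Rightarrow> bool"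
where
  "has_pderiv J f f' \<longleftrightarrow>
     (\<exists>cs. (\<forall>p\<in>set cs. set (snd p) \<subseteq> J) \<and>
        (\<forall>x. f x = (\<Sum>p\<leftarrow>cs. fst p * prod_list (map x (snd p)))) \<and>
        (\<forall>v\<in>J. \<forall>x. f' v x = (\<Sum>p\<leftarrow>cs. fst p * dmono v (snd p) x)))"

lemma dmono_append:
  "dmono v (w @ w') x = dmono v w x * prod_list (map x w') + prod_list (map x w) * dmono v w' x"
  by (induction w) (auto simp: algebra_simps)

text \<open>This sum over positions has the shape of the sum over partners of the first letter in
  Wick's rule; comparing the two gives integration by parts in \<open>W_stein\<close>.\<close>

lemma dmono_nth:
  "dmono v w x = (\<Sum>l<length w. if w ! l = v
     then prod_list (map x (take l w @ drop (Suc l) w)) else 0)"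
proof (induction w)
  case (Cons a w)
  then show ?case
    by (simp add: sum.lessThan_Suc_shift sum_distrib_left if_distrib mult.assoc cong: if_cong
        del: sum.lessThan_Suc)
qed simp

lemma sum_list_product_mult:
  fixes f :: "'b \<Rightarrow> 'a::comm_ring_1"
  shows "(\<Sum>p\<leftarrow>List.product xs ys. f (fst p) * g (snd p)) = sum_list (map f xs) * sum_list (map g ys)"
  by (induction xs) (simp_all add: o_def sum_list_const_mult algebra_simps)

lemma has_pderiv_const [intro]: "has_pderiv J (\<lambda>x. c) (\<lambda>v x. 0)"
  unfolding has_pderiv_def by (intro exI[of _ "[(c, [])]"]) auto

lemma has_pderiv_var: "a \<in> J \<Longrightarrow> has_pderiv J (\<lambda>x. x a) (\<lambda>v x. if a = v then 1 else 0)"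
  unfolding has_pderiv_def by (intro exI[of _ "[(1, [a])]"]) auto

lemma has_pderiv_add [intro]:
  assumes "has_pderiv J f f'" "has_pderiv J g g'"
  shows "has_pderiv J (\<lambda>x. f x + g x) (\<lambda>v x. f' v x + g' v x)"
proof -
  from assms obtain cs ds where
    "\<forall>p\<in>set cs. set (snd p) \<subseteq> J" "\<And>x. f x = (\<Sum>p\<leftarrow>cs. fst p * prod_list (map x (snd p)))"
    "\<And>v x. v \<in> J \<Longrightarrow> f' v x = (\<Sum>p\<leftarrow>cs. fst p * dmono v (snd p) x)"
    "\<forall>p\<in>set ds. set (snd p) \<subseteq> J" "\<And>x. g x = (\<Sum>p\<leftarrow>ds. fst p * prod_list (map x (snd p)))"
    "\<And>v x. v \<in> J \<Longrightarrow> g' v x = (\<Sum>p\<leftarrow>ds. fst p * dmono v (snd p) x)"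
    unfolding has_pderiv_def by blast
  then show ?thesis
    unfolding has_pderiv_def by (intro exI[of _ "cs @ ds"]) auto
qed

lemma has_pderiv_mult [intro]:
  assumes "has_pderiv J f f'" "has_pderiv J g g'"
  shows "has_pderiv J (\<lambda>x. f x * g x) (\<lambda>v x. f' v x * g x + f x * g' v x)"
proof -
  from assms obtain cs ds where cs:
    "\<forall>p\<in>set cs. set (snd p) \<subseteq> J" "\<And>x. f x = (\<Sum>p\<leftarrow>cs. fst p * prod_list (map x (snd p)))"
    "\<And>v x. v \<in> J \<Longrightarrow> f' v x = (\<Sum>p\<leftarrow>cs. fst p * dmono v (snd p) x)"
    and ds: "\<forall>p\<in>set ds. set (snd p) \<subseteq> J" "\<And>x. g x = (\<Sum>p\<leftarrow>ds. fst p * prod_list (map x (snd p)))"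
    "\<And>v x. v \<in> J \<Longrightarrow> g' v x = (\<Sum>p\<leftarrow>ds. fst p * dmono v (snd p) x)"
    unfolding has_pderiv_def by blast
  \<comment> \<open>Words are concatenated over all pairs of terms, so that the product and, through
    \<open>dmono_append\<close>, its Leibniz rule come from one and the same expansion.\<close>
  define es where "es = map (\<lambda>p. (fst (fst p) * fst (snd p), snd (fst p) @ snd (snd p))) (List.product cs ds)"
  show ?thesis
    unfolding has_pderiv_def
  proof (intro exI[of _ es] conjI allI ballI)
    show "set (snd p) \<subseteq> J" if "p \<in> set es" for p
      using that cs(1) ds(1) by (fastforce simp: es_def)
    show "f x * g x = (\<Sum>p\<leftarrow>es. fst p * prod_list (map x (snd p)))" for x
      unfolding cs(2) ds(2) es_def
      by (subst sum_list_product_mult[symmetric]) (simp add: o_def mult_ac)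
    show "f' v x * g x + f x * g' v x = (\<Sum>p\<leftarrow>es. fst p * dmono v (snd p) x)"
      if v: "v \<in> J" for v x
      unfolding cs(2) ds(2) cs(3)[OF v] ds(3)[OF v] es_def
      by (subst (1 2) sum_list_product_mult[symmetric])
        (simp add: o_def mult_ac dmono_append sum_list_addf[symmetric] distrib_left)
  qed
qed

lemma has_pderiv_cong:
  assumes "has_pderiv J f f'" "\<And>x. f x = g x" "\<And>v x. v \<in> J \<Longrightarrow> f' v x = g' v x"
  shows "has_pderiv J g g'"
  using assms(1) unfolding has_pderiv_def by (simp add: assms(2,3))

lemma has_pderiv_cmult [intro]:
  assumes "has_pderiv J f f'"
  shows "has_pderiv J (\<lambda>x. c * f x) (\<lambda>v x. c * f' v x)"
  by (rule has_pderiv_cong[OF has_pderiv_mult[OF has_pderiv_const[of J c] assms]]) auto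

lemma has_pderiv_uminus [intro]:
  assumes "has_pderiv J f f'"
  shows "has_pderiv J (\<lambda>x. - f x) (\<lambda>v x. - f' v x)"
  by (rule has_pderiv_cong[OF has_pderiv_cmult[OF assms, of "-1"]]) auto

lemma has_pderiv_diff [intro]:
  assumes "has_pderiv J f f'" "has_pderiv J g g'"
  shows "has_pderiv J (\<lambda>x. f x - g x) (\<lambda>v x. f' v x - g' v x)"
  by (rule has_pderiv_cong[OF has_pderiv_add[OF assms(1) has_pderiv_uminus[OF assms(2)]]]) auto

lemma has_pderiv_sum [intro]:
  assumes "\<And>a. a \<in> A \<Longrightarrow> has_pderiv J (f a) (f' a)"
  shows "has_pderiv J (\<lambda>x. \<Sum>a\<in>A. f a x) (\<lambda>v x. \<Sum>a\<in>A. f' a v x)"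
  using assms by (induction A rule: infinite_finite_induct) auto

definition polyfun :: "'v set \<Rightarrow> (('v \<Rightarrow> 'a::comm_ring_1) \<Rightarrow> 'a) \<Rightarrow> bool" where
  "polyfun J f \<longleftrightarrow> (\<exists>f'. has_pderiv J f f')"

lemma polyfun_iff:
  "polyfun J f \<longleftrightarrow> (\<exists>cs. (\<forall>p\<in>set cs. set (snd p) \<subseteq> J) \<and>
        (\<forall>x. f x = (\<Sum>p\<leftarrow>cs. fst p * prod_list (map x (snd p)))))"
  (is "_ \<longleftrightarrow> ?rhs")
proof
  assume "polyfun J f"
  then obtain f' where "has_pderiv J f f'" unfolding polyfun_def by (rule exE)
  then show ?rhs unfolding has_pderiv_def by metis
next
  assume ?rhs
  then obtain cs where "\<forall>p\<in>set cs. set (snd p) \<subseteq> J"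
    "\<forall>x. f x = (\<Sum>p\<leftarrow>cs. fst p * prod_list (map x (snd p)))" by metis
  then have "has_pderiv J f (\<lambda>v x. \<Sum>p\<leftarrow>cs. fst p * dmono v (snd p) x)"
    unfolding has_pderiv_def by (intro exI[of _ cs]) simp
  then show "polyfun J f" unfolding polyfun_def by (intro exI)
qed

lemma polyfun_const [intro]: "polyfun J (\<lambda>x. c)"
  unfolding polyfun_def using has_pderiv_const by blast

lemma polyfun_var: "a \<in> J \<Longrightarrow> polyfun J (\<lambda>x. x a)"
  unfolding polyfun_def by (rule exI, rule has_pderiv_var)

lemma polyfun_add [intro]: "polyfun J f \<Longrightarrow> polyfun J g \<Longrightarrow> polyfun J (\<lambda>x. f x + g x)"
  unfolding polyfun_def by (elim exE) (rule exI, rule has_pderiv_add)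

lemma polyfun_diff [intro]: "polyfun J f \<Longrightarrow> polyfun J g \<Longrightarrow> polyfun J (\<lambda>x. f x - g x)"
  unfolding polyfun_def by (elim exE) (rule exI, rule has_pderiv_diff)

lemma polyfun_mult [intro]: "polyfun J f \<Longrightarrow> polyfun J g \<Longrightarrow> polyfun J (\<lambda>x. f x * g x)"
  unfolding polyfun_def by (elim exE) (rule exI, rule has_pderiv_mult)

lemma polyfun_cmult: "polyfun J f \<Longrightarrow> polyfun J (\<lambda>x. c * f x)"
  unfolding polyfun_def by (elim exE) (rule exI, rule has_pderiv_cmult)

lemma polyfun_if [intro]: "(P \<Longrightarrow> polyfun J f) \<Longrightarrow> polyfun J (\<lambda>x. if P then f x else 0)"
  by (cases P) auto

lemma polyfun_sum [intro]:
  assumes "\<And>a. a \<in> A \<Longrightarrow> polyfun J (f a)"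
  shows "polyfun J (\<lambda>x. \<Sum>a\<in>A. f a x)"
  using assms by (induction A rule: infinite_finite_induct) auto

lemma polyfun_power [intro]: "polyfun J f \<Longrightarrow> polyfun J (\<lambda>x. f x ^ n)"
  by (induction n) auto

lemma polyfun_prod_list: "set w \<subseteq> J \<Longrightarrow> polyfun J (\<lambda>x. prod_list (map x w))"
  by (induction w) (auto intro: polyfun_var)

lemma polyfun_sum_list:
  assumes "\<And>p. p \<in> set ps \<Longrightarrow> polyfun J (f p)"
  shows "polyfun J (\<lambda>x. \<Sum>p\<leftarrow>ps. f p x)"
  using assms by (induction ps) auto

subsection \<open>Gaussian limit functionals\<close>

text \<open>Covariance of a Hermitian Gaussian matrix of variance 1 / m: an entry pairs only with
  the transposed entry. The entries are separate complex coordinates and no conjugation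
  occurs.\<close>

definition gue_cov :: "nat \<Rightarrow> nat \<times> nat \<Rightarrow> nat \<times> nat \<Rightarrow> complex" where
  "gue_cov m a c = (if fst a = snd c \<and> snd a = fst c then 1 / of_nat m else 0)"

text \<open>Linearity is stated for explicit combinations of words, and convergence is not part of
  the assumptions: it is a consequence of \<open>L_wick\<close> and \<open>L_one\<close>.\<close>

locale asymptotically_gue =
  fixes m :: nat and L :: "nat \<Rightarrow> ((nat \<times> nat \<Rightarrow> complex) \<Rightarrow> complex) \<Rightarrow> complex"
  assumes m_pos: "0 < m"
    and L_lincomb: "(\<And>p. p \<in> set cs \<Longrightarrow> set (snd p) \<subseteq> {..<m} \<times> {..<m}) \<Longrightarrow>
      L N (\<lambda>x. \<Sum>p\<leftarrow>cs. fst p * prod_list (map x (snd p))) =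
      (\<Sum>p\<leftarrow>cs. fst p * L N (\<lambda>x. prod_list (map x (snd p))))"
    and L_one: "L N (\<lambda>x. 1) = 1"
    and L_wick: "\<lbrakk>a \<in> {..<m} \<times> {..<m}; set w \<subseteq> {..<m} \<times> {..<m}\<rbrakk> \<Longrightarrow>
      (\<lambda>N. L N (\<lambda>x. x a * prod_list (map x w)) -
         (\<Sum>l<length w. gue_cov m a (w ! l) *
            L N (\<lambda>x. prod_list (map x (take l w @ drop (Suc l) w))))) \<longlonglongrightarrow> 0"
begin

abbreviation "I \<equiv> {..<m} \<times> {..<m}"

definition W :: "((nat \<times> nat \<Rightarrow> complex) \<Rightarrow> complex) \<Rightarrow> complex" where
  "W f = lim (\<lambda>N. L N f)"

text \<open>Up to a null sequence, Wick's rule expresses the value on a word by values on words with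
  two letters less, so strong induction on the length applies.\<close>

lemma convergent_L_word:
  assumes "set w \<subseteq> I"
  shows "convergent (\<lambda>N. L N (\<lambda>x. prod_list (map x w)))"
  using assms
proof (induction "length w" arbitrary: w rule: less_induct)
  case less
  show ?case
  proof (cases w)
    case Nil
    then show ?thesis by (simp add: L_one convergent_const)
  next
    case (Cons a v)
    have "convergent (\<lambda>N. L N (\<lambda>x. prod_list (map x (take l v @ drop (Suc l) v))))"
      if "l < length v" for l
    proof (rule less.hyps)
      show "length (take l v @ drop (Suc l) v) < length w" using that Cons by simp
      show "set (take l v @ drop (Suc l) v) \<subseteq> I"
        using less.prems Cons set_take_subset[of l v] set_drop_subset[of "Suc l" v] by auto
    qed
    then have "convergent (\<lambda>N. \<Sum>l<length v. gue_cov m a (v ! l) *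
            L N (\<lambda>x. prod_list (map x (take l v @ drop (Suc l) v))))"
      by (intro convergent_sum convergent_mult convergent_const) auto
    moreover have "convergent (\<lambda>N. L N (\<lambda>x. x a * prod_list (map x v)) -
         (\<Sum>l<length v. gue_cov m a (v ! l) *
            L N (\<lambda>x. prod_list (map x (take l v @ drop (Suc l) v)))))"
      using L_wick[of a v] less.prems Cons by (auto simp: convergent_def)
    ultimately show ?thesis
      using convergent_add by (fastforce simp: Cons)
  qed
qed

lemma L_polyfun:
  assumes "\<And>p. p \<in> set cs \<Longrightarrow> set (snd p) \<subseteq> I"
    and "\<And>x. f x = (\<Sum>p\<leftarrow>cs. fst p * prod_list (map x (snd p)))"
  shows "L N f = (\<Sum>p\<leftarrow>cs. fst p * L N (\<lambda>x. prod_list (map x (snd p))))"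
proof -
  have "f = (\<lambda>x. \<Sum>p\<leftarrow>cs. fst p * prod_list (map x (snd p)))" using assms(2) by auto
  then show ?thesis using L_lincomb[of cs N] assms(1) by simp
qed

lemma tendsto_sum_list:
  fixes f :: "'b \<Rightarrow> 'c \<Rightarrow> 'd::real_normed_algebra"
  assumes "\<And>p. p \<in> set ps \<Longrightarrow> (f p \<longlongrightarrow> g p) F"
  shows "((\<lambda>n. \<Sum>p\<leftarrow>ps. f p n) \<longlongrightarrow> (\<Sum>p\<leftarrow>ps. g p)) F"
  using assms by (induction ps) (auto intro!: tendsto_intros)

lemma L_tendsto_W:
  assumes "polyfun I f"
  shows "(\<lambda>N. L N f) \<longlonglongrightarrow> W f"
proof -
  from assms obtain cs where cs: "\<forall>p\<in>set cs. set (snd p) \<subseteq> I"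
    "\<And>x. f x = (\<Sum>p\<leftarrow>cs. fst p * prod_list (map x (snd p)))"
    unfolding polyfun_iff by blast
  have "(\<lambda>N. L N (\<lambda>x. prod_list (map x (snd p)))) \<longlonglongrightarrow> W (\<lambda>x. prod_list (map x (snd p)))"
    if "p \<in> set cs" for p
    unfolding W_def convergent_LIMSEQ_iff[symmetric]
    by (rule convergent_L_word) (use cs(1) that in blast)
  then have "(\<lambda>N. \<Sum>p\<leftarrow>cs. fst p * L N (\<lambda>x. prod_list (map x (snd p)))) \<longlonglongrightarrow>
      (\<Sum>p\<leftarrow>cs. fst p * W (\<lambda>x. prod_list (map x (snd p))))"
    by (intro tendsto_sum_list tendsto_intros) auto
  moreover have "L N f = (\<Sum>p\<leftarrow>cs. fst p * L N (\<lambda>x. prod_list (map x (snd p))))" for N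
    by (rule L_polyfun) (use cs in auto)
  ultimately have "convergent (\<lambda>N. L N f)" unfolding convergent_def by force
  then show ?thesis unfolding W_def convergent_LIMSEQ_iff .
qed

lemma L_add: "polyfun I f \<Longrightarrow> polyfun I g \<Longrightarrow> L N (\<lambda>x. f x + g x) = L N f + L N g"
proof -
  assume "polyfun I f" "polyfun I g"
  then obtain cs ds where cs: "\<forall>p\<in>set cs. set (snd p) \<subseteq> I"
    "\<And>x. f x = (\<Sum>p\<leftarrow>cs. fst p * prod_list (map x (snd p)))"
    and ds: "\<forall>p\<in>set ds. set (snd p) \<subseteq> I"
    "\<And>x. g x = (\<Sum>p\<leftarrow>ds. fst p * prod_list (map x (snd p)))"
    unfolding polyfun_iff by blast
  have "L N (\<lambda>x. f x + g x) = (\<Sum>p\<leftarrow>cs @ ds. fst p * L N (\<lambda>x. prod_list (map x (snd p))))"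
    by (rule L_polyfun) (use cs ds in auto)
  moreover have "L N f = (\<Sum>p\<leftarrow>cs. fst p * L N (\<lambda>x. prod_list (map x (snd p))))"
    by (rule L_polyfun) (use cs in auto)
  moreover have "L N g = (\<Sum>p\<leftarrow>ds. fst p * L N (\<lambda>x. prod_list (map x (snd p))))"
    by (rule L_polyfun) (use ds in auto)
  ultimately show ?thesis by (simp only: map_append sum_list_append)
qed

lemma L_cmult: "polyfun I f \<Longrightarrow> L N (\<lambda>x. c * f x) = c * L N f"
proof -
  assume "polyfun I f"
  then obtain cs where cs: "\<forall>p\<in>set cs. set (snd p) \<subseteq> I"
    "\<And>x. f x = (\<Sum>p\<leftarrow>cs. fst p * prod_list (map x (snd p)))"
    unfolding polyfun_iff by blast
  have "L N (\<lambda>x. c * f x) =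
      (\<Sum>p\<leftarrow>map (\<lambda>p. (c * fst p, snd p)) cs. fst p * L N (\<lambda>x. prod_list (map x (snd p))))"
  proof (rule L_polyfun)
    show "c * f x = (\<Sum>p\<leftarrow>map (\<lambda>p. (c * fst p, snd p)) cs. fst p * prod_list (map x (snd p)))" for x
      unfolding cs(2) by (simp add: o_def sum_list_const_mult[symmetric] mult_ac)
  qed (use cs(1) in fastforce)
  moreover have "L N f = (\<Sum>p\<leftarrow>cs. fst p * L N (\<lambda>x. prod_list (map x (snd p))))"
    by (rule L_polyfun) (use cs in auto)
  ultimately show ?thesis
    by (simp only: o_def sum_list_const_mult[symmetric] mult.assoc map_map fst_conv snd_conv)
qed

lemma W_add: "polyfun I f \<Longrightarrow> polyfun I g \<Longrightarrow> W (\<lambda>x. f x + g x) = W f + W g"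
  by (rule LIMSEQ_unique[OF L_tendsto_W])
    (auto simp: L_add intro!: tendsto_add L_tendsto_W)

lemma W_cmult: "polyfun I f \<Longrightarrow> W (\<lambda>x. c * f x) = c * W f"
  by (rule LIMSEQ_unique[OF L_tendsto_W])
    (auto simp: L_cmult polyfun_cmult intro!: tendsto_mult L_tendsto_W)

lemma W_one: "W (\<lambda>x. 1) = 1"
  unfolding W_def by (simp add: L_one lim_const)

lemma W_const: "W (\<lambda>x. c) = c"
  using W_cmult[of "\<lambda>x. 1" c] W_one by auto

lemma W_sum:
  assumes "finite A" "\<And>a. a \<in> A \<Longrightarrow> polyfun I (f a)"
  shows "W (\<lambda>x. \<Sum>a\<in>A. f a x) = (\<Sum>a\<in>A. W (f a))"
  using assms by (induction A rule: finite_induct) (simp_all add: W_const W_add polyfun_sum)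

lemma W_sum_list:
  assumes "\<And>p. p \<in> set ps \<Longrightarrow> polyfun I (f p)"
  shows "W (\<lambda>x. \<Sum>p\<leftarrow>ps. f p x) = (\<Sum>p\<leftarrow>ps. W (f p))"
  using assms by (induction ps) (auto simp: W_const W_add polyfun_sum_list)

text \<open>The defect in \<open>L_wick\<close> vanishes in the limit, where Wick's rule on a word
  becomes the sum in \<open>dmono_nth\<close>; the rest is linearity. The derivative is taken at
  \<open>(j, i)\<close> because \<open>gue_cov\<close> pairs \<open>(i, j)\<close> with
  \<open>(j, i)\<close> only.\<close>

lemma W_stein:
  assumes f: "has_pderiv I f f'" and ij: "i < m" "j < m"
  shows "W (\<lambda>x. x (i, j) * f x) = W (f' (j, i)) / of_nat m"
proof -
  have rem: "polyfun I (\<lambda>x. prod_list (map x (take l w @ drop (Suc l) w)))" if "set w \<subseteq> I" for l w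
    using that set_take_subset[of l w] set_drop_subset[of "Suc l" w]
    by (intro polyfun_prod_list) auto
  have word: "W (\<lambda>x. x (i, j) * prod_list (map x w)) = W (dmono (j, i) w) / of_nat m"
    if w: "set w \<subseteq> I" for w
  proof -
    define g where "g = (\<lambda>l x. prod_list (map x (take l w @ drop (Suc l) w)) :: complex)"
    have g: "polyfun I (g l)" for l unfolding g_def by (rule rem[OF w])
    have pw: "polyfun I (\<lambda>x. x (i, j) * prod_list (map x w))"
      using ij w by (intro polyfun_mult polyfun_var polyfun_prod_list) auto
    have "(\<lambda>N. L N (\<lambda>x. x (i, j) * prod_list (map x w)) -
         (\<Sum>l<length w. gue_cov m (i, j) (w ! l) * L N (g l))) \<longlonglongrightarrow>
         W (\<lambda>x. x (i, j) * prod_list (map x w)) - (\<Sum>l<length w. gue_cov m (i, j) (w ! l) * W (g l))"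
      by (intro tendsto_intros L_tendsto_W g pw)
    moreover have "(\<lambda>N. L N (\<lambda>x. x (i, j) * prod_list (map x w)) -
         (\<Sum>l<length w. gue_cov m (i, j) (w ! l) * L N (g l))) \<longlonglongrightarrow> 0"
      unfolding g_def using L_wick[of "(i, j)" w] ij w by simp
    ultimately have "W (\<lambda>x. x (i, j) * prod_list (map x w)) = (\<Sum>l<length w. gue_cov m (i, j) (w ! l) * W (g l))"
      using LIMSEQ_unique by fastforce
    also have "\<dots> = (\<Sum>l<length w. W (\<lambda>x. if w ! l = (j, i) then g l x else 0)) / of_nat m"
      unfolding sum_divide_distrib
    proof (intro sum.cong refl)
      fix l
      show "gue_cov m (i, j) (w ! l) * W (g l) =
          W (\<lambda>x. if w ! l = (j, i) then g l x else 0) / of_nat m"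
        by (cases "w ! l = (j, i)") (auto simp: gue_cov_def W_const prod_eq_iff)
    qed
    also have "(\<Sum>l<length w. W (\<lambda>x. if w ! l = (j, i) then g l x else 0)) =
        W (\<lambda>x. \<Sum>l<length w. if w ! l = (j, i) then g l x else 0)"
      by (rule W_sum[symmetric]) (auto intro: g)
    also have "(\<lambda>x. \<Sum>l<length w. if w ! l = (j, i) then g l x else 0) = dmono (j, i) w"
      unfolding fun_eq_iff dmono_nth g_def by (intro allI refl)
    finally show ?thesis .
  qed
  from f obtain cs where cs: "\<forall>p\<in>set cs. set (snd p) \<subseteq> I"
    "\<And>x. f x = (\<Sum>p\<leftarrow>cs. fst p * prod_list (map x (snd p)))"
    "\<And>v x. v \<in> I \<Longrightarrow> f' v x = (\<Sum>p\<leftarrow>cs. fst p * dmono v (snd p) x)"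
    unfolding has_pderiv_def by blast
  have pd: "polyfun I (dmono (j, i) w :: _ \<Rightarrow> complex)" if "set w \<subseteq> I" for w
    unfolding dmono_nth[abs_def] by (intro polyfun_sum polyfun_if rem that)
  have "W (\<lambda>x. x (i, j) * f x) =
      W (\<lambda>x. \<Sum>p\<leftarrow>cs. fst p * (x (i, j) * prod_list (map x (snd p))))"
    unfolding cs(2) by (auto simp: sum_list_const_mult[symmetric] mult_ac)
  also have "\<dots> = (\<Sum>p\<leftarrow>cs. fst p * W (\<lambda>x. x (i, j) * prod_list (map x (snd p))))"
  proof -
    have "polyfun I (\<lambda>x. x (i, j) * prod_list (map x (snd p)))" if "p \<in> set cs" for p
      using cs(1) that ij by (intro polyfun_mult polyfun_var polyfun_prod_list) auto
    then show ?thesis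
      by (subst W_sum_list) (auto intro!: polyfun_cmult W_cmult arg_cong[of _ _ sum_list])
  qed
  also have "\<dots> = (\<Sum>p\<leftarrow>cs. fst p * W (dmono (j, i) (snd p))) / of_nat m"
    using cs(1) word by (simp add: divide_inverse sum_list_mult_const[symmetric] mult.assoc cong: map_cong)
  also have "(\<Sum>p\<leftarrow>cs. fst p * W (dmono (j, i) (snd p))) = W (f' (j, i))"
  proof -
    have "f' (j, i) = (\<lambda>x. \<Sum>p\<leftarrow>cs. fst p * dmono (j, i) (snd p) x)"
      using cs(3)[of "(j, i)"] ij by auto
    then have "W (f' (j, i)) = (\<Sum>p\<leftarrow>cs. W (\<lambda>x. fst p * dmono (j, i) (snd p) x))"
      using cs(1) pd by (simp only:) (intro W_sum_list polyfun_cmult, blast)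
    also have "\<dots> = (\<Sum>p\<leftarrow>cs. fst p * W (dmono (j, i) (snd p)))"
      using cs(1) pd by (intro arg_cong[of _ _ sum_list] map_cong refl W_cmult) blast
    finally show ?thesis by simp
  qed
  finally show ?thesis .
qed

end

lemma polyfun_dmono: "set w \<subseteq> J \<Longrightarrow> polyfun J (dmono v w :: ('v \<Rightarrow> 'a::comm_ring_1) \<Rightarrow> 'a)"
proof (induction w)
  case (Cons a w)
  then have "polyfun J (\<lambda>x :: 'v \<Rightarrow> 'a. (if a = v then prod_list (map x w) else 0) + x a * dmono v w x)"
    by (intro polyfun_add polyfun_mult polyfun_if polyfun_var polyfun_prod_list) auto
  then show ?case by (metis (no_types, lifting) dmono.simps(2) ext)
next
  case Nil
  have "dmono v [] = (\<lambda>x :: 'v \<Rightarrow> 'a. 0)" by auto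
  then show ?case by auto
qed

lemma has_pderiv_polyfun:
  assumes "has_pderiv J f f'" "v \<in> J"
  shows "polyfun J (f' v)"
proof -
  from assms(1) obtain cs where cs: "\<forall>p\<in>set cs. set (snd p) \<subseteq> J"
    "\<And>v x. v \<in> J \<Longrightarrow> f' v x = (\<Sum>p\<leftarrow>cs. fst p * dmono v (snd p) x)"
    unfolding has_pderiv_def by blast
  have "polyfun J (\<lambda>x. \<Sum>p\<leftarrow>cs. fst p * dmono v (snd p) x)"
    using cs(1) by (intro polyfun_sum_list polyfun_cmult polyfun_dmono) auto
  moreover have "f' v = (\<lambda>x. \<Sum>p\<leftarrow>cs. fst p * dmono v (snd p) x)"
    using cs(2)[OF assms(2)] by auto
  ultimately show ?thesis by simp
qed

subsection \<open>Formal resolvents\<close>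

notation fps_nth (infixl \<open>$.\<close> 75)

section \<open>Matrix powers as polynomials in the entries\<close>

definition unit_mat :: "nat \<Rightarrow> nat \<Rightarrow> 'a::comm_ring_1" where
  "unit_mat i j = (if i = j then 1 else 0)"

fun mpow :: "nat \<Rightarrow> (nat \<times> nat \<Rightarrow> 'a::comm_ring_1) \<Rightarrow> nat \<Rightarrow> nat \<Rightarrow> nat \<Rightarrow> 'a" where
  "mpow n x 0 i j = unit_mat i j"
| "mpow n x (Suc k) i j = (\<Sum>l<n. x (i, l) * mpow n x k l j)"

lemma sum_unit_mat [simp]:
  "i < n \<Longrightarrow> (\<Sum>l<n. unit_mat i l * f l) = f i"
  "i < n \<Longrightarrow> (\<Sum>l<n. unit_mat l i * f l) = f i"
  "i < n \<Longrightarrow> (\<Sum>l<n. f l * unit_mat l i) = f i"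
  by (simp_all add: unit_mat_def if_distrib if_distribR cong: if_cong)

lemma mpow_add:
  assumes "i < n"
  shows "mpow n x (a + b) i j = (\<Sum>l<n. mpow n x a i l * mpow n x b l j)"
  using assms
proof (induction a arbitrary: i)
  case 0
  then show ?case by simp
next
  case (Suc a)
  have "mpow n x (Suc a + b) i j = (\<Sum>l<n. \<Sum>r<n. x (i, l) * (mpow n x a l r * mpow n x b r j))"
    using Suc.IH by (simp add: sum_distrib_left)
  also have "\<dots> = (\<Sum>r<n. \<Sum>l<n. x (i, l) * (mpow n x a l r * mpow n x b r j))"
    by (rule sum.swap)
  finally show ?case by (simp add: sum_distrib_right mult.assoc)
qed

lemma polyfun_mpow:
  "i < n \<Longrightarrow> polyfun ({..<n} \<times> {..<n}) (\<lambda>x. mpow n x k i j)"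
  by (induction k arbitrary: i) (auto intro!: polyfun_sum polyfun_mult polyfun_var)

text \<open>Leibniz rule for a product of k equal factors: differentiating the factor after the
  first \<open>a\<close> ones leaves a power on each side.\<close>

lemma has_pderiv_mpow:
  assumes "i < n" "j < n"
  shows "has_pderiv ({..<n} \<times> {..<n}) (\<lambda>x. mpow n x k i j)
     (\<lambda>v x. \<Sum>a<k. mpow n x a i (fst v) * mpow n x (k - Suc a) (snd v) j)"
  using assms(1)
proof (induction k arbitrary: i)
  case 0
  then show ?case by auto
next
  case (Suc k)
  have "has_pderiv ({..<n} \<times> {..<n}) (\<lambda>x :: nat \<times> nat \<Rightarrow> 'a. \<Sum>l<n. x (i, l) * mpow n x k l j)
    (\<lambda>v x. \<Sum>l<n. (if (i, l) = v then 1 else 0) * mpow n x k l j +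
       x (i, l) * (\<Sum>a<k. mpow n x a l (fst v) * mpow n x (k - Suc a) (snd v) j))"
    by (intro has_pderiv_sum has_pderiv_mult has_pderiv_var Suc.IH) (use Suc.prems in auto)
  then show ?case
  proof (rule has_pderiv_cong)
    fix v and x :: "nat \<times> nat \<Rightarrow> 'a"
    assume v: "v \<in> {..<n} \<times> {..<n}"
    have "(\<Sum>l<n. (if (i, l) = v then 1 else 0) * mpow n x k l j) =
        (\<Sum>l<n. unit_mat l (snd v) * (unit_mat i (fst v) * mpow n x k l j))"
      by (intro sum.cong) (cases v, auto simp: unit_mat_def)+
    also have "\<dots> = unit_mat i (fst v) * mpow n x k (snd v) j"
      using v by (subst sum_unit_mat) auto
    finally have 1: "(\<Sum>l<n. (if (i, l) = v then 1 else 0) * mpow n x k l j) =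
        unit_mat i (fst v) * mpow n x k (snd v) j" .
    have "(\<Sum>l<n. x (i, l) * (\<Sum>a<k. mpow n x a l (fst v) * mpow n x (k - Suc a) (snd v) j)) =
        (\<Sum>a<k. \<Sum>l<n. x (i, l) * mpow n x a l (fst v) * mpow n x (k - Suc a) (snd v) j)"
      by (subst sum.swap) (simp add: sum_distrib_left mult.assoc)
    then show "(\<Sum>l<n. (if (i, l) = v then 1 else 0) * mpow n x k l j +
          x (i, l) * (\<Sum>a<k. mpow n x a l (fst v) * mpow n x (k - Suc a) (snd v) j)) =
        (\<Sum>a<Suc k. mpow n x a i (fst v) * mpow n x (Suc k - Suc a) (snd v) j)"
      by (simp add: sum.distrib 1 sum.lessThan_Suc_shift sum_distrib_right del: sum.lessThan_Suc)
  qed simp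
qed

section \<open>Power series with polynomial coefficients, and differentiation in u\<close>

definition fps_pderiv ::
  "'v set \<Rightarrow> (('v \<Rightarrow> 'a::comm_ring_1) \<Rightarrow> 'a fps) \<Rightarrow> ('v \<Rightarrow> ('v \<Rightarrow> 'a) \<Rightarrow> 'a fps) \<Rightarrow> bool"
where
  "fps_pderiv J F F' \<longleftrightarrow> (\<forall>k. has_pderiv J (\<lambda>x. F x $. k) (\<lambda>v x. F' v x $. k))"

lemma fps_pderiv_const [intro]: "fps_pderiv J (\<lambda>x. c) (\<lambda>v x. 0)"
  unfolding fps_pderiv_def by auto

lemma fps_pderiv_add [intro]:
  "\<lbrakk>fps_pderiv J F F'; fps_pderiv J G G'\<rbrakk> \<Longrightarrow>
    fps_pderiv J (\<lambda>x. F x + G x) (\<lambda>v x. F' v x + G' v x)"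
  unfolding fps_pderiv_def by auto

lemma fps_pderiv_sum [intro]:
  assumes "\<And>a. a \<in> A \<Longrightarrow> fps_pderiv J (F a) (F' a)"
  shows "fps_pderiv J (\<lambda>x. \<Sum>a\<in>A. F a x) (\<lambda>v x. \<Sum>a\<in>A. F' a v x)"
  using assms by (induction A rule: infinite_finite_induct) auto

lemma fps_pderiv_mult [intro]:
  assumes "fps_pderiv J F F'" "fps_pderiv J G G'"
  shows "fps_pderiv J (\<lambda>x. F x * G x) (\<lambda>v x. F' v x * G x + F x * G' v x)"
  unfolding fps_pderiv_def
proof
  fix k
  have "has_pderiv J (\<lambda>x. \<Sum>i=0..k. F x $. i * G x $. (k - i))
     (\<lambda>v x. \<Sum>i=0..k. F' v x $. i * G x $. (k - i) + F x $. i * G' v x $. (k - i))"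
    using assms unfolding fps_pderiv_def by (intro has_pderiv_sum has_pderiv_mult) auto
  then show "has_pderiv J (\<lambda>x. (F x * G x) $. k) (\<lambda>v x. (F' v x * G x + F x * G' v x) $. k)"
    by (rule has_pderiv_cong) (simp_all add: fps_mult_nth sum.distrib)
qed

lemma fps_pderiv_cong:
  assumes "fps_pderiv J F F'" "\<And>x. F x = G x" "\<And>v x. v \<in> J \<Longrightarrow> F' v x = G' v x"
  shows "fps_pderiv J G G'"
  using assms(1) unfolding fps_pderiv_def
  by (auto intro: has_pderiv_cong simp: assms(2,3))

lemma fps_pderiv_cmult [intro]:
  "fps_pderiv J F F' \<Longrightarrow> fps_pderiv J (\<lambda>x. c * F x) (\<lambda>v x. c * F' v x)"
  by (rule fps_pderiv_cong[OF fps_pderiv_mult[OF fps_pderiv_const[of J c]]]) auto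

lemma polyfun_fps_nth: "fps_pderiv J F F' \<Longrightarrow> polyfun J (\<lambda>x. F x $. k)"
  unfolding fps_pderiv_def polyfun_def by blast

text \<open>In terms of \<open>u = 1 / X\<close>, this derivation is \<open>d / du\<close>.\<close>

definition dop :: "'a::comm_ring_1 fps \<Rightarrow> 'a fps" where
  "dop F = - (fps_X\<^sup>2 * fps_deriv F)"

text \<open>Truncated subtraction makes the formula uniform: for \<open>k\<close> equal to 0 or 1
  the factor \<open>of_nat (k - 1)\<close> is zero, as it must be since X^2 divides the
  series.\<close>

lemma dop_nth: "dop F $. k = - of_nat (k - 1) * F $. (k - 1)"
proof (cases "k < 2")
  case True
  then show ?thesis by (auto simp: dop_def fps_X_power_mult_nth less_2_cases_iff)
next
  case False
  then obtain j where "k = Suc (Suc j)" by (metis Suc_1 add_2_eq_Suc le_Suc_ex not_less)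
  then have eq: "(fps_X\<^sup>2 * fps_deriv F) $. k = of_nat (Suc j) * F $. Suc j"
    by (simp add: fps_X_power_mult_nth)
  then show ?thesis
    unfolding dop_def fps_neg_nth eq using \<open>k = Suc (Suc j)\<close> by (simp add: algebra_simps)
qed

lemma dop_add: "dop (F + G) = dop F + dop G"
  and dop_diff: "dop (F - G) = dop F - dop G"
  and dop_uminus: "dop (- F) = - dop F"
  and dop_mult: "dop (F * G) = dop F * G + F * dop G"
  and dop_0 [simp]: "dop 0 = 0"
  and dop_1 [simp]: "dop 1 = 0"
  and dop_cmult: "dop (fps_const c * F) = fps_const c * dop F"
  by (simp_all add: dop_def algebra_simps)

lemma dop_of_nat: "dop (of_nat c) = 0"
  by (simp add: dop_def fps_of_nat[symmetric])

lemma dop_sum: "dop (\<Sum>a\<in>A. F a) = (\<Sum>a\<in>A. dop (F a))"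
  by (induction A rule: infinite_finite_induct) (simp_all add: dop_add)

lemma fps_pderiv_dop [intro]:
  assumes "fps_pderiv J F F'"
  shows "fps_pderiv J (\<lambda>x. dop (F x)) (\<lambda>v x. dop (F' v x))"
  using assms unfolding fps_pderiv_def dop_nth by (intro allI has_pderiv_cmult) blast

text \<open>The derivation \<open>dop\<close> raises the degree in X by one, hence its commutator
  with the Euler operator is one copy of \<open>dop\<close>. The induction in
  \<open>euler_grad\<close> rests on this.\<close>

lemma dop_euler_commute:
  "dop (fps_X * fps_deriv F) = fps_X * fps_deriv (dop F) - dop F"
  by (simp add: dop_def algebra_simps power2_eq_square)

section \<open>The resolvent and its elementary symmetric functions\<close>

locale resolvent =
  fixes n :: nat
begin

text \<open>Expansion of (u - x)^{-1} at u = infinity in X = 1 / u. The k-th matrix power belongs to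
  u^{-k-1}, whence the shift by one and the zero constant term.\<close>

definition res :: "(nat \<times> nat \<Rightarrow> complex) \<Rightarrow> nat \<Rightarrow> nat \<Rightarrow> complex fps" where
  "res x i j = Abs_fps (\<lambda>k. if k = 0 then 0 else mpow n x (k - 1) i j)"

definition res2 :: "(nat \<times> nat \<Rightarrow> complex) \<Rightarrow> nat \<Rightarrow> nat \<Rightarrow> complex fps" where
  "res2 x i j = (\<Sum>l<n. res x i l * res x l j)"

definition q1 :: "(nat \<times> nat \<Rightarrow> complex) \<Rightarrow> complex fps" where
  "q1 x = (\<Sum>i<n. res x i i)"

definition q2 :: "(nat \<times> nat \<Rightarrow> complex) \<Rightarrow> complex fps" where
  "q2 x = (\<Sum>i<n. res2 x i i)"

definition q3 :: "(nat \<times> nat \<Rightarrow> complex) \<Rightarrow> complex fps" where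
  "q3 x = (\<Sum>i<n. \<Sum>l<n. res x i l * res2 x l i)"

text \<open>\<open>eps r\<close> is the \<open>r\<close>-th elementary symmetric polynomial of the numbers
  \<open>1 / (u - \<lambda>)\<close>, \<open>\<lambda>\<close> an eigenvalue, and \<open>grad r\<close> is the matrix of its partial derivatives.\<close>

fun eps :: "nat \<Rightarrow> (nat \<times> nat \<Rightarrow> complex) \<Rightarrow> complex fps" where
  "eps 0 x = 1"
| "eps (Suc r) x = fps_const (1 / of_nat (Suc r)) * (q1 x * eps r x + dop (eps r x))"

fun grad :: "nat \<Rightarrow> (nat \<times> nat \<Rightarrow> complex) \<Rightarrow> nat \<Rightarrow> nat \<Rightarrow> complex fps" where
  "grad 0 x i j = 0"
| "grad (Suc r) x i j = fps_const (1 / of_nat (Suc r)) *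
     (res2 x i j * eps r x + q1 x * grad r x i j + dop (grad r x i j))"

text \<open>Second derivatives of \<open>eps\<close>: the recursion of \<open>grad\<close>
  differentiated term by term, \<open>v\<close> being the variable of the second derivative.\<close>

fun dgrad :: "nat \<Rightarrow> nat \<Rightarrow> nat \<Rightarrow> nat \<times> nat \<Rightarrow> (nat \<times> nat \<Rightarrow> complex) \<Rightarrow> complex fps" where
  "dgrad 0 k l v x = 0"
| "dgrad (Suc r) k l v x = fps_const (1 / of_nat (Suc r)) *
     ((res x k (fst v) * res2 x (snd v) l + res2 x k (fst v) * res x (snd v) l) * eps r x +
      res2 x k l * grad r x (snd v) (fst v) +
      (res2 x (snd v) (fst v) * grad r x k l + q1 x * dgrad r k l v x) +
      dop (dgrad r k l v x))"

text \<open>The Laplacian of \<open>eps r\<close> in the matrix entries: \<open>grad r x j i\<close>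
  is the derivative in the entry \<open>(i, j)\<close>, and each summand differentiates it once more
  in \<open>(j, i)\<close>, the entry that \<open>W_stein\<close> pairs with
  \<open>(i, j)\<close>.\<close>

definition dvg :: "nat \<Rightarrow> (nat \<times> nat \<Rightarrow> complex) \<Rightarrow> complex fps" where
  "dvg r x = (\<Sum>i<n. \<Sum>j<n. dgrad r j i (j, i) x)"

lemma fps_const_of_nat_cancel:
  "of_nat (Suc r) * (fps_const (1 / of_nat (Suc r)) * F) = (F :: complex fps)"
proof -
  have "of_nat (Suc r) * fps_const (1 / of_nat (Suc r)) = (1 :: complex fps)"
    unfolding fps_of_nat[symmetric] fps_const_mult by (simp del: of_nat_Suc)
  then show ?thesis by (metis mult.assoc mult_1)
qed

text \<open>With y_i = 1 / (u - lambda_i) one has y_i' = - y_i^2. Multiplying e_r by the sum of the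
  y_i gives (r + 1) e_{r+1} plus the terms in which one y_i is squared, and adding the derivative of
  e_r removes exactly these. This is why \<open>eps\<close> can be defined from the trace
  \<open>q1\<close> alone.\<close>

lemma eps_Suc': "of_nat (Suc r) * eps (Suc r) x = q1 x * eps r x + dop (eps r x)"
  unfolding eps.simps by (rule fps_const_of_nat_cancel)

lemma grad_Suc': "of_nat (Suc r) * grad (Suc r) x i j =
    res2 x i j * eps r x + q1 x * grad r x i j + dop (grad r x i j)"
  unfolding grad.simps by (rule fps_const_of_nat_cancel)

lemma dgrad_Suc': "of_nat (Suc r) * dgrad (Suc r) k l v x =
     (res x k (fst v) * res2 x (snd v) l + res2 x k (fst v) * res x (snd v) l) * eps r x +
      res2 x k l * grad r x (snd v) (fst v) +
      (res2 x (snd v) (fst v) * grad r x k l + q1 x * dgrad r k l v x) +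
      dop (dgrad r k l v x)"
  unfolding dgrad.simps by (rule fps_const_of_nat_cancel)

lemma res_nth_0 [simp]: "res x i j $. 0 = 0"
  and res_nth_Suc [simp]: "res x i j $. Suc k = mpow n x k i j"
  by (simp_all add: res_def)

lemma res_mult_nth_Suc:
  "(res x i p * res x q j) $. Suc k = (\<Sum>a<k. mpow n x a i p * mpow n x (k - Suc a) q j)"
proof -
  have "(res x i p * res x q j) $. Suc k =
      (\<Sum>a<Suc (Suc k). res x i p $. a * res x q j $. (Suc k - a))"
    by (simp add: fps_mult_nth lessThan_Suc_atMost atMost_atLeast0)
  also have "\<dots> = (\<Sum>a<k. mpow n x a i p * res x q j $. (k - a))"
    by (subst sum.lessThan_Suc_shift) simp
  also have "\<dots> = (\<Sum>a<k. mpow n x a i p * mpow n x (k - Suc a) q j)"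
  proof (rule sum.cong)
    fix a assume "a \<in> {..<k}"
    then have "k - a = Suc (k - Suc a)" by auto
    then show "mpow n x a i p * res x q j $. (k - a) = mpow n x a i p * mpow n x (k - Suc a) q j"
      by simp
  qed simp
  finally show ?thesis .
qed

text \<open>Entrywise form of R' = - R^2: within one coefficient of R^2 all products of two powers
  coincide, and their number is the factor in \<open>dop_nth\<close>.\<close>

lemma dop_res: "i < n \<Longrightarrow> dop (res x i j) = - res2 x i j"
proof (rule fps_ext)
  fix k assume i: "i < n"
  show "dop (res x i j) $. k = (- res2 x i j) $. k"
  proof (cases k)
    case 0
    then show ?thesis by (simp add: dop_nth res2_def fps_sum_nth)
  next
    case (Suc k')
    have "res2 x i j $. Suc k' = (\<Sum>a<k'. \<Sum>l<n. mpow n x a i l * mpow n x (k' - Suc a) l j)"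
      unfolding res2_def fps_sum_nth res_mult_nth_Suc by (rule sum.swap)
    also have "\<dots> = (\<Sum>a<k'. mpow n x (k' - 1) i j)"
      by (intro sum.cong) (auto simp: mpow_add[OF i, symmetric])
    finally show ?thesis
      using Suc by (cases k') (simp_all add: dop_nth algebra_simps)
  qed
qed

text \<open>The identity u R - x R = 1, multiplied by X = 1 / u.\<close>

lemma res_euler: "fps_X * (\<Sum>l<n. fps_const (x (i, l)) * res x l j) = res x i j - fps_X * fps_const (unit_mat i j)"
proof (rule fps_ext)
  fix k
  show "(fps_X * (\<Sum>l<n. fps_const (x (i, l)) * res x l j)) $. k =
      (res x i j - fps_X * fps_const (unit_mat i j)) $. k"
  proof (cases k)
    case (Suc k')
    then show ?thesis by (cases k') (simp_all add: fps_sum_nth)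
  qed simp
qed

lemma fps_pderiv_res:
  assumes "i < n" "j < n"
  shows "fps_pderiv ({..<n} \<times> {..<n}) (\<lambda>x. res x i j) (\<lambda>v x. res x i (fst v) * res x (snd v) j)"
  unfolding fps_pderiv_def
proof
  fix k
  show "has_pderiv ({..<n} \<times> {..<n}) (\<lambda>x. res x i j $. k)
      (\<lambda>v x. (res x i (fst v) * res x (snd v) j) $. k)"
  proof (cases k)
    case 0
    then show ?thesis using has_pderiv_const by simp
  next
    case (Suc k')
    then show ?thesis
      using has_pderiv_mpow[OF assms, of k'] by (simp only: res_nth_Suc res_mult_nth_Suc)
  qed
qed

lemma fps_pderiv_res2:
  assumes "i < n" "j < n"
  shows "fps_pderiv ({..<n} \<times> {..<n}) (\<lambda>x. res2 x i j)
    (\<lambda>v x. res x i (fst v) * res2 x (snd v) j + res2 x i (fst v) * res x (snd v) j)"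
  unfolding res2_def
  by (rule fps_pderiv_cong[OF fps_pderiv_sum[OF fps_pderiv_mult[OF fps_pderiv_res fps_pderiv_res]]])
    (use assms in \<open>auto simp: sum.distrib sum_distrib_left sum_distrib_right mult_ac\<close>)

lemma fps_pderiv_q1:
  "fps_pderiv ({..<n} \<times> {..<n}) q1 (\<lambda>v x. res2 x (snd v) (fst v))"
  unfolding q1_def[abs_def] res2_def
  by (rule fps_pderiv_cong[OF fps_pderiv_sum[OF fps_pderiv_res]]) (auto simp: mult.commute)

text \<open>The transposed index is the usual one for gradients of spectral functions: the
  derivative of tr R in the entry \<open>(i, j)\<close> is the \<open>(j, i)\<close> entry of
  R^2.\<close>

lemma fps_pderiv_eps:
  "fps_pderiv ({..<n} \<times> {..<n}) (eps r) (\<lambda>v x. grad r x (snd v) (fst v))"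
proof (induction r)
  case 0
  have "eps 0 = (\<lambda>x. 1)" by auto
  then show ?case using fps_pderiv_const by simp
next
  case (Suc r)
  have "eps (Suc r) = (\<lambda>x. fps_const (1 / of_nat (Suc r)) * (q1 x * eps r x + dop (eps r x)))"
    by auto
  then show ?case
    unfolding grad.simps
    by (simp only:) (intro fps_pderiv_cmult fps_pderiv_add fps_pderiv_mult fps_pderiv_q1
        fps_pderiv_dop Suc)
qed

lemma fps_pderiv_grad:
  assumes "k < n" "l < n"
  shows "fps_pderiv ({..<n} \<times> {..<n}) (\<lambda>x. grad r x k l) (\<lambda>v x. dgrad r k l v x)"
proof (induction r)
  case 0
  then show ?case using fps_pderiv_const by simp
next
  case (Suc r)
  show ?case
    unfolding grad.simps dgrad.simps
    by (intro fps_pderiv_cmult fps_pderiv_add fps_pderiv_mult fps_pderiv_q1 fps_pderiv_res2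
        fps_pderiv_eps fps_pderiv_dop Suc assms)
qed

section \<open>Traces, Laplacian and Euler operator of the elementary symmetric functions\<close>

definition mm :: "(nat \<Rightarrow> nat \<Rightarrow> complex fps) \<Rightarrow> (nat \<Rightarrow> nat \<Rightarrow> complex fps) \<Rightarrow> nat \<Rightarrow> nat \<Rightarrow> complex fps" where
  "mm A B i j = (\<Sum>l<n. A i l * B l j)"

lemma mm_assoc: "mm (mm A B) C i j = mm A (mm B C) i j"
proof -
  have "mm (mm A B) C i j = (\<Sum>l<n. \<Sum>r<n. A i r * (B r l * C l j))"
    by (simp add: mm_def sum_distrib_right mult.assoc)
  also have "\<dots> = (\<Sum>r<n. \<Sum>l<n. A i r * (B r l * C l j))" by (rule sum.swap)
  finally show ?thesis by (simp add: mm_def sum_distrib_left)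
qed

lemma res2_mm: "res2 x = mm (res x) (res x)"
  by (intro ext) (simp add: res2_def mm_def)

lemma dop_res2: "i < n \<Longrightarrow> dop (res2 x i j) = - 2 * mm (res x) (res2 x) i j"
proof -
  assume i: "i < n"
  have "dop (res2 x i j) = - mm (res2 x) (res x) i j - mm (res x) (res2 x) i j"
  proof -
    have "dop (res2 x i j) = (\<Sum>l<n. dop (res x i l) * res x l j + res x i l * dop (res x l j))"
      by (simp add: res2_def dop_sum dop_mult)
    also have "\<dots> = (\<Sum>l<n. - (res2 x i l * res x l j) - res x i l * res2 x l j)"
      by (intro sum.cong) (use i in \<open>auto simp: dop_res\<close>)
    finally show ?thesis by (simp add: sum_subtractf sum_negf mm_def)
  qed
  also have "mm (res2 x) (res x) i j = mm (res x) (res2 x) i j"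
    unfolding res2_mm by (rule mm_assoc)
  finally show ?thesis by simp
qed

text \<open>On eigenvalues this is the rule that the derivative of e_{r+1} in y_i equals e_r minus
  y_i times the derivative of e_r in y_i; the factor y_i^2 from y_i = 1 / (u - lambda_i) gives the
  \<open>res2\<close> term. The point is a recursion for \<open>grad\<close> without
  \<open>dop\<close>, which makes traces against powers of R computable.\<close>

lemma grad_rec:
  assumes "i < n" "j < n"
  shows "grad (Suc r) x i j = eps r x * res2 x i j - mm (res x) (grad r x) i j"
  using assms(1)
proof (induction r arbitrary: i)
  case 0
  then show ?case by (simp add: mm_def)
next
  case (Suc r)
  note i = Suc.prems
  let ?R = "res x" and ?N = "grad r x" and ?N1 = "grad (Suc r) x"
  have IH: "?N1 k j = eps r x * res2 x k j - mm ?R ?N k j" if "k < n" for k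
    using Suc.IH that by blast
  have RN1: "mm ?R ?N1 i j = eps r x * mm ?R (res2 x) i j - mm ?R (mm ?R ?N) i j"
    by (simp add: mm_def[of ?R ?N1] IH del: grad.simps)
      (simp add: mm_def sum_subtractf sum_distrib_left algebra_simps)
  \<comment> \<open>The product of R with \<open>?N1\<close> is needed in two forms: above from the
    induction hypothesis, here from the defining recursion. Used with multiplicities 1 and
    \<open>Suc r\<close>, they add up to the factor \<open>Suc (Suc r)\<close> of the claim.\<close>
  have RN1': "of_nat (Suc r) * mm ?R ?N1 i j =
      eps r x * mm ?R (res2 x) i j + (\<Sum>k<n. ?R i k * (q1 x * ?N k j + dop (?N k j)))"
  proof -
    have "of_nat (Suc r) * mm ?R ?N1 i j = (\<Sum>k<n. ?R i k * (of_nat (Suc r) * ?N1 k j))"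
      by (simp only: mm_def sum_distrib_left mult.left_commute)
    then show ?thesis
      unfolding grad_Suc' by (simp add: mm_def sum.distrib sum_distrib_left algebra_simps)
  qed
  have dRN: "dop (mm ?R ?N i j) = - mm ?R (mm ?R ?N) i j + (\<Sum>k<n. ?R i k * dop (?N k j))"
  proof -
    have "dop (mm ?R ?N i j) = - mm (res2 x) ?N i j + (\<Sum>k<n. ?R i k * dop (?N k j))"
      using i by (simp add: mm_def dop_sum dop_mult dop_res sum.distrib sum_subtractf sum_negf)
    then show ?thesis by (simp only: res2_mm mm_assoc)
  qed
  have e: "of_nat (Suc r) * eps (Suc r) x = q1 x * eps r x + dop (eps r x)" by (rule eps_Suc')
  have sumq: "(\<Sum>k<n. ?R i k * (q1 x * ?N k j + dop (?N k j))) =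
      q1 x * mm ?R ?N i j + (\<Sum>k<n. ?R i k * dop (?N k j))"
    by (simp add: mm_def sum.distrib sum_distrib_left algebra_simps)
  have "of_nat (Suc (Suc r)) * grad (Suc (Suc r)) x i j =
      res2 x i j * eps (Suc r) x + q1 x * ?N1 i j + dop (?N1 i j)"
    by (rule grad_Suc')
  also have "q1 x * ?N1 i j = q1 x * eps r x * res2 x i j - q1 x * mm ?R ?N i j"
    by (simp only: IH[OF i]) (simp add: algebra_simps)
  also have "dop (?N1 i j) = dop (eps r x) * res2 x i j + eps r x * (- 2 * mm ?R (res2 x) i j) -
      (- mm ?R (mm ?R ?N) i j + (\<Sum>k<n. ?R i k * dop (?N k j)))"
    by (simp only: IH[OF i] dop_diff dop_mult dop_res2[OF i] dRN)
  also have "res2 x i j * eps (Suc r) x + (q1 x * eps r x * res2 x i j - q1 x * mm ?R ?N i j) +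
      (dop (eps r x) * res2 x i j + eps r x * (- 2 * mm ?R (res2 x) i j) -
      (- mm ?R (mm ?R ?N) i j + (\<Sum>k<n. ?R i k * dop (?N k j)))) =
      res2 x i j * eps (Suc r) x + (q1 x * eps r x + dop (eps r x)) * res2 x i j
      - (eps r x * mm ?R (res2 x) i j + (q1 x * mm ?R ?N i j + (\<Sum>k<n. ?R i k * dop (?N k j))))
      - (eps r x * mm ?R (res2 x) i j - mm ?R (mm ?R ?N) i j)"
    by (simp add: algebra_simps)
  also have "\<dots> = res2 x i j * eps (Suc r) x + of_nat (Suc r) * eps (Suc r) x * res2 x i j
      - of_nat (Suc r) * mm ?R ?N1 i j - mm ?R ?N1 i j"
    by (simp only: e[symmetric] RN1 RN1'[unfolded sumq, symmetric])
  also have "\<dots> = of_nat (Suc (Suc r)) * (eps (Suc r) x * res2 x i j - mm ?R ?N1 i j)"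
    by (simp add: algebra_simps)
  finally show ?case
    by (simp only: mult_cancel_left of_nat_eq_0_iff) (simp del: grad.simps eps.simps)
qed

lemma dop_q1: "dop (q1 x) = - q2 x"
  by (simp add: q1_def q2_def dop_sum dop_res sum_negf)

lemma dop_q2: "dop (q2 x) = - 2 * q3 x"
  by (simp add: q2_def q3_def dop_sum dop_res2 sum_negf mm_def sum_distrib_left)

text \<open>The trace of the gradient is the derivative along the identity matrix; adding a scalar
  to the matrix has the same effect as moving u in the opposite direction.\<close>

lemma tr_grad: "(\<Sum>i<n. grad r x i i) = - dop (eps r x)"
proof (induction r)
  case (Suc r)
  have "of_nat (Suc r) * (\<Sum>i<n. grad (Suc r) x i i) =
      q2 x * eps r x + q1 x * (\<Sum>i<n. grad r x i i) + dop (\<Sum>i<n. grad r x i i)"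
    by (simp only: sum_distrib_left grad_Suc' sum.distrib dop_sum q2_def sum_distrib_right)
  also have "\<dots> = - dop (of_nat (Suc r) * eps (Suc r) x)"
    unfolding Suc eps_Suc' by (simp add: dop_add dop_mult dop_q1 dop_uminus algebra_simps)
  also have "\<dots> = of_nat (Suc r) * (- dop (eps (Suc r) x))"
    by (simp only: dop_mult dop_of_nat) simp
  finally show ?case by (simp only: mult_cancel_left of_nat_eq_0_iff) simp
qed simp

lemma tr_res_grad: "(\<Sum>i<n. mm (res x) (grad r x) i i) = eps r x * q2 x + dop (eps (Suc r) x)"
proof -
  have "- dop (eps (Suc r) x) = eps r x * q2 x - (\<Sum>i<n. mm (res x) (grad r x) i i)"
    unfolding tr_grad[symmetric] q2_def sum_distrib_left sum_subtractf[symmetric]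
    by (intro sum.cong refl grad_rec) auto
  then show ?thesis by (simp add: algebra_simps)
qed

text \<open>The factor R^2 is reached by multiplying \<open>grad_rec\<close> by R and taking the
  trace, and the resulting trace with a single R is \<open>tr_res_grad\<close> for
  \<open>Suc r\<close>.\<close>

lemma tr_res2_grad: "(\<Sum>i<n. mm (res2 x) (grad r x) i i) =
   eps r x * q3 x - eps (Suc r) x * q2 x - dop (eps (Suc (Suc r)) x)"
proof -
  have "mm (res x) (grad (Suc r) x) i i = eps r x * mm (res x) (res2 x) i i -
      mm (res x) (mm (res x) (grad r x)) i i" if "i < n" for i
    using that
    by (simp add: mm_def[of _ "grad (Suc r) x"] grad_rec del: grad.simps)
      (simp add: mm_def sum_subtractf sum_distrib_left algebra_simps)
  then have "(\<Sum>i<n. mm (res x) (grad (Suc r) x) i i) =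
      eps r x * q3 x - (\<Sum>i<n. mm (res2 x) (grad r x) i i)"
    unfolding res2_mm mm_assoc q3_def
    by (simp add: sum_subtractf sum_distrib_left mm_def del: grad.simps)
  then show ?thesis unfolding tr_res_grad by (simp add: algebra_simps del: eps.simps)
qed

text \<open>The identity that closes the system. The recursion of \<open>dgrad\<close> produces
  products such as \<open>q1 x * q2 x\<close>, and \<open>eps_Suc'\<close> with its derivatives in u
  turns them into terms linear in \<open>eps\<close>. For r = 1 it says that the Laplacian of tr R,
  which is 2 tr R tr R^2, equals e_1'' - 2 e_2'.\<close>

lemma dvg_eq: "dvg r x = dop (dop (eps r x)) - 2 * of_nat r * dop (eps (Suc r) x)"
proof (induction r)
  case 0
  then show ?case by (simp add: dvg_def)
next
  case (Suc r)
  let ?e = "\<lambda>r. eps r x"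
  have tr: "(\<Sum>i<n. \<Sum>j<n. res2 x j i * grad r x i j) = (\<Sum>i<n. mm (res2 x) (grad r x) i i)"
    unfolding mm_def by (rule sum.swap)
  have tr': "(\<Sum>i<n. \<Sum>j<n. res2 x i j * grad r x j i) = (\<Sum>i<n. mm (res2 x) (grad r x) i i)"
    unfolding mm_def ..
  have qq: "(\<Sum>i<n. \<Sum>j<n. res x j j * res2 x i i) = q1 x * q2 x"
    "(\<Sum>i<n. \<Sum>j<n. res2 x j j * res x i i) = q1 x * q2 x"
    unfolding q1_def q2_def
    by (subst sum.swap, simp add: sum_product) (simp add: sum_product mult.commute)
  have "of_nat (Suc r) * dvg (Suc r) x =
     (\<Sum>i<n. \<Sum>j<n. res x j j * res2 x i i) * eps r x +
     (\<Sum>i<n. \<Sum>j<n. res2 x j j * res x i i) * eps r x +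
     (\<Sum>i<n. \<Sum>j<n. res2 x j i * grad r x i j) + (\<Sum>i<n. \<Sum>j<n. res2 x i j * grad r x j i)
     + q1 x * dvg r x + dop (dvg r x)"
    unfolding dvg_def sum_distrib_left dgrad_Suc' fst_conv snd_conv
    by (simp add: sum.distrib sum_distrib_left sum_distrib_right dop_sum algebra_simps)
  also have "\<dots> = 2 * q1 x * q2 x * ?e r + 2 * (\<Sum>i<n. mm (res2 x) (grad r x) i i) +
      q1 x * dvg r x + dop (dvg r x)"
    unfolding tr tr' qq by (simp add: algebra_simps)
  finally have main: "of_nat (Suc r) * dvg (Suc r) x =
      2 * q1 x * q2 x * ?e r + 2 * (?e r * q3 x - ?e (Suc r) * q2 x - dop (?e (Suc (Suc r)))) +
      q1 x * dvg r x + dop (dvg r x)"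
    unfolding tr_res2_grad .
  define e0 e1 e2 where "e0 = ?e r" and "e1 = ?e (Suc r)" and "e2 = ?e (Suc (Suc r))"
  have s1: "of_nat (Suc r) * e1 = q1 x * e0 + dop e0"
    unfolding e0_def e1_def by (rule eps_Suc')
  have s2: "of_nat (Suc (Suc r)) * e2 = q1 x * e1 + dop e1"
    unfolding e2_def e1_def by (rule eps_Suc')
  have d1: "of_nat (Suc r) * dop e1 = - q2 x * e0 + q1 x * dop e0 + dop (dop e0)"
    using arg_cong[OF s1, of dop] by (simp only: dop_mult dop_of_nat dop_add dop_q1) simp
  have dd1: "of_nat (Suc r) * dop (dop e1) = 2 * q3 x * e0 - 2 * q2 x * dop e0 + q1 x * dop (dop e0)
      + dop (dop (dop e0))"
    using arg_cong[OF d1, of dop]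
    by (simp only: dop_mult dop_of_nat dop_add dop_uminus dop_q1 dop_q2) (simp add: algebra_simps)
  have d2: "of_nat (Suc (Suc r)) * dop e2 = - q2 x * e1 + q1 x * dop e1 + dop (dop e1)"
    using arg_cong[OF s2, of dop] by (simp only: dop_mult dop_of_nat dop_add dop_q1) simp
  have IH: "dvg r x = dop (dop e0) - 2 * of_nat r * dop e1"
    using Suc unfolding e0_def e1_def .
  have dIH: "dop (dvg r x) = dop (dop (dop e0)) - 2 * of_nat r * dop (dop e1)"
  proof -
    have "dop (2 * of_nat r * dop e1) = 2 * of_nat r * dop (dop e1)"
      using dop_mult[of "of_nat (2 * r)" "dop e1"] dop_of_nat[of "2 * r", where 'a=complex] by simp
    then show ?thesis unfolding IH by (simp add: dop_diff)
  qed
  have "of_nat (Suc r) * dvg (Suc r) x =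
      2 * q1 x * q2 x * e0 + 2 * (e0 * q3 x - e1 * q2 x - dop e2) +
      q1 x * (dop (dop e0) - 2 * of_nat r * dop e1) + (dop (dop (dop e0)) - 2 * of_nat r * dop (dop e1))"
    using main unfolding dIH unfolding IH e0_def[symmetric] e1_def[symmetric] e2_def[symmetric] .
  also have "\<dots> = of_nat (Suc r) * (dop (dop e1) - 2 * of_nat (Suc r) * dop e2)"
  proof -
    define c :: "complex fps" where "c = of_nat r"
    have c: "of_nat (Suc r) = c + 1" "of_nat (Suc (Suc r)) = c + 2" by (simp_all add: c_def)
    note s1 = s1[unfolded c] and d1 = d1[unfolded c] and dd1 = dd1[unfolded c] and d2 = d2[unfolded c]
    show ?thesis
      unfolding c c_def[symmetric]
    proof -
      have "2 * q1 x * q2 x * e0 + 2 * (e0 * q3 x - e1 * q2 x - dop e2) +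
          q1 x * (dop (dop e0) - 2 * c * dop e1) + (dop (dop (dop e0)) - 2 * c * dop (dop e1)) =
          (2 * q3 x * e0 - 2 * q2 x * dop e0 + q1 x * dop (dop e0) + dop (dop (dop e0))) +
          2 * q2 x * (q1 x * e0 + dop e0) - 2 * e1 * q2 x - 2 * dop e2
          - 2 * c * (- q2 x * e1 + q1 x * dop e1 + dop (dop e1)) - 2 * c * q2 x * e1"
        by (simp add: algebra_simps)
      then show "2 * q1 x * q2 x * e0 + 2 * (e0 * q3 x - e1 * q2 x - dop e2) +
          q1 x * (dop (dop e0) - 2 * c * dop e1) + (dop (dop (dop e0)) - 2 * c * dop (dop e1)) =
          (c + 1) * (dop (dop e1) - 2 * (c + 1) * dop e2)"
        unfolding s1[symmetric] dd1[symmetric] d2[symmetric] by (simp add: algebra_simps)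
    qed
  qed
  finally show ?case
    unfolding e1_def e2_def by (simp only: mult_cancel_left of_nat_eq_0_iff) simp
qed

text \<open>Homogeneity: e_r has degree -r in u and the eigenvalues together, so its coefficient at
  u^{-k} is a homogeneous polynomial of degree k - r in the matrix entries, and the left side is the
  Euler operator in the entries.\<close>

lemma euler_grad:
  "(\<Sum>i<n. \<Sum>j<n. fps_const (x (i, j)) * grad r x j i) = fps_X * fps_deriv (eps r x) - of_nat r * eps r x"
proof (induction r)
  case (Suc r)
  have base: "(\<Sum>i<n. \<Sum>j<n. fps_const (x (i, j)) * res2 x j i) = fps_X * fps_deriv (q1 x) - q1 x"
  proof -
    have "(\<Sum>i<n. \<Sum>j<n. fps_const (x (i, j)) * res2 x j i) =
        (\<Sum>i<n. \<Sum>j<n. \<Sum>l<n. fps_const (x (i, j)) * (res x j l * res x l i))"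
      by (simp add: res2_def sum_distrib_left)
    also have "\<dots> = (\<Sum>i<n. \<Sum>l<n. \<Sum>j<n. fps_const (x (i, j)) * (res x j l * res x l i))"
      by (intro sum.cong refl sum.swap)
    \<comment> \<open>The extra factor X makes \<open>res_euler\<close> applicable; it is cancelled
      again at the end.\<close>
    finally have "fps_X * (\<Sum>i<n. \<Sum>j<n. fps_const (x (i, j)) * res2 x j i) =
        (\<Sum>i<n. \<Sum>l<n. (fps_X * (\<Sum>j<n. fps_const (x (i, j)) * res x j l)) * res x l i)"
      by (simp add: sum_distrib_left sum_distrib_right mult.assoc)
    also have "\<dots> = (\<Sum>i<n. \<Sum>l<n. res x i l * res x l i - fps_X * (fps_const (unit_mat i l) * res x l i))"
      unfolding res_euler by (simp add: algebra_simps)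
    also have "\<dots> = q2 x - fps_X * q1 x"
    proof -
      have "(\<Sum>l<n. fps_const (unit_mat i l) * res x l i) = res x i i" if "i < n" for i
        using that by (simp add: unit_mat_def if_distrib if_distribR cong: if_cong)
      then show ?thesis
        by (simp add: sum_subtractf sum_distrib_left[symmetric] q2_def res2_def q1_def)
    qed
    also have "\<dots> = fps_X * (fps_X * fps_deriv (q1 x) - q1 x)"
      using dop_q1[of x] by (simp add: dop_def algebra_simps power2_eq_square)
    finally show ?thesis by (simp add: mult_cancel_left)
  qed
  have xd: "(\<Sum>i<n. \<Sum>j<n. fps_const (x (i, j)) * dop (grad r x j i)) =
      dop (\<Sum>i<n. \<Sum>j<n. fps_const (x (i, j)) * grad r x j i)"
    by (simp add: dop_sum dop_cmult)
  have "of_nat (Suc r) * (\<Sum>i<n. \<Sum>j<n. fps_const (x (i, j)) * grad (Suc r) x j i) =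
      (\<Sum>i<n. \<Sum>j<n. fps_const (x (i, j)) * (of_nat (Suc r) * grad (Suc r) x j i))"
    by (simp only: sum_distrib_left mult.left_commute)
  also have "\<dots> = (\<Sum>i<n. \<Sum>j<n. fps_const (x (i, j)) * res2 x j i) * eps r x +
      q1 x * (\<Sum>i<n. \<Sum>j<n. fps_const (x (i, j)) * grad r x j i) +
      dop (\<Sum>i<n. \<Sum>j<n. fps_const (x (i, j)) * grad r x j i)"
    unfolding grad_Suc' xd[symmetric]
    by (simp add: sum.distrib sum_distrib_left sum_distrib_right algebra_simps)
  also have "\<dots> = fps_X * fps_deriv (q1 x * eps r x + dop (eps r x))
      - of_nat (Suc r) * (q1 x * eps r x + dop (eps r x))"
  proof -
    have "dop (of_nat r * eps r x) = of_nat r * dop (eps r x)"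
      by (simp add: dop_mult dop_of_nat)
    then show ?thesis
      unfolding Suc base dop_diff dop_euler_commute by (simp add: algebra_simps)
  qed
  also have "\<dots> = of_nat (Suc r) * (fps_X * fps_deriv (eps (Suc r) x) - of_nat (Suc r) * eps (Suc r) x)"
    unfolding eps_Suc'[symmetric]
    by (simp only: fps_deriv_mult fps_deriv_of_nat) (simp add: algebra_simps del: of_nat_Suc eps.simps)
  finally show ?case by (simp only: mult_cancel_left of_nat_eq_0_iff) simp
qed simp

lemma eps_nth_less: "k < r \<Longrightarrow> eps r x $. k = 0"
proof (induction r arbitrary: k)
  case (Suc r)
  have "(q1 x * eps r x) $. k = 0"
    unfolding fps_mult_nth
  proof (intro sum.neutral ballI)
    fix a assume "a \<in> {0..k}"
    then show "q1 x $. a * eps r x $. (k - a) = 0"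
      using Suc by (cases "a = 0") (auto simp: q1_def fps_sum_nth)
  qed
  moreover have "dop (eps r x) $. k = 0"
    using Suc by (cases k) (auto simp: dop_nth)
  ultimately show ?case by simp
qed simp

text \<open>Each 1 / (u - lambda) starts with X, so e_r starts with X^r times the number of
  r-element sets of eigenvalues. These are the initial values of the recursion for the
  expectations.\<close>

lemma eps_nth_self: "eps r x $. r = of_nat (n choose r)"
proof (induction r)
  case 0
  show ?case by simp
next
  case (Suc r)
  have "(q1 x * eps r x) $. Suc r = (\<Sum>a=0..Suc r. if a = 1 then q1 x $. 1 * eps r x $. r else 0)"
    unfolding fps_mult_nth
  proof (intro sum.cong refl)
    fix a assume "a \<in> {0..Suc r}"
    then show "q1 x $. a * eps r x $. (Suc r - a) = (if a = 1 then q1 x $. 1 * eps r x $. r else 0)"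
      by (cases "a = 0"; cases "a = 1") (auto simp: q1_def fps_sum_nth eps_nth_less)
  qed
  also have "\<dots> = of_nat n * of_nat (n choose r)"
    using Suc by (simp add: q1_def fps_sum_nth unit_mat_def)
  finally have "eps (Suc r) x $. Suc r =
      (of_nat n * of_nat (n choose r) - of_nat r * of_nat (n choose r)) / of_nat (Suc r)"
    using Suc by (simp add: dop_nth del: of_nat_Suc)
  also have "\<dots> = of_nat (n choose Suc r)"
  proof (cases "r \<le> n")
    case True
    have "of_nat (Suc r * (n choose Suc r)) = (of_nat ((n - r) * (n choose r)) :: complex)"
      by (simp only: binomial_absorb_comp binomial_absorption)
    then show ?thesis using True
      by (subst nonzero_divide_eq_eq[OF of_nat_neq_0]) (simp add: algebra_simps of_nat_diff)
  next
    case False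
    then show ?thesis by (simp add: binomial_eq_0)
  qed
  finally show ?case .
qed

end

subsection \<open>Moments of the Gaussian unitary ensemble\<close>

text \<open>For r = 1, and after multiplication by (2k)!, this is the Harer-Zagier expression: (2k -
  1)!! times the sum over j of 2^j C(k, j) C(m, j + 1). In general it is the coefficient of z^k in
  exp(z / 2) times the sum over j of C(m, r + j) z^j / j!, and \<open>hz_rec\<close> is
  differentiation in z.\<close>

definition hz :: "nat \<Rightarrow> nat \<Rightarrow> nat \<Rightarrow> real" where
  "hz m r k = (\<Sum>j\<le>k. real (m choose (r + j)) / (fact j * (2 ^ (k - j) * fact (k - j))))"

lemma hz_rec: "2 * real (Suc k) * hz m r (Suc k) = hz m r k + 2 * hz m (Suc r) k"
proof -
  let ?c = "\<lambda>j. real (m choose (r + j))"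
  let ?t = "\<lambda>j. ?c j / (fact j * (2 ^ (Suc k - j) * fact (Suc k - j)))"
  have "2 * real (Suc k) * hz m r (Suc k) =
      (\<Sum>j\<le>Suc k. 2 * real (Suc k - j) * ?t j) + (\<Sum>j\<le>Suc k. 2 * real j * ?t j)"
    unfolding hz_def sum_distrib_left sum.distrib[symmetric]
  proof (intro sum.cong refl)
    fix j assume "j \<in> {..Suc k}"
    then have "real (Suc k) = real (Suc k - j) + real j" by auto
    then show "2 * real (Suc k) * ?t j = 2 * real (Suc k - j) * ?t j + 2 * real j * ?t j"
      by (simp only: distrib_left distrib_right)
  qed
  also have "(\<Sum>j\<le>Suc k. 2 * real (Suc k - j) * ?t j) = (\<Sum>j\<le>k. 2 * real (Suc k - j) * ?t j)"
    by simp
  also have "\<dots> = hz m r k"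
    unfolding hz_def
  proof (intro sum.cong refl)
    fix j assume "j \<in> {..k}"
    then obtain d where "k = j + d" using le_Suc_ex by auto
    then have d: "Suc k - j = Suc d" "k - j = d" by auto
    show "2 * real (Suc k - j) * ?t j = ?c j / (fact j * (2 ^ (k - j) * fact (k - j)))"
      unfolding d by (simp add: divide_simps del: of_nat_Suc)
  qed
  also have "(\<Sum>j\<le>Suc k. 2 * real j * ?t j) = (\<Sum>j\<le>k. 2 * real (Suc j) * ?t (Suc j))"
    by (subst sum.atMost_Suc_shift) simp
  also have "\<dots> = 2 * hz m (Suc r) k"
    unfolding hz_def sum_distrib_left
    by (intro sum.cong) (auto simp: divide_simps simp del: of_nat_Suc)
  finally show ?thesis .
qed

text \<open>Expectation of the unnormalized trace of the k-th power; division by m gives the moment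
  of the limit law.\<close>

definition gue_moment :: "nat \<Rightarrow> nat \<Rightarrow> real" where
  "gue_moment m k = (if odd k then 0 else fact k / real m ^ (k div 2) * hz m 1 (k div 2))"

context asymptotically_gue
begin

sublocale resolvent m .

definition epsW :: "nat \<Rightarrow> nat \<Rightarrow> complex" where
  "epsW r k = W (\<lambda>x. eps r x $. k)"

lemma epsW_less: "k < r \<Longrightarrow> epsW r k = 0"
  unfolding epsW_def by (simp add: eps_nth_less W_const)

lemma epsW_self: "epsW r r = of_nat (m choose r)"
  unfolding epsW_def by (simp add: eps_nth_self W_const)

text \<open>Three facts are combined coefficientwise: \<open>euler_grad\<close> writes k - r times
  the coefficient as a sum of entries times derivatives, \<open>W_stein\<close> turns this sum into
  the Laplacian over m, and \<open>dvg_eq\<close> leads back to \<open>eps\<close>. Wherever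
  subtraction truncates on the right, a factor vanishes.\<close>

lemma epsW_rec: "of_nat m * (of_nat k - of_nat r) * epsW r k =
    of_nat (k - 1) * of_nat (k - 1 - 1) * epsW r (k - 1 - 1) +
    2 * of_nat r * of_nat (k - 1) * epsW (Suc r) (k - 1)"
proof -
  have pe: "polyfun I (\<lambda>x. eps r x $. k)" for r k
    by (rule polyfun_fps_nth[OF fps_pderiv_eps])
  have pg: "polyfun I (\<lambda>x. grad r x j i $. k)" if "i < m" "j < m" for i j
    by (rule polyfun_fps_nth[OF fps_pderiv_grad[OF that(2,1)]])
  have pd: "polyfun I (\<lambda>x. dgrad r j i (j, i) x $. k)" if "i < m" "j < m" for i j
    using has_pderiv_polyfun[OF fps_pderiv_grad[of j i r, unfolded fps_pderiv_def, rule_format, of k]]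
      that by auto
  have "(of_nat k - of_nat r) * epsW r k =
      W (\<lambda>x. (fps_X * fps_deriv (eps r x) - of_nat r * eps r x) $. k)"
  proof -
    have "(fps_X * fps_deriv (eps r x) - of_nat r * eps r x) $. k =
        (of_nat k - of_nat r) * eps r x $. k" for x
      by (cases k) (simp_all add: fps_of_nat[symmetric] algebra_simps)
    then show ?thesis unfolding epsW_def by (simp add: W_cmult pe)
  qed
  also have "\<dots> = W (\<lambda>x. \<Sum>i<m. \<Sum>j<m. x (i, j) * grad r x j i $. k)"
    unfolding euler_grad[symmetric] by (simp add: fps_sum_nth)
  also have "\<dots> = (\<Sum>i<m. \<Sum>j<m. W (\<lambda>x. x (i, j) * grad r x j i $. k))"
    by (subst W_sum, simp, intro polyfun_sum polyfun_mult polyfun_var pg)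
      (auto intro!: sum.cong W_sum polyfun_mult polyfun_var pg)
  also have "\<dots> = (\<Sum>i<m. \<Sum>j<m. W (\<lambda>x. dgrad r j i (j, i) x $. k) / of_nat m)"
  proof (intro sum.cong refl)
    fix i j assume ij: "i \<in> {..<m}" "j \<in> {..<m}"
    then show "W (\<lambda>x. x (i, j) * grad r x j i $. k) = W (\<lambda>x. dgrad r j i (j, i) x $. k) / of_nat m"
      using W_stein[OF fps_pderiv_grad[of j i r, unfolded fps_pderiv_def, rule_format, of k]] by auto
  qed
  also have "\<dots> = W (\<lambda>x. dvg r x $. k) / of_nat m"
    unfolding dvg_def fps_sum_nth sum_divide_distrib[symmetric]
    by (subst W_sum, simp, intro polyfun_sum pd)
      (auto intro!: sum.cong W_sum[symmetric] pd)
  also have "W (\<lambda>x. dvg r x $. k) =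
      of_nat (k - 1) * of_nat (k - 1 - 1) * epsW r (k - 1 - 1) +
      2 * of_nat r * of_nat (k - 1) * epsW (Suc r) (k - 1)"
  proof -
    have "dvg r x $. k = (of_nat (k - 1) * of_nat (k - 1 - 1)) * eps r x $. (k - 1 - 1) +
        (2 * of_nat r * of_nat (k - 1)) * eps (Suc r) x $. (k - 1)" for x
    proof -
      have c: "2 * of_nat r = fps_const (2 * of_nat r :: complex)"
        by (metis fps_of_nat of_nat_mult of_nat_numeral)
      show ?thesis
        unfolding dvg_eq c by (simp add: dop_nth del: eps.simps One_nat_def)
    qed
    then show ?thesis
      unfolding epsW_def by (simp only: W_add W_cmult pe polyfun_cmult)
  qed
  finally show ?thesis using m_pos by (simp add: field_simps)
qed

text \<open>The recursion at (r, r + 2 (k + 1)) refers to (r, r + 2 k) and (r + 1, r + 1 + 2 k),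
  both with the same k. Hence the induction runs over k for all r at once, and after extracting
  factorials the recursion is \<open>hz_rec\<close>.\<close>

lemma epsW_even: "r \<ge> 1 \<Longrightarrow>
    epsW r (r + 2 * k) = of_real (fact (r - 1 + 2 * k) / (fact (r - 1) * real m ^ k) * hz m r k)"
proof (induction k arbitrary: r)
  case 0
  then show ?case by (simp add: epsW_self hz_def)
next
  case (Suc k)
  define f :: real where "f = fact (r - 1 + 2 * k)"
  obtain s where s: "r = Suc s" using Suc.prems by (cases r) auto
  have "of_nat m * of_nat (2 * Suc k) * epsW r (r + 2 * Suc k) =
      of_nat (r + 2 * k + 1) * of_nat (r + 2 * k) * epsW r (r + 2 * k) +
      2 * of_nat r * of_nat (r + 2 * k + 1) * epsW (Suc r) (Suc r + 2 * k)"
    using epsW_rec[of "r + 2 * Suc k" r] by simp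
  also have "\<dots> = of_real (of_nat (r + 2 * k + 1) * of_nat (r + 2 * k) *
      (fact (r - 1 + 2 * k) / (fact (r - 1) * real m ^ k) * hz m r k) +
      2 * of_nat r * of_nat (r + 2 * k + 1) *
      (fact (r + 2 * k) / (fact r * real m ^ k) * hz m (Suc r) k))"
    using Suc.IH[of r] Suc.IH[of "Suc r"] Suc.prems by simp
  also have "of_nat (r + 2 * k + 1) * of_nat (r + 2 * k) *
      (fact (r - 1 + 2 * k) / (fact (r - 1) * real m ^ k) * hz m r k) +
      2 * of_nat r * of_nat (r + 2 * k + 1) *
      (fact (r + 2 * k) / (fact r * real m ^ k) * hz m (Suc r) k) =
      fact (r + 2 * k + 1) / (fact (r - 1) * real m ^ k) * (hz m r k + 2 * hz m (Suc r) k)"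
  proof -
    have 1: "fact (r + 2 * k + 1) = real (r + 2 * k + 1) * (real (r + 2 * k) * fact (r - 1 + 2 * k))"
      "fact (r + 2 * k) = real (r + 2 * k) * fact (r - 1 + 2 * k)"
      "fact r = real r * fact (r - 1)"
      unfolding s by simp_all
    have "real r \<noteq> 0" using s by simp
    then show ?thesis unfolding 1 using m_pos
      by (simp add: field_simps del: of_nat_add of_nat_Suc)
  qed
  also have "\<dots> = fact (r + 2 * k + 1) / (fact (r - 1) * real m ^ k) * (2 * real (Suc k) * hz m r (Suc k))"
    by (simp only: hz_rec)
  also have "\<dots> = real m * real (2 * Suc k) *
      (fact (r - 1 + 2 * Suc k) / (fact (r - 1) * real m ^ Suc k) * hz m r (Suc k))"
  proof -
    have idx: "r - 1 + 2 * Suc k = r + 2 * k + 1" using s by simp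
    show ?thesis unfolding idx using m_pos by (simp add: divide_simps del: fact_Suc)
  qed
  finally have "of_nat m * of_nat (2 * Suc k) * epsW r (r + 2 * Suc k) =
      of_nat m * of_nat (2 * Suc k) *
      of_real (fact (r - 1 + 2 * Suc k) / (fact (r - 1) * real m ^ Suc k) * hz m r (Suc k))"
    by (simp only: of_real_mult of_real_of_nat_eq)
  moreover have "of_nat m * of_nat (2 * Suc k) \<noteq> (0 :: complex)"
    using m_pos by (simp del: of_nat_Suc)
  ultimately show ?case by (metis mult_left_cancel)
qed

text \<open>The same recursion on the other parity class. It starts from zero, because for k = 0
  both terms on the right lie below the leading degree.\<close>

lemma epsW_odd: "r \<ge> 1 \<Longrightarrow> epsW r (r + 2 * k + 1) = 0"
proof (induction k arbitrary: r)
  case 0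
  have "of_nat m * (of_nat (r + 1) - of_nat r) * epsW r (r + 1) = 0"
    using epsW_rec[of "r + 1" r] 0 by (simp add: epsW_less)
  then show ?case using m_pos by simp
next
  case (Suc k)
  have "of_nat m * of_nat (2 * Suc k + 1) * epsW r (r + 2 * Suc k + 1) = 0"
    using epsW_rec[of "r + 2 * Suc k + 1" r] Suc.IH[of r] Suc.IH[of "Suc r"] Suc.prems by simp
  moreover have "of_nat m * of_nat (2 * Suc k + 1) \<noteq> (0 :: complex)"
    using m_pos by (simp del: of_nat_Suc of_nat_add)
  ultimately show ?case by simp
qed

text \<open>\<open>eps 1\<close> is the trace of the resolvent, whose coefficient of index
  \<open>Suc k\<close> is the trace of the k-th power.\<close>

theorem trace_moment_tendsto:
  "(\<lambda>N. L N (\<lambda>x. \<Sum>i<m. mpow m x k i i)) \<longlonglongrightarrow> of_real (gue_moment m k)"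
proof -
  have "eps 1 x $. Suc k = (\<Sum>i<m. mpow m x k i i)" for x
    by (simp add: q1_def fps_sum_nth)
  then have "W (\<lambda>x. \<Sum>i<m. mpow m x k i i) = epsW 1 (Suc k)"
    unfolding epsW_def by simp
  also have "\<dots> = of_real (gue_moment m k)"
  proof (cases "even k")
    case True
    then show ?thesis using epsW_even[of 1 "k div 2"] by (simp add: gue_moment_def)
  next
    case False
    then have "k = Suc (2 * (k div 2))" by simp
    then show ?thesis using epsW_odd[of 1 "k div 2"] False by (simp add: gue_moment_def)
  qed
  moreover have "polyfun I (\<lambda>x. \<Sum>i<m. mpow m x k i i :: complex)"
    by (intro polyfun_sum polyfun_mpow) auto
  ultimately show ?thesis using L_tendsto_W by metis
qed

end

subsection \<open>Words over a finite alphabet\<close>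

definition words :: "'i set \<Rightarrow> nat \<Rightarrow> 'i list set" where
  "words J n = {xs. set xs \<subseteq> J \<and> length xs = n}"

lemma finite_words [simp]: "finite J \<Longrightarrow> finite (words J n)"
  unfolding words_def by (rule finite_lists_length_eq)

lemma words_0 [simp]: "words J 0 = {[]}"
  by (auto simp: words_def)

lemma sum_words_Suc:
  fixes f :: "'i list \<Rightarrow> 'b::comm_monoid_add"
  shows "(\<Sum>xs\<in>words J (Suc n). f xs) = (\<Sum>x\<in>J. \<Sum>xs\<in>words J n. f (x # xs))"
proof -
  have "words J (Suc n) = (\<lambda>(x, xs). x # xs) ` (J \<times> words J n)"
    by (auto simp: words_def image_iff length_Suc_conv)
  moreover have "inj_on (\<lambda>(x, xs). x # xs) (J \<times> words J n)" by (auto simp: inj_on_def)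
  ultimately have "(\<Sum>xs\<in>words J (Suc n). f xs) = (\<Sum>p\<in>J \<times> words J n. f (case p of (x, xs) \<Rightarrow> x # xs))"
    by (simp only: sum.reindex o_def)
  then show ?thesis by (simp add: sum.cartesian_product case_prod_beta)
qed

lemma sum_words_append:
  fixes f :: "'i list \<Rightarrow> 'b::comm_monoid_add"
  shows "(\<Sum>xs\<in>words J (a + b). f xs) = (\<Sum>xs\<in>words J a. \<Sum>ys\<in>words J b. f (xs @ ys))"
  by (induction a arbitrary: f) (simp_all add: sum_words_Suc)

text \<open>Serves to compare Wick's rule with full moments: a sum over a partner letter and a
  remaining word becomes one sum over words that contain the partner at position
  \<open>l\<close>.\<close>

lemma sum_words_insert:
  fixes f :: "'i list \<Rightarrow> 'b::comm_monoid_add"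
  assumes "l \<le> n"
  shows "(\<Sum>xs\<in>words J (Suc n). f xs) = (\<Sum>y\<in>J. \<Sum>ys\<in>words J n. f (take l ys @ y # drop l ys))"
proof -
  obtain b where b: "n = l + b" using assms le_Suc_ex by blast
  have "(\<Sum>xs\<in>words J (Suc n). f xs) = (\<Sum>xs\<in>words J l. \<Sum>y\<in>J. \<Sum>ys\<in>words J b. f (xs @ y # ys))"
    using sum_words_append[of f J l "Suc b"] by (simp add: b sum_words_Suc)
  also have "\<dots> = (\<Sum>y\<in>J. \<Sum>xs\<in>words J l. \<Sum>ys\<in>words J b. f (xs @ y # ys))"
    by (rule sum.swap)
  also have "\<dots> = (\<Sum>y\<in>J. \<Sum>ys\<in>words J n. f (take l ys @ y # drop l ys))"
    unfolding b sum_words_append by (intro sum.cong) (auto simp: words_def)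
  finally show ?thesis .
qed

text \<open>Such a word is encoded by a list of d letters that contains all of its letters, and by n
  positions in this list. The exponent of \<open>card J\<close> is the number of free letters, which
  the normalization has to compensate.\<close>

lemma card_words_few_letters:
  assumes "finite J" "J \<noteq> {}"
  shows "card {xs \<in> words J n. card (set xs) \<le> d} \<le> d ^ n * card J ^ d"
proof -
  obtain a where a: "a \<in> J" using assms(2) by auto
  have "{xs \<in> words J n. card (set xs) \<le> d} \<subseteq>
      (\<lambda>(ys, is). map ((!) ys) is) ` (words J d \<times> words {..<d} n)"
  proof
    fix xs assume "xs \<in> {xs \<in> words J n. card (set xs) \<le> d}"
    then have xs: "set xs \<subseteq> J" "length xs = n" "card (set xs) \<le> d" by (auto simp: words_def)
    obtain zs where zs: "set zs = set xs" "distinct zs"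
      using finite_distinct_list[of "set xs"] by auto
    \<comment> \<open>The list of distinct letters is padded with an arbitrary letter to length
      exactly \<open>d\<close>.\<close>
    define ys where "ys = zs @ replicate (d - length zs) a"
    have len: "length ys = d" using zs xs(3) distinct_card[of zs] by (simp add: ys_def)
    have sub: "set ys \<subseteq> J" "set xs \<subseteq> set ys" using zs xs a by (auto simp: ys_def)
    then have "\<forall>x\<in>set xs. \<exists>i<d. ys ! i = x" using len by (metis in_set_conv_nth subsetD)
    then obtain i where i: "\<And>x. x \<in> set xs \<Longrightarrow> i x < d \<and> ys ! i x = x" by metis
    have "xs = map ((!) ys) (map i xs)" using i by (simp add: map_idI)
    moreover have "ys \<in> words J d" "map i xs \<in> words {..<d} n"
      using len sub i xs by (auto simp: words_def)
    ultimately show "xs \<in> (\<lambda>(ys, is). map ((!) ys) is) ` (words J d \<times> words {..<d} n)"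
      by (intro image_eqI[of _ _ "(ys, map i xs)"]) auto
  qed
  then have "card {xs \<in> words J n. card (set xs) \<le> d} \<le> card (words J d \<times> words {..<d} n)"
    by (rule surj_card_le[rotated]) (use assms in auto)
  also have "\<dots> = d ^ n * card J ^ d"
    using assms(1) by (simp add: card_cartesian_product words_def card_lists_length_eq)
  finally show ?thesis .
qed

lemma prod_list_count:
  fixes f :: "'i \<Rightarrow> 'b::comm_monoid_mult"
  assumes "finite S" "set xs \<subseteq> S"
  shows "prod_list (map f xs) = (\<Prod>x\<in>S. f x ^ count_list xs x)"
  using assms(2)
proof (induction xs)
  case (Cons a xs)
  have "(\<Prod>x\<in>S. f x ^ count_list (a # xs) x) =
      (\<Prod>x\<in>S. (if x = a then f a else 1) * f x ^ count_list xs x)"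
    by (intro prod.cong) auto
  then show ?case using Cons assms(1) by (simp add: prod.distrib prod.delta)
qed simp

lemma length_ge_card_set:
  assumes "\<And>x. x \<in> set xs \<Longrightarrow> count_list xs x \<ge> 2"
  shows "2 * card (set xs) \<le> length xs"
proof -
  have "2 * card (set xs) = (\<Sum>x\<in>set xs. 2)" by simp
  also have "\<dots> \<le> (\<Sum>x\<in>set xs. count_list xs x)" by (rule sum_mono) (rule assms)
  also have "\<dots> = length xs" by (rule sum_count_set) auto
  finally show ?thesis .
qed

text \<open>A letter of multiplicity three makes the count strict, which keeps such words out of the
  leading order in \<open>mom_wick\<close>.\<close>

lemma length_ge_card_set':
  assumes "\<And>x. x \<in> set xs \<Longrightarrow> count_list xs x \<ge> 2" "y \<in> set xs" "count_list xs y \<ge> 3"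
  shows "2 * card (set xs) + 1 \<le> length xs"
proof -
  have "2 * card (set xs) + 1 = (\<Sum>x\<in>set xs. 2 + (if x = y then 1 else 0))"
    using assms(2) by (simp add: sum.distrib sum.delta del: add_2_eq_Suc add_2_eq_Suc')
  also have "\<dots> \<le> (\<Sum>x\<in>set xs. count_list xs x)"
  proof (rule sum_mono)
    fix x assume "x \<in> set xs"
    then show "2 + (if x = y then 1 else 0) \<le> count_list xs x"
      using assms(1)[of x] assms(3) by (cases "x = y") auto
  qed
  also have "\<dots> = length xs" by (rule sum_count_set) auto
  finally show ?thesis .
qed

subsection \<open>Moments of independent families\<close>

text \<open>\<open>D k\<close> bounds the absolute moments of all orders up to k at once, because
  the letters of a word of length k occur with various multiplicities.\<close>

locale centered_family = prob_space M for M :: "'a measure" +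
  fixes J :: "'i set" and \<xi> :: "'i \<Rightarrow> 'a \<Rightarrow> real" and D :: "nat \<Rightarrow> real"
  assumes finite_J: "finite J" and J_nonempty: "J \<noteq> {}"
    and indep: "indep_vars (\<lambda>_. borel) \<xi> J"
    and mean_zero: "\<alpha> \<in> J \<Longrightarrow> expectation (\<xi> \<alpha>) = 0"
    and integrable_abs_power: "\<alpha> \<in> J \<Longrightarrow> integrable M (\<lambda>\<omega>. \<bar>\<xi> \<alpha> \<omega>\<bar> ^ k)"
    and moment_bound: "\<alpha> \<in> J \<Longrightarrow> j \<le> k \<Longrightarrow> expectation (\<lambda>\<omega>. \<bar>\<xi> \<alpha> \<omega>\<bar> ^ j) \<le> D k"
    and D_ge_1: "1 \<le> D k"
begin

definition wprod :: "'i list \<Rightarrow> 'a \<Rightarrow> real" where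
  "wprod xs \<omega> = prod_list (map (\<lambda>\<alpha>. \<xi> \<alpha> \<omega>) xs)"

definition mom :: "'i list \<Rightarrow> real" where
  "mom xs = expectation (wprod xs)"

lemma wprod_simps [simp]: "wprod [] \<omega> = 1" "wprod (x # xs) \<omega> = \<xi> x \<omega> * wprod xs \<omega>"
  "wprod (xs @ ys) \<omega> = wprod xs \<omega> * wprod ys \<omega>"
  by (simp_all add: wprod_def)

lemma xi_measurable [measurable]: "\<alpha> \<in> J \<Longrightarrow> \<xi> \<alpha> \<in> borel_measurable M"
  using indep unfolding indep_vars_def by auto

lemma integrable_power: "\<alpha> \<in> J \<Longrightarrow> integrable M (\<lambda>\<omega>. \<xi> \<alpha> \<omega> ^ k)"
  by (rule Bochner_Integration.integrable_bound[OF integrable_abs_power[of \<alpha> k]])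
    (auto simp: power_abs)

lemma
  assumes S: "S \<subseteq> J" "set xs \<subseteq> S"
  shows integrable_wprod': "integrable M (wprod xs)"
    and mom_eq: "mom xs = (\<Prod>\<alpha>\<in>S. expectation (\<lambda>\<omega>. \<xi> \<alpha> \<omega> ^ count_list xs \<alpha>))"
proof -
  have fS: "finite S" using S(1) finite_J finite_subset by blast
  have ind: "indep_vars (\<lambda>_. borel) (\<lambda>\<alpha> \<omega>. \<xi> \<alpha> \<omega> ^ count_list xs \<alpha>) S"
    by (rule indep_vars_compose2[OF indep_vars_subset[OF indep S(1)]]) measurable
  have eq: "wprod xs = (\<lambda>\<omega>. \<Prod>\<alpha>\<in>S. \<xi> \<alpha> \<omega> ^ count_list xs \<alpha>)"
    unfolding wprod_def using prod_list_count[OF fS S(2)] by auto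
  have int: "\<And>\<alpha>. \<alpha> \<in> S \<Longrightarrow> integrable M (\<lambda>\<omega>. \<xi> \<alpha> \<omega> ^ count_list xs \<alpha>)"
    using S(1) integrable_power by auto
  show "integrable M (wprod xs)"
    unfolding eq by (rule indep_vars_integrable[OF fS ind int])
  show "mom xs = (\<Prod>\<alpha>\<in>S. expectation (\<lambda>\<omega>. \<xi> \<alpha> \<omega> ^ count_list xs \<alpha>))"
    unfolding mom_def eq by (rule indep_vars_lebesgue_integral[OF fS ind int])
qed

lemma integrable_wprod: "set xs \<subseteq> J \<Longrightarrow> integrable M (wprod xs)"
  by (rule integrable_wprod'[of "set xs"]) auto

lemma abs_mom_le:
  assumes "set xs \<subseteq> J" "length xs \<le> k"
  shows "\<bar>mom xs\<bar> \<le> D k ^ k"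
proof -
  have "\<bar>mom xs\<bar> = (\<Prod>\<alpha>\<in>set xs. \<bar>expectation (\<lambda>\<omega>. \<xi> \<alpha> \<omega> ^ count_list xs \<alpha>)\<bar>)"
    using mom_eq[OF assms(1) subset_refl] by (simp add: abs_prod)
  also have "\<dots> \<le> (\<Prod>\<alpha>\<in>set xs. D k)"
  proof (intro prod_mono conjI)
    fix \<alpha> assume "\<alpha> \<in> set xs"
    then have "\<alpha> \<in> J" using assms by auto
    have "\<bar>expectation (\<lambda>\<omega>. \<xi> \<alpha> \<omega> ^ count_list xs \<alpha>)\<bar> \<le>
        expectation (\<lambda>\<omega>. \<bar>\<xi> \<alpha> \<omega> ^ count_list xs \<alpha>\<bar>)"
      using integral_norm_bound[of M "\<lambda>\<omega>. \<xi> \<alpha> \<omega> ^ count_list xs \<alpha>"] by simp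
    also have "\<dots> = expectation (\<lambda>\<omega>. \<bar>\<xi> \<alpha> \<omega>\<bar> ^ count_list xs \<alpha>)" by (simp add: power_abs)
    also have "\<dots> \<le> D k"
      using count_le_length[of xs \<alpha>] assms \<open>\<alpha> \<in> J\<close> by (intro moment_bound) auto
    finally show "\<bar>expectation (\<lambda>\<omega>. \<xi> \<alpha> \<omega> ^ count_list xs \<alpha>)\<bar> \<le> D k" .
  qed simp
  also have "\<dots> = D k ^ card (set xs)" by simp
  also have "\<dots> \<le> D k ^ k"
    using card_length[of xs] assms D_ge_1 by (intro power_increasing) auto
  finally show ?thesis .
qed

lemma mom_eq_0:
  assumes "set xs \<subseteq> J" "count_list xs \<alpha> = 1"
  shows "mom xs = 0"
proof -
  have "\<alpha> \<in> set xs" using assms(2) by (metis count_list_0_iff zero_neq_one)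
  moreover from this have "expectation (\<lambda>\<omega>. \<xi> \<alpha> \<omega> ^ count_list xs \<alpha>) = 0"
    using assms mean_zero by auto
  ultimately show ?thesis
    unfolding mom_eq[OF assms(1) subset_refl] by (auto intro!: prod_zero)
qed

text \<open>By \<open>mom_eq_0\<close> every letter of a contributing word occurs at least
  twice.\<close>

lemma mom_few_letters:
  assumes "set xs \<subseteq> J" "length xs div 2 < card (set xs)"
  shows "mom xs = 0"
proof (rule ccontr)
  assume "mom xs \<noteq> 0"
  then have "count_list xs x \<noteq> 1" for x using mom_eq_0[OF assms(1)] by blast
  moreover have "count_list xs x \<noteq> 0" if "x \<in> set xs" for x
    using that by (simp add: count_list_0_iff)
  ultimately have "2 * card (set xs) \<le> length xs"
    by (intro length_ge_card_set) (metis One_nat_def less_2_cases not_less)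
  then show False using assms(2) by linarith
qed

text \<open>Product of the bound for one moment of length n and of the factor d^n from
  \<open>card_words_few_letters\<close>, where d is at most n.\<close>

definition kap :: "nat \<Rightarrow> real" where
  "kap n = D n ^ n * real n ^ n"

lemma sum_few_letters_le:
  fixes g :: "'i list \<Rightarrow> 'b::real_normed_vector"
  assumes "\<And>xs. xs \<in> words J n \<Longrightarrow> norm (g xs) \<le> B"
    and "\<And>xs. xs \<in> words J n \<Longrightarrow> d < card (set xs) \<Longrightarrow> g xs = 0" and "0 \<le> B" "d \<le> n"
  shows "norm (\<Sum>xs\<in>words J n. g xs) \<le> B * real n ^ n * real (card J) ^ d"
proof -
  let ?S = "{xs \<in> words J n. card (set xs) \<le> d}"
  have "(\<Sum>xs\<in>words J n. g xs) = (\<Sum>xs\<in>?S. g xs)"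
  proof (rule sum.mono_neutral_right)
    show "\<forall>xs\<in>words J n - ?S. g xs = 0"
    proof
      fix xs assume "xs \<in> words J n - ?S"
      then show "g xs = 0" using assms(2)[of xs] by auto
    qed
  qed (use finite_J in auto)
  also have "norm \<dots> \<le> (\<Sum>xs\<in>?S. B)"
    by (rule sum_norm_le) (use assms(1) in auto)
  also have "\<dots> = B * real (card ?S)" by simp
  also have "\<dots> \<le> B * (real n ^ n * real (card J) ^ d)"
  proof (intro mult_left_mono assms(3))
    have "card ?S \<le> d ^ n * card J ^ d"
      by (rule card_words_few_letters[OF finite_J J_nonempty])
    also have "\<dots> \<le> n ^ n * card J ^ d"
      using assms(4) by (intro mult_right_mono power_mono) auto
    finally have "real (card ?S) \<le> real (n ^ n * card J ^ d)" by (rule of_nat_mono)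
    then show "real (card ?S) \<le> real n ^ n * real (card J) ^ d" by simp
  qed
  finally show ?thesis by (simp add: mult.assoc)
qed

text \<open>The counting bound behind all size estimates: n positions carry at most
  \<open>n div 2\<close> free letters.\<close>

lemma sum_mom_le:
  fixes c :: "'i list \<Rightarrow> 'b::real_normed_field"
  assumes "\<And>xs. xs \<in> words J n \<Longrightarrow> norm (c xs) \<le> C" "0 \<le> C"
  shows "norm (\<Sum>xs\<in>words J n. c xs * of_real (mom xs)) \<le> C * kap n * real (card J) ^ (n div 2)"
proof -
  have "norm (\<Sum>xs\<in>words J n. c xs * of_real (mom xs)) \<le>
      (C * D n ^ n) * real n ^ n * real (card J) ^ (n div 2)"
  proof (rule sum_few_letters_le)
    fix xs assume xs: "xs \<in> words J n"
    then show "norm (c xs * of_real (mom xs)) \<le> C * D n ^ n"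
      unfolding norm_mult norm_of_real using assms abs_mom_le[of xs n]
      by (intro mult_mono) (auto simp: words_def)
    assume "n div 2 < card (set xs)"
    then show "c xs * of_real (mom xs) = 0"
      using mom_few_letters[of xs] xs by (auto simp: words_def)
  qed (use assms D_ge_1[of n] in auto)
  then show ?thesis by (simp add: kap_def mult_ac)
qed

lemma kap_nonneg: "0 \<le> kap n"
  unfolding kap_def using D_ge_1[of n] by simp

text \<open>A homogeneous polynomial of degree n with coefficients bounded by C. Words are not
  symmetrized and no orthogonality between degrees is meant.\<close>

definition chaos :: "nat \<Rightarrow> real \<Rightarrow> ('a \<Rightarrow> real) \<Rightarrow> bool" where
  "chaos n C Z \<longleftrightarrow> (\<exists>c. (\<forall>xs\<in>words J n. \<bar>c xs\<bar> \<le> C) \<and>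
     (\<forall>\<omega>. Z \<omega> = (\<Sum>xs\<in>words J n. c xs * wprod xs \<omega>)))"

lemma chaos_mult:
  assumes "chaos a C Z" "chaos b C' Z'" "0 \<le> C"
  shows "chaos (a + b) (C * C') (\<lambda>\<omega>. Z \<omega> * Z' \<omega>)"
proof -
  from assms obtain c c' where c: "\<forall>xs\<in>words J a. \<bar>c xs\<bar> \<le> C" "\<forall>xs\<in>words J b. \<bar>c' xs\<bar> \<le> C'"
    and Z: "\<And>\<omega>. Z \<omega> = (\<Sum>xs\<in>words J a. c xs * wprod xs \<omega>)"
    "\<And>\<omega>. Z' \<omega> = (\<Sum>xs\<in>words J b. c' xs * wprod xs \<omega>)" unfolding chaos_def by blast
  show ?thesis
    unfolding chaos_def
  proof (intro exI[of _ "\<lambda>xs. c (take a xs) * c' (drop a xs)"] conjI ballI allI)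
    fix xs assume "xs \<in> words J (a + b)"
    then have "take a xs \<in> words J a" "drop a xs \<in> words J b"
      using set_take_subset[of a xs] set_drop_subset[of a xs] by (auto simp: words_def)
    then show "\<bar>c (take a xs) * c' (drop a xs)\<bar> \<le> C * C'"
      using c assms(3) by (auto simp: abs_mult intro!: mult_mono)
  next
    fix \<omega>
    have "Z \<omega> * Z' \<omega> = (\<Sum>xs\<in>words J a. \<Sum>ys\<in>words J b. c xs * c' ys * (wprod xs \<omega> * wprod ys \<omega>))"
      unfolding Z sum_product by (intro sum.cong refl) (simp only: mult_ac)
    also have "\<dots> = (\<Sum>xs\<in>words J (a + b). c (take a xs) * c' (drop a xs) * wprod xs \<omega>)"
      unfolding sum_words_append by (intro sum.cong) (auto simp: words_def)
    finally show "Z \<omega> * Z' \<omega> = (\<Sum>xs\<in>words J (a + b). c (take a xs) * c' (drop a xs) * wprod xs \<omega>)" .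
  qed
qed

lemma chaos_power:
  assumes "chaos n C Z" "0 \<le> C"
  shows "chaos (n * p) (C ^ p) (\<lambda>\<omega>. Z \<omega> ^ p)"
proof (induction p)
  case 0
  show ?case unfolding chaos_def by (intro exI[of _ "\<lambda>_. 1"]) auto
next
  case (Suc p)
  then show ?case using chaos_mult[OF assms(1) Suc assms(2)] by simp
qed

lemma chaos_integrable: "chaos n C Z \<Longrightarrow> integrable M Z"
proof -
  assume "chaos n C Z"
  then obtain c where "Z = (\<lambda>\<omega>. \<Sum>xs\<in>words J n. c xs * wprod xs \<omega>)"
    unfolding chaos_def by blast
  then show ?thesis
    by (auto intro!: Bochner_Integration.integrable_sum integrable_mult_right integrable_wprod simp: words_def)
qed

lemma chaos_expectation:
  assumes "chaos n C Z" "0 \<le> C"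
  shows "\<bar>expectation Z\<bar> \<le> C * kap n * real (card J) ^ (n div 2)"
proof -
  from assms obtain c where c: "\<forall>xs\<in>words J n. \<bar>c xs\<bar> \<le> C"
    and Z: "Z = (\<lambda>\<omega>. \<Sum>xs\<in>words J n. c xs * wprod xs \<omega>)" unfolding chaos_def by blast
  have "expectation Z = (\<Sum>xs\<in>words J n. expectation (\<lambda>\<omega>. c xs * wprod xs \<omega>))"
    unfolding Z by (rule Bochner_Integration.integral_sum)
      (auto intro!: integrable_mult_right integrable_wprod simp: words_def)
  then have "expectation Z = (\<Sum>xs\<in>words J n. c xs * of_real (mom xs))"
    by (simp add: mom_def)
  then show ?thesis using sum_mom_le[of n c C] c assms(2) by simp
qed

text \<open>Wick's rule with the actual covariances is exact on words with more than
  \<open>n div 2\<close> distinct letters. The letter \<open>x\<close> decides. If it does not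
  recur, both sides vanish; if it recurs once, independence splits off the pair; if it recurs more
  often, some other letter occurs only once, for otherwise the n + 1 positions could not hold that
  many letters.\<close>

lemma mom_wick:
  assumes "x \<in> J" "xs \<in> words J n"
  shows "\<bar>mom (x # xs) - (\<Sum>l<n. mom [x, xs ! l] * mom (take l xs @ drop (Suc l) xs))\<bar> \<le>
     D (Suc n) ^ Suc n + real n * (D 2 ^ 2 * D n ^ n)" (is "?A \<le> ?B")
    and "n div 2 < card (set (x # xs)) \<Longrightarrow>
     mom (x # xs) - (\<Sum>l<n. mom [x, xs ! l] * mom (take l xs @ drop (Suc l) xs)) = 0"
proof -
  have xs: "set xs \<subseteq> J" "length xs = n" using assms by (auto simp: words_def)
  have rem: "set (take l xs @ drop (Suc l) xs) \<subseteq> J" for l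
    using xs set_take_subset[of l xs] set_drop_subset[of "Suc l" xs] by auto
  have "\<bar>\<Sum>l<n. mom [x, xs ! l] * mom (take l xs @ drop (Suc l) xs)\<bar> \<le> (\<Sum>l<n. D 2 ^ 2 * D n ^ n)"
  proof (rule order_trans[OF sum_abs], rule sum_mono)
    fix l assume "l \<in> {..<n}"
    then show "\<bar>mom [x, xs ! l] * mom (take l xs @ drop (Suc l) xs)\<bar> \<le> D 2 ^ 2 * D n ^ n"
      unfolding abs_mult using xs assms(1) rem[of l] D_ge_1[of 2]
      by (intro mult_mono abs_mom_le) (auto simp: nth_mem subset_iff)
  qed
  moreover have "\<bar>mom (x # xs)\<bar> \<le> D (Suc n) ^ Suc n"
    using xs assms(1) by (intro abs_mom_le) auto
  ultimately show "?A \<le> ?B" by simp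
  have ne: "mom [x, y] = 0" if "y \<in> J" "y \<noteq> x" for y
    using that assms(1) by (intro mom_eq_0[of _ x]) auto
  have cnt: "count_list xs y = count_list (take l xs @ drop (Suc l) xs) y + (if xs ! l = y then 1 else 0)"
    if "l < n" for l y
    using arg_cong[OF id_take_nth_drop[of l xs], of "\<lambda>zs. count_list zs y"] that xs by simp
  assume big: "n div 2 < card (set (x # xs))"
  consider "count_list xs x = 0" | "count_list xs x = 1" | "count_list xs x \<ge> 2" by linarith
  then show "mom (x # xs) - (\<Sum>l<n. mom [x, xs ! l] * mom (take l xs @ drop (Suc l) xs)) = 0"
  proof cases
    case 1
    then have "x \<notin> set xs" by (simp add: count_list_0_iff)
    then have "mom [x, xs ! l] = 0" if "l < n" for l
      using that xs by (intro ne) (auto simp: nth_mem subset_iff)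
    moreover have "mom (x # xs) = 0" using 1 xs assms(1) by (intro mom_eq_0[of _ x]) auto
    ultimately show ?thesis by simp
  next
    case 2
    then have "x \<in> set xs" by (metis count_list_0_iff zero_neq_one)
    then obtain l where l: "l < n" "xs ! l = x" using xs by (metis in_set_conv_nth)
    have other: "mom [x, xs ! k] = 0" if "k < n" "k \<noteq> l" for k
    proof (rule ne)
      show "xs ! k \<in> J" using that xs by (auto simp: nth_mem subset_iff)
      show "xs ! k \<noteq> x"
      proof
        assume "xs ! k = x"
        then have "{k, l} \<subseteq> {i. i < length xs \<and> xs ! i = x}" using that l xs by auto
        then have "card {k, l} \<le> card {i. i < length xs \<and> xs ! i = x}" by (intro card_mono) auto
        moreover have "card {i. i < length xs \<and> xs ! i = x} = count_list xs x"
          by (simp add: count_list_eq_length_filter length_filter_conv_card eq_commute)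
        ultimately show False using that(2) 2 by simp
      qed
    qed
    let ?r = "take l xs @ drop (Suc l) xs"
    have "mom (x # xs) = mom [x, x] * mom ?r"
    proof -
      have r: "count_list ?r x = 0" using cnt[OF l(1), of x] l 2 by simp
      have eq: "mom zs = expectation (\<lambda>\<omega>. \<xi> x \<omega> ^ count_list zs x) *
          (\<Prod>\<alpha>\<in>J - {x}. expectation (\<lambda>\<omega>. \<xi> \<alpha> \<omega> ^ count_list zs \<alpha>))" if "set zs \<subseteq> J" for zs
        unfolding mom_eq[OF subset_refl that] by (rule prod.remove[OF finite_J assms(1)])
      have "(\<Prod>\<alpha>\<in>J - {x}. expectation (\<lambda>\<omega>. \<xi> \<alpha> \<omega> ^ count_list (x # xs) \<alpha>)) =
          (\<Prod>\<alpha>\<in>J - {x}. expectation (\<lambda>\<omega>. \<xi> \<alpha> \<omega> ^ count_list ?r \<alpha>))"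
        using cnt[OF l(1)] l(2) by (intro prod.cong) auto
      moreover have "(\<Prod>\<alpha>\<in>J - {x}. expectation (\<lambda>\<omega>. \<xi> \<alpha> \<omega> ^ count_list [x, x] \<alpha>)) = 1"
        by (intro prod.neutral) (auto simp: prob_space)
      ultimately show ?thesis
        using eq[of "x # xs"] eq[of "[x, x]"] eq[of ?r] xs assms(1) rem[of l] 2 r
        by (simp add: prob_space)
    qed
    moreover have "(\<Sum>k<n. mom [x, xs ! k] * mom (take k xs @ drop (Suc k) xs)) =
        mom [x, xs ! l] * mom ?r"
      using l(1) other by (subst sum.remove[of _ l]) auto
    ultimately show ?thesis using l(2) by simp
  next
    case 3
    have "\<exists>y. y \<noteq> x \<and> count_list xs y = 1"
    proof (rule ccontr)
      assume none: "\<nexists>y. y \<noteq> x \<and> count_list xs y = 1"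
      have x: "x \<in> set xs" using 3 by (metis count_list_0_iff not_numeral_le_zero)
      have "2 * card (set (x # xs)) + 1 \<le> length (x # xs)"
      proof (rule length_ge_card_set'[of _ x])
        fix y assume "y \<in> set (x # xs)"
        then have "y \<in> set xs" using x by auto
        then have "count_list xs y \<noteq> 0" by (simp add: count_list_0_iff)
        moreover have "y \<noteq> x \<Longrightarrow> count_list xs y \<noteq> 1" using none by blast
        ultimately show "2 \<le> count_list (x # xs) y" using 3 by (cases "y = x") auto
      qed (use 3 in auto)
      then show False using big xs by simp
    qed
    then obtain y where y: "y \<noteq> x" "count_list xs y = 1" by blast
    \<comment> \<open>Pairing \<open>x\<close> with another copy of itself leaves \<open>y\<close> a
      single letter, and any other partner has covariance zero with \<open>x\<close>.\<close>
    have z: "mom [x, xs ! l] * mom (take l xs @ drop (Suc l) xs) = 0" if "l < n" for l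
    proof (cases "xs ! l = x")
      case True
      then have "count_list (take l xs @ drop (Suc l) xs) y = 1" using cnt[OF that, of y] y by simp
      then show ?thesis using mom_eq_0[OF rem] by simp
    next
      case False
      then show ?thesis using ne[of "xs ! l"] that xs by (auto simp: nth_mem subset_iff)
    qed
    have "mom (x # xs) = 0"
      using y xs assms(1) by (intro mom_eq_0[of _ y]) auto
    moreover have "(\<Sum>l<n. mom [x, xs ! l] * mom (take l xs @ drop (Suc l) xs)) = 0"
      by (intro sum.neutral ballI z) simp
    ultimately show ?thesis by simp
  qed
qed

section \<open>Wick's rule for linear forms in the independent variables\<close>

definition lin :: "('i \<Rightarrow> complex) \<Rightarrow> 'a \<Rightarrow> complex" where
  "lin c \<omega> = (\<Sum>\<alpha>\<in>J. c \<alpha> * of_real (\<xi> \<alpha> \<omega>))"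

definition wt :: "('i \<Rightarrow> complex) list \<Rightarrow> 'i list \<Rightarrow> complex" where
  "wt cs xs = prod_list (map2 (\<lambda>c x. c x) cs xs)"

lemma prod_lin: "prod_list (map (\<lambda>c. lin c \<omega>) cs) =
    (\<Sum>xs\<in>words J (length cs). wt cs xs * of_real (wprod xs \<omega>))"
  by (induction cs) (auto simp: wt_def lin_def sum_words_Suc sum_product mult_ac intro!: sum.cong)

lemma
  shows integrable_sum_wprod: "integrable M (\<lambda>\<omega>. \<Sum>xs\<in>words J n. c xs * complex_of_real (wprod xs \<omega>))"
    and expectation_sum_wprod: "(\<integral>\<omega>. (\<Sum>xs\<in>words J n. c xs * complex_of_real (wprod xs \<omega>)) \<partial>M) =
      (\<Sum>xs\<in>words J n. c xs * of_real (mom xs))"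
proof -
  have int: "integrable M (\<lambda>\<omega>. c xs * complex_of_real (wprod xs \<omega>))" if "xs \<in> words J n" for xs
    using that by (intro integrable_mult_right integrable_of_real integrable_wprod) (auto simp: words_def)
  then show "integrable M (\<lambda>\<omega>. \<Sum>xs\<in>words J n. c xs * complex_of_real (wprod xs \<omega>))"
    by (rule Bochner_Integration.integrable_sum)
  show "(\<integral>\<omega>. (\<Sum>xs\<in>words J n. c xs * complex_of_real (wprod xs \<omega>)) \<partial>M) =
      (\<Sum>xs\<in>words J n. c xs * of_real (mom xs))"
    by (subst Bochner_Integration.integral_sum[OF int]) (simp_all add: mom_def)
qed

lemma integrable_prod_lin: "integrable M (\<lambda>\<omega>. prod_list (map (\<lambda>c. lin c \<omega>) cs))"
  unfolding prod_lin by (rule integrable_sum_wprod)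

lemma expectation_prod_lin: "(\<integral>\<omega>. prod_list (map (\<lambda>c. lin c \<omega>) cs) \<partial>M) =
    (\<Sum>xs\<in>words J (length cs). wt cs xs * of_real (mom xs))"
  unfolding prod_lin by (rule expectation_sum_wprod)

lemma norm_wt_le:
  assumes "xs \<in> words J (length cs)" "\<And>c \<alpha>. c \<in> set cs \<Longrightarrow> \<alpha> \<in> J \<Longrightarrow> cmod (c \<alpha>) \<le> C" "0 \<le> C"
  shows "cmod (wt cs xs) \<le> C ^ length cs"
  using assms(1,2)
proof (induction cs arbitrary: xs)
  case (Cons c cs)
  then obtain y ys where xs: "xs = y # ys" "y \<in> J" "ys \<in> words J (length cs)"
    by (auto simp: words_def length_Suc_conv)
  have "cmod (c y) \<le> C" "cmod (wt cs ys) \<le> C ^ length cs"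
    using Cons xs by auto
  then show ?case using xs assms(3) by (auto simp: wt_def norm_mult intro!: mult_mono)
qed (simp add: wt_def)

lemma expectation_prod_lin_le:
  assumes "\<And>c \<alpha>. c \<in> set cs \<Longrightarrow> \<alpha> \<in> J \<Longrightarrow> cmod (c \<alpha>) \<le> C" "0 \<le> C"
  shows "cmod (\<integral>\<omega>. prod_list (map (\<lambda>c. lin c \<omega>) cs) \<partial>M) \<le>
    C ^ length cs * kap (length cs) * real (card J) ^ (length cs div 2)"
  unfolding expectation_prod_lin
  by (rule sum_mom_le) (use norm_wt_le assms in auto)

text \<open>By \<open>mom_wick\<close> only \<open>n div 2\<close> free letters face n + 1
  coefficients. With C of the order of the inverse square root of \<open>card J\<close> the bound is
  therefore at most of that order, while a product of expectations stays of order one.\<close>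

lemma wick_lin:
  assumes c: "\<And>c \<alpha>. c \<in> set (c0 # cs) \<Longrightarrow> \<alpha> \<in> J \<Longrightarrow> cmod (c \<alpha>) \<le> C" and "0 \<le> C"
    and n: "length cs = n"
  shows "cmod ((\<integral>\<omega>. lin c0 \<omega> * prod_list (map (\<lambda>c. lin c \<omega>) cs) \<partial>M) -
     (\<Sum>l<n. (\<integral>\<omega>. lin c0 \<omega> * lin (cs ! l) \<omega> \<partial>M) *
        (\<integral>\<omega>. prod_list (map (\<lambda>c. lin c \<omega>) (take l cs @ drop (Suc l) cs)) \<partial>M)))
    \<le> C ^ Suc n * (D (Suc n) ^ Suc n + real n * (D 2 ^ 2 * D n ^ n)) * real (Suc n) ^ Suc n *
        real (card J) ^ (n div 2)"
proof -
  let ?rm = "\<lambda>l zs. take l zs @ drop (Suc l) zs"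
  define g where "g = (\<lambda>zs. wt (c0 # cs) zs * of_real (mom zs -
      (\<Sum>l<n. mom [hd zs, tl zs ! l] * mom (?rm l (tl zs)))))"
  \<comment> \<open>The product of two expectations is a sum over \<open>x\<close>, a partner
    \<open>y\<close> and a remaining word. Inserting \<open>y\<close> at position \<open>l\<close>
    turns it into a sum over words of length n with the same weight as in the full moment.\<close>
  have term_l: "(\<integral>\<omega>. lin c0 \<omega> * lin (cs ! l) \<omega> \<partial>M) *
        (\<integral>\<omega>. prod_list (map (\<lambda>c. lin c \<omega>) (?rm l cs)) \<partial>M) =
      (\<Sum>x\<in>J. \<Sum>xs\<in>words J n. wt (c0 # cs) (x # xs) * of_real (mom [x, xs ! l] * mom (?rm l xs)))"
    if l: "l < n" for l
  proof -
    obtain n' where n': "n = Suc n'" using l by (cases n) auto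
    have ln: "l \<le> n'" using l n' by simp
    have len: "length (?rm l cs) = n'" using l n n' by simp
    have w: "wt cs (take l ys @ y # drop l ys) = (cs ! l) y * wt (?rm l cs) ys"
      if ys: "ys \<in> words J n'" for y ys
    proof -
      have "wt cs (take l ys @ y # drop l ys) =
          wt (take l cs @ cs ! l # drop (Suc l) cs) (take l ys @ y # drop l ys)"
        using id_take_nth_drop[of l cs] l n by simp
      moreover have "wt (?rm l cs) ys = wt (?rm l cs) (take l ys @ drop l ys)" by simp
      moreover have "length (take l cs) = length (take l ys)" using ys l n n' by (auto simp: words_def)
      ultimately show ?thesis unfolding wt_def by (simp only: zip_append map_append) simp
    qed
    have "(\<integral>\<omega>. lin c0 \<omega> * lin (cs ! l) \<omega> \<partial>M) =
        (\<Sum>x\<in>J. \<Sum>y\<in>J. c0 x * (cs ! l) y * of_real (mom [x, y]))"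
      using expectation_prod_lin[of "[c0, cs ! l]"]
      by (simp add: sum_words_Suc wt_def numeral_2_eq_2)
    moreover have "(\<integral>\<omega>. prod_list (map (\<lambda>c. lin c \<omega>) (?rm l cs)) \<partial>M) =
        (\<Sum>ys\<in>words J n'. wt (?rm l cs) ys * of_real (mom ys))"
      unfolding expectation_prod_lin len ..
    ultimately have "(\<integral>\<omega>. lin c0 \<omega> * lin (cs ! l) \<omega> \<partial>M) *
        (\<integral>\<omega>. prod_list (map (\<lambda>c. lin c \<omega>) (?rm l cs)) \<partial>M) =
       (\<Sum>x\<in>J. \<Sum>y\<in>J. \<Sum>ys\<in>words J n'. c0 x * (cs ! l) y * of_real (mom [x, y]) *
          (wt (?rm l cs) ys * of_real (mom ys)))"
      by (simp only: sum_distrib_right) (simp only: sum_distrib_left)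
    also have "\<dots> = (\<Sum>x\<in>J. \<Sum>xs\<in>words J n. wt (c0 # cs) (x # xs) *
        of_real (mom [x, xs ! l] * mom (?rm l xs)))"
      unfolding n' sum_words_insert[OF ln]
    proof (intro sum.cong refl)
      fix x y ys assume ys: "ys \<in> words J n'"
      then have "length (take l ys) = l" using ln by (auto simp: words_def)
      then have "(take l ys @ y # drop l ys) ! l = y" "?rm l (take l ys @ y # drop l ys) = ys"
        by (simp_all add: nth_append)
      moreover have "wt (c0 # cs) (x # zs) = c0 x * wt cs zs" for zs by (simp add: wt_def)
      ultimately show "c0 x * (cs ! l) y * of_real (mom [x, y]) * (wt (?rm l cs) ys * of_real (mom ys)) =
          wt (c0 # cs) (x # (take l ys @ y # drop l ys)) *
          of_real (mom [x, (take l ys @ y # drop l ys) ! l] * mom (?rm l (take l ys @ y # drop l ys)))"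
        using w[OF ys, of y] by (simp only: of_real_mult) simp
    qed
    finally show ?thesis .
  qed
  have "(\<integral>\<omega>. lin c0 \<omega> * prod_list (map (\<lambda>c. lin c \<omega>) cs) \<partial>M) -
     (\<Sum>l<n. (\<integral>\<omega>. lin c0 \<omega> * lin (cs ! l) \<omega> \<partial>M) *
        (\<integral>\<omega>. prod_list (map (\<lambda>c. lin c \<omega>) (?rm l cs)) \<partial>M)) =
     (\<Sum>x\<in>J. \<Sum>xs\<in>words J n. wt (c0 # cs) (x # xs) * of_real (mom (x # xs))) -
     (\<Sum>l<n. \<Sum>x\<in>J. \<Sum>xs\<in>words J n. wt (c0 # cs) (x # xs) * of_real (mom [x, xs ! l] * mom (?rm l xs)))"
    using expectation_prod_lin[of "c0 # cs"] term_l by (simp add: sum_words_Suc n)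
  also have "(\<Sum>l<n. \<Sum>x\<in>J. \<Sum>xs\<in>words J n. wt (c0 # cs) (x # xs) * of_real (mom [x, xs ! l] * mom (?rm l xs))) =
     (\<Sum>x\<in>J. \<Sum>xs\<in>words J n. \<Sum>l<n. wt (c0 # cs) (x # xs) * complex_of_real (mom [x, xs ! l] * mom (?rm l xs)))"
    by (subst sum.swap) (intro sum.cong refl sum.swap)
  also have "(\<Sum>x\<in>J. \<Sum>xs\<in>words J n. wt (c0 # cs) (x # xs) * of_real (mom (x # xs))) - \<dots> =
      (\<Sum>zs\<in>words J (Suc n). g zs)"
    unfolding sum_words_Suc sum_subtractf[symmetric] g_def
    by (intro sum.cong refl) (simp add: sum_distrib_left right_diff_distrib)
  also have "cmod \<dots> \<le> (C ^ Suc n * (D (Suc n) ^ Suc n + real n * (D 2 ^ 2 * D n ^ n))) *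
      real (Suc n) ^ Suc n * real (card J) ^ (n div 2)"
  proof (rule sum_few_letters_le)
    fix zs assume zs: "zs \<in> words J (Suc n)"
    then obtain x xs where x: "zs = x # xs" "x \<in> J" "xs \<in> words J n"
      by (auto simp: words_def length_Suc_conv)
    show "cmod (g zs) \<le> C ^ Suc n * (D (Suc n) ^ Suc n + real n * (D 2 ^ 2 * D n ^ n))"
      unfolding g_def norm_mult norm_of_real
    proof (rule mult_mono)
      show "cmod (wt (c0 # cs) zs) \<le> C ^ Suc n"
        using norm_wt_le[of zs "c0 # cs" C] zs assms by simp
    qed (use mom_wick(1)[OF x(2,3)] x(1) assms(2) in auto)
    assume "n div 2 < card (set zs)"
    then show "g zs = 0" using mom_wick(2)[OF x(2,3)] x(1) by (simp add: g_def)
  qed (use assms(2) D_ge_1[of n] D_ge_1[of "Suc n"] in auto)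
  finally show ?thesis .
qed

end

subsection \<open>Moments of the limit distribution\<close>

fun herm_poly :: "nat \<Rightarrow> real poly" where
  "herm_poly 0 = 1"
| "herm_poly (Suc n) = [:0, 1:] * herm_poly n - pderiv (herm_poly n)"

lemma deriv_gauss:
  "(deriv ^^ j) (\<lambda>t. exp (- t\<^sup>2 / 2)) = (\<lambda>x. (- 1) ^ j * poly (herm_poly j) x * exp (- x\<^sup>2 / 2 :: real))"
proof (induction j)
  case (Suc j)
  have "((\<lambda>x. (- 1) ^ j * poly (herm_poly j) x * exp (- x\<^sup>2 / 2)) has_real_derivative
      (- 1) ^ Suc j * poly (herm_poly (Suc j)) x * exp (- x\<^sup>2 / 2)) (at x)" for x :: real
    by (auto intro!: derivative_eq_intros simp: algebra_simps)
  then have "deriv (\<lambda>x. (- 1) ^ j * poly (herm_poly j) x * exp (- x\<^sup>2 / 2)) =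
      (\<lambda>x :: real. (- 1) ^ Suc j * poly (herm_poly (Suc j)) x * exp (- x\<^sup>2 / 2))"
    by (intro ext DERIV_imp_deriv)
  then show ?case by (simp only: funpow.simps o_apply Suc)
qed simp

lemma hermite_eq: "hermite j x = poly (herm_poly j) x"
  unfolding hermite_def deriv_gauss
  by (simp add: exp_minus field_simps power_mult_distrib[symmetric])

definition gexp :: "real poly \<Rightarrow> real" where
  "gexp p = (\<integral>x. std_normal_density x * poly p x \<partial>lborel)"

lemma integrable_gauss_poly: "integrable lborel (\<lambda>x. std_normal_density x * poly p x)"
  unfolding poly_altdef sum_distrib_left
  by (intro Bochner_Integration.integrable_sum)
    (simp add: mult.left_commute integrable_std_normal_moment)

lemma gexp_add: "gexp (p + q) = gexp p + gexp q"
  and gexp_smult: "gexp (Polynomial.smult c p) = c * gexp p"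
  and gexp_diff: "gexp (p - q) = gexp p - gexp q"
  unfolding gexp_def using integrable_gauss_poly
  by (simp_all add: distrib_left right_diff_distrib mult.left_commute)

lemma gexp_sum: "gexp (\<Sum>i\<in>A. p i) = (\<Sum>i\<in>A. gexp (p i))"
  by (induction A rule: infinite_finite_induct) (simp_all add: gexp_add, simp_all add: gexp_def)

lemma gexp_even: "gexp (monom 1 (2 * k)) = fact (2 * k) / (2 ^ k * fact k)"
  and gexp_odd: "gexp (monom 1 (2 * k + 1)) = 0"
  unfolding gexp_def poly_monom
  using integral_std_normal_moment_even[of k] integral_std_normal_moment_odd[of k] by simp_all

lemma gexp_monom_rec: "gexp (monom 1 (Suc k)) = of_nat k * gexp (monom 1 (k - 1))"
proof (cases "even k")
  case True
  then obtain j where "k = 2 * j" by blast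
  then show ?thesis
    using gexp_odd[of j] gexp_odd[of "j - 1"] by (cases j) (auto simp: numeral_2_eq_2)
next
  case False
  then obtain j where k: "k = 2 * j + 1" by (elim oddE)
  have "gexp (monom 1 (2 * Suc j)) = fact (2 * Suc j) / (2 ^ Suc j * fact (Suc j))"
    by (rule gexp_even)
  also have "\<dots> = real (2 * j + 1) * (fact (2 * j) / (2 ^ j * fact j))"
    by (simp add: divide_simps del: of_nat_Suc) (simp add: algebra_simps)
  finally show ?thesis using k gexp_even[of j] by simp
qed

lemma gexp_stein: "gexp ([:0, 1:] * p) = gexp (pderiv p)"
proof -
  have monom: "gexp ([:0, 1:] * monom c i) = gexp (pderiv (monom c i))" for c i
  proof -
    have "[:0, 1:] * monom c i = Polynomial.smult c (monom 1 (Suc i))"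
      by (simp add: smult_monom monom_Suc)
    moreover have "pderiv (monom c i) = Polynomial.smult (c * of_nat i) (monom 1 (i - 1))"
      by (simp add: pderiv_monom smult_monom mult.commute)
    ultimately show ?thesis by (simp only: gexp_smult gexp_monom_rec mult.assoc)
  qed
  have "gexp ([:0, 1:] * (\<Sum>i\<le>degree p. monom (coeff p i) i)) =
      gexp (pderiv (\<Sum>i\<le>degree p. monom (coeff p i) i))"
    by (simp only: sum_distrib_left gexp_sum monom pderiv_sum)
  then show ?thesis by (simp only: poly_as_sum_of_monoms)
qed

text \<open>H_{n+1} arises from H_n by the operator x - d/dx, the adjoint of d/dx for the Gaussian
  weight.\<close>

lemma gexp_herm: "gexp (herm_poly (Suc n) * q) = gexp (herm_poly n * pderiv q)"
proof -
  have "herm_poly (Suc n) * q = [:0, 1:] * (herm_poly n * q) - pderiv (herm_poly n) * q"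
    by (simp only: herm_poly.simps left_diff_distrib mult.assoc)
  then have "gexp (herm_poly (Suc n) * q) = gexp (pderiv (herm_poly n * q)) - gexp (pderiv (herm_poly n) * q)"
    by (simp only: gexp_diff gexp_stein)
  then show ?thesis by (simp add: pderiv_mult gexp_add mult.commute)
qed

lemma pderiv_herm: "pderiv (herm_poly n) = Polynomial.smult (of_nat n) (herm_poly (n - 1))"
proof (induction n)
  case (Suc n)
  have x: "pderiv [:0, 1:] = (1 :: real poly)" by (simp add: pderiv_pCons)
  show ?case
  proof (cases n)
    case 0
    then show ?thesis by (simp add: pderiv_pCons pderiv_mult)
  next
    case (Suc n')
    have "pderiv (herm_poly (Suc n)) = herm_poly n + [:0, 1:] * pderiv (herm_poly n) - pderiv (pderiv (herm_poly n))"
      by (simp only: herm_poly.simps(2) pderiv_diff pderiv_mult x mult_1_right add.commute)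
    also have "\<dots> = herm_poly n + Polynomial.smult (of_nat n) ([:0, 1:] * herm_poly n' - pderiv (herm_poly n'))"
      unfolding Suc.IH by (simp add: Suc pderiv_smult smult_diff_right del: herm_poly.simps)
    also have "[:0, 1:] * herm_poly n' - pderiv (herm_poly n') = herm_poly n"
      by (simp add: Suc)
    finally show ?thesis by (simp add: smult_add_left del: herm_poly.simps)
  qed
qed simp

definition hmoment :: "nat \<Rightarrow> nat \<Rightarrow> nat \<Rightarrow> real" where
  "hmoment i j k = gexp (herm_poly i * herm_poly j * monom 1 k)"

text \<open>Exponential generating function in the power k, formally the Gaussian expectation of
  H_i(x) H_j(x) exp(t x).\<close>

definition hgf :: "nat \<Rightarrow> nat \<Rightarrow> real fps" where
  "hgf i j = Abs_fps (\<lambda>k. hmoment i j k / fact k)"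

lemma hmoment_commute: "hmoment i j k = hmoment j i k"
  by (simp add: hmoment_def mult.commute)

lemma hmoment_rec: "hmoment (Suc i) j k = of_nat k * hmoment i j (k - 1) + of_nat j * hmoment i (j - 1) k"
proof -
  have "pderiv (herm_poly j * monom 1 k) = Polynomial.smult (of_nat k) (herm_poly j * monom 1 (k - 1)) +
      Polynomial.smult (of_nat j) (herm_poly (j - 1) * monom 1 k)"
  proof -
    have "pderiv (monom 1 k) = Polynomial.smult (of_nat k) (monom 1 (k - 1) :: real poly)"
      by (simp add: pderiv_monom smult_monom)
    then show ?thesis by (simp add: pderiv_mult pderiv_herm mult.commute del: herm_poly.simps)
  qed
  then have "gexp (herm_poly (Suc i) * (herm_poly j * monom 1 k)) =
      gexp (Polynomial.smult (of_nat k) (herm_poly i * (herm_poly j * monom 1 (k - 1))) +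
        Polynomial.smult (of_nat j) (herm_poly i * (herm_poly (j - 1) * monom 1 k)))"
    unfolding gexp_herm by (simp add: distrib_left del: herm_poly.simps)
  then show ?thesis
    unfolding hmoment_def by (simp add: gexp_add gexp_smult mult.assoc del: herm_poly.simps)
qed

lemma hgf_rec: "hgf (Suc i) j = of_nat j * hgf i (j - 1) + fps_X * hgf i j"
proof (rule fps_ext)
  fix k
  have "(of_nat j * hgf i (j - 1)) $. k = of_nat j * hmoment i (j - 1) k / fact k"
    by (simp add: hgf_def fps_of_nat[symmetric])
  then show "hgf (Suc i) j $. k = (of_nat j * hgf i (j - 1) + fps_X * hgf i j) $. k"
  proof (cases k)
    case (Suc k')
    have "real (Suc k') * x / fact (Suc k') = x / fact k'" for x :: real
      by (simp add: divide_simps del: of_nat_Suc)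
    then show ?thesis
      using Suc \<open>(of_nat j * hgf i (j - 1)) $. k = of_nat j * hmoment i (j - 1) k / fact k\<close>
      by (simp add: hgf_def hmoment_rec[of i j] add_divide_distrib del: of_nat_Suc fact_Suc)
  qed (simp_all add: hgf_def hmoment_rec[of i j])
qed

text \<open>The series of exp(t^2 / 2).\<close>

definition gauss_fps :: "real fps" where
  "gauss_fps = Abs_fps (\<lambda>k. if even k then 1 / (2 ^ (k div 2) * fact (k div 2)) else 0)"

text \<open>Closed form of the expectation of H_i(x) H_j(x) exp(t x) divided by exp(t^2 / 2). Where
  the exponent would be truncated, one has l > j and the binomial coefficient is zero.\<close>

definition hker :: "nat \<Rightarrow> nat \<Rightarrow> real fps" where
  "hker i j = (\<Sum>l\<le>i. fps_const (real (i choose l) * real (j choose l) * fact l) * fps_X ^ (i + j - 2 * l))"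

lemma hker_rec: "hker (Suc i) j = of_nat j * hker i (j - 1) + fps_X * hker i j"
proof -
  let ?t = "\<lambda>c l. fps_const (c * real (j choose l) * fact l) * fps_X ^ (Suc i + j - 2 * l) :: real fps"
  have "hker (Suc i) j = ?t 1 0 + (\<Sum>l\<le>i. ?t (real (Suc i choose Suc l)) (Suc l))"
    unfolding hker_def by (subst sum.atMost_Suc_shift) simp
  also have "(\<Sum>l\<le>i. ?t (real (Suc i choose Suc l)) (Suc l)) =
      (\<Sum>l\<le>i. ?t (real (i choose l)) (Suc l)) + (\<Sum>l\<le>i. ?t (real (i choose Suc l)) (Suc l))"
    unfolding sum.distrib[symmetric]
    by (intro sum.cong refl) (simp add: distrib_right fps_const_add[symmetric] del: fps_const_add)
  also have "(\<Sum>l\<le>i. ?t (real (i choose l)) (Suc l)) = of_nat j * hker i (j - 1)"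
  proof (cases j)
    case 0
    then show ?thesis by simp
  next
    case (Suc j')
    have "of_nat j * (fps_const (real (i choose l) * real (j' choose l) * fact l) * fps_X ^ (i + j' - 2 * l)) =
        ?t (real (i choose l)) (Suc l)" for l
    proof -
      have "real j * real (j' choose l) = real (j choose Suc l) * (1 + real l)"
        using arg_cong[OF Suc_times_binomial_eq[of j' l], of real]
        by (simp only: Suc of_nat_mult of_nat_Suc)
      then have "real j * (real (i choose l) * real (j' choose l) * fact l) =
          real (i choose l) * real (j choose Suc l) * fact (Suc l)"
        by (simp only: fact_Suc of_nat_Suc mult_ac) (metis mult.assoc mult.commute)
      then have "fps_const (real j) * fps_const (real (i choose l) * real (j' choose l) * fact l) =
          fps_const (real (i choose l) * real (j choose Suc l) * fact (Suc l))"
        by (simp only: fps_const_mult)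
      moreover have "i + j' - 2 * l = Suc i + j - 2 * Suc l" using Suc by simp
      ultimately show ?thesis by (simp only: fps_of_nat[symmetric] mult.assoc[symmetric])
    qed
    moreover have "of_nat j * hker i (j - 1) = (\<Sum>l\<le>i. of_nat j *
        (fps_const (real (i choose l) * real (j' choose l) * fact l) * fps_X ^ (i + j' - 2 * l)))"
      by (simp only: hker_def sum_distrib_left Suc diff_Suc_1)
    ultimately show ?thesis by (simp only:)
  qed
  also have "?t 1 0 + (of_nat j * hker i (j - 1) + (\<Sum>l\<le>i. ?t (real (i choose Suc l)) (Suc l))) =
      of_nat j * hker i (j - 1) + ((\<Sum>l\<le>i. ?t (real (i choose Suc l)) (Suc l)) + ?t 1 0)"
    by (simp only: add_ac)
  also have "(\<Sum>l\<le>i. ?t (real (i choose Suc l)) (Suc l)) + ?t 1 0 = fps_X * hker i j"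
  proof -
    have "(\<Sum>l\<le>i. ?t (real (i choose Suc l)) (Suc l)) + ?t 1 0 = (\<Sum>l\<le>Suc i. ?t (real (i choose l)) l)"
      by (subst sum.atMost_Suc_shift) simp
    also have "\<dots> = (\<Sum>l\<le>i. ?t (real (i choose l)) l)" by simp
    also have "\<dots> = fps_X * hker i j"
      unfolding hker_def sum_distrib_left
    proof (intro sum.cong refl)
      fix l assume l: "l \<in> {..i}"
      show "?t (real (i choose l)) l = fps_X * (fps_const (real (i choose l) * real (j choose l) * fact l) * fps_X ^ (i + j - 2 * l))"
      proof (cases "l \<le> j")
        case True
        then have "Suc i + j - 2 * l = Suc (i + j - 2 * l)" using l by simp
        then show ?thesis by (simp add: mult_ac)
      next
        case False
        then show ?thesis by (simp add: binomial_eq_0)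
      qed
    qed
    finally show ?thesis .
  qed
  finally show ?thesis .
qed

text \<open>Both sides satisfy the same recursion in the first index. For i = 0 the second index is
  lowered by exchanging the two Hermite polynomials.\<close>

lemma hgf_eq: "hgf i j = gauss_fps * hker i j"
proof (induction i arbitrary: j)
  case 0
  have h0: "hker 0 j = fps_X ^ j" for j by (simp add: hker_def)
  show ?case
  proof (induction j)
    case 0
    show ?case
    proof (rule fps_ext)
      fix k
      have "hmoment 0 0 k / fact k = gauss_fps $. k"
      proof (cases "even k")
        case True
        then obtain n where "k = 2 * n" by blast
        then show ?thesis using gexp_even[of n] by (simp add: hmoment_def gauss_fps_def)
      next
        case False
        then obtain n where "k = 2 * n + 1" by (elim oddE)
        then show ?thesis using gexp_odd[of n] by (simp add: hmoment_def gauss_fps_def)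
      qed
      then show "hgf 0 0 $. k = (gauss_fps * hker 0 0) $. k" by (simp add: hgf_def hker_def)
    qed
  next
    case (Suc j)
    have "hgf 0 (Suc j) = hgf (Suc j) 0" by (simp add: hgf_def hmoment_commute)
    also have "\<dots> = fps_X * hgf j 0" by (simp add: hgf_rec)
    also have "hgf j 0 = hgf 0 j" by (simp add: hgf_def hmoment_commute)
    finally show ?case by (simp only: Suc h0 power_Suc mult.left_commute)
  qed
next
  case (Suc i)
  show ?case by (simp only: hgf_rec hker_rec Suc distrib_left mult.left_commute)
qed

text \<open>Coefficient extraction from \<open>hgf_eq\<close>. Replacing l by i - l makes the
  exponent of t equal to 2 l, and vanishing binomials or powers allow the range to be changed from i
  to \<open>k div 2\<close>.\<close>

lemma hmoment_diag: "hmoment i i k / fact i =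
    (if odd k then 0 else fact k * (\<Sum>l\<le>k div 2. real (i choose l) / (fact l * (2 ^ (k div 2 - l) * fact (k div 2 - l)))))"
proof -
  let ?n = "k div 2"
  have "hmoment i i k / fact k = (gauss_fps * hker i i) $. k"
    unfolding hgf_eq[symmetric] by (simp add: hgf_def)
  also have "\<dots> = (\<Sum>l\<le>i. real (i choose l) * real (i choose l) * fact l *
      (if k < 2 * i - 2 * l then 0 else gauss_fps $. (k - (2 * i - 2 * l))))"
    unfolding hker_def sum_distrib_left fps_sum_nth
  proof (intro sum.cong refl)
    fix l
    have "gauss_fps * (fps_const (real (i choose l) * real (i choose l) * fact l) * fps_X ^ (i + i - 2 * l)) =
       fps_const (real (i choose l) * real (i choose l) * fact l) * (gauss_fps * fps_X ^ (i + i - 2 * l))"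
      by (simp only: mult.left_commute)
    then show "(gauss_fps * (fps_const (real (i choose l) * real (i choose l) * fact l) * fps_X ^ (i + i - 2 * l))) $. k =
       real (i choose l) * real (i choose l) * fact l *
      (if k < 2 * i - 2 * l then 0 else gauss_fps $. (k - (2 * i - 2 * l)))"
      by (simp only: fps_mult_left_const_nth fps_X_power_mult_right_nth mult_2)
  qed
  also have "\<dots> = (\<Sum>l\<le>i. real (i choose l) * real (i choose l) * fact (i - l) *
      (if k < 2 * l then 0 else gauss_fps $. (k - 2 * l)))"
    by (rule sum.reindex_bij_witness[of _ "\<lambda>l. i - l" "\<lambda>l. i - l"])
      (auto simp: binomial_symmetric[symmetric] diff_mult_distrib2)
  also have "\<dots> = fact i * (\<Sum>l\<le>i. real (i choose l) / fact l * (if k < 2 * l then 0 else gauss_fps $. (k - 2 * l)))"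
    unfolding sum_distrib_left
  proof (intro sum.cong refl)
    fix l assume "l \<in> {..i}"
    then have "real (i choose l) * fact (i - l) = fact i / fact l"
      by (simp add: binomial_fact divide_simps)
    then have "real (i choose l) * real (i choose l) * fact (i - l) = fact i * (real (i choose l) / fact l)"
      by (metis mult.assoc mult.commute times_divide_eq_right)
    then show "real (i choose l) * real (i choose l) * fact (i - l) * (if k < 2 * l then 0 else gauss_fps $. (k - 2 * l)) =
        fact i * (real (i choose l) / fact l * (if k < 2 * l then 0 else gauss_fps $. (k - 2 * l)))"
      by (simp only: mult.assoc)
  qed
  finally have main: "hmoment i i k / fact i = fact k *
      (\<Sum>l\<le>i. real (i choose l) / fact l * (if k < 2 * l then 0 else gauss_fps $. (k - 2 * l)))"
    by (simp add: field_simps)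
  show ?thesis
  proof (cases "odd k")
    case True
    have z: "(\<Sum>l\<le>i. real (i choose l) / fact l * (if k < 2 * l then 0 else gauss_fps $. (k - 2 * l))) = 0"
      using True by (intro sum.neutral) (auto simp: gauss_fps_def)
    show ?thesis unfolding main z using True by simp
  next
    case False
    then obtain n where n: "k = 2 * n" by blast
    have "(\<Sum>l\<le>i. real (i choose l) / fact l * (if k < 2 * l then 0 else gauss_fps $. (k - 2 * l))) =
        (\<Sum>l\<le>max i n. real (i choose l) / fact l * (if k < 2 * l then 0 else gauss_fps $. (k - 2 * l)))"
      by (rule sum.mono_neutral_left) (auto simp: binomial_eq_0)
    also have "\<dots> = (\<Sum>l\<le>n. real (i choose l) / fact l * (if k < 2 * l then 0 else gauss_fps $. (k - 2 * l)))"
      by (rule sum.mono_neutral_right) (auto simp: n)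
    also have "\<dots> = (\<Sum>l\<le>n. real (i choose l) / (fact l * (2 ^ (n - l) * fact (n - l))))"
    proof (intro sum.cong refl)
      fix l assume "l \<in> {..n}"
      then have "\<not> k < 2 * l" "k - 2 * l = 2 * (n - l)" using n by auto
      then show "real (i choose l) / fact l * (if k < 2 * l then 0 else gauss_fps $. (k - 2 * l)) =
          real (i choose l) / (fact l * (2 ^ (n - l) * fact (n - l)))"
        by (simp add: gauss_fps_def)
    qed
    finally show ?thesis unfolding main using n by simp
  qed
qed

text \<open>The hockey-stick identity sums C(i, l) over i < m to C(m, l + 1) and so produces the
  number that the differential equations gave.\<close>

lemma sum_hmoment_diag: "(\<Sum>i<m. hmoment i i k / fact i) = (if odd k then 0 else fact k * hz m 1 (k div 2))"
proof (cases "odd k")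
  case False
  have "(\<Sum>i<m. real (i choose l)) = real (m choose Suc l)" for l
  proof (cases m)
    case (Suc m')
    then show ?thesis
      using sum_choose_upper[of l m'] by (simp add: lessThan_Suc_atMost of_nat_sum[symmetric] del: of_nat_sum)
  qed simp
  then show ?thesis
    using False
    by (simp add: hmoment_diag hz_def sum_distrib_left[symmetric] sum_divide_distrib[symmetric])
      (subst sum.swap, simp add: sum_divide_distrib[symmetric])
qed (simp add: hmoment_diag)

section \<open>The limit density, its moments, and convergence to it\<close>

definition herm_density :: "nat \<Rightarrow> real \<Rightarrow> real" where
  "herm_density m y = (\<Sum>j<m. std_normal_density y * (poly (herm_poly j) y)\<^sup>2 / fact j)"

lemma limit_density_eq: "limit_density m x = 1 / sqrt (real m) * herm_density m (sqrt (real m) * x)"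
proof -
  have "(hermite_function j y)\<^sup>2 = std_normal_density y * (poly (herm_poly j) y)\<^sup>2 / fact j" for j y
  proof -
    have "(exp (- y\<^sup>2 / 4))\<^sup>2 = exp (- y\<^sup>2 / 2)"
      by (simp add: power2_eq_square exp_add[symmetric])
    moreover have "(sqrt (sqrt (2 * pi) * fact j))\<^sup>2 = sqrt (2 * pi) * fact j"
      by simp
    ultimately show ?thesis
      by (simp add: hermite_function_def hermite_eq std_normal_density_def power_mult_distrib power_divide)
  qed
  then show ?thesis by (simp add: limit_density_def herm_density_def)
qed

lemma
  shows integrable_herm_density: "integrable lborel (\<lambda>y. herm_density m y * y ^ k)"
    and integral_herm_density: "(\<integral>y. herm_density m y * y ^ k \<partial>lborel) = (\<Sum>i<m. hmoment i i k / fact i)"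
proof -
  have eq: "herm_density m y * y ^ k =
      (\<Sum>j<m. std_normal_density y * poly (herm_poly j * herm_poly j * monom 1 k) y / fact j)" for y
    by (simp add: herm_density_def sum_distrib_right poly_monom power2_eq_square mult.assoc)
  show "integrable lborel (\<lambda>y. herm_density m y * y ^ k)"
    unfolding eq by (intro Bochner_Integration.integrable_sum integrable_divide integrable_gauss_poly)
  show "(\<integral>y. herm_density m y * y ^ k \<partial>lborel) = (\<Sum>i<m. hmoment i i k / fact i)"
    unfolding eq hmoment_def gexp_def
    by (subst Bochner_Integration.integral_sum)
      (auto intro!: integrable_divide integrable_gauss_poly simp del: poly_mult)
qed

lemma herm_density_nonneg: "0 \<le> herm_density m y"
  by (simp add: herm_density_def sum_nonneg)

lemma herm_density_measurable [measurable]: "herm_density m \<in> borel_measurable borel"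
  using borel_measurable_integrable[OF integrable_herm_density[of m 0]] by simp

lemma limit_density_measurable [measurable]: "limit_density m \<in> borel_measurable borel"
  unfolding limit_density_eq[abs_def] by measurable

context
  fixes m :: nat
  assumes m: "0 < m"
begin

lemma
  shows integrable_limit_density: "integrable lborel (\<lambda>x. limit_density m x * x ^ k)"
    and integral_limit_density: "(\<integral>x. limit_density m x * x ^ k \<partial>lborel) = gue_moment m k / real m"
proof -
  define c where "c = sqrt (real m)"
  have c: "c > 0" "c * c = real m" using m by (auto simp: c_def)
  \<comment> \<open>The exponent \<open>Suc k\<close> collects k factors from the power and one from
    the prefactor of the density; the substitution contributes one more factor \<open>c\<close>, so
    that two of them become the final 1 / m.\<close>
  define F where "F y = herm_density m y * y ^ k / c ^ Suc k" for y
  have F: "limit_density m x * x ^ k = F (0 + c * x)" for x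
    using c by (simp add: limit_density_eq F_def c_def[symmetric] power_mult_distrib)
  have intF: "integrable lborel F"
    unfolding F_def by (intro integrable_divide integrable_herm_density)
  then show "integrable lborel (\<lambda>x. limit_density m x * x ^ k)"
    unfolding F by (rule lborel_integrable_real_affine) (use c in auto)
  have "(\<integral>y. F y \<partial>lborel) = c * (\<integral>x. limit_density m x * x ^ k \<partial>lborel)"
    unfolding F using lborel_integral_real_affine[of c F 0] c by simp
  moreover have "(\<integral>y. F y \<partial>lborel) = (\<Sum>i<m. hmoment i i k / fact i) / c ^ Suc k"
    unfolding F_def by (simp add: integral_herm_density del: power_Suc)
  ultimately have "(\<integral>x. limit_density m x * x ^ k \<partial>lborel) = (\<Sum>i<m. hmoment i i k / fact i) / c ^ Suc k / c"
    using c(1) by (metis less_irrefl nonzero_mult_div_cancel_left)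
  also have "\<dots> = (\<Sum>i<m. hmoment i i k / fact i) / (c ^ k * (c * c))" by (simp add: mult_ac)
  also have "\<dots> = gue_moment m k / real m"
  proof (cases "odd k")
    case False
    then obtain n where n: "k = 2 * n" by blast
    have "c ^ k = real m ^ n" unfolding n power_mult power2_eq_square c ..
    then show ?thesis unfolding sum_hmoment_diag c gue_moment_def using n by simp
  qed (simp add: sum_hmoment_diag gue_moment_def)
  finally show "(\<integral>x. limit_density m x * x ^ k \<partial>lborel) = gue_moment m k / real m" .
qed

lemma limit_density_nonneg: "0 \<le> limit_density m x"
  unfolding limit_density_eq using herm_density_nonneg by simp

lemma real_distribution_limit: "real_distribution (limit_distribution m)"
proof -
  have "emeasure (limit_distribution m) UNIV = (\<integral>\<^sup>+x. ennreal (limit_density m x) \<partial>lborel)"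
    by (simp add: limit_distribution_def emeasure_density)
  also have "\<dots> = ennreal (\<integral>x. limit_density m x \<partial>lborel)"
    using integrable_limit_density[of 0] by (intro nn_integral_eq_integral) (auto simp: limit_density_nonneg)
  also have "(\<integral>x. limit_density m x \<partial>lborel) = 1"
    using integral_limit_density[of 0] m by (simp add: gue_moment_def hz_def)
  finally have "prob_space (limit_distribution m)"
    by (intro prob_spaceI) (simp add: limit_distribution_def)
  then show ?thesis
    by (simp add: real_distribution_def real_distribution_axioms_def limit_distribution_def)
qed

lemma
  shows integrable_limit_moment: "integrable (limit_distribution m) (\<lambda>x. x ^ k)"
    and limit_moment: "(\<integral>x. x ^ k \<partial>limit_distribution m) = gue_moment m k / real m"
  unfolding limit_distribution_def
  using integrable_limit_density[of k] integral_limit_density[of k] limit_density_nonneg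
  by (simp_all add: integrable_density integral_density)

text \<open>This is the Taylor remainder of the limit characteristic function. Up to exponential
  factors the moment of order 2K is at most (2K)! / K!, so after division by (2K)! an inverse K! is
  left.\<close>

lemma gue_moment_growth:
  "(\<lambda>K. 2 * \<bar>t\<bar> ^ (2 * K) / fact (2 * K) * (gue_moment m (2 * K) / real m)) \<longlonglongrightarrow> 0"
proof (rule Lim_null_comparison)
  \<comment> \<open>Binomials of \<open>m\<close> are at most 2^m and the powers of 2 in the
    denominators are at least 1; the remaining sum is 2^n / n!.\<close>
  have hz: "\<bar>hz m 1 n\<bar> \<le> 2 ^ m * (2 ^ n / fact n)" for n
  proof -
    have "\<bar>hz m 1 n\<bar> \<le> (\<Sum>j\<le>n. 2 ^ m * (real (n choose j) / fact n))"
      unfolding hz_def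
    proof (rule order_trans[OF sum_abs], rule sum_mono)
      fix j assume "j \<in> {..n}"
      then have 1: "real (n choose j) / fact n = 1 / (fact j * fact (n - j))"
        by (simp add: binomial_fact)
      have 2: "real (m choose (1 + j)) \<le> 2 ^ m"
        using binomial_le_pow2[of m "1 + j"] by (metis of_nat_le_iff of_nat_numeral of_nat_power)
      have "real (m choose (1 + j)) / (fact j * (2 ^ (n - j) * fact (n - j))) \<le> 2 ^ m / (fact j * (1 * fact (n - j)))"
        by (intro frac_le mult_mono 2) auto
      then show "\<bar>real (m choose (1 + j)) / (fact j * (2 ^ (n - j) * fact (n - j)))\<bar> \<le> 2 ^ m * (real (n choose j) / fact n)"
        unfolding 1 by simp
    qed
    also have "\<dots> = 2 ^ m * (2 ^ n / fact n)"
      unfolding sum_distrib_left[symmetric] sum_divide_distrib[symmetric]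
      using choose_row_sum[of n] by (metis (mono_tags, lifting) of_nat_numeral of_nat_power of_nat_sum sum.cong)
    finally show ?thesis .
  qed
  show "\<forall>\<^sub>F K in sequentially. norm (2 * \<bar>t\<bar> ^ (2 * K) / fact (2 * K) * (gue_moment m (2 * K) / real m)) \<le>
      2 * 2 ^ m / real m * (inverse (fact K) * (2 * t\<^sup>2 / real m) ^ K)"
  proof (intro always_eventually allI)
    fix K
    have "norm (2 * \<bar>t\<bar> ^ (2 * K) / fact (2 * K) * (gue_moment m (2 * K) / real m)) =
        2 * t\<^sup>2 ^ K / real m ^ K / real m * \<bar>hz m 1 K\<bar>"
      by (simp add: gue_moment_def abs_mult power_mult)
    also have "\<dots> \<le> 2 * t\<^sup>2 ^ K / real m ^ K / real m * (2 ^ m * (2 ^ K / fact K))"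
      by (intro mult_left_mono hz) auto
    also have "\<dots> = 2 * 2 ^ m / real m * (inverse (fact K) * (2 * t\<^sup>2 / real m) ^ K)"
      by (simp add: power_mult_distrib power_divide divide_inverse power_inverse mult_ac)
    finally show "norm (2 * \<bar>t\<bar> ^ (2 * K) / fact (2 * K) * (gue_moment m (2 * K) / real m)) \<le>
      2 * 2 ^ m / real m * (inverse (fact K) * (2 * t\<^sup>2 / real m) ^ K)" .
  qed
  have "(\<lambda>K. inverse (fact K) * (2 * t\<^sup>2 / real m) ^ K) \<longlonglongrightarrow> 0"
    by (rule summable_LIMSEQ_zero[OF summable_exp])
  then show "(\<lambda>K. 2 * 2 ^ m / real m * (inverse (fact K) * (2 * t\<^sup>2 / real m) ^ K)) \<longlonglongrightarrow> 0"
    using tendsto_mult_right_zero by fastforce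
qed

text \<open>Phrased through the Taylor bound \<open>approx\<close> instead of moments of
  \<open>\<mu> n\<close>, so that it serves two situations: random spectral measures, where
  \<open>Y\<close> is a trace moment at one \<omega>, and the averaged measure, where
  \<open>Y\<close> is its expectation. The order K is fixed from the limit moments before n
  grows.\<close>

lemma weak_conv_limit_distribution:
  fixes \<mu> :: "nat \<Rightarrow> real measure" and Y :: "nat \<Rightarrow> nat \<Rightarrow> real"
  assumes dist: "\<And>n. real_distribution (\<mu> n)"
    and Y: "\<And>k. (\<lambda>n. Y n k) \<longlonglongrightarrow> gue_moment m k / real m"
    and approx: "\<And>n K t. cmod (char (\<mu> n) t - (\<Sum>k\<le>2 * K. ((\<i> * t) ^ k / fact k) * Y n k)) \<le>
        2 * \<bar>t\<bar> ^ (2 * K) / fact (2 * K) * Y n (2 * K)"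
  shows "weak_conv_m \<mu> (limit_distribution m)"
proof (rule levy_continuity[OF dist real_distribution_limit])
  fix t :: real
  let ?\<beta> = "\<lambda>k. gue_moment m k / real m"
  let ?B = "\<lambda>K. 2 * \<bar>t\<bar> ^ (2 * K) / fact (2 * K) * ?\<beta> (2 * K)"
  let ?S = "\<lambda>y K. \<Sum>k\<le>2 * K. ((\<i> * t) ^ k / fact k) * complex_of_real (y k)"
  interpret L: real_distribution "limit_distribution m" by (rule real_distribution_limit)
  have lim: "cmod (char (limit_distribution m) t - ?S ?\<beta> K) \<le> ?B K" for K
    using L.char_approx1[of "2 * K" t] integrable_limit_moment limit_moment
    by (simp add: power_even_abs)
  show "(\<lambda>n. char (\<mu> n) t) \<longlonglongrightarrow> char (limit_distribution m) t"
  proof (rule tendstoI)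
    fix r :: real assume "0 < r"
    then have r: "0 < r / 4" by simp
    have "\<forall>\<^sub>F K in sequentially. dist (?B K) 0 < r / 4"
      by (rule tendstoD[OF gue_moment_growth r])
    then obtain K where K: "\<bar>?B K\<bar> < r / 4" by (auto simp: eventually_sequentially)
    have "(\<lambda>n. ?S (Y n) K) \<longlonglongrightarrow> ?S ?\<beta> K"
      by (intro tendsto_intros Y)
    then have e1: "\<forall>\<^sub>F n in sequentially. dist (?S (Y n) K) (?S ?\<beta> K) < r / 4"
      by (rule tendstoD[OF _ r])
    have "(\<lambda>n. 2 * \<bar>t\<bar> ^ (2 * K) / fact (2 * K) * Y n (2 * K)) \<longlonglongrightarrow> ?B K"
      by (intro tendsto_mult tendsto_const Y)
    then have e2: "\<forall>\<^sub>F n in sequentially.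
        dist (2 * \<bar>t\<bar> ^ (2 * K) / fact (2 * K) * Y n (2 * K)) (?B K) < r / 4"
      by (rule tendstoD[OF _ r])
    show "\<forall>\<^sub>F n in sequentially. dist (char (\<mu> n) t) (char (limit_distribution m) t) < r"
      using e1 e2
    proof eventually_elim
      case (elim n)
      define x B where "x = 2 * \<bar>t\<bar> ^ (2 * K) / fact (2 * K) * Y n (2 * K)" and "B = ?B K"
      define a b c where "a = char (\<mu> n) t - ?S (Y n) K" and "b = ?S (Y n) K - ?S ?\<beta> K"
        and "c = char (limit_distribution m) t - ?S ?\<beta> K"
      have eq: "char (\<mu> n) t - char (limit_distribution m) t = a + b - c"
        by (simp add: a_def b_def c_def)
      have "norm (a + b - c) \<le> norm (a + b) + norm c" by (rule norm_triangle_ineq4)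
      moreover have "norm (a + b) \<le> norm a + norm b" by (rule norm_triangle_ineq)
      moreover have "norm a \<le> x" unfolding a_def x_def by (rule approx)
      moreover have "norm c \<le> B" unfolding c_def B_def by (rule lim)
      moreover have "norm b < r / 4" using elim(1) unfolding b_def dist_norm .
      moreover have "\<bar>x - B\<bar> < r / 4"
        using elim(2) unfolding dist_norm real_norm_def x_def B_def .
      moreover have "\<bar>B\<bar> < r / 4" using K unfolding B_def .
      ultimately show ?case unfolding dist_norm eq by linarith
    qed
  qed
qed

end

subsection \<open>Spectra of real symmetric matrices\<close>

lemma symmetric_eigenvalue_real:
  fixes A :: "real mat" and a :: complex
  assumes A: "A \<in> carrier_mat n n" and sym: "\<And>i j. i < n \<Longrightarrow> j < n \<Longrightarrow> A $$ (i, j) = A $$ (j, i)"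
    and ev: "eigenvalue (map_mat complex_of_real A) a"
  shows "a \<in> \<real>"
proof -
  let ?A = "map_mat complex_of_real A"
  from ev obtain v where v: "v \<in> carrier_vec n" "v \<noteq> 0\<^sub>v n" "?A *\<^sub>v v = a \<cdot>\<^sub>v v"
    using A unfolding eigenvalue_def eigenvector_def by auto
  have row: "(\<Sum>j<n. complex_of_real (A $$ (i, j)) * vec_index v j) = a * vec_index v i" if "i < n" for i
  proof -
    have "vec_index (?A *\<^sub>v v) i = (\<Sum>j<n. complex_of_real (A $$ (i, j)) * vec_index v j)"
      using A v(1) that by (simp add: scalar_prod_def atLeast0LessThan)
    then show ?thesis using v that by simp
  qed
  define T where "T = (\<Sum>i<n. (cmod (vec_index v i))\<^sup>2)"
  define s where "s = (\<Sum>i<n. \<Sum>j<n. cnj (vec_index v i) * (complex_of_real (A $$ (i, j)) * vec_index v j))"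
  have "s = (\<Sum>i<n. cnj (vec_index v i) * (a * vec_index v i))"
    unfolding s_def by (intro sum.cong refl) (simp add: sum_distrib_left[symmetric] row)
  also have "\<dots> = a * of_real T"
    unfolding T_def of_real_sum sum_distrib_left
    by (intro sum.cong refl) (simp add: mult_ac flip: complex_norm_square)
  finally have sT: "s = a * of_real T" .
  have "cnj s = (\<Sum>i<n. \<Sum>j<n. vec_index v i * (complex_of_real (A $$ (i, j)) * cnj (vec_index v j)))"
    by (simp add: s_def)
  also have "\<dots> = (\<Sum>j<n. \<Sum>i<n. vec_index v i * (complex_of_real (A $$ (i, j)) * cnj (vec_index v j)))"
    by (rule sum.swap)
  also have "\<dots> = s"
    unfolding s_def by (intro sum.cong refl) (simp add: sym mult_ac)
  finally have "cnj a * of_real T = a * of_real T" using sT by simp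
  moreover have "T \<noteq> 0"
  proof -
    obtain i where "i < n" "vec_index v i \<noteq> 0"
      using v(1,2) by (metis carrier_vecD eq_vecI index_zero_vec)
    then have "0 < T" unfolding T_def by (intro sum_pos2[of _ i]) auto
    then show ?thesis by simp
  qed
  ultimately show "a \<in> \<real>" by (simp add: Reals_cnj_iff)
qed

text \<open>The polynomial splits over the complex numbers with real roots, and the real
  factorization is read off by comparing values at real points.\<close>

lemma symmetric_char_poly_factorized:
  fixes A :: "real mat"
  assumes A: "A \<in> carrier_mat n n" and sym: "\<And>i j. i < n \<Longrightarrow> j < n \<Longrightarrow> A $$ (i, j) = A $$ (j, i)"
  shows "\<exists>es. char_poly A = (\<Prod>e\<leftarrow>es. [:- e, 1:]) \<and> length es = n"
proof -
  let ?A = "map_mat complex_of_real A"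
  have cA: "?A \<in> carrier_mat n n" using A by simp
  obtain as where as: "char_poly ?A = (\<Prod>a\<leftarrow>as. [:- a, 1:])" "length as = n"
    using char_poly_factorized[OF cA] by blast
  have real: "a \<in> \<real>" if "a \<in> set as" for a
  proof -
    have "poly (char_poly ?A) a = 0"
      unfolding as using that by (auto simp: poly_prod_list prod_list_zero_iff)
    then have "eigenvalue ?A a" using eigenvalue_root_char_poly[OF cA] by simp
    then show ?thesis using symmetric_eigenvalue_real[of A n a] A sym by blast
  qed
  have hom: "char_poly ?A = map_poly complex_of_real (char_poly A)"
    using of_real_hom.char_poly_hom[OF A] by simp
  have "poly (char_poly A) x = poly (\<Prod>e\<leftarrow>map Re as. [:- e, 1:]) x" for x
  proof -
    have "complex_of_real (poly (char_poly A) x) = poly (char_poly ?A) (of_real x)"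
      unfolding hom by simp
    also have "\<dots> = (\<Prod>a\<leftarrow>as. of_real x - a)"
      unfolding as by (simp add: poly_prod_list o_def)
    also have "\<dots> = (\<Prod>a\<leftarrow>as. complex_of_real (x - Re a))"
      using real by (intro arg_cong[of _ _ prod_list] map_cong) (auto simp: complex_is_Real_iff complex_eq_iff)
    also have "\<dots> = complex_of_real (\<Prod>a\<leftarrow>as. x - Re a)"
      by (induction as) auto
    also have "(\<Prod>a\<leftarrow>as. x - Re a) = poly (\<Prod>e\<leftarrow>map Re as. [:- e, 1:]) x"
      by (simp add: poly_prod_list o_def)
    finally show ?thesis by (simp only: of_real_eq_iff)
  qed
  then have "char_poly A = (\<Prod>e\<leftarrow>map Re as. [:- e, 1:])"
    by (metis poly_eq_poly_eq_iff ext)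
  then show ?thesis using as(2) by (intro exI[of _ "map Re as"]) simp
qed

lemma pow_mat_mpow:
  fixes A :: "'a::comm_ring_1 mat"
  assumes A: "A \<in> carrier_mat n n" and "i < n" "j < n"
  shows "(A ^\<^sub>m k) $$ (i, j) = mpow n (\<lambda>p. A $$ p) k i j"
  using assms(3)
proof (induction k arbitrary: j)
  case 0
  then show ?case using A assms(2) by (simp add: unit_mat_def)
next
  case (Suc k)
  have "(A ^\<^sub>m Suc k) $$ (i, j) = (\<Sum>l<n. (A ^\<^sub>m k) $$ (i, l) * A $$ (l, j))"
    using A assms(2) Suc.prems pow_carrier_mat[OF A, of k]
    by (simp add: scalar_prod_def atLeast0LessThan)
  also have "\<dots> = (\<Sum>l<n. mpow n (\<lambda>p. A $$ p) k i l * mpow n (\<lambda>p. A $$ p) 1 l j)"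
    using Suc by (intro sum.cong) (auto simp: unit_mat_def if_distrib cong: if_cong)
  also have "\<dots> = mpow n (\<lambda>p. A $$ p) (Suc k) i j"
    using mpow_add[OF assms(2), of "\<lambda>p. A $$ p" k 1 j] by simp
  finally show ?case .
qed

lemma mpow_upper_triangular:
  assumes "\<And>i j. j < i \<Longrightarrow> i < n \<Longrightarrow> x (i, j) = 0" "i < n"
  shows "j < i \<Longrightarrow> mpow n x k i j = 0" and "mpow n x k i i = x (i, i) ^ k"
proof -
  have *: "mpow n x k i j = 0" if "j < i" "i < n" for i j
    using that
  proof (induction k arbitrary: i)
    case (Suc k)
    have "x (i, l) * mpow n x k l j = 0" if "l < n" for l
      using Suc assms(1)[of l i] that by (cases "l < i") auto
    then show ?case by simp
  qed (simp add: unit_mat_def)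
  then show "j < i \<Longrightarrow> mpow n x k i j = 0" using assms(2) by blast
  have *: "mpow n x k i j = 0" if "j < i" "i < n" for i j k
    using that
  proof (induction k arbitrary: i)
    case (Suc k)
    have "x (i, l) * mpow n x k l j = 0" if "l < n" for l
      using Suc assms(1)[of l i] that by (cases "l < i") auto
    then show ?case by simp
  qed (simp add: unit_mat_def)
  show "mpow n x k i i = x (i, i) ^ k"
  proof (induction k)
    case (Suc k)
    have "(\<Sum>l<n. x (i, l) * mpow n x k l i) = (\<Sum>l<n. if l = i then x (i, i) * mpow n x k i i else 0)"
    proof (intro sum.cong refl)
      fix l assume "l \<in> {..<n}"
      then show "x (i, l) * mpow n x k l i = (if l = i then x (i, i) * mpow n x k i i else 0)"
        using assms(1)[of l i] assms(2) *[of i l k] by (cases l i rule: linorder_cases) auto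
    qed
    then show ?case using Suc assms(2) by simp
  qed (simp add: unit_mat_def)
qed

text \<open>Since the characteristic polynomial splits, the matrix is triangularized by a
  similarity; powers of a triangular matrix have the powers of its diagonal on the diagonal, and the
  trace is cyclic.\<close>

lemma trace_pow_eigenvalues:
  fixes A :: "real mat"
  assumes A: "A \<in> carrier_mat n n" and c: "char_poly A = (\<Prod>e\<leftarrow>es. [:- e, 1:])"
  shows "(\<Sum>e\<leftarrow>es. e ^ k) = (\<Sum>i<n. mpow n (\<lambda>p. A $$ p) k i i)"
proof -
  obtain B P Q where "schur_decomposition A es = (B, P, Q)" by (metis prod_cases3)
  from schur_decomposition[OF A c this] have sim: "similar_mat_wit A B P Q"
    and ut: "upper_triangular B" and dg: "diag_mat B = es" by auto
  from similar_mat_witD2[OF A sim] have PQ: "P * Q = 1\<^sub>m n" "Q * P = 1\<^sub>m n"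
    and B: "B \<in> carrier_mat n n" and P: "P \<in> carrier_mat n n" and Q: "Q \<in> carrier_mat n n"
    by auto
  have pow: "A ^\<^sub>m k = P * B ^\<^sub>m k * Q" by (rule similar_mat_wit_pow_id[OF sim])
  define C where "C = B ^\<^sub>m k"
  have C: "C \<in> carrier_mat n n" unfolding C_def using B by simp
  define R where "R = P * C"
  have R: "R \<in> carrier_mat n n" unfolding R_def using P C by simp
  have "(\<Sum>i<n. mpow n (\<lambda>p. A $$ p) k i i) = (\<Sum>i<n. (R * Q) $$ (i, i))"
    using pow_mat_mpow[OF A, of _ _ k] pow unfolding C_def R_def by (intro sum.cong) auto
  also have "\<dots> = (\<Sum>i<n. \<Sum>l<n. R $$ (i, l) * Q $$ (l, i))"
    using R Q by (intro sum.cong) (auto simp: scalar_prod_def atLeast0LessThan)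
  also have "\<dots> = (\<Sum>l<n. \<Sum>i<n. Q $$ (l, i) * R $$ (i, l))"
    by (subst sum.swap) (simp add: mult.commute)
  also have "\<dots> = (\<Sum>l<n. (Q * R) $$ (l, l))"
    using R Q by (intro sum.cong) (auto simp: scalar_prod_def atLeast0LessThan)
  also have "Q * R = C"
    unfolding R_def using assoc_mult_mat[OF Q P C] PQ(2) C by simp
  also have "(\<Sum>l<n. C $$ (l, l)) = (\<Sum>l<n. (B $$ (l, l)) ^ k)"
  proof (intro sum.cong refl)
    fix l assume "l \<in> {..<n}"
    then have l: "l < n" by simp
    have "C $$ (l, l) = mpow n (\<lambda>p. B $$ p) k l l"
      unfolding C_def using pow_mat_mpow[OF B l l] .
    also have "\<dots> = (B $$ (l, l)) ^ k"
      using ut B l by (intro mpow_upper_triangular(2)) (auto simp: upper_triangular_def)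
    finally show "C $$ (l, l) = (B $$ (l, l)) ^ k" .
  qed
  also have "\<dots> = (\<Sum>e\<leftarrow>es. e ^ k)"
    unfolding dg[symmetric] diag_mat_def using B
    by (simp add: o_def interv_sum_list_conv_sum_set_nat atLeast0LessThan)
  finally show ?thesis by simp
qed

lemma proots_linear_factors: "proots (\<Prod>e\<leftarrow>es. [:- e, 1 :: real:]) = mset es"
proof (induction es)
  case (Cons a es)
  have "(\<Prod>e\<leftarrow>es. [:- e, 1 :: real:]) \<noteq> 0" by (auto simp: prod_list_zero_iff)
  then have "proots ([:- a, 1:] * (\<Prod>e\<leftarrow>es. [:- e, 1:])) = proots [:- a, 1:] + proots (\<Prod>e\<leftarrow>es. [:- e, 1:])"
    by (intro proots_mult) auto
  then show ?case using Cons by (simp del: mult_pCons_left)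
qed simp

lemma eigenvalue_list_symmetric:
  fixes A :: "real mat"
  assumes A: "A \<in> carrier_mat n n" and sym: "\<And>i j. i < n \<Longrightarrow> j < n \<Longrightarrow> A $$ (i, j) = A $$ (j, i)"
  shows "length (eigenvalue_list A) = n"
    and "(\<Sum>e\<leftarrow>eigenvalue_list A. e ^ k) = (\<Sum>i<n. mpow n (\<lambda>p. A $$ p) k i i)"
proof -
  obtain es where es: "char_poly A = (\<Prod>e\<leftarrow>es. [:- e, 1:])" "length es = n"
    using symmetric_char_poly_factorized[OF A sym] by blast
  have "proots (char_poly A) = mset es"
    unfolding es(1) by (rule proots_linear_factors)
  then have m: "mset (eigenvalue_list A) = mset es"
    by (simp add: eigenvalue_list_def)
  then show "length (eigenvalue_list A) = n" using es(2) mset_eq_length by blast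
  have "(\<Sum>e\<leftarrow>eigenvalue_list A. e ^ k) = (\<Sum>e\<leftarrow>es. e ^ k)"
    by (metis m mset_map sum_mset_sum_list)
  then show "(\<Sum>e\<leftarrow>eigenvalue_list A. e ^ k) = (\<Sum>i<n. mpow n (\<lambda>p. A $$ p) k i i)"
    using trace_pow_eigenvalues[OF A es(1)] by simp
qed

lemma
  assumes A: "dim_row A = n" "length (eigenvalue_list A) = n" and n: "0 < n"
  shows emeasure_empirical: "B \<in> sets borel \<Longrightarrow> emeasure (empirical_eigenvalue_distribution A) B =
      ennreal ((\<Sum>e\<leftarrow>eigenvalue_list A. indicator B e) / n)"
    and integral_empirical: "f \<in> borel_measurable borel \<Longrightarrow>
      (\<integral>x. f x \<partial>empirical_eigenvalue_distribution A) = (\<Sum>e\<leftarrow>eigenvalue_list A. f e) / (n::nat)"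
    and integrable_empirical: "f \<in> borel_measurable borel \<Longrightarrow>
      integrable (empirical_eigenvalue_distribution A) (f :: real \<Rightarrow> real)"
    and prob_space_empirical: "prob_space (empirical_eigenvalue_distribution A)"
proof -
  let ?U = "uniform_count_measure {..<n}"
  let ?g = "\<lambda>j. eigenvalue_list A ! j"
  have D: "empirical_eigenvalue_distribution A = distr ?U borel ?g"
    by (simp add: empirical_eigenvalue_distribution_def A)
  have ms [measurable]: "?g \<in> measurable ?U borel"
    by (simp add: measurable_def space_uniform_count_measure sets_uniform_count_measure)
  have sm: "(\<Sum>j<n. f (?g j)) = (\<Sum>e\<leftarrow>eigenvalue_list A. f e)" for f :: "real \<Rightarrow> real"
    using A by (simp add: sum_list_sum_nth atLeast0LessThan)
  interpret U: prob_space ?U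
    using n by (intro prob_space_uniform_count_measure) auto
  show "prob_space (empirical_eigenvalue_distribution A)"
    unfolding D by (rule U.prob_space_distr) measurable
  have intU: "integrable ?U h" for h :: "nat \<Rightarrow> real"
    unfolding uniform_count_measure_def by (intro integrable_point_measure_finite) auto
  show "integrable (empirical_eigenvalue_distribution A) f" if "f \<in> borel_measurable borel" for f :: "real \<Rightarrow> real"
    unfolding D using that intU by (simp add: integrable_distr_eq)
  show I: "(\<integral>x. f x \<partial>empirical_eigenvalue_distribution A) = (\<Sum>e\<leftarrow>eigenvalue_list A. f e) / n"
    if "f \<in> borel_measurable borel" for f :: "real \<Rightarrow> real"
    unfolding D using that n
    by (subst integral_distr) (simp_all add: integral_uniform_count_measure sm)
  show "emeasure (empirical_eigenvalue_distribution A) B = ennreal ((\<Sum>e\<leftarrow>eigenvalue_list A. indicator B e) / n)"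
    if B: "B \<in> sets borel"
  proof -
    interpret P: prob_space "empirical_eigenvalue_distribution A" by fact
    have "space (empirical_eigenvalue_distribution A) = UNIV" by (simp add: D)
    then have "emeasure (empirical_eigenvalue_distribution A) B = ennreal (\<integral>x. indicator B x \<partial>empirical_eigenvalue_distribution A)"
      by (simp add: P.emeasure_eq_measure)
    then show ?thesis using I[of "indicator B"] B by simp
  qed
qed

subsection \<open>The averaged spectral measure\<close>

lemma tendsto_sum_list_real:
  fixes f :: "nat \<Rightarrow> real \<Rightarrow> real"
  assumes "\<And>x. (\<lambda>n. f n x) \<longlonglongrightarrow> g x"
  shows "(\<lambda>n. \<Sum>x\<leftarrow>xs. f n x) \<longlonglongrightarrow> (\<Sum>x\<leftarrow>xs. g x)"
  by (induction xs) (auto intro!: tendsto_add assms)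

text \<open>The functions \<open>g\<close> for which a linear statistic of a random list is measurable are closed
  under pointwise limits. Starting from monomials one reaches \<open>exp (c x)\<close>, then
  \<open>exp (- z exp (c x))\<close>, then indicators of half lines, then all indicators of Borel sets.\<close>

lemma measurable_sum_list_indicator:
  fixes ev :: "'a \<Rightarrow> real list"
  assumes pw: "\<And>k. (\<lambda>\<omega>. \<Sum>e\<leftarrow>ev \<omega>. e ^ k) \<in> borel_measurable M"
    and B: "B \<in> sets borel"
  shows "(\<lambda>\<omega>. \<Sum>e\<leftarrow>ev \<omega>. indicator B e :: real) \<in> borel_measurable M"
proof -
  define G :: "(real \<Rightarrow> real) set" where "G = {g. (\<lambda>\<omega>. \<Sum>e\<leftarrow>ev \<omega>. g e) \<in> borel_measurable M}"
  have G_lim: "g \<in> G" if "\<And>n. f n \<in> G" "\<And>x. (\<lambda>n. f n x) \<longlonglongrightarrow> g x" for f :: "nat \<Rightarrow> real \<Rightarrow> real" and g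
  proof -
    have "(\<lambda>\<omega>. \<Sum>e\<leftarrow>ev \<omega>. g e) \<in> borel_measurable M"
      by (rule borel_measurable_LIMSEQ_real[where u = "\<lambda>n \<omega>. \<Sum>e\<leftarrow>ev \<omega>. f n e"])
        (use that in \<open>auto simp: G_def intro!: tendsto_sum_list_real\<close>)
    then show ?thesis by (simp add: G_def)
  qed
  have G_cmult: "(\<lambda>x. c * g x) \<in> G" if "g \<in> G" for c g
  proof -
    have "(\<lambda>\<omega>. c * (\<Sum>e\<leftarrow>ev \<omega>. g e)) \<in> borel_measurable M"
      using that unfolding G_def by (intro borel_measurable_times borel_measurable_const) auto
    then show ?thesis by (simp add: G_def sum_list_const_mult)
  qed
  have G_add: "(\<lambda>x. f x + g x) \<in> G" if "f \<in> G" "g \<in> G" for f g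
    using that by (simp add: G_def sum_list_addf)
  have G_0: "(\<lambda>x. 0) \<in> G" by (simp add: G_def)
  have G_sum: "(\<lambda>x. \<Sum>k<n. f k x) \<in> G" if "\<And>k. f k \<in> G" for f and n :: nat
  proof (induction n)
    case (Suc n)
    then show ?case using G_add[OF Suc that[of n]] by simp
  qed (simp add: G_0)
  have G_power: "(\<lambda>x. x ^ k) \<in> G" for k using pw by (simp add: G_def)
  have exp_lim: "(\<lambda>n. \<Sum>k<n. y ^ k / fact k) \<longlonglongrightarrow> exp y" for y :: real
    using exp_converges[of y] by (simp add: sums_def divide_inverse mult.commute)
  have G_exp: "(\<lambda>x. exp (c * x)) \<in> G" for c
  proof (rule G_lim)
    show "(\<lambda>n. \<Sum>k<n. (c * x) ^ k / fact k) \<longlonglongrightarrow> exp (c * x)" for x by (rule exp_lim)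
    have "(\<lambda>x. \<Sum>k<n. c ^ k / fact k * x ^ k) \<in> G" for n
      by (intro G_sum G_cmult G_power)
    then show "(\<lambda>x. \<Sum>k<n. (c * x) ^ k / fact k) \<in> G" for n
      by (simp add: power_mult_distrib)
  qed
  have G_expexp: "(\<lambda>x. exp (- z * exp (c * x))) \<in> G" for z c
  proof (rule G_lim)
    show "(\<lambda>n. \<Sum>k<n. (- z * exp (c * x)) ^ k / fact k) \<longlonglongrightarrow> exp (- z * exp (c * x))" for x
      by (rule exp_lim)
    have eq: "(- z * exp (c * x)) ^ k / fact k = (- z) ^ k / fact k * exp ((real k * c) * x)" for x k
      unfolding power_mult_distrib mult.assoc exp_of_nat_mult by simp
    have "(\<lambda>x. \<Sum>k<n. (- z) ^ k / fact k * exp ((real k * c) * x)) \<in> G" for n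
      by (intro G_sum G_cmult G_exp)
    then show "(\<lambda>x. \<Sum>k<n. (- z * exp (c * x)) ^ k / fact k) \<in> G" for n
      unfolding eq .
  qed
  \<comment> \<open>Pointwise limit of exp(- exp(n (x - a))). At x = a all members equal exp(-1), so
    \<open>h a\<close> is not yet an indicator; approaching the threshold from above, along a + 1 /
    (n + 1), removes this value.\<close>
  define h :: "real \<Rightarrow> real \<Rightarrow> real" where
    "h a x = (if x < a then 1 else if x = a then exp (- 1) else 0)" for a x
  have G_h: "h a \<in> G" for a
  proof (rule G_lim)
    show "(\<lambda>x. exp (- exp (- real n * a) * exp (real n * x))) \<in> G" for n by (rule G_expexp)
    fix x
    have eq: "exp (- exp (- real n * a) * exp (real n * x)) = exp (- exp (real n * (x - a)))" for n
      by (simp add: exp_add[symmetric] algebra_simps)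
    show "(\<lambda>n. exp (- exp (- real n * a) * exp (real n * x))) \<longlonglongrightarrow> h a x"
      unfolding eq
    proof (cases x a rule: linorder_cases)
      case less
      then have "LIM n sequentially. (x - a) * real n :> at_bot"
        by (intro filterlim_tendsto_neg_mult_at_bot[OF tendsto_const _ filterlim_real_sequentially]) simp
      then have "LIM n sequentially. real n * (x - a) :> at_bot" by (simp add: mult.commute)
      then have "(\<lambda>n. exp (- exp (real n * (x - a)))) \<longlonglongrightarrow> exp (- 0)"
        by (intro tendsto_exp tendsto_minus filterlim_compose[OF exp_at_bot])
      then show "(\<lambda>n. exp (- exp (real n * (x - a)))) \<longlonglongrightarrow> h a x" using less by (simp add: h_def)
    next
      case equal
      then show "(\<lambda>n. exp (- exp (real n * (x - a)))) \<longlonglongrightarrow> h a x" by (simp add: h_def)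
    next
      case greater
      then have "filterlim (\<lambda>n. exp (real n * (x - a))) at_top sequentially"
        by (intro filterlim_compose[OF exp_at_top]
            filterlim_at_top_mult_tendsto_pos[OF tendsto_const _ filterlim_real_sequentially]) auto
      then have "(\<lambda>n. exp (- exp (real n * (x - a)))) \<longlonglongrightarrow> 0"
        by (intro filterlim_compose[OF exp_at_bot] filterlim_compose[OF filterlim_uminus_at_bot_at_top])
      then show "(\<lambda>n. exp (- exp (real n * (x - a)))) \<longlonglongrightarrow> h a x" using greater by (simp add: h_def)
    qed
  qed
  have G_atMost: "indicator {..a} \<in> G" for a
  proof (rule G_lim)
    show "h (a + inverse (real (Suc n))) \<in> G" for n by (rule G_h)
    fix x
    show "(\<lambda>n. h (a + inverse (real (Suc n))) x) \<longlonglongrightarrow> indicator {..a} x"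
    proof (cases "x \<le> a")
      case True
      have "h (a + inverse (real (Suc n))) x = 1" for n
      proof -
        have "0 < inverse (real (Suc n))" by simp
        then have "x < a + inverse (real (Suc n))" using True by linarith
        then show ?thesis by (simp add: h_def)
      qed
      then show ?thesis using True by simp
    next
      case False
      have "\<forall>\<^sub>F n in sequentially. inverse (real (Suc n)) < x - a"
        using False by (intro order_tendstoD(2)[OF LIMSEQ_inverse_real_of_nat]) simp
      then have "\<forall>\<^sub>F n in sequentially. h (a + inverse (real (Suc n))) x = 0"
        by eventually_elim (auto simp: h_def)
      then show ?thesis using False by (simp add: tendsto_eventually)
    qed
  qed
  have G_UNIV: "indicator UNIV \<in> G" using G_power[of 0] by (simp add: indicator_def[abs_def])
  have st: "Int_stable (range (atMost :: real \<Rightarrow> _))" "range (atMost :: real \<Rightarrow> _) \<subseteq> Pow UNIV"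
    by (auto simp: Int_stable_def)
  have "B \<in> sigma_sets UNIV (range atMost)"
    using B by (simp add: borel_eq_atMost[where 'a = real])
  with st have "indicator B \<in> G"
  proof (induction rule: sigma_sets_induct_disjoint)
    case (compl A)
    have "(\<lambda>x. indicator UNIV x + (- 1) * indicator A x) \<in> G"
      by (intro G_add G_UNIV G_cmult compl)
    moreover have "(\<lambda>x. indicator UNIV x + (- 1) * indicator A x) = (indicator (UNIV - A) :: real \<Rightarrow> real)"
      by (auto simp: indicator_def)
    ultimately show ?case by simp
  next
    case (union A)
    show ?case
    proof (rule G_lim)
      show "(\<lambda>x. \<Sum>k<n. indicator (A k) x) \<in> G" for n by (intro G_sum union)
      fix x
      show "(\<lambda>n. \<Sum>k<n. indicator (A k) x :: real) \<longlonglongrightarrow> indicator (\<Union> (range A)) x"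
      proof (cases "x \<in> \<Union> (range A)")
        case True
        then obtain k where k: "x \<in> A k" by auto
        then have "indicator (A j) x = (if j = k then 1 else 0 :: real)" for j
          using union(1) by (auto simp: disjoint_family_on_def indicator_def)
        then have "\<forall>\<^sub>F n in sequentially. (\<Sum>j<n. indicator (A j) x) = (1 :: real)"
          by (intro eventually_sequentiallyI[of "Suc k"]) simp
        then show ?thesis using True by (simp add: tendsto_eventually)
      qed auto
    qed
  next
    case (basic A)
    then show ?case using G_atMost by auto
  next
    case empty
    have "(indicator {} :: real \<Rightarrow> real) = (\<lambda>x. 0)" by auto
    then show ?case using G_0 by simp
  qed
  then show ?thesis by (simp add: G_def)
qed

subsection \<open>An eighth moment concentration inequality\<close>

lemma prod_list_fun_upd:
  fixes x :: "'i \<Rightarrow> 'b::comm_monoid_mult"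
  shows "prod_list (map (x(a := y)) w) = y ^ count_list w a * prod_list (map x (filter (\<lambda>b. b \<noteq> a) w))"
  by (induction w) (auto simp: mult_ac)

lemma count_list_filter_neq: "count_list (filter (\<lambda>b. b \<noteq> a) w) c = (if c = a then 0 else count_list w c)"
  by (induction w) auto

lemma power2_sum_le:
  fixes f :: "nat \<Rightarrow> real"
  shows "(\<Sum>l<k. f l)\<^sup>2 \<le> real k * (\<Sum>l<k. (f l)\<^sup>2)"
  using Cauchy_Schwarz_ineq_sum[of "\<lambda>_. 1" f "{..<k}"] by simp

lemma power4_sum_le:
  fixes f :: "nat \<Rightarrow> real"
  shows "(\<Sum>l<k. f l) ^ 4 \<le> real k ^ 3 * (\<Sum>l<k. f l ^ 4)"
proof -
  have "((\<Sum>l<k. f l)\<^sup>2)\<^sup>2 \<le> (real k * (\<Sum>l<k. (f l)\<^sup>2))\<^sup>2"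
    by (intro power_mono power2_sum_le) simp
  also have "\<dots> \<le> (real k)\<^sup>2 * (real k * (\<Sum>l<k. ((f l)\<^sup>2)\<^sup>2))"
    by (subst power_mult_distrib) (intro mult_left_mono power2_sum_le zero_le_power2)
  also have "\<dots> = real k ^ 3 * (\<Sum>l<k. ((f l)\<^sup>2)\<^sup>2)"
    by (simp add: power2_eq_square[of "real k"] power3_eq_cube)
  finally show ?thesis by (simp only: power_mult[symmetric]) simp
qed

context centered_family
begin

abbreviation X :: "'a \<Rightarrow> 'i \<Rightarrow> real" where
  "X \<omega> \<equiv> (\<lambda>\<alpha>. \<xi> \<alpha> \<omega>)"

lemma wprod_X: "prod_list (map (X \<omega>) w) = wprod w \<omega>"
  by (simp add: wprod_def)

lemma integrable_polyfun: "polyfun J f \<Longrightarrow> integrable M (\<lambda>\<omega>. f (X \<omega>))"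
proof -
  assume "polyfun J f"
  then obtain cs where cs: "\<forall>p\<in>set cs. set (snd p) \<subseteq> J"
    "\<forall>x. f x = (\<Sum>p\<leftarrow>cs. fst p * prod_list (map x (snd p)))" unfolding polyfun_iff by blast
  have "integrable M (\<lambda>\<omega>. \<Sum>p\<leftarrow>cs. fst p * prod_list (map (X \<omega>) (snd p)))"
    using cs(1) by (induction cs) (auto simp: wprod_X intro!: integrable_wprod)
  then show ?thesis using cs(2) by simp
qed

section \<open>Integrating out one variable, and the Efron-Stein inequality\<close>

definition part :: "'i \<Rightarrow> (('i \<Rightarrow> real) \<Rightarrow> real) \<Rightarrow> ('i \<Rightarrow> real) \<Rightarrow> real" where
  "part a f x = (\<integral>\<omega>. f (x(a := \<xi> a \<omega>)) \<partial>M)"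

lemma integrable_section:
  assumes "polyfun J f" "a \<in> J"
  shows "integrable M (\<lambda>\<omega>. f (x(a := \<xi> a \<omega>)))"
proof -
  obtain cs where cs: "\<forall>p\<in>set cs. set (snd p) \<subseteq> J"
    "\<forall>x. f x = (\<Sum>p\<leftarrow>cs. fst p * prod_list (map x (snd p)))"
    using assms(1) unfolding polyfun_iff by blast
  have "integrable M (\<lambda>\<omega>. \<Sum>p\<leftarrow>cs. fst p * prod_list (map (x(a := \<xi> a \<omega>)) (snd p)))"
    unfolding prod_list_fun_upd using assms(2)
    by (induction cs) (auto intro!: integrable_power)
  then show ?thesis using cs(2) by simp
qed

lemma
  assumes f: "polyfun J f" and a: "a \<in> J"
  shows polyfun_part: "polyfun J (part a f)"
    and expectation_part: "(\<integral>\<omega>. part a f (X \<omega>) \<partial>M) = (\<integral>\<omega>. f (X \<omega>) \<partial>M)"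
proof -
  obtain cs where cs: "\<forall>p\<in>set cs. set (snd p) \<subseteq> J"
    "\<forall>x. f x = (\<Sum>p\<leftarrow>cs. fst p * prod_list (map x (snd p)))"
    using f unfolding polyfun_iff by blast
  let ?fl = "\<lambda>w. filter (\<lambda>b. b \<noteq> a) w"
  let ?m = "\<lambda>w. expectation (\<lambda>\<omega>. \<xi> a \<omega> ^ count_list w a)"
  have "part a f x = (\<Sum>p\<leftarrow>cs. fst p * ?m (snd p) * prod_list (map x (?fl (snd p))))" for x
  proof -
    have "(\<integral>\<omega>. (\<Sum>p\<leftarrow>cs. fst p * prod_list (map (x(a := \<xi> a \<omega>)) (snd p))) \<partial>M) =
        (\<Sum>p\<leftarrow>cs. fst p * ?m (snd p) * prod_list (map x (?fl (snd p))))
      \<and> integrable M (\<lambda>\<omega>. \<Sum>p\<leftarrow>cs. fst p * prod_list (map (x(a := \<xi> a \<omega>)) (snd p)))"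
      unfolding prod_list_fun_upd using a integrable_power[OF a]
      by (induction cs) (simp_all add: mult.assoc)
    then show ?thesis unfolding part_def using cs(2) by simp
  qed
  then have eq: "part a f = (\<lambda>x. \<Sum>p\<leftarrow>cs. fst p * ?m (snd p) * prod_list (map x (?fl (snd p))))" by auto
  show "polyfun J (part a f)"
    unfolding eq using cs(1) by (intro polyfun_sum_list polyfun_cmult polyfun_prod_list) auto
  have mom: "mom w = ?m w * mom (?fl w)" if "set w \<subseteq> J" for w
  proof -
    have fl: "set (?fl w) \<subseteq> J" using that by auto
    show ?thesis
      unfolding mom_eq[OF subset_refl that] mom_eq[OF subset_refl fl] count_list_filter_neq
        prod.remove[OF finite_J a]
      by (auto simp: prob_space intro!: prod.cong)
  qed
  have "(\<integral>\<omega>. (\<Sum>p\<leftarrow>cs. fst p * ?m (snd p) * prod_list (map (X \<omega>) (?fl (snd p)))) \<partial>M) =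
      (\<integral>\<omega>. (\<Sum>p\<leftarrow>cs. fst p * prod_list (map (X \<omega>) (snd p))) \<partial>M)
    \<and> integrable M (\<lambda>\<omega>. \<Sum>p\<leftarrow>cs. fst p * ?m (snd p) * prod_list (map (X \<omega>) (?fl (snd p))))
    \<and> integrable M (\<lambda>\<omega>. \<Sum>p\<leftarrow>cs. fst p * prod_list (map (X \<omega>) (snd p)))"
    unfolding wprod_X using cs(1)
  proof (induction cs)
    case (Cons p cs)
    have sub: "set (snd p) \<subseteq> J" "set (?fl (snd p)) \<subseteq> J" using Cons.prems by auto
    have "fst p * ?m (snd p) * expectation (wprod (?fl (snd p))) = fst p * expectation (wprod (snd p))"
      using mom[OF sub(1)] by (simp add: mom_def)
    then show ?case
      using Cons integrable_wprod[OF sub(1)] integrable_wprod[OF sub(2)] by simp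
  qed simp
  then show "(\<integral>\<omega>. part a f (X \<omega>) \<partial>M) = (\<integral>\<omega>. f (X \<omega>) \<partial>M)"
    unfolding eq using cs(2) by simp
qed

text \<open>The mean minimizes the quadratic deviation from a constant, so the value at zero may
  stand in for an independent copy of the variable. For this reason all increments are taken towards
  zero. The second claim is Jensen's inequality.\<close>

lemma part_power2_le:
  assumes "polyfun J f" "a \<in> J"
  shows "part a (\<lambda>x. (f x)\<^sup>2) x - (part a f x)\<^sup>2 \<le> part a (\<lambda>x. (f x - f (x(a := 0)))\<^sup>2) x"
    and "(part a f x)\<^sup>2 \<le> part a (\<lambda>x. (f x)\<^sup>2) x"
proof -
  let ?F = "\<lambda>\<omega>. f (x(a := \<xi> a \<omega>))"
  have int: "integrable M ?F" "integrable M (\<lambda>\<omega>. (?F \<omega>)\<^sup>2)"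
    using integrable_section[OF assms, of x] integrable_section[OF polyfun_power[OF assms(1), of 2] assms(2), of x]
    by auto
  have sq: "(\<integral>\<omega>. (?F \<omega> - c)\<^sup>2 \<partial>M) = (\<integral>\<omega>. (?F \<omega>)\<^sup>2 \<partial>M) - 2 * c * (\<integral>\<omega>. ?F \<omega> \<partial>M) + c\<^sup>2" for c
  proof -
    have "(\<integral>\<omega>. (?F \<omega> - c)\<^sup>2 \<partial>M) = (\<integral>\<omega>. (?F \<omega>)\<^sup>2 - 2 * c * ?F \<omega> + c\<^sup>2 \<partial>M)"
      by (intro Bochner_Integration.integral_cong) (auto simp: power2_eq_square algebra_simps)
    then show ?thesis using int by (simp add: prob_space)
  qed
  have "0 \<le> ((\<integral>\<omega>. ?F \<omega> \<partial>M) - f (x(a := 0)))\<^sup>2" by simp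
  then show "part a (\<lambda>x. (f x)\<^sup>2) x - (part a f x)\<^sup>2 \<le> part a (\<lambda>x. (f x - f (x(a := 0)))\<^sup>2) x"
    using sq[of "f (x(a := 0))"] by (simp add: part_def power2_eq_square algebra_simps)
  have "0 \<le> (\<integral>\<omega>. (?F \<omega> - (\<integral>\<omega>. ?F \<omega> \<partial>M))\<^sup>2 \<partial>M)" by simp
  then show "(part a f x)\<^sup>2 \<le> part a (\<lambda>x. (f x)\<^sup>2) x"
    unfolding sq by (simp add: part_def power2_eq_square algebra_simps)
qed

lemma polyfun_zero_upd: "polyfun J f \<Longrightarrow> polyfun J (\<lambda>x. f (x(a := 0)))"
proof -
  assume "polyfun J f"
  then obtain cs where cs: "\<forall>p\<in>set cs. set (snd p) \<subseteq> J"
    "\<forall>x. f x = (\<Sum>p\<leftarrow>cs. fst p * prod_list (map x (snd p)))" unfolding polyfun_iff by blast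
  have "polyfun J (\<lambda>x. \<Sum>p\<leftarrow>cs. fst p * (0 ^ count_list (snd p) a * prod_list (map x (filter (\<lambda>b. b \<noteq> a) (snd p)))))"
    using cs(1) by (intro polyfun_sum_list polyfun_cmult polyfun_prod_list) auto
  then show ?thesis using cs(2) by (simp add: prod_list_fun_upd)
qed

lemma part_diff_zero_upd:
  assumes "polyfun J f" "a \<in> J" "b \<noteq> a"
  shows "part a f x - part a f (x(b := 0)) = part a (\<lambda>x. f x - f (x(b := 0))) x"
  using integrable_section[OF assms(1,2)] integrable_section[OF polyfun_zero_upd[OF assms(1), of b] assms(2)]
    assms(3)
  by (simp add: part_def fun_upd_twist)

lemma expectation_polyfun_mono:
  assumes "polyfun J f" "polyfun J g" "\<And>x. f x \<le> g x"
  shows "(\<integral>\<omega>. f (X \<omega>) \<partial>M) \<le> (\<integral>\<omega>. g (X \<omega>) \<partial>M)"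
  by (rule integral_mono) (use assms integrable_polyfun in auto)

text \<open>The variables are integrated out one at a time. Each step costs one conditional
  variance, and by Jensen's inequality the increments of the averaged function are, in mean square,
  not larger than those of \<open>f\<close>.\<close>

lemma efron_stein_list:
  assumes "polyfun J f" "distinct as" "set as \<subseteq> J"
  shows "(\<integral>\<omega>. (f (X \<omega>))\<^sup>2 \<partial>M) - (\<integral>\<omega>. (fold part as f (X \<omega>))\<^sup>2 \<partial>M) \<le>
    (\<Sum>a\<in>set as. \<integral>\<omega>. (f (X \<omega>) - f ((X \<omega>)(a := 0)))\<^sup>2 \<partial>M)"
  using assms
proof (induction as arbitrary: f)
  case (Cons a as)
  note f = Cons.prems(1)
  have a: "a \<in> J" using Cons.prems by auto
  have g: "polyfun J (part a f)" by (rule polyfun_part[OF f a])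
  have 1: "(\<integral>\<omega>. (f (X \<omega>))\<^sup>2 \<partial>M) - (\<integral>\<omega>. (part a f (X \<omega>))\<^sup>2 \<partial>M) \<le>
      (\<integral>\<omega>. (f (X \<omega>) - f ((X \<omega>)(a := 0)))\<^sup>2 \<partial>M)"
  proof -
    have p2: "polyfun J (\<lambda>x. (f x)\<^sup>2)" and pd: "polyfun J (\<lambda>x. (f x - f (x(a := 0)))\<^sup>2)"
      by (intro polyfun_power polyfun_diff polyfun_zero_upd f)+
    have "(\<integral>\<omega>. (f (X \<omega>))\<^sup>2 \<partial>M) - (\<integral>\<omega>. (part a f (X \<omega>))\<^sup>2 \<partial>M) =
        (\<integral>\<omega>. part a (\<lambda>x. (f x)\<^sup>2) (X \<omega>) - (part a f (X \<omega>))\<^sup>2 \<partial>M)"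
      using expectation_part[OF p2 a] integrable_polyfun[OF polyfun_part[OF p2 a]]
        integrable_polyfun[OF polyfun_power[OF g, of 2]] by simp
    also have "\<dots> \<le> (\<integral>\<omega>. part a (\<lambda>x. (f x - f (x(a := 0)))\<^sup>2) (X \<omega>) \<partial>M)"
      by (rule expectation_polyfun_mono[OF polyfun_diff[OF polyfun_part[OF p2 a] polyfun_power[OF g]]
            polyfun_part[OF pd a] part_power2_le(1)[OF f a]])
    also have "\<dots> = (\<integral>\<omega>. (f (X \<omega>) - f ((X \<omega>)(a := 0)))\<^sup>2 \<partial>M)"
      by (rule expectation_part[OF pd a])
    finally show ?thesis .
  qed
  have 2: "(\<integral>\<omega>. (part a f (X \<omega>) - part a f ((X \<omega>)(b := 0)))\<^sup>2 \<partial>M) \<le>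
      (\<integral>\<omega>. (f (X \<omega>) - f ((X \<omega>)(b := 0)))\<^sup>2 \<partial>M)" if b: "b \<in> set as" for b
  proof -
    have ba: "b \<noteq> a" using b Cons.prems(2) by auto
    have h: "polyfun J (\<lambda>x. f x - f (x(b := 0)))" by (intro polyfun_diff polyfun_zero_upd f)
    have "(\<integral>\<omega>. (part a f (X \<omega>) - part a f ((X \<omega>)(b := 0)))\<^sup>2 \<partial>M) =
        (\<integral>\<omega>. (part a (\<lambda>x. f x - f (x(b := 0))) (X \<omega>))\<^sup>2 \<partial>M)"
      unfolding part_diff_zero_upd[OF f a ba] ..
    also have "\<dots> \<le> (\<integral>\<omega>. part a (\<lambda>x. (f x - f (x(b := 0)))\<^sup>2) (X \<omega>) \<partial>M)"
      by (rule expectation_polyfun_mono[OF polyfun_power[OF polyfun_part[OF h a]]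
            polyfun_part[OF polyfun_power[OF h] a] part_power2_le(2)[OF h a]])
    also have "\<dots> = (\<integral>\<omega>. (f (X \<omega>) - f ((X \<omega>)(b := 0)))\<^sup>2 \<partial>M)"
      by (rule expectation_part[OF polyfun_power[OF h] a])
    finally show ?thesis .
  qed
  have "(\<integral>\<omega>. (part a f (X \<omega>))\<^sup>2 \<partial>M) - (\<integral>\<omega>. (fold part as (part a f) (X \<omega>))\<^sup>2 \<partial>M) \<le>
    (\<Sum>b\<in>set as. \<integral>\<omega>. (part a f (X \<omega>) - part a f ((X \<omega>)(b := 0)))\<^sup>2 \<partial>M)"
    using Cons.prems by (intro Cons.IH g) auto
  also have "\<dots> \<le> (\<Sum>b\<in>set as. \<integral>\<omega>. (f (X \<omega>) - f ((X \<omega>)(b := 0)))\<^sup>2 \<partial>M)"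
    by (rule sum_mono) (rule 2)
  finally show ?case using 1 Cons.prems(2) by (simp del: fun_upd_apply)
qed simp

lemma fold_part:
  assumes "polyfun J f" "set as \<subseteq> J"
  shows "polyfun J (fold part as f)"
    and "(\<integral>\<omega>. fold part as f (X \<omega>) \<partial>M) = (\<integral>\<omega>. f (X \<omega>) \<partial>M)"
  using assms by (induction as arbitrary: f) (auto simp: polyfun_part expectation_part)

text \<open>Integrating out \<open>b\<close> makes the function independent of it, and later
  integrations preserve this; the disjunction in the hypothesis carries both situations through the
  induction.\<close>

lemma fold_part_upd:
  assumes "b \<in> set as \<or> (\<forall>x y. f (x(b := y)) = f x)"
  shows "fold part as f (x(b := y)) = fold part as f x"
  using assms
proof (induction as arbitrary: f)
  case (Cons a as)
  have "b \<in> set as \<or> (\<forall>x y. part a f (x(b := y)) = part a f x)"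
  proof (cases "b = a")
    case True
    then show ?thesis by (simp add: part_def)
  next
    case False
    have "part a f (x(b := y)) = part a f x" if "\<forall>x y. f (x(b := y)) = f x" for x y
    proof -
      have "f ((x(b := y))(a := z)) = f (x(a := z))" for z
        unfolding fun_upd_twist[OF False] using that by blast
      then show ?thesis by (simp only: part_def)
    qed
    then show ?thesis using Cons.prems False by (auto simp del: fun_upd_apply)
  qed
  then show ?case unfolding fold_Cons o_apply by (rule Cons.IH)
qed auto

lemma efron_stein:
  assumes f: "polyfun J f"
  shows "(\<integral>\<omega>. (f (X \<omega>))\<^sup>2 \<partial>M) \<le> (\<integral>\<omega>. f (X \<omega>) \<partial>M)\<^sup>2 +
    (\<Sum>a\<in>J. \<integral>\<omega>. (f (X \<omega>) - f ((X \<omega>)(a := 0)))\<^sup>2 \<partial>M)"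
proof -
  obtain as where as: "set as = J" "distinct as" using finite_distinct_list[OF finite_J] by blast
  define g where "g = fold part as f"
  have g: "polyfun J g" unfolding g_def using f as by (intro fold_part) auto
  \<comment> \<open>After all of \<open>J\<close> has been integrated out, \<open>g\<close> depends
    on no coordinate in \<open>J\<close> by \<open>fold_part_upd\<close>, and on no other coordinate
    because it is a polynomial function over \<open>J\<close>.\<close>
  have const: "g x = g (\<lambda>_. 0)" for x
  proof -
    have "g x = g (\<lambda>\<alpha>. if \<alpha> \<in> S then 0 else x \<alpha>)" if "finite S" "S \<subseteq> J" for S
      using that
    proof (induction S rule: finite_induct)
      case (insert b S)
      have "(\<lambda>\<alpha>. if \<alpha> \<in> insert b S then 0 else x \<alpha>) = (\<lambda>\<alpha>. if \<alpha> \<in> S then 0 else x \<alpha>)(b := 0)"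
        by auto
      moreover have "g ((\<lambda>\<alpha>. if \<alpha> \<in> S then 0 else x \<alpha>)(b := 0)) = g (\<lambda>\<alpha>. if \<alpha> \<in> S then 0 else x \<alpha>)"
        unfolding g_def using insert.prems as by (intro fold_part_upd) auto
      ultimately show ?case using insert by simp
    qed simp
    then have "g x = g (\<lambda>\<alpha>. if \<alpha> \<in> J then 0 else x \<alpha>)" using finite_J by blast
    also have "\<dots> = g (\<lambda>_. 0)"
    proof -
      obtain cs where cs: "\<forall>p\<in>set cs. set (snd p) \<subseteq> J"
        "\<forall>x. g x = (\<Sum>p\<leftarrow>cs. fst p * prod_list (map x (snd p)))"
        using g unfolding polyfun_iff by blast
      have eq: "map (\<lambda>\<alpha>. if \<alpha> \<in> J then 0 else x \<alpha>) (snd p) = map (\<lambda>_. 0) (snd p)" if "p \<in> set cs" for p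
        using cs(1) that by auto
      then show ?thesis
        unfolding cs(2)[rule_format]
      proof (intro arg_cong[of _ _ sum_list] map_cong refl)
        fix p assume "p \<in> set cs"
        from eq[OF this] show "fst p * prod_list (map (\<lambda>\<alpha>. if \<alpha> \<in> J then 0 else x \<alpha>) (snd p)) =
            fst p * prod_list (map (\<lambda>_. 0) (snd p))" by (simp only:)
      qed
    qed
    finally show ?thesis .
  qed
  have "(\<integral>\<omega>. f (X \<omega>) \<partial>M) = g (\<lambda>_. 0)"
    using fold_part(2)[OF f, of as] as unfolding g_def[symmetric] const[of "X _"] by (simp add: prob_space)
  moreover have "(\<integral>\<omega>. (g (X \<omega>))\<^sup>2 \<partial>M) = (g (\<lambda>_. 0))\<^sup>2"
    unfolding const[of "X _"] by (simp add: prob_space)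
  ultimately show ?thesis
    using efron_stein_list[OF f as(2)] as(1) unfolding g_def[symmetric] by simp
qed

lemma expectation_power2_le:
  assumes f: "polyfun J f"
  shows "(\<integral>\<omega>. f (X \<omega>) \<partial>M)\<^sup>2 \<le> (\<integral>\<omega>. (f (X \<omega>))\<^sup>2 \<partial>M)"
proof -
  define c where "c = (\<integral>\<omega>. f (X \<omega>) \<partial>M)"
  have int: "integrable M (\<lambda>\<omega>. f (X \<omega>))" "integrable M (\<lambda>\<omega>. (f (X \<omega>))\<^sup>2)"
    using integrable_polyfun[OF f] integrable_polyfun[OF polyfun_power[OF f]] by auto
  have "0 \<le> (\<integral>\<omega>. (f (X \<omega>) - c)\<^sup>2 \<partial>M)" by simp
  also have "\<dots> = (\<integral>\<omega>. (f (X \<omega>))\<^sup>2 - 2 * c * f (X \<omega>) + c\<^sup>2 \<partial>M)"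
    by (intro Bochner_Integration.integral_cong) (auto simp: power2_eq_square algebra_simps)
  also have "\<dots> = (\<integral>\<omega>. (f (X \<omega>))\<^sup>2 \<partial>M) - c\<^sup>2"
    using int by (simp add: prob_space c_def[symmetric] power2_eq_square)
  finally show ?thesis by (simp add: c_def)
qed

section \<open>Higher moments from squared increments\<close>

definition grad2 :: "(('i \<Rightarrow> real) \<Rightarrow> real) \<Rightarrow> ('i \<Rightarrow> real) \<Rightarrow> real" where
  "grad2 V x = (\<Sum>a\<in>J. (V x - V (x(a := 0)))\<^sup>2)"

lemma polyfun_grad2: "polyfun J V \<Longrightarrow> polyfun J (grad2 V)"
  unfolding grad2_def[abs_def] by (intro polyfun_sum polyfun_power polyfun_diff polyfun_zero_upd)

lemma grad2_nonneg: "0 \<le> grad2 V x"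
  unfolding grad2_def by (intro sum_nonneg) simp

lemma diff_le_grad2: "a \<in> J \<Longrightarrow> (V x - V (x(a := 0)))\<^sup>2 \<le> grad2 V x"
  unfolding grad2_def using finite_J by (intro member_le_sum) auto

lemma efron_stein_grad2:
  assumes f: "polyfun J f" and G: "polyfun J G" and le: "\<And>x. grad2 f x \<le> G x"
  shows "(\<integral>\<omega>. (f (X \<omega>))\<^sup>2 \<partial>M) \<le> (\<integral>\<omega>. f (X \<omega>) \<partial>M)\<^sup>2 + (\<integral>\<omega>. G (X \<omega>) \<partial>M)"
proof -
  have "integrable M (\<lambda>\<omega>. (f (X \<omega>) - f ((X \<omega>)(a := 0)))\<^sup>2)" for a
    by (rule integrable_polyfun[of "\<lambda>x. (f x - f (x(a := 0)))\<^sup>2"])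
      (intro polyfun_power polyfun_diff polyfun_zero_upd f)
  then have "(\<Sum>a\<in>J. \<integral>\<omega>. (f (X \<omega>) - f ((X \<omega>)(a := 0)))\<^sup>2 \<partial>M) = (\<integral>\<omega>. grad2 f (X \<omega>) \<partial>M)"
    unfolding grad2_def by (simp add: Bochner_Integration.integral_sum)
  also have "\<dots> \<le> (\<integral>\<omega>. G (X \<omega>) \<partial>M)"
    by (rule expectation_polyfun_mono[OF polyfun_grad2[OF f] G le])
  finally show ?thesis using efron_stein[OF f] by simp
qed

text \<open>The bracket in \<open>young8\<close> at v = 300, g = 1. The threshold 300 is such that
  144 / 300 is below 1 / 2, with room for the lower terms.\<close>

definition C8 :: real where
  "C8 = 144 * 300 ^ 3 + 36 * 300\<^sup>2 + 64 * 300 + 16"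

lemma young8:
  fixes v g :: real
  assumes "0 \<le> v" "0 \<le> g"
  shows "g * (144 * v ^ 3 + 36 * v\<^sup>2 * g + 64 * v * g\<^sup>2 + 16 * g ^ 3) \<le> v ^ 4 / 2 + C8 * g ^ 4"
proof (cases "v \<le> 300 * g")
  case True
  have "144 * v ^ 3 + 36 * v\<^sup>2 * g + 64 * v * g\<^sup>2 + 16 * g ^ 3 \<le>
      144 * (300 * g) ^ 3 + 36 * (300 * g)\<^sup>2 * g + 64 * (300 * g) * g\<^sup>2 + 16 * g ^ 3"
    using True assms by (intro add_mono mult_mono power_mono) auto
  also have "\<dots> = C8 * g ^ 3"
    by (simp add: C8_def power_mult_distrib power2_eq_square power3_eq_cube)
  finally have "g * (144 * v ^ 3 + 36 * v\<^sup>2 * g + 64 * v * g\<^sup>2 + 16 * g ^ 3) \<le> g * (C8 * g ^ 3)"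
    by (rule mult_left_mono) (rule assms)
  also have "\<dots> = C8 * g ^ 4" by (simp add: power_numeral_reduce)
  finally show ?thesis using assms by (simp add: add_increasing)
next
  case False
  then have g: "g \<le> v / 300" by simp
  have "g * (144 * v ^ 3 + 36 * v\<^sup>2 * g + 64 * v * g\<^sup>2 + 16 * g ^ 3) \<le>
      (v / 300) * (144 * v ^ 3 + 36 * v\<^sup>2 * (v / 300) + 64 * v * (v / 300)\<^sup>2 + 16 * (v / 300) ^ 3)"
    using g assms by (intro add_mono mult_mono power_mono) auto
  also have "\<dots> = v ^ 4 * ((144 + 36 / 300 + 64 / 300\<^sup>2 + 16 / 300 ^ 3) / 300)"
    by (simp add: field_simps power_numeral_reduce)
  also have "\<dots> \<le> v ^ 4 * (1 / 2)"
    using assms by (intro mult_left_mono) (auto simp: power2_eq_square power3_eq_cube)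
  finally show ?thesis using assms by (simp add: C8_def add_increasing2)
qed

text \<open>Efron-Stein is applied to V, V^2 and V^4, and in the last two cases half of the left
  side is absorbed. For the fourth moment 34 = 32 + 2 comes from completing the square and 70 = 2 (1
  + 34); for the eighth, 9800 is twice the square of 70.\<close>

lemma eighth_moment:
  assumes V: "polyfun J V" and mean: "(\<integral>\<omega>. V (X \<omega>) \<partial>M) = 0"
  shows "(\<integral>\<omega>. V (X \<omega>) ^ 8 \<partial>M) \<le> (9800 + 2 * C8) * (\<integral>\<omega>. grad2 V (X \<omega>) ^ 4 \<partial>M)"
proof -
  let ?E = "\<lambda>f. \<integral>\<omega>. f (X \<omega>) \<partial>M"
  let ?G = "grad2 V"
  have G: "polyfun J ?G" by (rule polyfun_grad2[OF V])
  have P: "polyfun J (\<lambda>x. V x ^ k)" "polyfun J (\<lambda>x. ?G x ^ k)" for k using V G by auto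
  have intV: "integrable M (\<lambda>\<omega>. V (X \<omega>) ^ k)" and intG: "integrable M (\<lambda>\<omega>. ?G (X \<omega>) ^ k)" for k
    using integrable_polyfun[OF P(1)] integrable_polyfun[OF P(2)] by auto
  have two: "?E (\<lambda>x. V x ^ 2) \<le> ?E ?G"
    using efron_stein_grad2[OF V G] mean by simp
  have g4: "grad2 (\<lambda>x. V x ^ 2) x \<le> (1 / 2) * V x ^ 4 + 34 * ?G x ^ 2" for x
  proof -
    have "(V x ^ 2 - V (x(a := 0)) ^ 2)\<^sup>2 \<le> (V x - V (x(a := 0)))\<^sup>2 * (8 * V x ^ 2 + 2 * ?G x)"
      if "a \<in> J" for a
    proof -
      \<comment> \<open>The value \<open>w\<close> changes with \<open>a\<close>, so it is
        eliminated in favour of \<open>v\<close> and the increment, which \<open>grad2\<close>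
        controls.\<close>
      define v w where "v = V x" and "w = V (x(a := 0))"
      have "(v ^ 2 - w ^ 2)\<^sup>2 = (v - w)\<^sup>2 * (v + w)\<^sup>2" by (simp add: power2_eq_square algebra_simps)
      also have "\<dots> \<le> (v - w)\<^sup>2 * (8 * v ^ 2 + 2 * (v - w)\<^sup>2)"
      proof (intro mult_left_mono)
        have "8 * v ^ 2 + 2 * (v - w)\<^sup>2 - (v + w)\<^sup>2 = (3 * v - w)\<^sup>2"
          by (simp add: power2_eq_square algebra_simps)
        then show "(v + w)\<^sup>2 \<le> 8 * v ^ 2 + 2 * (v - w)\<^sup>2" by (smt (verit) zero_le_power2)
      qed simp
      also have "\<dots> \<le> (v - w)\<^sup>2 * (8 * v ^ 2 + 2 * ?G x)"
        using diff_le_grad2[OF that, of V x] by (intro mult_left_mono) (auto simp: v_def w_def)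
      finally show ?thesis by (simp add: v_def w_def)
    qed
    then have "grad2 (\<lambda>x. V x ^ 2) x \<le> ?G x * (8 * V x ^ 2 + 2 * ?G x)"
      unfolding grad2_def[of "\<lambda>x. V x ^ 2"] grad2_def[of V] sum_distrib_right
      by (intro sum_mono) (simp add: grad2_def)
    also have "\<dots> \<le> (1 / 2) * V x ^ 4 + 34 * ?G x ^ 2"
    proof -
      have "(1 / 2) * V x ^ 4 + 34 * ?G x ^ 2 - ?G x * (8 * V x ^ 2 + 2 * ?G x) = (V x ^ 2 - 8 * ?G x)\<^sup>2 / 2"
        by (simp add: power2_eq_square power_numeral_reduce field_simps)
      then show ?thesis by (smt (verit) zero_le_power2 divide_nonneg_nonneg)
    qed
    finally show ?thesis .
  qed
  have four: "?E (\<lambda>x. V x ^ 4) \<le> 70 * ?E (\<lambda>x. ?G x ^ 2)"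
  proof -
    have "?E (\<lambda>x. (V x ^ 2)\<^sup>2) \<le> (?E (\<lambda>x. V x ^ 2))\<^sup>2 + ?E (\<lambda>x. (1 / 2) * V x ^ 4 + 34 * ?G x ^ 2)"
      by (rule efron_stein_grad2[OF P(1) _ g4]) (intro polyfun_add polyfun_cmult P)
    moreover have "(?E (\<lambda>x. V x ^ 2))\<^sup>2 \<le> (?E ?G)\<^sup>2"
      by (rule power_mono[OF two]) simp
    moreover have "(?E ?G)\<^sup>2 \<le> ?E (\<lambda>x. ?G x ^ 2)" by (rule expectation_power2_le[OF G])
    moreover have "?E (\<lambda>x. (1 / 2) * V x ^ 4 + 34 * ?G x ^ 2) = (1 / 2) * ?E (\<lambda>x. V x ^ 4) + 34 * ?E (\<lambda>x. ?G x ^ 2)"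
      using intV[of 4] intG[of 2] by simp
    moreover have "(\<lambda>x. (V x ^ 2)\<^sup>2) = (\<lambda>x. V x ^ 4)" by (auto simp: power_mult[symmetric])
    ultimately show ?thesis by simp
  qed
  have g8: "grad2 (\<lambda>x. V x ^ 4) x \<le> (1 / 2) * V x ^ 8 + C8 * ?G x ^ 4" for x
  proof -
    define g where "g = ?G x"
    have g0: "0 \<le> g" unfolding g_def by (rule grad2_nonneg)
    let ?T = "\<lambda>v. 144 * v ^ 6 + 36 * v ^ 4 * g + 64 * v\<^sup>2 * g\<^sup>2 + 16 * g ^ 3"
    have "(V x ^ 4 - V (x(a := 0)) ^ 4)\<^sup>2 \<le> (V x - V (x(a := 0)))\<^sup>2 * ?T (V x)"
      if "a \<in> J" for a
    proof -
      define v w where "v = V x" and "w = V (x(a := 0))"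
      define d where "d = (v - w)\<^sup>2"
      have d: "0 \<le> d" "d \<le> g" using diff_le_grad2[OF that, of V x] by (auto simp: d_def v_def w_def g_def)
      have "8 * v ^ 2 + 2 * d - (v + w)\<^sup>2 = (3 * v - w)\<^sup>2"
        by (simp add: d_def power2_eq_square algebra_simps)
      then have s1: "(v + w)\<^sup>2 \<le> 8 * v ^ 2 + 2 * d" by (smt (verit) zero_le_power2)
      have "3 * v ^ 2 + 2 * d - (v\<^sup>2 + w\<^sup>2) = (2 * v - w)\<^sup>2"
        by (simp add: d_def power2_eq_square algebra_simps)
      then have "v\<^sup>2 + w\<^sup>2 \<le> 3 * v ^ 2 + 2 * d" by (smt (verit) zero_le_power2)
      then have "(v\<^sup>2 + w\<^sup>2)\<^sup>2 \<le> (3 * v ^ 2 + 2 * d)\<^sup>2" by (intro power_mono) auto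
      also have "\<dots> \<le> 18 * v ^ 4 + 8 * d\<^sup>2"
      proof -
        have "18 * v ^ 4 + 8 * d\<^sup>2 - (3 * v ^ 2 + 2 * d)\<^sup>2 = (3 * v ^ 2 - 2 * d)\<^sup>2"
          by (simp add: power2_eq_square power_numeral_reduce algebra_simps)
        then show ?thesis by (smt (verit) zero_le_power2)
      qed
      finally have s2: "(v\<^sup>2 + w\<^sup>2)\<^sup>2 \<le> 18 * v ^ 4 + 8 * d\<^sup>2" .
      have "(v ^ 4 - w ^ 4)\<^sup>2 = d * ((v + w)\<^sup>2 * (v\<^sup>2 + w\<^sup>2)\<^sup>2)"
      proof -
        have "v ^ 4 - w ^ 4 = (v - w) * ((v + w) * (v\<^sup>2 + w\<^sup>2))"
          by (simp add: power2_eq_square power_numeral_reduce algebra_simps)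
        then show ?thesis by (simp add: d_def power_mult_distrib)
      qed
      also have "\<dots> \<le> d * ((8 * v ^ 2 + 2 * d) * (18 * v ^ 4 + 8 * d\<^sup>2))"
        using s1 s2 d by (intro mult_left_mono mult_mono) auto
      also have "\<dots> = d * (144 * v ^ 6 + 36 * v ^ 4 * d + 64 * v\<^sup>2 * d\<^sup>2 + 16 * d ^ 3)"
        by (simp add: power2_eq_square power_numeral_reduce algebra_simps)
      also have "\<dots> \<le> d * ?T v"
      proof (intro mult_left_mono d(1))
        have "36 * v ^ 4 * d \<le> 36 * v ^ 4 * g" using d by (intro mult_left_mono) auto
        moreover have "64 * v\<^sup>2 * d\<^sup>2 \<le> 64 * v\<^sup>2 * g\<^sup>2"
          using d by (intro mult_left_mono power_mono) auto
        moreover have "16 * d ^ 3 \<le> 16 * g ^ 3" using d by (intro mult_left_mono power_mono) auto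
        ultimately show "144 * v ^ 6 + 36 * v ^ 4 * d + 64 * v\<^sup>2 * d\<^sup>2 + 16 * d ^ 3 \<le> ?T v" by simp
      qed
      finally show ?thesis by (simp add: d_def v_def w_def)
    qed
    then have "grad2 (\<lambda>x. V x ^ 4) x \<le> g * ?T (V x)"
      unfolding grad2_def[of "\<lambda>x. V x ^ 4"] g_def grad2_def[of V] sum_distrib_right
      by (intro sum_mono) (simp add: g_def grad2_def)
    also have "\<dots> = g * (144 * (V x ^ 2) ^ 3 + 36 * (V x ^ 2)\<^sup>2 * g + 64 * V x ^ 2 * g\<^sup>2 + 16 * g ^ 3)"
      by (simp add: power_mult[symmetric])
    also have "\<dots> \<le> (V x ^ 2) ^ 4 / 2 + C8 * g ^ 4"
      by (rule young8) (use g0 in auto)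
    finally show ?thesis by (simp add: g_def power_mult[symmetric])
  qed
  have "?E (\<lambda>x. (V x ^ 4)\<^sup>2) \<le> (?E (\<lambda>x. V x ^ 4))\<^sup>2 + ?E (\<lambda>x. (1 / 2) * V x ^ 8 + C8 * ?G x ^ 4)"
    by (rule efron_stein_grad2[OF P(1) _ g8]) (intro polyfun_add polyfun_cmult P)
  moreover have "?E (\<lambda>x. (1 / 2) * V x ^ 8 + C8 * ?G x ^ 4) = (1 / 2) * ?E (\<lambda>x. V x ^ 8) + C8 * ?E (\<lambda>x. ?G x ^ 4)"
    using intV[of 8] intG[of 4] by simp
  moreover have "(?E (\<lambda>x. V x ^ 4))\<^sup>2 \<le> (70 * ?E (\<lambda>x. ?G x ^ 2))\<^sup>2"
    by (rule power_mono[OF four]) simp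
  moreover have "(?E (\<lambda>x. ?G x ^ 2))\<^sup>2 \<le> ?E (\<lambda>x. (?G x ^ 2)\<^sup>2)" by (rule expectation_power2_le[OF P(2)])
  moreover have "(\<lambda>x. (V x ^ 4)\<^sup>2) = (\<lambda>x. V x ^ 8)" "(\<lambda>x. (?G x ^ 2)\<^sup>2) = (\<lambda>x. ?G x ^ 4)"
    by (auto simp: power_mult[symmetric])
  ultimately show ?thesis by (simp add: power_mult_distrib algebra_simps)
qed

section \<open>Concentration of homogeneous polynomials with summable coefficients\<close>

lemma sum_power_words:
  fixes g :: "'i \<Rightarrow> real"
  shows "(\<Sum>\<alpha>\<in>J. g \<alpha>) ^ p = (\<Sum>w\<in>words J p. prod_list (map g w))"
  by (induction p) (simp_all add: sum_words_Suc sum_product)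

lemma expectation_sum_fourth_power:
  "(\<integral>\<omega>. (\<Sum>\<alpha>\<in>J. \<xi> \<alpha> \<omega> ^ 4) ^ 4 \<partial>M) \<le> D 16 ^ 16 * real (card J) ^ 4"
proof -
  let ?r = "\<lambda>w :: 'i list. concat (map (replicate 4) w)"
  have w: "prod_list (map (\<lambda>\<alpha>. \<xi> \<alpha> \<omega> ^ 4) w) = wprod (?r w) \<omega>" for w \<omega>
    by (induction w) (simp_all add: wprod_def map_replicate_const prod_list_replicate)
  have sub: "set (?r w) \<subseteq> J" "length (?r w) = 16" if "w \<in> words J 4" for w
    using that by (auto simp: words_def length_concat o_def sum_list_triv)
  have "(\<integral>\<omega>. (\<Sum>\<alpha>\<in>J. \<xi> \<alpha> \<omega> ^ 4) ^ 4 \<partial>M) = (\<Sum>w\<in>words J 4. mom (?r w))"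
    unfolding sum_power_words w mom_def using sub
    by (intro Bochner_Integration.integral_sum integrable_wprod)
  also have "\<dots> \<le> (\<Sum>w\<in>words J 4. D 16 ^ 16)"
    using sub abs_mom_le by (intro sum_mono) (smt (verit) order_refl)
  also have "\<dots> = D 16 ^ 16 * real (card J) ^ 4"
    using finite_J by (simp add: words_def card_lists_length_eq)
  finally show ?thesis .
qed

text \<open>Splitting a word at the first occurrence of the letter that is set to zero.\<close>

lemma diff_zero_upd_words:
  fixes c :: "'i list \<Rightarrow> real"
  assumes a: "a \<in> J"
  shows "(\<Sum>w\<in>words J k. c w * (prod_list (map x w) - prod_list (map (x(a := 0)) w))) =
    x a * (\<Sum>l<k. \<Sum>r\<in>words J (k - 1).
      (if a \<in> set (take l r) then 0 else c (take l r @ a # drop l r)) * prod_list (map x r))"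
proof (induction k arbitrary: c)
  case (Suc k)
  let ?p = "\<lambda>w. prod_list (map x w)" and ?z = "\<lambda>w. prod_list (map (x(a := 0)) w)"
  have step: "c (b # w) * (?p (b # w) - ?z (b # w)) =
      (if b = a then c (a # w) * x a * ?p w else 0) +
      (if b = a then 0 else c (b # w) * x b) * (?p w - ?z w)" for b w
    by (simp add: algebra_simps)
  have IH: "(\<Sum>w\<in>words J k. (if b = a then 0 else c (b # w) * x b) * (?p w - ?z w)) =
      x a * (\<Sum>l<k. \<Sum>r\<in>words J (k - 1).
        (if a \<in> set (take l r) then 0 else (if b = a then 0 else c (b # take l r @ a # drop l r) * x b)) * ?p r)" for b
    by (rule Suc.IH[of "\<lambda>w. if b = a then 0 else c (b # w) * x b"])
  have "(\<Sum>w\<in>words J (Suc k). c w * (?p w - ?z w)) =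
      (\<Sum>w\<in>words J k. c (a # w) * x a * ?p w) +
      (\<Sum>b\<in>J. \<Sum>w\<in>words J k. (if b = a then 0 else c (b # w) * x b) * (?p w - ?z w))"
  proof -
    have "(\<Sum>b\<in>J. \<Sum>w\<in>words J k. if b = a then c (a # w) * x a * ?p w else 0) =
        (\<Sum>b\<in>J. if b = a then \<Sum>w\<in>words J k. c (a # w) * x a * ?p w else 0)"
      by (intro sum.cong) auto
    also have "\<dots> = (\<Sum>w\<in>words J k. c (a # w) * x a * ?p w)"
      using finite_J a by simp
    finally show ?thesis unfolding sum_words_Suc step sum.distrib by simp
  qed
  also have "(\<Sum>b\<in>J. \<Sum>w\<in>words J k. (if b = a then 0 else c (b # w) * x b) * (?p w - ?z w)) =
      x a * (\<Sum>l<k. \<Sum>b\<in>J. \<Sum>r\<in>words J (k - 1).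
        (if a \<in> set (take l r) then 0 else (if b = a then 0 else c (b # take l r @ a # drop l r) * x b)) * ?p r)"
    unfolding IH sum_distrib_left[symmetric] by (subst sum.swap) simp
  also have "(\<Sum>l<k. \<Sum>b\<in>J. \<Sum>r\<in>words J (k - 1).
        (if a \<in> set (take l r) then 0 else (if b = a then 0 else c (b # take l r @ a # drop l r) * x b)) * ?p r) =
      (\<Sum>l<k. \<Sum>r\<in>words J k.
        (if a \<in> set (take (Suc l) r) then 0 else c (take (Suc l) r @ a # drop (Suc l) r)) * ?p r)"
  proof (intro sum.cong refl)
    fix l assume "l \<in> {..<k}"
    then obtain k' where k': "k = Suc k'" by (cases k) auto
    show "(\<Sum>b\<in>J. \<Sum>r\<in>words J (k - 1).
        (if a \<in> set (take l r) then 0 else (if b = a then 0 else c (b # take l r @ a # drop l r) * x b)) * ?p r) =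
      (\<Sum>r\<in>words J k.
        (if a \<in> set (take (Suc l) r) then 0 else c (take (Suc l) r @ a # drop (Suc l) r)) * ?p r)"
      unfolding k' sum_words_Suc by (intro sum.cong) auto
  qed
  also have "(\<Sum>w\<in>words J k. c (a # w) * x a * ?p w) +
      x a * (\<Sum>l<k. \<Sum>r\<in>words J k.
        (if a \<in> set (take (Suc l) r) then 0 else c (take (Suc l) r @ a # drop (Suc l) r)) * ?p r) =
      x a * (\<Sum>l<Suc k. \<Sum>r\<in>words J (Suc k - 1).
        (if a \<in> set (take l r) then 0 else c (take l r @ a # drop l r)) * ?p r)"
    by (subst sum.lessThan_Suc_shift) (simp add: sum_distrib_left distrib_left mult_ac)
  finally show ?case .
qed simp

text \<open>Depends on the family only through \<open>D\<close>, and in the model \<open>D\<close>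
  is the same for all N.\<close>

definition conc_const :: "nat \<Rightarrow> real \<Rightarrow> real" where
  "conc_const k C = (9800 + 2 * C8) * (real k ^ 8 *
     (D 16 ^ 16 + (C * C) ^ 8 * kap ((k - 1 + (k - 1)) * 8)))"

text \<open>Let n be the number of variables; the general size of the eighth moment is n^{4k}.
  Summing coefficients over one letter costs no factor n by \<open>c1\<close>, so the squared
  gradient without its factor \<open>(x a)\<^sup>2\<close> has size n^{k-1}. That factor is at most
  the square root of the sum of fourth powers, of size n^{1/2}. The fourth power of the product has
  size n^{4k-2}.\<close>

theorem concentration:
  fixes c :: "'i list \<Rightarrow> real"
  assumes k: "1 \<le> k" and C: "0 \<le> C" and c: "\<And>w. w \<in> words J k \<Longrightarrow> \<bar>c w\<bar> \<le> C"
    and c1: "\<And>l r. l < k \<Longrightarrow> r \<in> words J (k - 1) \<Longrightarrow> (\<Sum>\<alpha>\<in>J. \<bar>c (take l r @ \<alpha> # drop l r)\<bar>) \<le> C"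
  defines "Y \<equiv> (\<lambda>x. \<Sum>w\<in>words J k. c w * prod_list (map x w))"
  shows "(\<integral>\<omega>. (Y (X \<omega>) - (\<integral>\<omega>. Y (X \<omega>) \<partial>M)) ^ 8 \<partial>M) \<le> conc_const k C * real (card J) ^ (4 * k - 2)"
proof -
  define n where "n = real (card J)"
  have n: "1 \<le> n" using finite_J J_nonempty by (simp add: n_def Suc_leI card_gt_0_iff)
  define \<mu> where "\<mu> = (\<integral>\<omega>. Y (X \<omega>) \<partial>M)"
  define V where "V x = Y x - \<mu>" for x
  have Y: "polyfun J Y" unfolding Y_def
    by (intro polyfun_sum polyfun_mult polyfun_const polyfun_prod_list) (auto simp: words_def)
  then have V: "polyfun J V" unfolding V_def[abs_def] by auto
  have mean: "(\<integral>\<omega>. V (X \<omega>) \<partial>M) = 0"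
    using integrable_polyfun[OF Y] by (simp add: V_def \<mu>_def prob_space)
  define U where "U a l x = (\<Sum>r\<in>words J (k - 1).
      (if a \<in> set (take l r) then 0 else c (take l r @ a # drop l r)) * prod_list (map x r))" for a l x
  define Q where "Q x = (\<Sum>a\<in>J. x a ^ 4)" for x :: "'i \<Rightarrow> real"
  define S where "S l x = (\<Sum>a\<in>J. (U a l x)\<^sup>2)" for l x
  have diff: "V x - V (x(a := 0)) = x a * (\<Sum>l<k. U a l x)" if "a \<in> J" for a x
    unfolding V_def Y_def U_def using diff_zero_upd_words[OF that, where k = k and c = c and x = x]
    by (simp add: sum_subtractf right_diff_distrib)
  have S0: "0 \<le> S l x" for l x unfolding S_def by (intro sum_nonneg) simp
  have Q0: "0 \<le> Q x" for x unfolding Q_def by (intro sum_nonneg) simp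
  have grad: "grad2 V x \<le> real k * (\<Sum>l<k. sqrt (Q x) * S l x)" for x
  proof -
    have "grad2 V x = (\<Sum>a\<in>J. (x a)\<^sup>2 * (\<Sum>l<k. U a l x)\<^sup>2)"
      unfolding grad2_def by (intro sum.cong) (auto simp: diff power_mult_distrib)
    also have "\<dots> \<le> (\<Sum>a\<in>J. (x a)\<^sup>2 * (real k * (\<Sum>l<k. (U a l x)\<^sup>2)))"
    proof (intro sum_mono mult_left_mono)
      fix a
      show "(\<Sum>l<k. U a l x)\<^sup>2 \<le> real k * (\<Sum>l<k. (U a l x)\<^sup>2)"
        by (rule power2_sum_le)
    qed simp
    also have "\<dots> = real k * (\<Sum>l<k. \<Sum>a\<in>J. (x a)\<^sup>2 * (U a l x)\<^sup>2)"
      by (subst sum.swap) (simp add: sum_distrib_left mult_ac)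
    also have "\<dots> \<le> real k * (\<Sum>l<k. sqrt (Q x) * S l x)"
    proof (intro mult_left_mono sum_mono)
      fix l
      have "(x a)\<^sup>2 \<le> sqrt (Q x)" if "a \<in> J" for a
      proof (rule real_le_rsqrt)
        have "x a ^ 4 \<le> Q x" unfolding Q_def using finite_J that by (intro member_le_sum) auto
        then show "((x a)\<^sup>2)\<^sup>2 \<le> Q x" by (simp add: power_mult[symmetric])
      qed
      then show "(\<Sum>a\<in>J. (x a)\<^sup>2 * (U a l x)\<^sup>2) \<le> sqrt (Q x) * S l x"
        unfolding S_def sum_distrib_left by (intro sum_mono mult_right_mono) auto
    qed simp
    finally show ?thesis .
  qed
  \<comment> \<open>Weight that balances Young's inequality: the expectations of
    \<open>Q x ^ 4\<close> and \<open>S l x ^ 8\<close> are of order n^4 and n^{8k-8}, so both terms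
    become n^{4k-2}. The quotient form is used because 4k - 6 is negative for k = 1.\<close>
  define L where "L = n ^ (4 * k) / n ^ 6"
  have L: "0 < L" using n by (simp add: L_def)
  have pw: "grad2 V x ^ 4 \<le> real k ^ 7 * (\<Sum>l<k. L * Q x ^ 4 / 2 + S l x ^ 8 / (2 * L))" for x
  proof -
    have "grad2 V x ^ 4 \<le> (real k * (\<Sum>l<k. sqrt (Q x) * S l x)) ^ 4"
      by (rule power_mono[OF grad grad2_nonneg])
    also have "\<dots> = real k ^ 4 * (\<Sum>l<k. sqrt (Q x) * S l x) ^ 4" by (simp add: power_mult_distrib)
    also have "\<dots> \<le> real k ^ 4 * (real k ^ 3 * (\<Sum>l<k. (sqrt (Q x) * S l x) ^ 4))"
      by (intro mult_left_mono power4_sum_le) simp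
    also have "\<dots> = real k ^ 7 * (\<Sum>l<k. Q x ^ 2 * S l x ^ 4)"
    proof -
      have "sqrt (Q x) ^ 4 = Q x ^ 2"
        using Q0[of x] by (metis mult_2 numeral_Bit0 power_mult real_sqrt_pow2 power2_eq_square power4_eq_xxxx mult.assoc)
      then show ?thesis by (simp add: power_mult_distrib power_add[symmetric] mult.assoc[symmetric])
    qed
    also have "\<dots> \<le> real k ^ 7 * (\<Sum>l<k. L * Q x ^ 4 / 2 + S l x ^ 8 / (2 * L))"
    proof (intro mult_left_mono sum_mono)
      fix l
      have "0 \<le> (L * Q x ^ 2 - S l x ^ 4)\<^sup>2 / (2 * L)" using L by simp
      also have "\<dots> = L * Q x ^ 4 / 2 + S l x ^ 8 / (2 * L) - Q x ^ 2 * S l x ^ 4"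
        using L by (simp add: power2_eq_square power_numeral_reduce field_simps)
      finally show "Q x ^ 2 * S l x ^ 4 \<le> L * Q x ^ 4 / 2 + S l x ^ 8 / (2 * L)" by simp
    qed simp
    finally show ?thesis .
  qed
  have Sch: "chaos (k - 1 + (k - 1)) (C * C) (\<lambda>\<omega>. S l (X \<omega>))" if l: "l < k" for l
  proof -
    define e where "e a r = (if a \<in> set (take l r) then 0 else c (take l r @ a # drop l r))" for a r
    let ?h = "k - 1"
    have eb: "\<bar>e a r\<bar> \<le> \<bar>c (take l r @ a # drop l r)\<bar>" for a r by (simp add: e_def)
    have ins: "take l r @ a # drop l r \<in> words J k" if "a \<in> J" "r \<in> words J ?h" for a r
      using that l set_take_subset[of l r] set_drop_subset[of l r] by (auto simp: words_def)
    show ?thesis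
      unfolding chaos_def
    proof (intro exI[of _ "\<lambda>z. \<Sum>a\<in>J. e a (take ?h z) * e a (drop ?h z)"] conjI ballI allI)
      fix z assume z: "z \<in> words J (?h + ?h)"
      have t: "take ?h z \<in> words J ?h" and d: "drop ?h z \<in> words J ?h"
        using z set_take_subset[of ?h z] set_drop_subset[of ?h z] by (auto simp: words_def)
      have "\<bar>\<Sum>a\<in>J. e a (take ?h z) * e a (drop ?h z)\<bar> \<le> (\<Sum>a\<in>J. \<bar>e a (take ?h z)\<bar> * \<bar>e a (drop ?h z)\<bar>)"
        by (rule order_trans[OF sum_abs]) (simp add: abs_mult)
      \<comment> \<open>One coefficient is bounded by \<open>C\<close> and the other is summed over
        the letter by \<open>c1\<close>; bounding both separately would lose a factor
        \<open>card J\<close>.\<close>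
      also have "\<dots> \<le> (\<Sum>a\<in>J. \<bar>c (take l (take ?h z) @ a # drop l (take ?h z))\<bar> * C)"
      proof (intro sum_mono mult_mono eb)
        fix a assume "a \<in> J"
        then show "\<bar>e a (drop ?h z)\<bar> \<le> C" using eb[of a "drop ?h z"] c[OF ins[OF _ d]] by fastforce
      qed (use C in auto)
      also have "\<dots> \<le> C * C"
        unfolding sum_distrib_right[symmetric] using c1[OF l t] C by (intro mult_right_mono) auto
      finally show "\<bar>\<Sum>a\<in>J. e a (take ?h z) * e a (drop ?h z)\<bar> \<le> C * C" .
    next
      fix \<omega>
      have "S l (X \<omega>) = (\<Sum>a\<in>J. \<Sum>r\<in>words J ?h. \<Sum>s\<in>words J ?h. (e a r * e a s) * (wprod r \<omega> * wprod s \<omega>))"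
        unfolding S_def U_def e_def[symmetric] power2_eq_square sum_product wprod_X
        by (intro sum.cong refl) (simp only: mult_ac)
      also have "\<dots> = (\<Sum>r\<in>words J ?h. \<Sum>s\<in>words J ?h. \<Sum>a\<in>J. (e a r * e a s) * (wprod r \<omega> * wprod s \<omega>))"
        by (subst sum.swap) (intro sum.cong refl sum.swap)
      also have "\<dots> = (\<Sum>z\<in>words J (?h + ?h). (\<Sum>a\<in>J. e a (take ?h z) * e a (drop ?h z)) * wprod z \<omega>)"
        unfolding sum_words_append by (intro sum.cong refl) (auto simp: sum_distrib_right words_def)
      finally show "S l (X \<omega>) = (\<Sum>z\<in>words J (?h + ?h). (\<Sum>a\<in>J. e a (take ?h z) * e a (drop ?h z)) * wprod z \<omega>)" .
    qed
  qed
  define K where "K = (C * C) ^ 8 * kap ((k - 1 + (k - 1)) * 8)"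
  have ES: "(\<integral>\<omega>. S l (X \<omega>) ^ 8 \<partial>M) \<le> K * n ^ (8 * (k - 1))" and intS: "integrable M (\<lambda>\<omega>. S l (X \<omega>) ^ 8)"
    if "l < k" for l
  proof -
    note ch = chaos_power[OF Sch[OF that], of 8]
    have "\<bar>\<integral>\<omega>. S l (X \<omega>) ^ 8 \<partial>M\<bar> \<le> (C * C) ^ 8 * kap ((k - 1 + (k - 1)) * 8) * n ^ ((k - 1 + (k - 1)) * 8 div 2)"
      unfolding n_def by (rule chaos_expectation[OF ch]) (use C in auto)
    moreover have "(k - 1 + (k - 1)) * 8 div 2 = 8 * (k - 1)" by simp
    ultimately show "(\<integral>\<omega>. S l (X \<omega>) ^ 8 \<partial>M) \<le> K * n ^ (8 * (k - 1))" unfolding K_def by simp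
    show "integrable M (\<lambda>\<omega>. S l (X \<omega>) ^ 8)" by (rule chaos_integrable[OF ch]) (use C in auto)
  qed
  have pQ: "polyfun J (\<lambda>x. Q x ^ 4)" unfolding Q_def by (intro polyfun_power polyfun_sum polyfun_var)
  have EQ: "(\<integral>\<omega>. Q (X \<omega>) ^ 4 \<partial>M) \<le> D 16 ^ 16 * n ^ 4"
    unfolding Q_def n_def by (rule expectation_sum_fourth_power)
  have "(\<integral>\<omega>. grad2 V (X \<omega>) ^ 4 \<partial>M) \<le>
      (\<integral>\<omega>. real k ^ 7 * (\<Sum>l<k. L * Q (X \<omega>) ^ 4 / 2 + S l (X \<omega>) ^ 8 / (2 * L)) \<partial>M)"
  proof (rule integral_mono)
    show "integrable M (\<lambda>\<omega>. grad2 V (X \<omega>) ^ 4)"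
      using integrable_polyfun[OF polyfun_power[OF polyfun_grad2[OF V], of 4]] .
    show "integrable M (\<lambda>\<omega>. real k ^ 7 * (\<Sum>l<k. L * Q (X \<omega>) ^ 4 / 2 + S l (X \<omega>) ^ 8 / (2 * L)))"
      using integrable_polyfun[OF pQ] intS
      by (intro integrable_mult_right Bochner_Integration.integrable_sum Bochner_Integration.integrable_add integrable_divide) auto
  qed (rule pw)
  also have "\<dots> = real k ^ 7 * (\<Sum>l<k. L * (\<integral>\<omega>. Q (X \<omega>) ^ 4 \<partial>M) / 2 + (\<integral>\<omega>. S l (X \<omega>) ^ 8 \<partial>M) / (2 * L))"
  proof -
    let ?f = "\<lambda>l \<omega>. L * Q (X \<omega>) ^ 4 / 2 + S l (X \<omega>) ^ 8 / (2 * L)"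
    have int: "integrable M (?f l)" if "l \<in> {..<k}" for l
      using integrable_polyfun[OF pQ] intS that by (intro Bochner_Integration.integrable_add) auto
    have "(\<integral>\<omega>. ?f l \<omega> \<partial>M) = L * (\<integral>\<omega>. Q (X \<omega>) ^ 4 \<partial>M) / 2 + (\<integral>\<omega>. S l (X \<omega>) ^ 8 \<partial>M) / (2 * L)"
      if "l \<in> {..<k}" for l
      using integrable_polyfun[OF pQ] intS that by (subst Bochner_Integration.integral_add) auto
    moreover have "(\<integral>\<omega>. (\<Sum>l<k. ?f l \<omega>) \<partial>M) = (\<Sum>l<k. \<integral>\<omega>. ?f l \<omega> \<partial>M)"
      by (rule Bochner_Integration.integral_sum) (rule int)
    ultimately show ?thesis
      unfolding integral_mult_right_zero by (simp only: cong: sum.cong)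
  qed
  also have "\<dots> \<le> real k ^ 7 * (\<Sum>l<k. (D 16 ^ 16 + K) * n ^ (4 * k - 2))"
  proof (intro mult_left_mono sum_mono)
    fix l assume "l \<in> {..<k}"
    then have l: "l < k" by simp
    have "4 * k = (4 * k - 2) + 2" using k by simp
    then have e1: "n ^ (4 * k) = n ^ (4 * k - 2) * n\<^sup>2" by (metis power_add)
    have "L * (\<integral>\<omega>. Q (X \<omega>) ^ 4 \<partial>M) \<le> L * (D 16 ^ 16 * n ^ 4)"
      using EQ L by (intro mult_left_mono) auto
    also have "\<dots> = D 16 ^ 16 * n ^ (4 * k - 2)"
      using n unfolding L_def e1 by (simp add: field_simps power_numeral_reduce)
    finally have 1: "L * (\<integral>\<omega>. Q (X \<omega>) ^ 4 \<partial>M) \<le> D 16 ^ 16 * n ^ (4 * k - 2)" .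
    have "(\<integral>\<omega>. S l (X \<omega>) ^ 8 \<partial>M) / L \<le> K * n ^ (8 * (k - 1)) / L"
      using ES[OF l] L by (intro divide_right_mono) auto
    also have "\<dots> = K * n ^ (4 * k - 2)"
    proof -
      have "n ^ (8 * (k - 1)) * n ^ 6 = n ^ (4 * k - 2) * n ^ (4 * k)"
        using k unfolding power_add[symmetric] by (intro arg_cong[of _ _ "\<lambda>j. n ^ j"]) simp
      then show ?thesis using n by (simp add: L_def field_simps)
    qed
    finally have 2: "(\<integral>\<omega>. S l (X \<omega>) ^ 8 \<partial>M) / L \<le> K * n ^ (4 * k - 2)" .
    have 3: "0 \<le> D 16 ^ 16 * n ^ (4 * k - 2)" "0 \<le> K * n ^ (4 * k - 2)"
      using n C D_ge_1[of 16] kap_nonneg by (auto simp: K_def)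
    have "(\<integral>\<omega>. S l (X \<omega>) ^ 8 \<partial>M) / (2 * L) = ((\<integral>\<omega>. S l (X \<omega>) ^ 8 \<partial>M) / L) / 2" by simp
    then show "L * (\<integral>\<omega>. Q (X \<omega>) ^ 4 \<partial>M) / 2 + (\<integral>\<omega>. S l (X \<omega>) ^ 8 \<partial>M) / (2 * L) \<le>
        (D 16 ^ 16 + K) * n ^ (4 * k - 2)"
      using 1 2 3 unfolding distrib_right by linarith
  qed simp
  also have "\<dots> = real k ^ 8 * (D 16 ^ 16 + K) * n ^ (4 * k - 2)"
    by (simp add: power_numeral_reduce)
  finally have "(9800 + 2 * C8) * (\<integral>\<omega>. grad2 V (X \<omega>) ^ 4 \<partial>M) \<le>
      (9800 + 2 * C8) * (real k ^ 8 * (D 16 ^ 16 + K) * n ^ (4 * k - 2))"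
    by (intro mult_left_mono) (auto simp: C8_def)
  then have "(\<integral>\<omega>. V (X \<omega>) ^ 8 \<partial>M) \<le> conc_const k C * n ^ (4 * k - 2)"
    using eighth_moment[OF V mean] unfolding conc_const_def K_def by (simp only: mult.assoc)
  then show ?thesis unfolding V_def \<mu>_def n_def .
qed

end

subsection \<open>Powers of matrices with entries in a finite family\<close>

text \<open>Entry of the product of the coefficient matrices along the word, which is the
  coefficient of that word in a matrix power.\<close>

fun wp :: "nat \<Rightarrow> ('i \<Rightarrow> nat \<times> nat \<Rightarrow> 'b::comm_ring_1) \<Rightarrow> 'i list \<Rightarrow> nat \<Rightarrow> nat \<Rightarrow> 'b" where
  "wp n e [] p q = unit_mat p q"
| "wp n e (\<alpha> # w) p q = (\<Sum>r<n. e \<alpha> (p, r) * wp n e w r q)"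

lemma mpow_wp:
  fixes x :: "'i \<Rightarrow> 'b::comm_ring_1"
  assumes "p < n" and y: "\<And>p q. p < n \<Longrightarrow> q < n \<Longrightarrow> y (p, q) = (\<Sum>\<alpha>\<in>J. e \<alpha> (p, q) * x \<alpha>)"
  shows "mpow n y k p q = (\<Sum>w\<in>words J k. wp n e w p q * prod_list (map x w))"
  using assms(1)
proof (induction k arbitrary: p)
  case (Suc k)
  have "mpow n y (Suc k) p q =
      (\<Sum>r<n. \<Sum>\<alpha>\<in>J. \<Sum>w\<in>words J k. (e \<alpha> (p, r) * x \<alpha>) * (wp n e w r q * prod_list (map x w)))"
    using Suc by (simp add: y sum_product)
  also have "\<dots> = (\<Sum>\<alpha>\<in>J. \<Sum>w\<in>words J k. \<Sum>r<n. (e \<alpha> (p, r) * x \<alpha>) * (wp n e w r q * prod_list (map x w)))"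
    by (subst sum.swap) (intro sum.cong refl sum.swap)
  also have "\<dots> = (\<Sum>w\<in>words J (Suc k). wp n e w p q * prod_list (map x w))"
    unfolding sum_words_Suc by (intro sum.cong refl) (simp add: sum_distrib_left sum_distrib_right mult_ac)
  finally show ?case .
qed simp

lemma wp_append:
  assumes "p < n"
  shows "wp n e (v @ w) p q = (\<Sum>r<n. wp n e v p r * wp n e w r q)"
  using assms
proof (induction v arbitrary: p)
  case (Cons \<alpha> v)
  have "wp n e ((\<alpha> # v) @ w) p q = (\<Sum>s<n. \<Sum>r<n. e \<alpha> (p, s) * (wp n e v s r * wp n e w r q))"
    using Cons by (simp add: sum_distrib_left)
  also have "\<dots> = (\<Sum>r<n. \<Sum>s<n. e \<alpha> (p, s) * (wp n e v s r * wp n e w r q))"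
    by (rule sum.swap)
  finally show ?case by (simp add: sum_distrib_right mult.assoc)
qed simp

text \<open>In the application the coefficients are 0 or 1: a variable occurs at most twice in a
  row, through a block entry and its mirror image, and a matrix entry carries at most one
  variable.\<close>

locale sparse_dictionary =
  fixes n :: nat and J :: "'i set" and e :: "'i \<Rightarrow> nat \<times> nat \<Rightarrow> real"
  assumes e_nonneg: "0 \<le> e \<alpha> (p, q)"
    and e_row: "p < n \<Longrightarrow> (\<Sum>q<n. e \<alpha> (p, q)) \<le> 2"
    and e_col: "(\<Sum>\<alpha>\<in>J. e \<alpha> (p, q)) \<le> 1"
begin

lemma wp_nonneg: "0 \<le> wp n e w p q"
  by (induction w arbitrary: p) (auto simp: unit_mat_def e_nonneg intro!: sum_nonneg)

lemma wp_row: "p < n \<Longrightarrow> (\<Sum>q<n. wp n e w p q) \<le> 2 ^ length w"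
proof (induction w arbitrary: p)
  case Nil
  then show ?case by (simp add: unit_mat_def)
next
  case (Cons \<alpha> w)
  have "(\<Sum>q<n. wp n e (\<alpha> # w) p q) = (\<Sum>r<n. e \<alpha> (p, r) * (\<Sum>q<n. wp n e w r q))"
    by (subst sum_distrib_left) (simp, rule sum.swap)
  also have "\<dots> \<le> (\<Sum>r<n. e \<alpha> (p, r) * 2 ^ length w)"
    using Cons.IH by (intro sum_mono mult_left_mono e_nonneg) auto
  also have "\<dots> \<le> 2 * 2 ^ length w"
    unfolding sum_distrib_right[symmetric] using e_row[OF Cons.prems] by (intro mult_right_mono) auto
  finally show ?case by simp
qed

lemma wp_le: "p < n \<Longrightarrow> q < n \<Longrightarrow> wp n e w p q \<le> 2 ^ length w"
  using wp_row[of p w] member_le_sum[of q "{..<n}" "\<lambda>q. wp n e w p q"] wp_nonneg by force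

definition tc :: "'i list \<Rightarrow> real" where
  "tc w = (\<Sum>p<n. wp n e w p p) / real n"

lemma tc_nonneg: "0 \<le> tc w"
  unfolding tc_def by (intro divide_nonneg_nonneg sum_nonneg wp_nonneg) simp

lemma tc_le: "0 < n \<Longrightarrow> tc w \<le> 2 ^ length w"
proof -
  assume n: "0 < n"
  have "(\<Sum>p<n. wp n e w p p) \<le> (\<Sum>p<n. 2 ^ length w)" by (intro sum_mono wp_le) auto
  then show ?thesis using n by (simp add: tc_def divide_le_eq mult.commute)
qed

text \<open>This provides the hypothesis \<open>c1\<close> of \<open>concentration\<close>. With row
  and column at the inserted place fixed, \<open>e_col\<close> bounds the sum over letters by 1; the
  sums over this row and this column then decouple and are bounded by \<open>wp_row\<close>.\<close>

lemma sum_tc_insert_le: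
  assumes n: "0 < n"
  shows "(\<Sum>\<alpha>\<in>J. tc (v @ \<alpha> # w)) \<le> 2 ^ (length v + length w)"
proof -
  have "(\<Sum>\<alpha>\<in>J. \<Sum>p<n. wp n e (v @ \<alpha> # w) p p) =
      (\<Sum>\<alpha>\<in>J. \<Sum>p<n. \<Sum>r<n. \<Sum>s<n. wp n e v p r * (e \<alpha> (r, s) * wp n e w s p))"
    by (intro sum.cong refl) (simp add: wp_append sum_distrib_left)
  also have "\<dots> = (\<Sum>p<n. \<Sum>\<alpha>\<in>J. \<Sum>r<n. \<Sum>s<n. wp n e v p r * (e \<alpha> (r, s) * wp n e w s p))"
    by (rule sum.swap)
  also have "\<dots> = (\<Sum>p<n. \<Sum>r<n. \<Sum>\<alpha>\<in>J. \<Sum>s<n. wp n e v p r * (e \<alpha> (r, s) * wp n e w s p))"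
    by (intro sum.cong refl sum.swap)
  also have "\<dots> = (\<Sum>p<n. \<Sum>r<n. \<Sum>s<n. \<Sum>\<alpha>\<in>J. wp n e v p r * (e \<alpha> (r, s) * wp n e w s p))"
    by (intro sum.cong refl sum.swap)
  also have "\<dots> = (\<Sum>p<n. \<Sum>r<n. \<Sum>s<n. (wp n e v p r * wp n e w s p) * (\<Sum>\<alpha>\<in>J. e \<alpha> (r, s)))"
    by (simp add: sum_distrib_left mult_ac)
  also have "\<dots> \<le> (\<Sum>p<n. \<Sum>r<n. \<Sum>s<n. (wp n e v p r * wp n e w s p) * 1)"
    by (intro sum_mono mult_left_mono e_col mult_nonneg_nonneg wp_nonneg)
  also have "\<dots> = (\<Sum>p<n. (\<Sum>r<n. wp n e v p r) * (\<Sum>s<n. wp n e w s p))"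
    by (simp add: sum_product)
  also have "\<dots> \<le> (\<Sum>p<n. 2 ^ length v * (\<Sum>s<n. wp n e w s p))"
    by (intro sum_mono mult_right_mono wp_row sum_nonneg wp_nonneg) auto
  also have "\<dots> = 2 ^ length v * (\<Sum>s<n. \<Sum>p<n. wp n e w s p)"
    unfolding sum_distrib_left[symmetric] by (subst sum.swap) simp
  also have "\<dots> \<le> 2 ^ length v * (\<Sum>s<n. 2 ^ length w)"
    by (intro mult_left_mono sum_mono wp_row) auto
  finally have "(\<Sum>\<alpha>\<in>J. \<Sum>p<n. wp n e (v @ \<alpha> # w) p p) \<le> 2 ^ (length v + length w) * real n"
    by (simp add: power_add mult_ac)
  then show ?thesis
    using n by (simp add: tc_def sum_divide_distrib[symmetric] divide_le_eq)
qed

end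

subsection \<open>The random block Toeplitz band model\<close>

text \<open>Each block entry equals one of the independent variables; the key of \<open>(s, i, j)\<close> names it.\<close>

definition key :: "int \<Rightarrow> nat \<Rightarrow> nat \<Rightarrow> int \<times> nat \<times> nat" where
  "key s i j = (if 0 < s then (s, i, j) else if s < 0 then (- s, j, i) else (0, min i j, max i j))"

text \<open>Transposition is the only coincidence among block entries. Both alternatives can hold
  together when the offset is zero, which matters in \<open>signed_pair_sum\<close>.\<close>

lemma key_eq_iff: "key s i j = key t k l \<longleftrightarrow> (t = s \<and> k = i \<and> l = j) \<or> (t = - s \<and> k = j \<and> l = i)"
  by (auto simp: key_def min_def max_def split: if_splits)

context random_block_toeplitz_band
begin

definition keys :: "nat \<Rightarrow> (int \<times> nat \<times> nat) set" where
  "keys N = {(s, i, j). 1 \<le> s \<and> s \<le> min (int (b N)) (int N - 1) \<and> i < m \<and> j < m} \<union>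
            {(s, i, j). s = 0 \<and> i \<le> j \<and> j < m}"

definition xi :: "nat \<Rightarrow> int \<times> nat \<times> nat \<Rightarrow> 'a \<Rightarrow> real" where
  "xi N = (\<lambda>(s, i, j) \<omega>. A N s \<omega> $$ (i, j))"

text \<open>The sum makes one number dominate the moments of all orders up to k, as
  \<open>centered_family\<close> demands, and the suprema make it independent of N.\<close>

definition dd :: "nat \<Rightarrow> real" where
  "dd k = 1 + (\<Sum>j\<le>k. enn2real (moment_sup M m A j))"

lemma keys_subset: "keys N \<subseteq> {0..int (b N)} \<times> {..<m} \<times> {..<m}"
  by (auto simp: keys_def)

lemma finite_keys: "finite (keys N)"
  by (rule finite_subset[OF keys_subset]) auto

lemma card_keys_le:
  assumes "1 \<le> N"
  shows "card (keys N) \<le> 2 * m\<^sup>2 * b N"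
proof -
  have "card (keys N) \<le> card ({0..int (b N)} \<times> {..<m} \<times> {..<m})"
    by (rule card_mono[OF _ keys_subset]) auto
  also have "\<dots> = (b N + 1) * m\<^sup>2" by (simp add: power2_eq_square nat_add_distrib)
  also have "\<dots> \<le> 2 * b N * m\<^sup>2" using bandwidth_pos[OF assms] by (intro mult_right_mono) auto
  finally show ?thesis by (simp add: mult_ac)
qed

lemma keys_bounds:
  assumes "\<alpha> \<in> keys N" "1 \<le> N"
  shows "fst \<alpha> \<le> int (b N)" "\<bar>fst \<alpha>\<bar> \<le> int N - 1" "fst (snd \<alpha>) < m" "snd (snd \<alpha>) < m" "0 \<le> fst \<alpha>"
  using assms by (auto simp: keys_def)

lemma key_in_keys:
  assumes "\<bar>s\<bar> \<le> int (b N)" "\<bar>s\<bar> \<le> int N - 1" "i < m" "j < m"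
  shows "key s i j \<in> keys N"
  using assms by (auto simp: key_def keys_def min_def max_def)

lemma entry_key:
  assumes "1 \<le> N" "\<bar>s\<bar> \<le> int N - 1" "i < m" "j < m" "\<omega> \<in> space M"
  shows "A N s \<omega> $$ (i, j) = xi N (key s i j) \<omega>"
proof -
  have c: "A N s \<omega> \<in> carrier_mat m m" "A N (- s) \<omega> \<in> carrier_mat m m"
    using block_carrier[of N s \<omega>] block_carrier[of N "- s" \<omega>] assms by auto
  have t: "A N (- s) \<omega> = transpose_mat (A N s \<omega>)" using block_transpose assms by blast
  then have sw: "A N (- s) \<omega> $$ (j, i) = A N s \<omega> $$ (i, j)" using c assms by simp
  consider "0 < s" | "s < 0" | "s = 0" by linarith
  then show ?thesis
  proof cases
    case 3
    then show ?thesis using sw by (auto simp: key_def xi_def min_def max_def)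
  qed (use sw in \<open>auto simp: key_def xi_def\<close>)
qed

lemma
  assumes "1 \<le> N" "\<bar>s\<bar> \<le> int N - 1" "i < m" "j < m" "1 \<le> k"
  shows integrable_entry: "integrable M (\<lambda>\<omega>. \<bar>A N s \<omega> $$ (i, j)\<bar> ^ k)"
    and entry_moment_le: "expectation (\<lambda>\<omega>. \<bar>A N s \<omega> $$ (i, j)\<bar> ^ k) \<le> enn2real (moment_sup M m A k)"
proof -
  note [measurable] = entry_measurable[OF assms(1-4)]
  let ?I = "{(N, s, i, j). 1 \<le> N \<and> \<bar>s\<bar> \<le> int N - 1 \<and> i < m \<and> j < m}"
  let ?f = "\<lambda>(N, s, i, j). \<integral>\<^sup>+\<omega>. ennreal (\<bar>A N s \<omega> $$ (i, j)\<bar> ^ k) \<partial>M"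
  have "?f (N, s, i, j) \<le> (\<Squnion>p\<in>?I. ?f p)" by (rule SUP_upper) (use assms in auto)
  then have le: "(\<integral>\<^sup>+\<omega>. ennreal (\<bar>A N s \<omega> $$ (i, j)\<bar> ^ k) \<partial>M) \<le> moment_sup M m A k"
    unfolding moment_sup_def by simp
  also have lt: "\<dots> < \<top>" by (rule moments[OF assms(5)])
  finally show int: "integrable M (\<lambda>\<omega>. \<bar>A N s \<omega> $$ (i, j)\<bar> ^ k)"
    unfolding integrable_iff_bounded by (auto simp: power_abs top.not_eq_extremum)
  have "ennreal (expectation (\<lambda>\<omega>. \<bar>A N s \<omega> $$ (i, j)\<bar> ^ k)) = (\<integral>\<^sup>+\<omega>. ennreal (\<bar>A N s \<omega> $$ (i, j)\<bar> ^ k) \<partial>M)"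
    by (rule nn_integral_eq_integral[OF int, symmetric]) auto
  then have "ennreal (expectation (\<lambda>\<omega>. \<bar>A N s \<omega> $$ (i, j)\<bar> ^ k)) \<le> moment_sup M m A k" using le by simp
  then show "expectation (\<lambda>\<omega>. \<bar>A N s \<omega> $$ (i, j)\<bar> ^ k) \<le> enn2real (moment_sup M m A k)"
    using enn2real_mono[OF _ lt] by (fastforce simp: integral_nonneg_AE)
qed

lemma dd_ge_1: "1 \<le> dd k"
  unfolding dd_def by (simp add: sum_nonneg)

lemma centered_family_keys:
  assumes m: "0 < m" and N: "1 \<le> N"
  shows "centered_family M (keys N) (xi N) dd"
proof
  show "finite (keys N)" by (rule finite_keys)
  show "keys N \<noteq> {}" using m by (auto simp: keys_def intro!: exI[of _ 0])
  show "indep_vars (\<lambda>_. borel) (xi N) (keys N)"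
    using independent[OF N] unfolding keys_def xi_def by simp
  show "expectation (xi N \<alpha>) = 0" if "\<alpha> \<in> keys N" for \<alpha>
    using keys_bounds[OF that N] centered[OF N, of "fst \<alpha>" "fst (snd \<alpha>)" "snd (snd \<alpha>)"]
    by (simp add: xi_def case_prod_beta)
  have eq: "(\<lambda>\<omega>. \<bar>xi N \<alpha> \<omega>\<bar> ^ k) = (\<lambda>\<omega>. \<bar>A N (fst \<alpha>) \<omega> $$ (fst (snd \<alpha>), snd (snd \<alpha>))\<bar> ^ k)" for \<alpha> k
    by (simp add: xi_def case_prod_beta)
  show "integrable M (\<lambda>\<omega>. \<bar>xi N \<alpha> \<omega>\<bar> ^ k)" if "\<alpha> \<in> keys N" for \<alpha> k
  proof (cases "k = 0")
    case False
    then show ?thesis unfolding eq using keys_bounds[OF that N] N by (intro integrable_entry) auto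
  qed simp
  show "expectation (\<lambda>\<omega>. \<bar>xi N \<alpha> \<omega>\<bar> ^ j) \<le> dd k" if "\<alpha> \<in> keys N" "j \<le> k" for \<alpha> j k
  proof (cases "j = 0")
    case True
    then show ?thesis using dd_ge_1 by (simp add: prob_space)
  next
    case False
    have "expectation (\<lambda>\<omega>. \<bar>xi N \<alpha> \<omega>\<bar> ^ j) \<le> enn2real (moment_sup M m A j)"
      unfolding eq using keys_bounds[OF that(1) N] N False by (intro entry_moment_le) auto
    also have "\<dots> \<le> (\<Sum>j\<le>k. enn2real (moment_sup M m A j))"
      using that(2) by (intro member_le_sum) auto
    finally show ?thesis by (simp add: dd_def)
  qed
  show "1 \<le> dd k" for k by (rule dd_ge_1)
qed

definition ecoef :: "nat \<Rightarrow> int \<times> nat \<times> nat \<Rightarrow> nat \<times> nat \<Rightarrow> real" where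
  "ecoef N \<alpha> = (\<lambda>(p, q). if \<bar>int (p div m) - int (q div m)\<bar> \<le> int (b N) \<and>
      key (int (p div m) - int (q div m)) (p mod m) (q mod m) = \<alpha> then 1 else 0)"

definition toep :: "nat \<Rightarrow> 'a \<Rightarrow> nat \<times> nat \<Rightarrow> real" where
  "toep N \<omega> = (\<lambda>(p, q). A N (int (p div m) - int (q div m)) \<omega> $$ (p mod m, q mod m))"

lemma div_mod_bounds:
  assumes "p < m * N" "q < m * N"
  shows "\<bar>int (p div m) - int (q div m)\<bar> \<le> int N - 1" "p mod m < m" "q mod m < m"
proof -
  have m: "0 < m" using assms by (cases m) auto
  have "p div m < N" "q div m < N" using assms by (auto simp: less_mult_imp_div_less mult.commute)
  then show "\<bar>int (p div m) - int (q div m)\<bar> \<le> int N - 1" by linarith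
  show "p mod m < m" "q mod m < m" using m by auto
qed

lemma toep_eq:
  assumes "1 \<le> N" "p < m * N" "q < m * N" "\<omega> \<in> space M"
  shows "toep N \<omega> (p, q) = (\<Sum>\<alpha>\<in>keys N. ecoef N \<alpha> (p, q) * xi N \<alpha> \<omega>)"
proof -
  let ?s = "int (p div m) - int (q div m)"
  note bd = div_mod_bounds[OF assms(2,3)]
  show ?thesis
  proof (cases "\<bar>?s\<bar> \<le> int (b N)")
    case True
    have "(\<Sum>\<alpha>\<in>keys N. ecoef N \<alpha> (p, q) * xi N \<alpha> \<omega>) =
        (\<Sum>\<alpha>\<in>keys N. if key ?s (p mod m) (q mod m) = \<alpha> then xi N \<alpha> \<omega> else 0)"
      using True by (intro sum.cong) (auto simp: ecoef_def)
    also have "\<dots> = xi N (key ?s (p mod m) (q mod m)) \<omega>"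
      using key_in_keys[OF True bd] finite_keys by simp
    finally show ?thesis using entry_key[OF assms(1) bd assms(4)] by (simp add: toep_def)
  next
    case False
    then have "A N ?s \<omega> = 0\<^sub>m m m" using band assms(1,4) bd(1) by auto
    then show ?thesis using False bd by (simp add: toep_def ecoef_def)
  qed
qed

lemma sparse_ecoef:
  assumes N: "1 \<le> N"
  shows "sparse_dictionary (m * N) (keys N) (ecoef N)"
proof
  show "0 \<le> ecoef N \<alpha> (p, q)" for \<alpha> p q by (simp add: ecoef_def)
  show "(\<Sum>\<alpha>\<in>keys N. ecoef N \<alpha> (p, q)) \<le> 1" for p q
  proof -
    have "(\<Sum>\<alpha>\<in>keys N. ecoef N \<alpha> (p, q)) \<le>
        (\<Sum>\<alpha>\<in>keys N. if \<alpha> = key (int (p div m) - int (q div m)) (p mod m) (q mod m) then 1 else 0)"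
      by (intro sum_mono) (auto simp: ecoef_def)
    also have "\<dots> \<le> 1" using finite_keys by simp
    finally show ?thesis .
  qed
  show "(\<Sum>q<m * N. ecoef N \<alpha> (p, q)) \<le> 2" if "p < m * N" for \<alpha> p
  proof -
    let ?P = "p div m" and ?i = "p mod m"
    let ?S = "{q \<in> {..<m * N}. key (int ?P - int (q div m)) ?i (q mod m) = \<alpha>}"
    have "(\<Sum>q<m * N. ecoef N \<alpha> (p, q)) \<le> (\<Sum>q<m * N. if key (int ?P - int (q div m)) ?i (q mod m) = \<alpha> then 1 else 0)"
      by (intro sum_mono) (auto simp: ecoef_def)
    also have "\<dots> = real (card ?S)" by (simp add: sum.If_cases Int_def)
    also have "card ?S \<le> 2"
    proof (cases "?S = {}")
      case False
      then obtain q0 where q0: "q0 \<in> ?S" by blast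
      let ?g = "\<lambda>q. (int (q div m), q mod m)"
      have "inj_on ?g ?S"
      proof (rule inj_onI)
        fix x y assume "?g x = ?g y"
        then show "x = y" by (metis div_mult_mod_eq of_nat_eq_iff prod.inject)
      qed
      \<comment> \<open>By \<open>key_eq_iff\<close> a second column with the same variable has the
        reflected block offset, hence the reflected block column, and the position \<open>?i\<close>
        inside its block.\<close>
      moreover have "?g ` ?S \<subseteq> {?g q0, (2 * int ?P - int (q0 div m), ?i)}"
      proof
        fix z assume "z \<in> ?g ` ?S"
        then obtain q where q: "z = ?g q" "q \<in> ?S" by blast
        then have "key (int ?P - int (q0 div m)) ?i (q0 mod m) = key (int ?P - int (q div m)) ?i (q mod m)"
          using q0 by simp
        then show "z \<in> {?g q0, (2 * int ?P - int (q0 div m), ?i)}"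
          unfolding key_eq_iff q(1) by auto
      qed
      ultimately have "card ?S \<le> card {?g q0, (2 * int ?P - int (q0 div m), ?i)}"
        by (intro card_inj_on_le) auto
      also have "\<dots> \<le> 2" by (simp add: card_insert_if)
      finally show ?thesis .
    next
      case True
      then show ?thesis by (simp only: card.empty)
    qed
    finally show ?thesis by simp
  qed
qed

definition trmom :: "nat \<Rightarrow> nat \<Rightarrow> 'a \<Rightarrow> real" where
  "trmom N k \<omega> = (\<Sum>p<m * N. mpow (m * N) (toep N \<omega>) k p p) / real (m * N)"

definition nrm :: "nat \<Rightarrow> real" where
  "nrm N = 1 / sqrt (2 * real m * real (b N))"

context
  fixes N :: nat
  assumes m: "0 < m" and N: "1 \<le> N"
begin

interpretation F: centered_family M "keys N" "xi N" dd
  by (rule centered_family_keys[OF m N])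

interpretation S: sparse_dictionary "m * N" "keys N" "ecoef N"
  by (rule sparse_ecoef[OF N])

lemma mpow_toep:
  assumes "\<omega> \<in> space M" "p < m * N"
  shows "mpow (m * N) (toep N \<omega>) k p q =
    (\<Sum>w\<in>words (keys N) k. wp (m * N) (ecoef N) w p q * F.wprod w \<omega>)"
  unfolding F.wprod_def
  by (rule mpow_wp[OF assms(2)]) (use toep_eq[OF N _ _ assms(1)] in auto)

lemma trmom_words:
  assumes "\<omega> \<in> space M"
  shows "trmom N k \<omega> = (\<Sum>w\<in>words (keys N) k. S.tc w * F.wprod w \<omega>)"
proof -
  have "(\<Sum>p<m * N. mpow (m * N) (toep N \<omega>) k p p) =
      (\<Sum>w\<in>words (keys N) k. \<Sum>p<m * N. wp (m * N) (ecoef N) w p p * F.wprod w \<omega>)"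
    using mpow_toep[OF assms] by (simp add: sum.swap[of _ "words (keys N) k"])
  then show ?thesis
    unfolding trmom_def S.tc_def times_divide_eq_left sum_divide_distrib[symmetric]
      sum_distrib_right[symmetric] by simp
qed

lemma integrable_mpow_toep: "p < m * N \<Longrightarrow> integrable M (\<lambda>\<omega>. mpow (m * N) (toep N \<omega>) k p q)"
  and expectation_mpow_toep_le: "p < m * N \<Longrightarrow> q < m * N \<Longrightarrow>
    \<bar>expectation (\<lambda>\<omega>. mpow (m * N) (toep N \<omega>) k p q)\<bar> \<le> 2 ^ k * F.kap k * real (card (keys N)) ^ (k div 2)"
proof -
  have eq: "F.chaos k (2 ^ k) (\<lambda>\<omega>. \<Sum>w\<in>words (keys N) k. wp (m * N) (ecoef N) w p q * F.wprod w \<omega>)"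
    if "p < m * N" "q < m * N"
    unfolding F.chaos_def using that S.wp_le[OF that] S.wp_nonneg
    by (intro exI[of _ "\<lambda>w. wp (m * N) (ecoef N) w p q"]) (auto simp: words_def)
  show "integrable M (\<lambda>\<omega>. mpow (m * N) (toep N \<omega>) k p q)" if "p < m * N"
  proof -
    have "integrable M (\<lambda>\<omega>. \<Sum>w\<in>words (keys N) k. wp (m * N) (ecoef N) w p q * F.wprod w \<omega>)"
      by (intro Bochner_Integration.integrable_sum integrable_mult_right F.integrable_wprod) (auto simp: words_def)
    then show ?thesis
      by (rule Bochner_Integration.integrable_cong[THEN iffD1, rotated -1]) (use mpow_toep[OF _ that] in auto)
  qed
  show "\<bar>expectation (\<lambda>\<omega>. mpow (m * N) (toep N \<omega>) k p q)\<bar> \<le> 2 ^ k * F.kap k * real (card (keys N)) ^ (k div 2)"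
    if "p < m * N" "q < m * N"
  proof -
    have "expectation (\<lambda>\<omega>. mpow (m * N) (toep N \<omega>) k p q) =
        expectation (\<lambda>\<omega>. \<Sum>w\<in>words (keys N) k. wp (m * N) (ecoef N) w p q * F.wprod w \<omega>)"
      by (intro Bochner_Integration.integral_cong) (use mpow_toep[OF _ that(1)] in auto)
    then show ?thesis using F.chaos_expectation[OF eq[OF that]] by simp
  qed
qed

lemma integrable_trmom: "integrable M (trmom N k)"
  unfolding trmom_def[abs_def]
  by (intro integrable_divide Bochner_Integration.integrable_sum integrable_mpow_toep) auto

lemma trmom_concentration:
  assumes k: "1 \<le> k"
  shows "integrable M (\<lambda>\<omega>. (trmom N k \<omega> - expectation (trmom N k)) ^ 8)"
    and "expectation (\<lambda>\<omega>. (trmom N k \<omega> - expectation (trmom N k)) ^ 8) \<le>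
      F.conc_const k (2 ^ k) * real (card (keys N)) ^ (4 * k - 2)"
proof -
  define Y where "Y x = (\<Sum>w\<in>words (keys N) k. S.tc w * prod_list (map x w))" for x :: "_ \<Rightarrow> real"
  have n: "0 < m * N" using m N by simp
  have Y: "trmom N k \<omega> = Y (F.X \<omega>)" if "\<omega> \<in> space M" for \<omega>
    using trmom_words[OF that] by (simp add: Y_def F.wprod_X)
  have E: "expectation (trmom N k) = expectation (\<lambda>\<omega>. Y (F.X \<omega>))"
    by (intro Bochner_Integration.integral_cong refl Y)
  have pY: "polyfun (keys N) Y" unfolding Y_def[abs_def]
    by (intro polyfun_sum polyfun_mult polyfun_const polyfun_prod_list) (auto simp: words_def)
  have "polyfun (keys N) (\<lambda>x. (Y x - expectation (trmom N k)) ^ 8)"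
    using pY by (intro polyfun_power polyfun_diff polyfun_const)
  from F.integrable_polyfun[OF this]
  show "integrable M (\<lambda>\<omega>. (trmom N k \<omega> - expectation (trmom N k)) ^ 8)"
    by (rule Bochner_Integration.integrable_cong[THEN iffD1, rotated -1]) (use Y in auto)
  have "expectation (\<lambda>\<omega>. (trmom N k \<omega> - expectation (trmom N k)) ^ 8) =
      expectation (\<lambda>\<omega>. (Y (F.X \<omega>) - expectation (\<lambda>\<omega>. Y (F.X \<omega>))) ^ 8)"
    unfolding E by (intro Bochner_Integration.integral_cong refl) (simp add: Y)
  also have "\<dots> \<le> F.conc_const k (2 ^ k) * real (card (keys N)) ^ (4 * k - 2)"
    unfolding Y_def
  proof (rule F.concentration[OF k])
    show "\<bar>S.tc w\<bar> \<le> 2 ^ k" if "w \<in> words (keys N) k" for w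
      using S.tc_le[OF n, of w] S.tc_nonneg[of w] that by (simp add: words_def)
    fix l r assume r: "r \<in> words (keys N) (k - 1)"
    have "(\<Sum>\<alpha>\<in>keys N. \<bar>S.tc (take l r @ \<alpha> # drop l r)\<bar>) = (\<Sum>\<alpha>\<in>keys N. S.tc (take l r @ \<alpha> # drop l r))"
      by (simp add: S.tc_nonneg)
    also have "\<dots> \<le> 2 ^ (length (take l r) + length (drop l r))" by (rule S.sum_tc_insert_le[OF n])
    also have "\<dots> \<le> 2 ^ k" using r by (intro power_increasing) (auto simp: words_def)
    finally show "(\<Sum>\<alpha>\<in>keys N. \<bar>S.tc (take l r @ \<alpha> # drop l r)\<bar>) \<le> 2 ^ k" .
  qed simp
  finally show "expectation (\<lambda>\<omega>. (trmom N k \<omega> - expectation (trmom N k)) ^ 8) \<le>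
      F.conc_const k (2 ^ k) * real (card (keys N)) ^ (4 * k - 2)" .
qed

end

text \<open>The value of the constant \<open>kap\<close> of the model; it does not depend on \<open>N\<close>.\<close>

definition kapd :: "nat \<Rightarrow> real" where "kapd n = dd n ^ n * real n ^ n"

end

subsection \<open>The symbol of the block Toeplitz matrix\<close>

lemma mpow_scale:
  "mpow n (\<lambda>p. c * x p) k i j = c ^ k * mpow n x k i j"
  by (induction k arbitrary: i) (simp_all add: sum_distrib_left mult_ac)

lemma mpow_cong:
  assumes "\<And>i j. i < n \<Longrightarrow> j < n \<Longrightarrow> x (i, j) = y (i, j)" "i < n"
  shows "mpow n x k i j = mpow n y k i j"
  using assms(2) by (induction k arbitrary: i) (simp_all add: assms(1))

lemma norm_wp_le:
  fixes e :: "'i \<Rightarrow> nat \<times> nat \<Rightarrow> complex"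
  assumes "\<And>\<alpha> p. norm (e \<alpha> p) \<le> C" "0 \<le> C"
  shows "norm (wp n e w p q) \<le> (real n * C) ^ length w"
proof (induction w arbitrary: p)
  case Nil
  then show ?case by (simp add: unit_mat_def)
next
  case (Cons \<alpha> w)
  have "norm (wp n e (\<alpha> # w) p q) \<le> (\<Sum>r<n. norm (e \<alpha> (p, r)) * norm (wp n e w r q))"
    unfolding wp.simps by (rule order_trans[OF norm_sum]) (simp add: norm_mult)
  also have "\<dots> \<le> (\<Sum>r<n. C * (real n * C) ^ length w)"
    using assms by (intro sum_mono mult_mono Cons) auto
  finally show ?case by (simp add: mult_ac)
qed

lemma continuous_wp:
  fixes e :: "real \<Rightarrow> 'i \<Rightarrow> nat \<times> nat \<Rightarrow> complex"
  assumes "\<And>\<alpha> p. continuous_on UNIV (\<lambda>t. e t \<alpha> p)"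
  shows "continuous_on UNIV (\<lambda>t. wp n (e t) w p q)"
  by (induction w arbitrary: p) (auto intro!: continuous_intros assms)

text \<open>For s = t = 0 both alternatives of \<open>key_eq_iff\<close> may hold; the last summand
  removes the double count.\<close>

lemma signed_pair_sum:
  fixes z :: "int \<Rightarrow> complex"
  assumes "z s * z (- s) = 1"
  shows "(if t = s \<and> a \<or> t = - s \<and> b then z s * z t else 0) =
    (if t = s then (if a then z s * z s else 0) else 0) + (if t = - s then (if b then 1 else 0) else 0) -
    (if t = s then (if s = 0 \<and> a \<and> b then 1 else 0) else 0)"
proof (cases "s = 0")
  case True
  then show ?thesis using assms by (cases a; cases b; cases "t = 0") simp_all
next
  case False
  then have ne: "s \<noteq> - s" "- s \<noteq> s" by auto
  show ?thesis
  proof (cases "t = s")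
    case True
    show ?thesis unfolding True using False ne by (cases a) simp_all
  next
    case t: False
    then show ?thesis using assms by (cases "t = - s"; cases b) simp_all
  qed
qed

text \<open>Lebesgue measure without normalization, so its mass 2 pi appears as a factor in the
  Fourier formulas.\<close>

definition circ :: "real measure" where
  "circ = restrict_space lborel {0..2 * pi}"

lemma finite_measure_circ: "finite_measure circ"
  by (rule finite_measureI) (simp add: circ_def space_restrict_space emeasure_restrict_space)

lemma integrable_circ:
  fixes f :: "real \<Rightarrow> complex"
  assumes "continuous_on UNIV f"
  shows "integrable circ f"
proof -
  have "set_integrable lborel {0..2 * pi} f"
    by (rule borel_integrable_atLeastAtMost') (rule continuous_on_subset[OF assms], simp)
  then show ?thesis
    unfolding circ_def set_integrable_def by (subst integrable_restrict_space) auto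
qed

lemma continuous_cis [continuous_intros]: "continuous_on S f \<Longrightarrow> continuous_on S (\<lambda>t. cis (f t))"
  unfolding cis_conv_exp by (intro continuous_intros)

lemma integral_circ_cis: "(\<integral>t. cis (of_int d * t) \<partial>circ) = (if d = 0 then complex_of_real (2 * pi) else 0)"
proof -
  have eq: "(\<integral>t. cis (of_int d * t) \<partial>circ) = (\<integral>t. indicator {0..2 * pi} t *\<^sub>R cis (of_int d * t) \<partial>lborel)"
    unfolding circ_def by (rule integral_restrict_space) simp
  show ?thesis
  proof (cases "d = 0")
    case True
    then show ?thesis unfolding eq by (simp add: scaleR_conv_of_real)
  next
    case False
    let ?F = "\<lambda>t. cis (of_int d * t) / (\<i> * of_int d)"
    have "(\<integral>t. indicator {0..2 * pi} t *\<^sub>R cis (of_int d * t) \<partial>lborel) = ?F (2 * pi) - ?F 0"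
    proof (rule integral_FTC_atLeastAtMost)
      fix t :: real
      show "(?F has_vector_derivative cis (of_int d * t)) (at t within {0..2 * pi})"
      proof -
        have "((\<lambda>z. exp (\<i> * (of_int d * z)) / (\<i> * of_int d)) has_field_derivative exp (\<i> * (of_int d * of_real t)))
            (at (complex_of_real t))"
          using False by (auto intro!: derivative_eq_intros simp: field_simps)
        from has_vector_derivative_real_field[OF this] show ?thesis
          by (simp add: cis_conv_exp)
      qed
    qed (auto intro!: continuous_intros)
    also have "cis (of_int d * (2 * pi)) = 1"
      using cis_multiple_2pi[of "of_int d"] by (simp add: mult_ac)
    finally show ?thesis unfolding eq using False by simp
  qed
qed

lemma sum_lessThan_mult:
  fixes f :: "nat \<Rightarrow> 'b::comm_monoid_add"
  shows "(\<Sum>r<m * N. f r) = (\<Sum>R<N. \<Sum>l<m. f (m * R + l))"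
proof -
  have "(\<Sum>r<N * m. f r) = (\<Sum>R<N. sum f {R * m..<R * m + m})"
    by (rule sum.nat_group[symmetric])
  also have "\<dots> = (\<Sum>R<N. \<Sum>l<m. f (m * R + l))"
  proof (rule sum.cong[OF refl])
    fix R
    have "sum f {R * m..<R * m + m} = (\<Sum>l\<in>{0..<m}. f (l + R * m))"
      using sum.shift_bounds_nat_ivl[of f 0 "R * m" m] by (simp add: add.commute)
    then show "sum f {R * m..<R * m + m} = (\<Sum>l<m. f (m * R + l))"
      by (simp add: atLeast0LessThan algebra_simps)
  qed
  finally show ?thesis by (simp add: mult.commute)
qed

context random_block_toeplitz_band
begin

abbreviation band_set :: "nat \<Rightarrow> int set" where
  "band_set N \<equiv> {- int (b N)..int (b N)}"

section \<open>The symbol in terms of the independent variables\<close>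

definition hsym :: "nat \<Rightarrow> real \<Rightarrow> 'a \<Rightarrow> nat \<times> nat \<Rightarrow> complex" where
  "hsym N \<theta> \<omega> = (\<lambda>(i, j). \<Sum>s\<in>band_set N. cis (of_int s * \<theta>) * of_real (A N s \<omega> $$ (i, j)))"

definition ccoef :: "nat \<Rightarrow> real \<Rightarrow> int \<times> nat \<times> nat \<Rightarrow> nat \<times> nat \<Rightarrow> complex" where
  "ccoef N \<theta> \<alpha> = (\<lambda>(i, j). \<Sum>s\<in>band_set N. if key s i j = \<alpha> then cis (of_int s * \<theta>) else 0)"

text \<open>Agrees with \<open>hsym\<close> on \<open>space M\<close> once \<open>b N < N\<close>,
  and is a linear form in the independent variables for every \<omega>.\<close>

definition hlin :: "nat \<Rightarrow> real \<Rightarrow> 'a \<Rightarrow> nat \<times> nat \<Rightarrow> complex" where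
  "hlin N \<theta> \<omega> p = (\<Sum>\<alpha>\<in>keys N. ccoef N \<theta> \<alpha> p * of_real (xi N \<alpha> \<omega>))"

lemma norm_ccoef_le: "norm (ccoef N \<theta> \<alpha> p) \<le> 2"
proof -
  obtain i j where p: "p = (i, j)" by force
  let ?S = "{s \<in> band_set N. key s i j = \<alpha>}"
  have "norm (ccoef N \<theta> \<alpha> p) \<le> (\<Sum>s\<in>band_set N. if key s i j = \<alpha> then 1 else 0)"
    unfolding ccoef_def p prod.case by (rule sum_norm_le) auto
  also have "\<dots> = real (card ?S)" by (simp add: sum.If_cases Int_def)
  also have "card ?S \<le> 2"
  proof (cases "?S = {}")
    case True
    then show ?thesis unfolding True by simp
  next
    case False
    then obtain s0 where s0: "s0 \<in> ?S" by blast
    have "?S \<subseteq> {s0, - s0}"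
    proof
      fix s assume "s \<in> ?S"
      then have "key s0 i j = key s i j" using s0 by simp
      then show "s \<in> {s0, - s0}" unfolding key_eq_iff by auto
    qed
    then have "card ?S \<le> card {s0, - s0}" by (intro card_mono) auto
    also have "\<dots> \<le> 2" by (simp add: card_insert_if)
    finally show ?thesis .
  qed
  finally show ?thesis by simp
qed

lemma continuous_ccoef: "continuous_on UNIV (\<lambda>\<theta>. ccoef N \<theta> \<alpha> p)"
proof -
  have "continuous_on UNIV (\<lambda>\<theta>. if key s (fst p) (snd p) = \<alpha> then cis (of_int s * \<theta>) else 0)" for s
    by (cases "key s (fst p) (snd p) = \<alpha>") (auto intro!: continuous_intros)
  then show ?thesis unfolding ccoef_def case_prod_beta by (intro continuous_intros)
qed

lemma nrm_pos: "0 < m \<Longrightarrow> 1 \<le> N \<Longrightarrow> 0 < nrm N"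
  using bandwidth_pos[of N] by (simp add: nrm_def)

lemma nrm_power2: "0 < m \<Longrightarrow> 1 \<le> N \<Longrightarrow> (nrm N)\<^sup>2 = 1 / (2 * real m * real (b N))"
  using bandwidth_pos[of N] by (simp add: nrm_def power_divide)

lemma nrm_le_1: "0 < m \<Longrightarrow> 1 \<le> N \<Longrightarrow> nrm N \<le> 1"
proof -
  assume a: "0 < m" "1 \<le> N"
  have "0 < 2 * m * b N" using a bandwidth_pos[of N] by simp
  then have "1 \<le> real (2 * m * b N)" by linarith
  then show ?thesis unfolding nrm_def by (simp add: real_le_rsqrt)
qed

text \<open>The normalization pays for the free letters: two factors \<open>nrm\<close> against one
  letter, which has at most 2 m^2 b choices, leave m.\<close>

lemma nrm_card:
  assumes "0 < m" "1 \<le> N"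
  shows "nrm N ^ n * real (card (keys N)) ^ (n div 2) \<le> real m ^ n"
proof -
  have b: "1 \<le> b N" by (rule bandwidth_pos[OF assms(2)])
  have "real (card (keys N)) \<le> real (2 * m\<^sup>2 * b N)"
    using card_keys_le[OF assms(2)] by (rule of_nat_mono)
  then have "(nrm N)\<^sup>2 * real (card (keys N)) \<le> (nrm N)\<^sup>2 * real (2 * m\<^sup>2 * b N)"
    by (intro mult_left_mono) auto
  also have "\<dots> = real m" unfolding nrm_power2[OF assms] using assms b by (simp add: power2_eq_square)
  finally have c: "(nrm N)\<^sup>2 * real (card (keys N)) \<le> real m" .
  have "nrm N ^ n = nrm N ^ (n mod 2) * ((nrm N)\<^sup>2) ^ (n div 2)"
    by (simp add: power_mult[symmetric] power_add[symmetric])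
  then have "nrm N ^ n * real (card (keys N)) ^ (n div 2) =
      nrm N ^ (n mod 2) * ((nrm N)\<^sup>2 * real (card (keys N))) ^ (n div 2)"
    by (simp add: power_mult_distrib mult_ac)
  also have "\<dots> \<le> 1 * real m ^ (n div 2)"
    using c nrm_le_1[OF assms] nrm_pos[OF assms]
    by (intro mult_mono power_mono power_le_one) auto
  also have "\<dots> \<le> real m ^ n" using assms(1) by (simp add: power_increasing)
  finally show ?thesis .
qed

context
  fixes N :: nat
  assumes m: "0 < m" and bN: "b N < N"
begin

lemma N1: "1 \<le> N" using bN by simp

interpretation F: centered_family M "keys N" "xi N" dd
  by (rule centered_family_keys[OF m N1])

lemma band_key: "s \<in> band_set N \<Longrightarrow> i < m \<Longrightarrow> j < m \<Longrightarrow> key s i j \<in> keys N"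
  using bN by (intro key_in_keys) auto

lemma hsym_eq_hlin:
  assumes "\<omega> \<in> space M" "i < m" "j < m"
  shows "hsym N \<theta> \<omega> (i, j) = hlin N \<theta> \<omega> (i, j)"
proof -
  have "hlin N \<theta> \<omega> (i, j) = (\<Sum>s\<in>band_set N. \<Sum>\<alpha>\<in>keys N.
      if key s i j = \<alpha> then cis (of_int s * \<theta>) * of_real (xi N \<alpha> \<omega>) else 0)"
    unfolding hlin_def ccoef_def prod.case sum_distrib_right
    by (subst sum.swap) (intro sum.cong refl, simp)
  also have "\<dots> = (\<Sum>s\<in>band_set N. cis (of_int s * \<theta>) * of_real (xi N (key s i j) \<omega>))"
    using band_key assms finite_keys by (intro sum.cong refl) simp
  also have "\<dots> = hsym N \<theta> \<omega> (i, j)"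
    unfolding hsym_def prod.case using bN assms
    by (intro sum.cong refl arg_cong2[of _ _ _ _ "(*)"] arg_cong[of _ _ complex_of_real] entry_key[symmetric]) auto
  finally show ?thesis by simp
qed

lemma kap_eq: "F.kap = kapd"
  by (intro ext) (simp add: F.kap_def kapd_def)

lemma scaled_hlin: "of_real c * hlin N \<theta> \<omega> p = F.lin (\<lambda>\<alpha>. of_real c * ccoef N \<theta> \<alpha> p) \<omega>"
  by (simp add: hlin_def F.lin_def sum_distrib_left mult.assoc)

lemma norm_scaled: "norm (of_real (nrm N) * ccoef N \<theta> \<alpha> p) \<le> 2 * nrm N"
  unfolding norm_mult using norm_ccoef_le nrm_pos[OF m N1] by (simp add: mult.commute mult_right_mono)

section \<open>Expectations of polynomials in the scaled symbol\<close>

definition Lw :: "real \<Rightarrow> ((nat \<times> nat \<Rightarrow> complex) \<Rightarrow> complex) \<Rightarrow> complex" where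
  "Lw \<theta> f = (\<integral>\<omega>. f (\<lambda>p. of_real (nrm N) * hlin N \<theta> \<omega> p) \<partial>M)"

lemma word_lin: "prod_list (map (\<lambda>p. of_real (nrm N) * hlin N \<theta> \<omega> p) w) =
    prod_list (map (\<lambda>c. F.lin c \<omega>) (map (\<lambda>p \<alpha>. of_real (nrm N) * ccoef N \<theta> \<alpha> p) w))"
  by (simp add: scaled_hlin o_def)

lemma integrable_word: "integrable M (\<lambda>\<omega>. prod_list (map (\<lambda>p. of_real (nrm N) * hlin N \<theta> \<omega> p) w))"
  unfolding word_lin by (rule F.integrable_prod_lin)

lemma Lw_word_le: "norm (Lw \<theta> (\<lambda>x. prod_list (map x w))) \<le> 2 ^ length w * kapd (length w) * real m ^ length w"
proof -
  have "norm (Lw \<theta> (\<lambda>x. prod_list (map x w))) \<le>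
      (2 * nrm N) ^ length w * F.kap (length w) * real (card (keys N)) ^ (length w div 2)"
  proof -
    let ?cs = "map (\<lambda>p \<alpha>. of_real (nrm N) * ccoef N \<theta> \<alpha> p) w"
    have "norm (\<integral>\<omega>. prod_list (map (\<lambda>c. F.lin c \<omega>) ?cs) \<partial>M) \<le>
      (2 * nrm N) ^ length ?cs * F.kap (length ?cs) * real (card (keys N)) ^ (length ?cs div 2)"
    proof (rule F.expectation_prod_lin_le)
      fix c \<alpha> assume "c \<in> set ?cs"
      then obtain p where "c = (\<lambda>\<alpha>. of_real (nrm N) * ccoef N \<theta> \<alpha> p)" by auto
      then show "norm (c \<alpha>) \<le> 2 * nrm N" using norm_scaled by simp
    qed (use nrm_pos[OF m N1] in simp)
    then show ?thesis unfolding Lw_def word_lin by (simp only: length_map)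
  qed
  also have "\<dots> = 2 ^ length w * kapd (length w) * (nrm N ^ length w * real (card (keys N)) ^ (length w div 2))"
    by (simp add: power_mult_distrib kap_eq mult_ac)
  also have "\<dots> \<le> 2 ^ length w * kapd (length w) * real m ^ length w"
    using F.kap_nonneg[unfolded kap_eq] by (intro mult_left_mono nrm_card[OF m N1]) auto
  finally show ?thesis .
qed

lemma Lw_lincomb:
  "Lw \<theta> (\<lambda>x. \<Sum>p\<leftarrow>cs. fst p * prod_list (map x (snd p))) =
      (\<Sum>p\<leftarrow>cs. fst p * Lw \<theta> (\<lambda>x. prod_list (map x (snd p))))"
proof -
  let ?x = "\<lambda>\<omega> p. complex_of_real (nrm N) * hlin N \<theta> \<omega> p"
  have "(\<integral>\<omega>. (\<Sum>p\<leftarrow>cs. fst p * prod_list (map (?x \<omega>) (snd p))) \<partial>M) =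
      (\<Sum>p\<leftarrow>cs. fst p * (\<integral>\<omega>. prod_list (map (?x \<omega>) (snd p)) \<partial>M))
    \<and> integrable M (\<lambda>\<omega>. \<Sum>p\<leftarrow>cs. fst p * prod_list (map (?x \<omega>) (snd p)))"
  proof (induction cs)
    case (Cons c cs)
    have i: "integrable M (\<lambda>\<omega>. fst c * prod_list (map (?x \<omega>) (snd c)))"
      by (rule integrable_mult_right) (rule integrable_word)
    note j = Cons.IH[THEN conjunct2]
    show ?case
      by (simp only: list.map sum_list.Cons Bochner_Integration.integral_add[OF i j]
          Bochner_Integration.integrable_add[OF i j] integral_mult_right_zero Cons.IH[THEN conjunct1] simp_thms)
  qed simp
  then show ?thesis unfolding Lw_def by blast
qed

lemma Lw_one: "Lw \<theta> (\<lambda>x. 1) = 1"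
  by (simp add: Lw_def prob_space)

definition wick_const :: "nat \<Rightarrow> real" where
  "wick_const n = 2 ^ Suc n * (dd (Suc n) ^ Suc n + real n * (dd 2 ^ 2 * dd n ^ n)) * real (Suc n) ^ Suc n * real m ^ n"

text \<open>Of the n + 1 factors \<open>nrm\<close>, n are absorbed by \<open>nrm_card\<close>; the
  remaining one is the rate.\<close>

lemma Lw_wick:
  "norm (Lw \<theta> (\<lambda>x. x a * prod_list (map x w)) -
     (\<Sum>l<length w. Lw \<theta> (\<lambda>x. x a * x (w ! l)) *
        Lw \<theta> (\<lambda>x. prod_list (map x (take l w @ drop (Suc l) w))))) \<le> wick_const (length w) * nrm N"
proof -
  let ?n = "length w"
  let ?g = "\<lambda>p \<alpha>. complex_of_real (nrm N) * ccoef N \<theta> \<alpha> p"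
  let ?K = "(dd (Suc ?n) ^ Suc ?n + real ?n * (dd 2 ^ 2 * dd ?n ^ ?n)) * real (Suc ?n) ^ Suc ?n"
  have dd_nonneg: "0 \<le> dd k" for k by (rule order_trans[OF zero_le_one dd_ge_1])
  have K: "0 \<le> ?K" by (simp add: dd_nonneg)
  have "norm ((\<integral>\<omega>. F.lin (?g a) \<omega> * prod_list (map (\<lambda>c. F.lin c \<omega>) (map ?g w)) \<partial>M) -
     (\<Sum>l<?n. (\<integral>\<omega>. F.lin (?g a) \<omega> * F.lin (map ?g w ! l) \<omega> \<partial>M) *
        (\<integral>\<omega>. prod_list (map (\<lambda>c. F.lin c \<omega>) (take l (map ?g w) @ drop (Suc l) (map ?g w))) \<partial>M)))
    \<le> (2 * nrm N) ^ Suc ?n * (dd (Suc ?n) ^ Suc ?n + real ?n * (dd 2 ^ 2 * dd ?n ^ ?n)) * real (Suc ?n) ^ Suc ?n *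
        real (card (keys N)) ^ (?n div 2)"
  proof (rule F.wick_lin)
    fix c \<alpha> assume "c \<in> set (?g a # map ?g w)"
    then have "c \<in> ?g ` set (a # w)" by simp
    then obtain p where "c = ?g p" by (rule imageE)
    then show "norm (c \<alpha>) \<le> 2 * nrm N" using norm_scaled by simp
  qed (use nrm_pos[OF m N1] in simp_all)
  also have "\<dots> = 2 ^ Suc ?n * ?K * nrm N * (nrm N ^ ?n * real (card (keys N)) ^ (?n div 2))"
    unfolding power_mult_distrib power_Suc[of "nrm N"] by (simp only: mult_ac)
  also have "\<dots> \<le> 2 ^ Suc ?n * ?K * nrm N * real m ^ ?n"
    by (intro mult_left_mono nrm_card[OF m N1] mult_nonneg_nonneg[OF mult_nonneg_nonneg[OF _ K]])
      (use nrm_pos[OF m N1] in simp_all)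
  also have "\<dots> = wick_const ?n * nrm N" unfolding wick_const_def by (simp only: mult_ac)
  finally have "norm ((\<integral>\<omega>. F.lin (?g a) \<omega> * prod_list (map (\<lambda>c. F.lin c \<omega>) (map ?g w)) \<partial>M) -
     (\<Sum>l<?n. (\<integral>\<omega>. F.lin (?g a) \<omega> * F.lin (map ?g w ! l) \<omega> \<partial>M) *
        (\<integral>\<omega>. prod_list (map (\<lambda>c. F.lin c \<omega>) (take l (map ?g w) @ drop (Suc l) (map ?g w))) \<partial>M)))
    \<le> wick_const ?n * nrm N" .
  moreover have "(\<Sum>l<?n. (\<integral>\<omega>. F.lin (?g a) \<omega> * F.lin (map ?g w ! l) \<omega> \<partial>M) *
        (\<integral>\<omega>. prod_list (map (\<lambda>c. F.lin c \<omega>) (take l (map ?g w) @ drop (Suc l) (map ?g w))) \<partial>M)) =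
      (\<Sum>l<?n. Lw \<theta> (\<lambda>x. x a * x (w ! l)) * Lw \<theta> (\<lambda>x. prod_list (map x (take l w @ drop (Suc l) w))))"
    unfolding Lw_def word_lin scaled_hlin
    by (rule sum.cong[OF refl]) (simp only: take_map drop_map map_append nth_map lessThan_iff list.map_comp o_def)
  moreover have "Lw \<theta> (\<lambda>x. x a * prod_list (map x w)) =
      (\<integral>\<omega>. F.lin (?g a) \<omega> * prod_list (map (\<lambda>c. F.lin c \<omega>) (map ?g w)) \<partial>M)"
    unfolding Lw_def word_lin scaled_hlin by (simp only: list.map_comp o_def)
  ultimately show ?thesis by (simp only:)
qed

text \<open>Two block entries are correlated if they are equal or mirror images. Mirror images carry
  opposite phases, so each of the 2b + 1 offsets contributes 1, and the normalization turns this
  into 1 / m. Equal entries carry the phase of 2 \<theta> per offset, and these phases add up to a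
  bounded geometric sum. This is why the symmetry is unitary and not orthogonal.\<close>

lemma Lw_cov:
  assumes ij: "i < m" "j < m" "k < m" "l < m" and \<theta>: "cis (2 * \<theta>) \<noteq> 1"
  shows "norm (Lw \<theta> (\<lambda>x. x (i, j) * x (k, l)) - gue_cov m (i, j) (k, l)) \<le>
    (nrm N)\<^sup>2 * (2 / norm (1 - cis (2 * \<theta>)) + 2)"
proof -
  let ?c = "complex_of_real (nrm N)"
  let ?g = "\<lambda>p \<alpha>. ?c * ccoef N \<theta> \<alpha> p"
  let ?B = "band_set N"
  have mom2: "F.mom [x, y] = (if x = y then 1 else 0)" if "x \<in> keys N" "y \<in> keys N" for x y
  proof (cases "x = y")
    case False
    then show ?thesis using that by (simp add: F.mom_eq_0[of "[x, y]" x])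
  next
    case True
    have "F.mom [x, x] = expectation (\<lambda>\<omega>. \<bar>A N (fst x) \<omega> $$ (fst (snd x), snd (snd x))\<bar>\<^sup>2)"
      unfolding F.mom_def F.wprod_def[abs_def]
      by (simp add: xi_def case_prod_beta power2_eq_square)
    also have "\<dots> = 1"
      using keys_bounds[OF that(1) N1] bN N1 by (intro unit_variance) auto
    finally show ?thesis using True by simp
  qed
  have "Lw \<theta> (\<lambda>x. x (i, j) * x (k, l)) = (\<Sum>x\<in>keys N. \<Sum>y\<in>keys N. ?g (i, j) x * ?g (k, l) y * of_real (F.mom [x, y]))"
    unfolding Lw_def scaled_hlin
    using F.expectation_prod_lin[of "[?g (i, j), ?g (k, l)]"]
    by (simp add: sum_words_Suc F.wt_def numeral_2_eq_2)
  also have "\<dots> = (\<Sum>x\<in>keys N. \<Sum>y\<in>keys N. if x = y then ?g (i, j) x * ?g (k, l) y else 0)"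
    by (intro sum.cong refl) (simp add: mom2)
  also have "\<dots> = (\<Sum>x\<in>keys N. ?g (i, j) x * ?g (k, l) x)"
    using finite_keys by simp
  also have "\<dots> = ?c\<^sup>2 * (\<Sum>x\<in>keys N. \<Sum>s\<in>?B. \<Sum>t\<in>?B.
      (if key s i j = x then cis (of_int s * \<theta>) else 0) * (if key t k l = x then cis (of_int t * \<theta>) else 0))"
    unfolding ccoef_def prod.case sum_product[symmetric] by (simp add: sum_distrib_left power2_eq_square mult_ac)
  also have "(\<Sum>x\<in>keys N. \<Sum>s\<in>?B. \<Sum>t\<in>?B.
      (if key s i j = x then cis (of_int s * \<theta>) else 0) * (if key t k l = x then cis (of_int t * \<theta>) else 0)) =
      (\<Sum>s\<in>?B. \<Sum>t\<in>?B. \<Sum>x\<in>keys N.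
      (if key s i j = x then cis (of_int s * \<theta>) else 0) * (if key t k l = x then cis (of_int t * \<theta>) else 0))"
    by (subst sum.swap) (intro sum.cong refl sum.swap)
  also have "\<dots> = (\<Sum>s\<in>?B. \<Sum>t\<in>?B. if key s i j = key t k l then cis (of_int s * \<theta>) * cis (of_int t * \<theta>) else 0)"
  proof (intro sum.cong refl)
    fix s t assume "s \<in> ?B" "t \<in> ?B"
    then have ks: "key s i j \<in> keys N" using band_key ij by blast
    have "(\<Sum>x\<in>keys N. (if key s i j = x then cis (of_int s * \<theta>) else 0) * (if key t k l = x then cis (of_int t * \<theta>) else 0)) =
       (\<Sum>x\<in>keys N. if key s i j = x then cis (of_int s * \<theta>) * (if key t k l = x then cis (of_int t * \<theta>) else 0) else 0)"
      by (intro sum.cong refl) simp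
    also have "\<dots> = (if key s i j = key t k l then cis (of_int s * \<theta>) * cis (of_int t * \<theta>) else 0)"
      using finite_keys ks by (auto simp: eq_commute)
    finally show "(\<Sum>x\<in>keys N. (if key s i j = x then cis (of_int s * \<theta>) else 0) * (if key t k l = x then cis (of_int t * \<theta>) else 0)) =
      (if key s i j = key t k l then cis (of_int s * \<theta>) * cis (of_int t * \<theta>) else 0)" .
  qed
  also have "\<dots> = (\<Sum>s\<in>?B. (if k = i \<and> l = j then cis (of_int s * (2 * \<theta>)) else 0) + (if k = j \<and> l = i then 1 else 0)
      - (if s = 0 then (if k = i \<and> l = j \<and> k = j \<and> l = i then 1 else 0) else 0))"
  proof (intro sum.cong refl)
    fix s assume s: "s \<in> ?B"
    have cc: "cis (of_int s * \<theta>) * cis (of_int s * \<theta>) = cis (of_int s * (2 * \<theta>))"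
      "cis (of_int s * \<theta>) * cis (- (of_int s * \<theta>)) = 1"
      unfolding cis_mult by (rule arg_cong[of _ _ cis], simp) simp
    have "(\<Sum>t\<in>?B. if key s i j = key t k l then cis (of_int s * \<theta>) * cis (of_int t * \<theta>) else 0) =
      (\<Sum>t\<in>?B. (if t = s then (if k = i \<and> l = j then cis (of_int s * (2 * \<theta>)) else 0) else 0) +
        (if t = - s then (if k = j \<and> l = i then 1 else 0) else 0) -
        (if t = s then (if s = 0 \<and> k = i \<and> l = j \<and> k = j \<and> l = i then 1 else 0) else 0))"
    proof (intro sum.cong refl)
      fix t
      show "(if key s i j = key t k l then cis (of_int s * \<theta>) * cis (of_int t * \<theta>) else 0) =
        (if t = s then (if k = i \<and> l = j then cis (of_int s * (2 * \<theta>)) else 0) else 0) +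
        (if t = - s then (if k = j \<and> l = i then 1 else 0) else 0) -
        (if t = s then (if s = 0 \<and> k = i \<and> l = j \<and> k = j \<and> l = i then 1 else 0) else 0)"
      proof -
        have z: "cis (of_int s * \<theta>) * cis (of_int (- s) * \<theta>) = 1"
          using cc(2) by simp
        show ?thesis
          unfolding key_eq_iff
          using signed_pair_sum[of "\<lambda>s. cis (of_int s * \<theta>)", OF z, of t "k = i \<and> l = j" "k = j \<and> l = i"]
          unfolding cc(1) conj_assoc .
      qed
    qed
    also have "\<dots> = (if k = i \<and> l = j then cis (of_int s * (2 * \<theta>)) else 0) + (if k = j \<and> l = i then 1 else 0)
      - (if s = 0 then (if k = i \<and> l = j \<and> k = j \<and> l = i then 1 else 0) else 0)"
    proof -
      have "(\<Sum>t\<in>?B. (if t = s then (if p then x else 0) else 0) + (if t = - s then (if q then 1 else 0) else 0) -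
          (if t = s then (if s = 0 \<and> r then 1 else 0) else 0)) =
        (if p then x else 0) + (if q then 1 else 0) - (if s = 0 then (if r then 1 else 0) else 0)"
        for p q r :: bool and x :: complex
        unfolding sum_subtractf sum.distrib using s by (cases p; cases q; cases r) simp_all
      then show ?thesis .
    qed
    finally show "(\<Sum>t\<in>?B. if key s i j = key t k l then cis (of_int s * \<theta>) * cis (of_int t * \<theta>) else 0) =
      (if k = i \<and> l = j then cis (of_int s * (2 * \<theta>)) else 0) + (if k = j \<and> l = i then 1 else 0)
      - (if s = 0 then (if k = i \<and> l = j \<and> k = j \<and> l = i then 1 else 0) else 0)" .
  qed
  also have "\<dots> = (if k = i \<and> l = j then \<Sum>s\<in>?B. cis (of_int s * (2 * \<theta>)) else 0) +
      (if k = j \<and> l = i then of_nat (2 * b N + 1) else 0) - (if k = i \<and> l = j \<and> k = j \<and> l = i then 1 else 0)"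
  proof -
    have "(\<Sum>s\<in>?B. (if p then cis (of_int s * (2 * \<theta>)) else 0) + (if q then 1 else 0) - (if s = 0 then (if r then 1 else 0) else 0)) =
      (if p then \<Sum>s\<in>?B. cis (of_int s * (2 * \<theta>)) else 0) + (if q then of_nat (2 * b N + 1) else 0) - (if r then 1 else 0)"
      for p q r :: bool
      unfolding sum_subtractf sum.distrib by (cases p; cases q; cases r) simp_all
    then show ?thesis .
  qed
  finally have eq: "Lw \<theta> (\<lambda>x. x (i, j) * x (k, l)) = ?c\<^sup>2 * ((if k = i \<and> l = j then \<Sum>s\<in>?B. cis (of_int s * (2 * \<theta>)) else 0) +
      (if k = j \<and> l = i then of_nat (2 * b N + 1) else 0) - (if k = i \<and> l = j \<and> k = j \<and> l = i then 1 else 0))" .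
  have cov: "gue_cov m (i, j) (k, l) = ?c\<^sup>2 * (if k = j \<and> l = i then of_nat (2 * b N) else 0)"
  proof -
    have "?c\<^sup>2 = complex_of_real (1 / (2 * real m * real (b N)))"
      unfolding of_real_power[symmetric] nrm_power2[OF m N1] ..
    then have "1 / of_nat m = ?c\<^sup>2 * of_nat (2 * b N)"
      using m bandwidth_pos[OF N1] by (simp add: field_simps)
    then have "(if q then 1 / of_nat m else 0) = ?c\<^sup>2 * (if q then of_nat (2 * b N) else 0)" for q :: bool
      by (cases q) simp_all
    moreover have "gue_cov m (i, j) (k, l) = (if k = j \<and> l = i then 1 / of_nat m else 0)"
      unfolding gue_cov_def by auto
    ultimately show ?thesis by (simp only:)
  qed
  \<comment> \<open>Multiplied by \<open>1 - ?z\<close> the sum telescopes, so the number of offsets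
    does not enter the bound.\<close>
  have D: "norm (\<Sum>s\<in>?B. cis (of_int s * (2 * \<theta>))) \<le> 2 / norm (1 - cis (2 * \<theta>))"
  proof -
    let ?z = "cis (2 * \<theta>)"
    have step: "(1 - ?z) * cis (of_int s * (2 * \<theta>)) = cis (of_int s * (2 * \<theta>)) - cis (of_int (s + 1) * (2 * \<theta>))" for s
      by (simp add: cis_mult algebra_simps)
    have tel: "(\<Sum>s\<in>{- int n..int n}. cis (of_int s * (2 * \<theta>)) - cis (of_int (s + 1) * (2 * \<theta>))) =
        cis (of_int (- int n) * (2 * \<theta>)) - cis (of_int (int n + 1) * (2 * \<theta>))" for n
    proof (induction n)
      case (Suc n)
      have "{- int (Suc n)..int (Suc n)} = insert (- int (Suc n)) (insert (int (Suc n)) {- int n..int n})" by auto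
      then show ?case using Suc by (simp add: algebra_simps)
    qed simp
    have "(1 - ?z) * (\<Sum>s\<in>?B. cis (of_int s * (2 * \<theta>))) =
        cis (of_int (- int (b N)) * (2 * \<theta>)) - cis (of_int (int (b N) + 1) * (2 * \<theta>))"
      unfolding sum_distrib_left step tel ..
    then have "norm (1 - ?z) * norm (\<Sum>s\<in>?B. cis (of_int s * (2 * \<theta>))) \<le> 2"
      unfolding norm_mult[symmetric] using norm_triangle_ineq4[of "cis (of_int (- int (b N)) * (2 * \<theta>))" "cis (of_int (int (b N) + 1) * (2 * \<theta>))"]
      by simp
    then show ?thesis using \<theta> by (simp add: pos_le_divide_eq mult.commute)
  qed
  define P where "P = (if k = i \<and> l = j then \<Sum>s\<in>?B. cis (of_int s * (2 * \<theta>)) else 0)"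
  \<comment> \<open>The bounded corrections: 2b + 1 offsets instead of 2b, and the double count at
    offset zero.\<close>
  define R :: complex where "R = (if k = j \<and> l = i then 1 else 0) - (if k = i \<and> l = j \<and> k = j \<and> l = i then 1 else 0)"
  have "norm P \<le> 2 / norm (1 - cis (2 * \<theta>))" 
  proof -
    have "norm (if p then \<Sum>s\<in>?B. cis (of_int s * (2 * \<theta>)) else 0) \<le> 2 / norm (1 - cis (2 * \<theta>))" for p
      using D by (cases p) simp_all
    then show ?thesis unfolding P_def .
  qed
  moreover have "norm R \<le> 2"
  proof -
    have "norm ((if p then 1 else 0) - (if q then 1 else 0) :: complex) \<le> 2" for p q
      by (cases p; cases q) simp_all
    then show ?thesis unfolding R_def .
  qed
  ultimately have PR: "norm (P + R) \<le> 2 / norm (1 - cis (2 * \<theta>)) + 2"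
    by (intro norm_triangle_le) linarith
  have "Lw \<theta> (\<lambda>x. x (i, j) * x (k, l)) - gue_cov m (i, j) (k, l) = ?c\<^sup>2 * (P + R)"
  proof -
    have "?c\<^sup>2 * (x + (if p then of_nat (2 * b N + 1) else 0) - y) - ?c\<^sup>2 * (if p then of_nat (2 * b N) else 0) =
        ?c\<^sup>2 * (x + ((if p then 1 else 0) - y))" for p x y
      by (cases p) (simp_all add: algebra_simps)
    then show ?thesis unfolding eq cov P_def R_def .
  qed
  then show ?thesis using mult_left_mono[OF PR, of "(nrm N)\<^sup>2"] by (simp add: norm_mult norm_power)
qed

text \<open>Expected trace of the k-th power of the unscaled symbol, written as a finite sum over
  words so that continuity in \<theta> is visible.\<close>

definition wE :: "nat \<Rightarrow> real \<Rightarrow> complex" where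
  "wE k \<theta> = (\<Sum>w\<in>words (keys N) k. (\<Sum>i<m. wp m (ccoef N \<theta>) w i i) * of_real (F.mom w))"

lemma mpow_hlin:
  assumes "i < m"
  shows "mpow m (hlin N \<theta> \<omega>) k i j = (\<Sum>w\<in>words (keys N) k. wp m (ccoef N \<theta>) w i j * of_real (F.wprod w \<omega>))"
proof -
  have "prod_list (map (\<lambda>\<alpha>. complex_of_real (xi N \<alpha> \<omega>)) w) = of_real (F.wprod w \<omega>)" for w
    by (induction w) (simp_all add: F.wprod_def)
  then show ?thesis
    using mpow_wp[OF assms, where y = "hlin N \<theta> \<omega>" and J = "keys N" and e = "ccoef N \<theta>"
      and x = "\<lambda>\<alpha>. complex_of_real (xi N \<alpha> \<omega>)" and k = k and q = j]
    by (simp add: hlin_def)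
qed

lemma expectation_mpow_hlin:
  "(\<integral>\<omega>. (\<Sum>i<m. mpow m (hlin N \<theta> \<omega>) k i i) \<partial>M) = wE k \<theta>"
proof -
  have "(\<Sum>i<m. mpow m (hlin N \<theta> \<omega>) k i i) =
      (\<Sum>w\<in>words (keys N) k. (\<Sum>i<m. wp m (ccoef N \<theta>) w i i) * of_real (F.wprod w \<omega>))" for \<omega>
    by (simp add: mpow_hlin sum.swap[of _ "words (keys N) k"] sum_distrib_right)
  then show ?thesis unfolding wE_def by (simp only: F.expectation_sum_wprod)
qed

lemma Lw_trace: "Lw \<theta> (\<lambda>x. \<Sum>i<m. mpow m x k i i) = of_real (nrm N) ^ k * wE k \<theta>"
  unfolding Lw_def mpow_scale sum_distrib_left[symmetric] expectation_mpow_hlin[symmetric]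
  by simp

lemma continuous_wE: "continuous_on UNIV (wE k)"
  unfolding wE_def[abs_def] by (intro continuous_intros continuous_wp continuous_ccoef)

text \<open>The bound is uniform in \<theta> and N and serves as the dominating constant for the
  integral over the angle.\<close>

lemma norm_wE_le: "norm (of_real (nrm N) ^ k * wE k \<theta>) \<le> real m * (2 * real m) ^ k * kapd k * real m ^ k"
proof -
  have "norm (wE k \<theta>) \<le> real m * (real m * 2) ^ k * F.kap k * real (card (keys N)) ^ (k div 2)"
    unfolding wE_def
  proof (rule F.sum_mom_le)
    fix w assume "w \<in> words (keys N) k"
    then have "norm (wp m (ccoef N \<theta>) w i i) \<le> (real m * 2) ^ k" for i
      using norm_wp_le[of "ccoef N \<theta>" 2 m w i i] norm_ccoef_le by (simp add: words_def)
    then have "norm (\<Sum>i<m. wp m (ccoef N \<theta>) w i i) \<le> (\<Sum>i<m. (real m * 2) ^ k)"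
      by (intro sum_norm_le) auto
    then show "norm (\<Sum>i<m. wp m (ccoef N \<theta>) w i i) \<le> real m * (real m * 2) ^ k" by simp
  qed simp
  then have "nrm N ^ k * norm (wE k \<theta>) \<le> nrm N ^ k * (real m * (real m * 2) ^ k * F.kap k * real (card (keys N)) ^ (k div 2))"
    using nrm_pos[OF m N1] by (intro mult_left_mono) auto
  also have "\<dots> = real m * (2 * real m) ^ k * kapd k * (nrm N ^ k * real (card (keys N)) ^ (k div 2))"
    by (simp add: kap_eq mult_ac)
  also have "\<dots> \<le> real m * (2 * real m) ^ k * kapd k * real m ^ k"
    using F.kap_nonneg[unfolded kap_eq] by (intro mult_left_mono nrm_card[OF m N1]) auto
  finally show ?thesis using nrm_pos[OF m N1] by (simp add: norm_mult norm_power)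
qed

text \<open>Convolution along block rows corresponds to multiplication of symbols. A path of k
  steps, each of at most \<open>b N\<close> block rows, cannot leave the matrix when it starts at
  such a depth, so the truncation is not felt. Only the starting row has to be deep, which is what
  lets the induction peel off the first step.\<close>

lemma mpow_toep_fourier:
  assumes \<omega>: "\<omega> \<in> space M" and "P < N" "i < m" "Q < N" "j < m" and "k * b N \<le> P" "P + k * b N < N"
  shows "complex_of_real (2 * pi) * of_real (mpow (m * N) (toep N \<omega>) k (m * P + i) (m * Q + j)) =
    (\<integral>\<theta>. mpow m (hsym N \<theta> \<omega>) k i j * cis (of_int (int Q - int P) * \<theta>) \<partial>circ)"
  using assms(2,3,6,7)
proof (induction k arbitrary: P i)
  case 0
  have "m * P + i = m * Q + j \<longleftrightarrow> P = Q \<and> i = j"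
    using 0 assms(5) by (metis add_left_imp_eq div_mult_self4 div_less less_nat_zero_code mod_less mod_mult_self4 add.right_neutral)
  moreover have "(\<integral>\<theta>. mpow m (hsym N \<theta> \<omega>) 0 i j * cis (of_int (int Q - int P) * \<theta>) \<partial>circ) =
      (if i = j then if int Q - int P = 0 then complex_of_real (2 * pi) else 0 else 0)"
    unfolding integral_circ_cis[symmetric] by (simp add: unit_mat_def)
  ultimately show ?case by (simp add: unit_mat_def)
next
  case (Suc k)
  let ?T = "toep N \<omega>" and ?h = "\<lambda>\<theta>. hsym N \<theta> \<omega>" and ?B = "band_set N"
  have P: "b N \<le> P" "P + b N < N" using Suc.prems by auto
  have cont: "continuous_on UNIV (\<lambda>\<theta>. mpow m (?h \<theta>) k l j)" for l
  proof (induction k arbitrary: l)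
    case (Suc k)
    show ?case unfolding mpow.simps
      by (intro continuous_intros Suc) (auto simp: hsym_def intro!: continuous_intros)
  qed simp
  define g where "g R l = complex_of_real (2 * pi) * of_real (mpow (m * N) ?T k (m * R + l) (m * Q + j))" for R l
  have "complex_of_real (2 * pi) * of_real (mpow (m * N) ?T (Suc k) (m * P + i) (m * Q + j)) =
      (\<Sum>R<N. \<Sum>l<m. of_real (?T (m * P + i, m * R + l)) * g R l)"
    unfolding mpow.simps sum_lessThan_mult g_def by (simp add: sum_distrib_left mult.left_commute)
  also have "\<dots> = (\<Sum>R<N. \<Sum>l<m. of_real (A N (int P - int R) \<omega> $$ (i, l)) * g R l)"
    using Suc.prems by (intro sum.cong refl) (simp add: toep_def)
  also have "\<dots> = (\<Sum>R\<in>{R. R < N \<and> int P - int R \<in> ?B}. \<Sum>l<m. of_real (A N (int P - int R) \<omega> $$ (i, l)) * g R l)"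
  proof (rule sum.mono_neutral_right)
    show "\<forall>R\<in>{..<N} - {R. R < N \<and> int P - int R \<in> ?B}. (\<Sum>l<m. of_real (A N (int P - int R) \<omega> $$ (i, l)) * g R l) = 0"
    proof
      fix R assume R: "R \<in> {..<N} - {R. R < N \<and> int P - int R \<in> ?B}"
      then have "A N (int P - int R) \<omega> = 0\<^sub>m m m"
        using Suc.prems(1) \<omega> N1 by (intro band) auto
      then show "(\<Sum>l<m. of_real (A N (int P - int R) \<omega> $$ (i, l)) * g R l) = 0"
        using Suc.prems by simp
    qed
  qed auto
  \<comment> \<open>The depth of \<open>P\<close> ensures that every offset \<open>s\<close> of the
    band is realized by a block column.\<close>
  also have "\<dots> = (\<Sum>s\<in>?B. \<Sum>l<m. of_real (A N s \<omega> $$ (i, l)) * g (nat (int P - s)) l)"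
    by (rule sum.reindex_bij_witness[of _ "\<lambda>s. nat (int P - s)" "\<lambda>R. int P - int R"]) (use P in auto)
  also have "\<dots> = (\<Sum>s\<in>?B. \<Sum>l<m. of_real (A N s \<omega> $$ (i, l)) *
      (\<integral>\<theta>. mpow m (?h \<theta>) k l j * cis (of_int (int Q - (int P - s)) * \<theta>) \<partial>circ))"
  proof (intro sum.cong refl)
    fix s l assume s: "s \<in> ?B" and l: "l \<in> {..<m}"
    have "int (b N + k * b N) \<le> int P" "int (P + (b N + k * b N)) < int N"
      using Suc.prems(3,4) by (simp_all only: of_nat_le_iff of_nat_less_iff mult_Suc)
    then have "nat (int P - s) < N" "k * b N \<le> nat (int P - s)" "nat (int P - s) + k * b N < N"
      "int (nat (int P - s)) = int P - s"
      using s P Suc.prems by (auto simp: nat_less_iff le_nat_iff)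
    then show "of_real (A N s \<omega> $$ (i, l)) * g (nat (int P - s)) l = of_real (A N s \<omega> $$ (i, l)) *
      (\<integral>\<theta>. mpow m (?h \<theta>) k l j * cis (of_int (int Q - (int P - s)) * \<theta>) \<partial>circ)"
      unfolding g_def using Suc.IH[of "nat (int P - s)" l] l by simp
  qed
  also have "\<dots> = (\<integral>\<theta>. (\<Sum>s\<in>?B. \<Sum>l<m. of_real (A N s \<omega> $$ (i, l)) *
      (mpow m (?h \<theta>) k l j * cis (of_int (int Q - (int P - s)) * \<theta>))) \<partial>circ)"
  proof -
    have int: "integrable circ (\<lambda>\<theta>. of_real (A N s \<omega> $$ (i, l)) *
      (mpow m (?h \<theta>) k l j * cis (of_int (int Q - (int P - s)) * \<theta>)))" for s l
      by (intro integrable_circ continuous_intros cont)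
    show ?thesis
      by (simp only: Bochner_Integration.integral_sum[OF Bochner_Integration.integrable_sum[OF int]]
          Bochner_Integration.integral_sum[OF int] integral_mult_right_zero)
  qed
  also have "\<dots> = (\<integral>\<theta>. mpow m (?h \<theta>) (Suc k) i j * cis (of_int (int Q - int P) * \<theta>) \<partial>circ)"
  proof (intro Bochner_Integration.integral_cong refl)
    fix \<theta>
    have c: "cis (of_int (int Q - (int P - s)) * \<theta>) = cis (of_int s * \<theta>) * cis (of_int (int Q - int P) * \<theta>)" for s
      unfolding cis_mult by (simp add: algebra_simps)
    have "(\<Sum>s\<in>?B. \<Sum>l<m. of_real (A N s \<omega> $$ (i, l)) *
      (mpow m (?h \<theta>) k l j * cis (of_int (int Q - (int P - s)) * \<theta>))) =
      (\<Sum>l<m. \<Sum>s\<in>?B. cis (of_int s * \<theta>) * of_real (A N s \<omega> $$ (i, l)) *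
        (mpow m (?h \<theta>) k l j * cis (of_int (int Q - int P) * \<theta>)))"
      unfolding c by (subst sum.swap) (simp add: mult_ac)
    also have "\<dots> = mpow m (?h \<theta>) (Suc k) i j * cis (of_int (int Q - int P) * \<theta>)"
      unfolding mpow.simps sum_distrib_right hsym_def prod.case by (simp add: sum_distrib_right mult.assoc)
    finally show "(\<Sum>s\<in>?B. \<Sum>l<m. of_real (A N s \<omega> $$ (i, l)) *
      (mpow m (?h \<theta>) k l j * cis (of_int (int Q - (int P - s)) * \<theta>))) =
      mpow m (?h \<theta>) (Suc k) i j * cis (of_int (int Q - int P) * \<theta>)" .
  qed
  finally show ?case .
qed

text \<open>Expectation and integration over \<theta> are interchanged word by word: the integral of
  each coefficient is a constant, and what remains is a finite sum. The result no longer depends on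
  \<open>P\<close>.\<close>

lemma expectation_toep_deep:
  assumes "P < N" "k * b N \<le> P" "P + k * b N < N"
  shows "complex_of_real (2 * pi) * of_real (\<Sum>i<m. expectation (\<lambda>\<omega>. mpow (m * N) (toep N \<omega>) k (m * P + i) (m * P + i))) =
    (\<integral>\<theta>. wE k \<theta> \<partial>circ)"
proof -
  have lt: "m * P + i < m * N" if "i < m" for i
  proof -
    have "m * P + i < m * Suc P" using that by simp
    also have "\<dots> \<le> m * N" using assms(1) by (intro mult_left_mono) auto
    finally show ?thesis .
  qed
  define I where "I i w = (\<integral>\<theta>. wp m (ccoef N \<theta>) w i i \<partial>circ)" for i w
  have int: "integrable circ (\<lambda>\<theta>. wp m (ccoef N \<theta>) w i i)" for w i
    by (intro integrable_circ continuous_wp continuous_ccoef)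
  have pt: "complex_of_real (2 * pi * mpow (m * N) (toep N \<omega>) k (m * P + i) (m * P + i)) =
      (\<Sum>w\<in>words (keys N) k. I i w * of_real (F.wprod w \<omega>))" if \<omega>: "\<omega> \<in> space M" and i: "i < m" for \<omega> i
  proof -
    have "complex_of_real (2 * pi * mpow (m * N) (toep N \<omega>) k (m * P + i) (m * P + i)) =
        (\<integral>\<theta>. mpow m (hsym N \<theta> \<omega>) k i i \<partial>circ)"
      using mpow_toep_fourier[OF \<omega> assms(1) i assms(1) i assms(2,3)] by simp
    also have "\<dots> = (\<integral>\<theta>. (\<Sum>w\<in>words (keys N) k. wp m (ccoef N \<theta>) w i i * of_real (F.wprod w \<omega>)) \<partial>circ)"
      using mpow_cong[of m "hsym N _ \<omega>" "hlin N _ \<omega>" i k i] hsym_eq_hlin[OF \<omega>] i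
      by (intro Bochner_Integration.integral_cong refl) (simp add: mpow_hlin[symmetric])
    also have "\<dots> = (\<Sum>w\<in>words (keys N) k. I i w * of_real (F.wprod w \<omega>))"
      unfolding I_def using int by (subst Bochner_Integration.integral_sum) auto
    finally show ?thesis .
  qed
  have "complex_of_real (2 * pi) * of_real (\<Sum>i<m. expectation (\<lambda>\<omega>. mpow (m * N) (toep N \<omega>) k (m * P + i) (m * P + i))) =
      (\<Sum>i<m. (\<integral>\<omega>. complex_of_real (2 * pi * mpow (m * N) (toep N \<omega>) k (m * P + i) (m * P + i)) \<partial>M))"
    by (simp add: sum_distrib_left)
  also have "\<dots> = (\<Sum>i<m. \<Sum>w\<in>words (keys N) k. I i w * of_real (F.mom w))"
  proof (intro sum.cong refl)
    fix i assume "i \<in> {..<m}"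
    then have "(\<integral>\<omega>. complex_of_real (2 * pi * mpow (m * N) (toep N \<omega>) k (m * P + i) (m * P + i)) \<partial>M) =
        (\<integral>\<omega>. (\<Sum>w\<in>words (keys N) k. I i w * of_real (F.wprod w \<omega>)) \<partial>M)"
      by (intro Bochner_Integration.integral_cong refl pt) auto
    then show "(\<integral>\<omega>. complex_of_real (2 * pi * mpow (m * N) (toep N \<omega>) k (m * P + i) (m * P + i)) \<partial>M) =
        (\<Sum>w\<in>words (keys N) k. I i w * of_real (F.mom w))"
      by (simp only: F.expectation_sum_wprod)
  qed
  also have "\<dots> = (\<Sum>w\<in>words (keys N) k. (\<Sum>i<m. I i w) * of_real (F.mom w))"
    by (subst sum.swap) (simp add: sum_distrib_right)
  also have "\<dots> = (\<integral>\<theta>. wE k \<theta> \<partial>circ)"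
    unfolding wE_def I_def using int
    by (subst Bochner_Integration.integral_sum) (auto simp: Bochner_Integration.integral_sum)
  finally show ?thesis .
qed

end

end

subsection \<open>Convergence of the expected moments\<close>

context random_block_toeplitz_band
begin

lemma kapd_nonneg: "0 \<le> kapd n"
  unfolding kapd_def using dd_ge_1[of n] by simp

lemma nrm_tendsto_0:
  assumes "0 < m"
  shows "nrm \<longlonglongrightarrow> 0"
proof -
  have "filterlim (\<lambda>N. real (b N)) at_top sequentially"
    by (rule filterlim_compose[OF filterlim_real_sequentially bandwidth_at_top])
  then have "filterlim (\<lambda>N. 2 * real m * real (b N)) at_top sequentially"
    using assms by (intro filterlim_tendsto_pos_mult_at_top[OF tendsto_const]) auto
  then have "filterlim (\<lambda>N. sqrt (2 * real m * real (b N))) at_top sequentially"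
    by (rule filterlim_compose[OF sqrt_at_top])
  then show ?thesis
    unfolding nrm_def[abs_def]
    by (intro tendsto_divide_0[OF tendsto_const] filterlim_at_top_imp_at_infinity)
qed

lemma band_ratio_tendsto_0: "(\<lambda>N. real (b N) / real N) \<longlonglongrightarrow> 0"
  by (rule smalloD_tendsto[OF bandwidth_small])

text \<open>From such an N on, all offsets of the band occur in the matrix, so the symbol uses the
  full band. The limits below are therefore taken along the shifted index
  \<open>N + N0\<close>.\<close>

lemma eventually_band_less: "\<exists>N0. \<forall>N\<ge>N0. b N < N"
proof -
  have "\<forall>\<^sub>F N in sequentially. real (b N) / real N < 1"
    using band_ratio_tendsto_0 by (rule order_tendstoD) simp
  then have "\<forall>\<^sub>F N in sequentially. b N < N"
    using eventually_gt_at_top[of 0]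
    by eventually_elim (simp add: pos_divide_less_eq)
  then show ?thesis by (simp add: eventually_sequentially)
qed

context
  fixes N0 :: nat
  assumes m: "0 < m" and N0: "\<And>N. N0 \<le> N \<Longrightarrow> b N < N"
begin

lemma band_less: "b (N + N0) < N + N0"
  by (rule N0) simp

lemma nrm_shift_tendsto_0: "(\<lambda>N. nrm (N + N0)) \<longlonglongrightarrow> 0"
  by (rule LIMSEQ_ignore_initial_segment[OF nrm_tendsto_0[OF m]])

text \<open>\<open>Lw_wick\<close> gives Wick's rule with the covariances at level N; replacing them
  by \<open>gue_cov\<close> costs the error in \<open>Lw_cov\<close> times an expectation bounded by
  \<open>Lw_word_le\<close>.\<close>

lemma asymptotically_gue_Lw:
  assumes \<theta>: "cis (2 * \<theta>) \<noteq> 1"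
  shows "asymptotically_gue m (\<lambda>N. Lw (N + N0) \<theta>)"
proof
  show "0 < m" by (rule m)
  show "Lw (N + N0) \<theta> (\<lambda>x. \<Sum>p\<leftarrow>cs. fst p * prod_list (map x (snd p))) =
      (\<Sum>p\<leftarrow>cs. fst p * Lw (N + N0) \<theta> (\<lambda>x. prod_list (map x (snd p))))" for N cs
    by (rule Lw_lincomb[OF m band_less])
  show "Lw (N + N0) \<theta> (\<lambda>x. 1) = 1" for N
    by (rule Lw_one[OF m band_less])
next
  fix a w assume a: "a \<in> {..<m} \<times> {..<m}" and w: "set w \<subseteq> {..<m} \<times> {..<m}"
  let ?L = "\<lambda>N. Lw (N + N0) \<theta>"
  let ?n = "length w"
  let ?rest = "\<lambda>l. take l w @ drop (Suc l) w"
  let ?D = "2 / norm (1 - cis (2 * \<theta>)) + 2"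
  let ?B = "\<lambda>l. 2 ^ length (?rest l) * kapd (length (?rest l)) * real m ^ length (?rest l)"
  show "(\<lambda>N. ?L N (\<lambda>x. x a * prod_list (map x w)) -
       (\<Sum>l<?n. gue_cov m a (w ! l) * ?L N (\<lambda>x. prod_list (map x (?rest l))))) \<longlonglongrightarrow> 0"
  proof (rule Lim_null_comparison)
    show "\<forall>\<^sub>F N in sequentially. norm (?L N (\<lambda>x. x a * prod_list (map x w)) -
       (\<Sum>l<?n. gue_cov m a (w ! l) * ?L N (\<lambda>x. prod_list (map x (?rest l)))))
      \<le> wick_const ?n * nrm (N + N0) + (\<Sum>l<?n. (nrm (N + N0))\<^sup>2 * ?D * ?B l)"
    proof (intro always_eventually allI)
      fix N
      let ?M = "\<Sum>l<?n. ?L N (\<lambda>x. x a * x (w ! l)) * ?L N (\<lambda>x. prod_list (map x (?rest l)))"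
      let ?G = "\<Sum>l<?n. gue_cov m a (w ! l) * ?L N (\<lambda>x. prod_list (map x (?rest l)))"
      have MG: "?M - ?G = (\<Sum>l<?n. (?L N (\<lambda>x. x a * x (w ! l)) - gue_cov m a (w ! l)) *
          ?L N (\<lambda>x. prod_list (map x (?rest l))))"
        by (simp add: sum_subtractf left_diff_distrib)
      have "norm (?M - ?G) \<le> (\<Sum>l<?n. (nrm (N + N0))\<^sup>2 * ?D * ?B l)"
        unfolding MG
      proof (rule sum_norm_le)
        fix l assume "l \<in> {..<?n}"
        then have "w ! l \<in> {..<m} \<times> {..<m}" using w nth_mem by blast
        then obtain k j where kj: "w ! l = (k, j)" "k < m" "j < m" by auto
        obtain i i' where ii: "a = (i, i')" "i < m" "i' < m" using a by auto
        show "norm ((?L N (\<lambda>x. x a * x (w ! l)) - gue_cov m a (w ! l)) * ?L N (\<lambda>x. prod_list (map x (?rest l))))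
          \<le> (nrm (N + N0))\<^sup>2 * ?D * ?B l"
          unfolding norm_mult kj(1) ii(1)
          by (intro mult_mono Lw_cov[OF m band_less] Lw_word_le[OF m band_less] ii kj \<theta>) auto
      qed
      moreover have "norm (?L N (\<lambda>x. x a * prod_list (map x w)) - ?M) \<le> wick_const ?n * nrm (N + N0)"
        using Lw_wick[where N = "N + N0" and a = a and w = w and \<theta> = \<theta>, OF m band_less] .
      ultimately show "norm (?L N (\<lambda>x. x a * prod_list (map x w)) - ?G)
          \<le> wick_const ?n * nrm (N + N0) + (\<Sum>l<?n. (nrm (N + N0))\<^sup>2 * ?D * ?B l)"
        by (rule norm_diff_triangle_le[rotated])
    qed
    have "(\<lambda>N. wick_const ?n * nrm (N + N0) + (\<Sum>l<?n. (nrm (N + N0))\<^sup>2 * ?D * ?B l))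
        \<longlonglongrightarrow> wick_const ?n * 0 + (\<Sum>l<?n. 0\<^sup>2 * ?D * ?B l)"
      by (intro tendsto_intros nrm_shift_tendsto_0)
    then show "(\<lambda>N. wick_const ?n * nrm (N + N0) + (\<Sum>l<?n. (nrm (N + N0))\<^sup>2 * ?D * ?B l)) \<longlonglongrightarrow> 0"
      by simp
  qed
qed

lemma wE_tendsto:
  assumes "cis (2 * \<theta>) \<noteq> 1"
  shows "(\<lambda>N. of_real (nrm (N + N0)) ^ k * wE (N + N0) k \<theta>) \<longlonglongrightarrow> of_real (gue_moment m k)"
proof -
  interpret asymptotically_gue m "\<lambda>N. Lw (N + N0) \<theta>"
    by (rule asymptotically_gue_Lw[OF assms])
  show ?thesis using trace_moment_tendsto[of k] by (simp only: Lw_trace[OF m band_less])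
qed

text \<open>The exceptional angles are multiples of pi, a countable set.\<close>

lemma AE_circ_cis: "AE \<theta> in circ. cis (2 * \<theta>) \<noteq> 1"
proof -
  have "\<theta> \<in> range (\<lambda>n. of_int n * pi)" if "cis (2 * \<theta>) = 1" for \<theta>
  proof -
    have "cos (2 * \<theta>) = 1" using that by (simp add: complex_eq_iff)
    then obtain n :: int where "2 * \<theta> = of_int n * 2 * pi" by (auto simp: cos_one_2pi_int)
    then have "\<theta> = of_int n * pi" by simp
    then show ?thesis by blast
  qed
  moreover have "AE \<theta> in lborel. \<theta> \<notin> range (\<lambda>n. of_int n * pi)"
    by (rule AE_not_in, rule countable_imp_null_set_lborel) simp
  ultimately have "AE \<theta> in lborel. cis (2 * \<theta>) \<noteq> 1" by (auto elim!: eventually_mono)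
  then show ?thesis unfolding circ_def by (subst AE_restrict_space_iff) (auto elim!: eventually_mono)
qed

lemma integral_wE_tendsto:
  "(\<lambda>N. \<integral>\<theta>. of_real (nrm (N + N0)) ^ k * wE (N + N0) k \<theta> \<partial>circ) \<longlonglongrightarrow> 2 * pi * gue_moment m k"
proof -
  interpret circ: finite_measure circ by (rule finite_measure_circ)
  have "(\<lambda>N. \<integral>\<theta>. of_real (nrm (N + N0)) ^ k * wE (N + N0) k \<theta> \<partial>circ) \<longlonglongrightarrow>
      (\<integral>\<theta>. complex_of_real (gue_moment m k) \<partial>circ)"
  proof (rule integral_dominated_convergence)
    let ?C = "real m * (2 * real m) ^ k * kapd k * real m ^ k"
    show "integrable circ (\<lambda>_. ?C)" by simp
    show "(\<lambda>\<theta>. of_real (nrm (N + N0)) ^ k * wE (N + N0) k \<theta>) \<in> borel_measurable circ" for N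
      by (intro borel_measurable_integrable integrable_circ continuous_intros continuous_wE[OF m band_less])
    show "AE \<theta> in circ. (\<lambda>N. of_real (nrm (N + N0)) ^ k * wE (N + N0) k \<theta>) \<longlonglongrightarrow> of_real (gue_moment m k)"
      using AE_circ_cis by (rule eventually_mono) (rule wE_tendsto)
    show "AE \<theta> in circ. norm (of_real (nrm (N + N0)) ^ k * wE (N + N0) k \<theta>) \<le> ?C" for N
      by (intro always_eventually allI norm_wE_le[OF m band_less])
  qed simp
  moreover have "(\<integral>\<theta>. complex_of_real (gue_moment m k) \<partial>circ) = 2 * pi * gue_moment m k"
    using integral_circ_cis[of 0] by (simp add: scaleR_conv_of_real)
  ultimately show ?thesis by (simp only:)
qed

lemma expectation_trmom_eq:
  assumes "1 \<le> N"
  shows "expectation (trmom N k) =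
    (\<Sum>P<N. \<Sum>i<m. expectation (\<lambda>\<omega>. mpow (m * N) (toep N \<omega>) k (m * P + i) (m * P + i))) / real (m * N)"
proof -
  have "expectation (trmom N k) =
      (\<Sum>p<m * N. expectation (\<lambda>\<omega>. mpow (m * N) (toep N \<omega>) k p p)) / real (m * N)"
  proof -
    have "expectation (\<lambda>\<omega>. \<Sum>p<m * N. mpow (m * N) (toep N \<omega>) k p p) =
        (\<Sum>p<m * N. expectation (\<lambda>\<omega>. mpow (m * N) (toep N \<omega>) k p p))"
      by (rule Bochner_Integration.integral_sum) (rule integrable_mpow_toep[OF m assms], simp)
    then show ?thesis unfolding trmom_def[abs_def] integral_divide_zero by (simp only:)
  qed
  then show ?thesis unfolding sum_lessThan_mult .
qed

lemma card_boundary_le: "card {P. P < N \<and> \<not> (c \<le> P \<and> P + c < N)} \<le> 2 * (c :: nat)"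
proof -
  have "{P. P < N \<and> \<not> (c \<le> P \<and> P + c < N)} \<subseteq> {..<c} \<union> {N - c..<N}" by auto
  then have "card {P. P < N \<and> \<not> (c \<le> P \<and> P + c < N)} \<le> card ({..<c} \<union> {N - c..<N})"
    by (intro card_mono) auto
  also have "\<dots> \<le> card {..<c} + card {N - c..<N}" by (rule card_Un_le)
  also have "\<dots> \<le> 2 * c" by simp
  finally show ?thesis .
qed

text \<open>Only the \<open>O(k b\<^sub>N)\<close> block rows near the boundary deviate from the symbol.\<close>

lemma expectation_trmom_approx:
  fixes k :: nat
  defines "C1 \<equiv> real m * 2 ^ k * kapd k * real m ^ k"
    and "C2 \<equiv> real m * (2 * real m) ^ k * kapd k * real m ^ k"
  assumes N: "N0 \<le> N"
  shows "\<bar>nrm N ^ k * expectation (trmom N k) -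
      Re (\<integral>\<theta>. of_real (nrm N) ^ k * wE N k \<theta> \<partial>circ) / (2 * pi) / real m\<bar>
    \<le> 2 * real k * (C1 + C2) / real m * (real (b N) / real N)"
proof -
  interpret circ: finite_measure circ by (rule finite_measure_circ)
  have bN: "b N < N" by (rule N0[OF N])
  then have N1: "1 \<le> N" by simp
  define v where "v P = nrm N ^ k * (\<Sum>i<m. expectation (\<lambda>\<omega>. mpow (m * N) (toep N \<omega>) k (m * P + i) (m * P + i)))" for P
  define J where "J = Re (\<integral>\<theta>. of_real (nrm N) ^ k * wE N k \<theta> \<partial>circ) / (2 * pi)"
  let ?S = "{P. P < N \<and> \<not> (k * b N \<le> P \<and> P + k * b N < N)}"
  have deep: "v P = J" if "P < N" "P \<notin> ?S" for P
  proof -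
    have "2 * pi * (\<Sum>i<m. expectation (\<lambda>\<omega>. mpow (m * N) (toep N \<omega>) k (m * P + i) (m * P + i))) =
        Re (\<integral>\<theta>. wE N k \<theta> \<partial>circ)"
      using arg_cong[OF expectation_toep_deep[OF m bN that(1), of k], of Re] that by simp
    moreover have "(\<integral>\<theta>. complex_of_real (nrm N) ^ k * wE N k \<theta> \<partial>circ) = of_real (nrm N ^ k) * (\<integral>\<theta>. wE N k \<theta> \<partial>circ)"
      by simp
    ultimately show ?thesis unfolding v_def J_def
      by (simp only: Re_complex_of_real times_complex.sel) (simp add: field_simps)
  qed
  have v_le: "\<bar>v P\<bar> \<le> C1" if "P < N" for P
  proof -
    have "\<bar>expectation (\<lambda>\<omega>. mpow (m * N) (toep N \<omega>) k (m * P + i) (m * P + i))\<bar> \<le>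
        2 ^ k * kapd k * real (card (keys N)) ^ (k div 2)" if "i < m" for i
    proof -
      have "m * P + i < m * Suc P" using that by simp
      also have "\<dots> \<le> m * N" using \<open>P < N\<close> by (intro mult_left_mono) auto
      finally show ?thesis using expectation_mpow_toep_le[OF m N1] kap_eq[OF m bN] by simp
    qed
    then have "\<bar>\<Sum>i<m. expectation (\<lambda>\<omega>. mpow (m * N) (toep N \<omega>) k (m * P + i) (m * P + i))\<bar> \<le>
        (\<Sum>i<m. 2 ^ k * kapd k * real (card (keys N)) ^ (k div 2))"
      by (intro order_trans[OF sum_abs] sum_mono) auto
    then have "\<bar>v P\<bar> \<le> nrm N ^ k * (\<Sum>i<m. 2 ^ k * kapd k * real (card (keys N)) ^ (k div 2))"
      unfolding v_def abs_mult using nrm_pos[OF m N1] by (simp add: mult_left_mono)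
    also have "\<dots> = real m * 2 ^ k * kapd k * (nrm N ^ k * real (card (keys N)) ^ (k div 2))"
      by (simp add: mult_ac)
    also have "\<dots> \<le> C1"
      unfolding C1_def using kapd_nonneg by (intro mult_left_mono nrm_card[OF m N1] mult_nonneg_nonneg) auto
    finally show ?thesis .
  qed
  have J_le: "\<bar>J\<bar> \<le> C2"
  proof -
    have "norm (\<integral>\<theta>. of_real (nrm N) ^ k * wE N k \<theta> \<partial>circ) \<le> (\<integral>\<theta>. C2 \<partial>circ)"
    proof (rule Bochner_Integration.integral_norm_bound_integral)
      show "integrable circ (\<lambda>\<theta>. of_real (nrm N) ^ k * wE N k \<theta>)"
        by (intro integrable_circ continuous_intros continuous_wE[OF m bN])
      show "norm (of_real (nrm N) ^ k * wE N k \<theta>) \<le> C2" for \<theta>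
        unfolding C2_def by (rule norm_wE_le[OF m bN])
    qed simp
    also have "(\<integral>\<theta>. C2 \<partial>circ) = 2 * pi * C2"
      using integral_circ_cis[of 0] by (simp add: scaleR_conv_of_real flip: of_real_mult)
    finally have "\<bar>Re (\<integral>\<theta>. of_real (nrm N) ^ k * wE N k \<theta> \<partial>circ)\<bar> \<le> 2 * pi * C2"
      using abs_Re_le_cmod order_trans by blast
    then show ?thesis unfolding J_def by (simp add: field_simps)
  qed
  have "nrm N ^ k * expectation (trmom N k) - J / real m = (\<Sum>P<N. v P - J) / real (m * N)"
    unfolding expectation_trmom_eq[OF N1] v_def sum_subtractf sum_distrib_left[symmetric]
    using m N1 by (simp add: field_simps)
  also have "(\<Sum>P<N. v P - J) = (\<Sum>P\<in>?S. v P - J)"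
    by (rule sum.mono_neutral_right) (use deep in auto)
  finally have eq: "nrm N ^ k * expectation (trmom N k) - J / real m = (\<Sum>P\<in>?S. v P - J) / real (m * N)" .
  have "\<bar>(\<Sum>P\<in>?S. v P - J) / real (m * N)\<bar> \<le> (2 * real k * real (b N) * (C1 + C2)) / real (m * N)"
  proof -
    have C: "0 \<le> C1 + C2" using v_le[of 0] J_le bN by linarith
    have "\<bar>\<Sum>P\<in>?S. v P - J\<bar> \<le> (\<Sum>P\<in>?S. C1 + C2)"
    proof (rule order_trans[OF sum_abs sum_mono])
      fix P assume "P \<in> ?S"
      then show "\<bar>v P - J\<bar> \<le> C1 + C2" using v_le[of P] J_le by auto
    qed
    also have "\<dots> \<le> (2 * real k * real (b N)) * (C1 + C2)"
    proof -
      have "real (card ?S) \<le> real (2 * (k * b N))" by (rule of_nat_mono) (rule card_boundary_le)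
      then show ?thesis using C by (simp only: sum_constant) (auto intro!: mult_right_mono)
    qed
    finally show ?thesis by (simp add: abs_divide divide_right_mono)
  qed
  also have "\<dots> = 2 * real k * (C1 + C2) / real m * (real (b N) / real N)" by simp
  finally show ?thesis unfolding eq[symmetric] unfolding J_def .
qed

lemma expectation_trmom_tendsto:
  "(\<lambda>N. nrm N ^ k * expectation (trmom N k)) \<longlonglongrightarrow> gue_moment m k / real m"
proof -
  let ?J = "\<lambda>N. Re (\<integral>\<theta>. of_real (nrm N) ^ k * wE N k \<theta> \<partial>circ) / (2 * pi) / real m"
  define C where "C = 2 * real k * (real m * 2 ^ k * kapd k * real m ^ k +
    real m * (2 * real m) ^ k * kapd k * real m ^ k) / real m"
  have "(\<lambda>N. ?J (N + N0)) \<longlonglongrightarrow> Re (complex_of_real (2 * pi * gue_moment m k)) / (2 * pi) / real m"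
    by (intro tendsto_intros integral_wE_tendsto) (use m in auto)
  then have J: "?J \<longlonglongrightarrow> gue_moment m k / real m"
    using LIMSEQ_offset[of ?J N0] by simp
  have "(\<lambda>N. nrm N ^ k * expectation (trmom N k) - ?J N) \<longlonglongrightarrow> 0"
  proof (rule Lim_null_comparison)
    show "\<forall>\<^sub>F N in sequentially. norm (nrm N ^ k * expectation (trmom N k) - ?J N) \<le> C * (real (b N) / real N)"
      unfolding C_def real_norm_def
      by (rule eventually_sequentiallyI[of N0]) (rule expectation_trmom_approx)
    show "(\<lambda>N. C * (real (b N) / real N)) \<longlonglongrightarrow> 0"
      by (rule tendsto_mult_right_zero[OF band_ratio_tendsto_0])
  qed
  from tendsto_add[OF this J] show ?thesis by simp
qed

end

end

subsection \<open>Averaged and almost sure convergence\<close>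

text \<open>Separates the real and imaginary parts, so that the mixture in \<open>char_bind\<close>
  is integrated against bounded real functions.\<close>

lemma (in real_distribution) char_eq_cos_sin:
  "char M t = of_real (\<integral>x. cos (t * x) \<partial>M) + \<i> * of_real (\<integral>x. sin (t * x) \<partial>M)"
proof -
  have c: "integrable M (\<lambda>x. cos (t * x))"
    by (rule integrable_const_bound[where B = 1]) (simp_all add: borel_measurable_continuous_onI continuous_intros)
  have s: "integrable M (\<lambda>x. sin (t * x))"
    by (rule integrable_const_bound[where B = 1]) (simp_all add: borel_measurable_continuous_onI continuous_intros)
  have "char M t = (\<integral>x. of_real (cos (t * x)) + \<i> * of_real (sin (t * x)) \<partial>M)"
    unfolding char_def by (intro Bochner_Integration.integral_cong refl)
      (simp add: complex_eq_iff Re_exp Im_exp)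
  also have "\<dots> = of_real (\<integral>x. cos (t * x) \<partial>M) + \<i> * of_real (\<integral>x. sin (t * x) \<partial>M)"
    using c s by (subst Bochner_Integration.integral_add) simp_all
  finally show ?thesis .
qed

context prob_space
begin

context
  fixes K :: "'a \<Rightarrow> real measure"
  assumes K: "K \<in> measurable M (subprob_algebra borel)"
    and dist: "\<And>\<omega>. \<omega> \<in> space M \<Longrightarrow> real_distribution (K \<omega>)"
begin

lemma real_distribution_bind: "real_distribution (M \<bind> K)"
proof -
  have "prob_space (M \<bind> K)"
    by (rule prob_space_bind[OF _ K]) (use dist in \<open>auto simp: real_distribution_def\<close>)
  moreover have "sets (M \<bind> K) = sets borel"
    by (rule sets_bind) (use dist real_distribution.events_eq_borel not_empty in auto)
  ultimately show ?thesis
    by (simp add: real_distribution_def real_distribution_axioms_def)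
qed

lemma integrable_char_kernel: "integrable M (\<lambda>\<omega>. char (K \<omega>) t)"
proof (rule integrable_const_bound[where B = 1])
  show "AE \<omega> in M. norm (char (K \<omega>) t) \<le> 1"
    using dist real_distribution.cmod_char_le_1 by (intro AE_I2) blast
  show "(\<lambda>\<omega>. char (K \<omega>) t) \<in> borel_measurable M"
    unfolding char_def
    by (rule measurable_compose[OF K integral_measurable_subprob_algebra]) simp
qed

lemma char_bind: "char (M \<bind> K) t = (\<integral>\<omega>. char (K \<omega>) t \<partial>M)"
proof -
  interpret B: real_distribution "M \<bind> K" by (rule real_distribution_bind)
  have bind: "(\<integral>x. f x \<partial>(M \<bind> K)) = (\<integral>\<omega>. (\<integral>x. f x \<partial>K \<omega>) \<partial>M)"
    if "f \<in> borel_measurable borel" "\<And>x. \<bar>f x\<bar> \<le> 1" for f :: "real \<Rightarrow> real"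
  proof (rule integral_bind[where B = 1 and B' = 1 and K = borel])
    show "AE \<omega> in M. emeasure (K \<omega>) (space (K \<omega>)) \<le> ennreal 1"
      using dist by (intro AE_I2) (auto simp: real_distribution_def prob_space.emeasure_space_1)
  qed (use that K finite_measure_axioms in auto)
  have cm: "(\<lambda>x. cos (t * x)) \<in> borel_measurable borel" "(\<lambda>x. sin (t * x)) \<in> borel_measurable borel"
    by measurable
  have Re: "Re (char \<mu> t) = (\<integral>x. cos (t * x) \<partial>\<mu>)" and Im: "Im (char \<mu> t) = (\<integral>x. sin (t * x) \<partial>\<mu>)"
    if "real_distribution \<mu>" for \<mu>
    unfolding real_distribution.char_eq_cos_sin[OF that] by simp_all
  show ?thesis
  proof (rule complex_eqI)
    have "Re (\<integral>\<omega>. char (K \<omega>) t \<partial>M) = (\<integral>\<omega>. Re (char (K \<omega>) t) \<partial>M)"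
      by (rule integral_Re[symmetric, OF integrable_char_kernel])
    also have "\<dots> = (\<integral>\<omega>. (\<integral>x. cos (t * x) \<partial>K \<omega>) \<partial>M)"
      by (intro Bochner_Integration.integral_cong refl Re dist)
    also have "\<dots> = Re (char (M \<bind> K) t)"
      unfolding Re[OF real_distribution_bind] by (rule bind[symmetric]) (use cm in auto)
    finally show "Re (char (M \<bind> K) t) = Re (\<integral>\<omega>. char (K \<omega>) t \<partial>M)" by simp
    have "Im (\<integral>\<omega>. char (K \<omega>) t \<partial>M) = (\<integral>\<omega>. Im (char (K \<omega>) t) \<partial>M)"
      by (rule integral_Im[symmetric, OF integrable_char_kernel])
    also have "\<dots> = (\<integral>\<omega>. (\<integral>x. sin (t * x) \<partial>K \<omega>) \<partial>M)"
      by (intro Bochner_Integration.integral_cong refl Im dist)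
    also have "\<dots> = Im (char (M \<bind> K) t)"
      unfolding Im[OF real_distribution_bind] by (rule bind[symmetric]) (use cm in auto)
    finally show "Im (char (M \<bind> K) t) = Im (\<integral>\<omega>. char (K \<omega>) t \<partial>M)" by simp
  qed
qed

end

text \<open>Borel-Cantelli in integrated form: the sum of the p-th powers has finite expectation,
  hence it is finite almost surely and its terms tend to zero.\<close>

lemma AE_tendsto_0_of_summable_moments:
  fixes X :: "nat \<Rightarrow> 'a \<Rightarrow> real"
  assumes int: "\<And>n. integrable M (\<lambda>\<omega>. X n \<omega> ^ p)" and p: "even p" "0 < p"
    and le: "\<And>n. expectation (\<lambda>\<omega>. X n \<omega> ^ p) \<le> c n" and c: "summable c"
  shows "AE \<omega> in M. (\<lambda>n. X n \<omega>) \<longlonglongrightarrow> 0"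
proof -
  have nn: "0 \<le> X n \<omega> ^ p" for n \<omega> using p(1) by (rule zero_le_even_power)
  have c0: "0 \<le> c n" for n
    by (rule order_trans[OF Bochner_Integration.integral_nonneg le]) (rule nn)
  have "(\<integral>\<^sup>+\<omega>. (\<Sum>n. ennreal (X n \<omega> ^ p)) \<partial>M) = (\<Sum>n. (\<integral>\<^sup>+\<omega>. ennreal (X n \<omega> ^ p) \<partial>M))"
    by (rule nn_integral_suminf) (use int in measurable)
  also have "\<dots> = (\<Sum>n. ennreal (expectation (\<lambda>\<omega>. X n \<omega> ^ p)))"
    by (intro arg_cong[where f = suminf] ext nn_integral_eq_integral int AE_I2 nn)
  also have "\<dots> \<le> (\<Sum>n. ennreal (c n))"
    by (intro suminf_le ennreal_leI le) auto
  also have "\<dots> = ennreal (suminf c)"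
    by (rule suminf_ennreal2[OF c0 c])
  finally have "(\<integral>\<^sup>+\<omega>. (\<Sum>n. ennreal (X n \<omega> ^ p)) \<partial>M) \<noteq> \<infinity>"
    using neq_top_trans[of "ennreal (suminf c)"] by simp
  moreover have "(\<lambda>\<omega>. \<Sum>n. ennreal (X n \<omega> ^ p)) \<in> borel_measurable M"
    using int by measurable
  ultimately have "AE \<omega> in M. (\<Sum>n. ennreal (X n \<omega> ^ p)) \<noteq> \<infinity>"
    by (intro nn_integral_noteq_infinite)
  then show ?thesis
  proof (rule eventually_mono)
    fix \<omega> assume "(\<Sum>n. ennreal (X n \<omega> ^ p)) \<noteq> \<infinity>"
    then have "summable (\<lambda>n. X n \<omega> ^ p)"
      by (intro summable_suminf_not_top nn) auto
    then have "(\<lambda>n. X n \<omega> ^ p) \<longlonglongrightarrow> 0" by (rule summable_LIMSEQ_zero)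
    then have "(\<lambda>n. root p (X n \<omega> ^ p)) \<longlonglongrightarrow> root p 0" by (rule tendsto_real_root)
    moreover have "root p (X n \<omega> ^ p) = \<bar>X n \<omega>\<bar>" for n
      using real_root_power_cancel[OF p(2) abs_ge_zero[of "X n \<omega>"]] p(1) by (simp add: power_even_abs)
    ultimately show "(\<lambda>n. X n \<omega>) \<longlonglongrightarrow> 0" by (simp add: tendsto_rabs_zero_cancel)
  qed
qed

end

text \<open>For N = 0 the matrix is empty and its empirical distribution is not a probability
  measure, so Levy's theorem is applied from N = 1 on.\<close>

lemma weak_conv_m_Suc: "weak_conv_m (\<lambda>n. \<mu> (Suc n)) \<nu> \<Longrightarrow> weak_conv_m \<mu> \<nu>"
  unfolding weak_conv_m_def weak_conv_def by (auto intro: LIMSEQ_imp_Suc)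

context random_block_toeplitz_band
begin

abbreviation nbt :: "nat \<Rightarrow> 'a \<Rightarrow> real mat" where
  "nbt \<equiv> normalized_block_toeplitz m b A"

definition nmom :: "nat \<Rightarrow> nat \<Rightarrow> 'a \<Rightarrow> real" where
  "nmom N k \<omega> = nrm N ^ k * trmom N k \<omega>"

lemma nbt_carrier: "nbt N \<omega> \<in> carrier_mat (m * N) (m * N)"
  by (simp add: normalized_block_toeplitz_def block_toeplitz_def)

lemma nbt_index: "p < m * N \<Longrightarrow> q < m * N \<Longrightarrow> nbt N \<omega> $$ (p, q) = nrm N * toep N \<omega> (p, q)"
  by (simp add: normalized_block_toeplitz_def block_toeplitz_def nrm_def toep_def)

lemma nbt_symmetric:
  assumes "1 \<le> N" "\<omega> \<in> space M" "p < m * N" "q < m * N"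
  shows "nbt N \<omega> $$ (p, q) = nbt N \<omega> $$ (q, p)"
proof -
  let ?s = "int (p div m) - int (q div m)"
  note bd = div_mod_bounds[OF assms(3,4)]
  have "A N (- ?s) \<omega> = transpose_mat (A N ?s \<omega>)"
    by (rule block_transpose[OF assms(1) bd(1) assms(2)])
  moreover have "A N ?s \<omega> \<in> carrier_mat m m"
    by (rule block_carrier[OF assms(1) bd(1) assms(2)])
  ultimately have "toep N \<omega> (q, p) = toep N \<omega> (p, q)"
    using bd by (simp add: toep_def)
  then show ?thesis using assms by (simp add: nbt_index)
qed

context
  assumes m: "0 < m"
begin

context
  fixes N :: nat
  assumes N: "1 \<le> N"
begin

lemma mN: "0 < m * N" using m N by simp

context
  fixes \<omega> assumes \<omega>: "\<omega> \<in> space M"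
begin

lemma length_eigenvalues: "length (eigenvalue_list (nbt N \<omega>)) = m * N"
  by (rule eigenvalue_list_symmetric(1)[OF nbt_carrier nbt_symmetric[OF N \<omega>]])

lemma power_sum_eigenvalues: "(\<Sum>e\<leftarrow>eigenvalue_list (nbt N \<omega>). e ^ k) = real (m * N) * nmom N k \<omega>"
proof -
  have "(\<Sum>e\<leftarrow>eigenvalue_list (nbt N \<omega>). e ^ k) = (\<Sum>i<m * N. mpow (m * N) (\<lambda>p. nbt N \<omega> $$ p) k i i)"
    by (rule eigenvalue_list_symmetric(2)[OF nbt_carrier nbt_symmetric[OF N \<omega>]])
  also have "\<dots> = (\<Sum>i<m * N. mpow (m * N) (\<lambda>p. nrm N * toep N \<omega> p) k i i)"
    by (intro sum.cong refl mpow_cong) (simp_all add: nbt_index)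
  also have "\<dots> = real (m * N) * nmom N k \<omega>"
    unfolding mpow_scale nmom_def trmom_def sum_distrib_left[symmetric] using mN by simp
  finally show ?thesis .
qed

lemma nbt_dim: "dim_row (nbt N \<omega>) = m * N"
  using nbt_carrier by (rule carrier_matD)

lemma real_distribution_nbt: "real_distribution (empirical_eigenvalue_distribution (nbt N \<omega>))"
  using prob_space_empirical[OF nbt_dim length_eigenvalues mN]
  by (simp add: real_distribution_def real_distribution_axioms_def empirical_eigenvalue_distribution_def)

lemma char_nbt_approx:
  "cmod (char (empirical_eigenvalue_distribution (nbt N \<omega>)) t -
      (\<Sum>k\<le>2 * K. ((\<i> * t) ^ k / fact k) * nmom N k \<omega>)) \<le>
    2 * \<bar>t\<bar> ^ (2 * K) / fact (2 * K) * nmom N (2 * K) \<omega>"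
proof -
  interpret E: real_distribution "empirical_eigenvalue_distribution (nbt N \<omega>)"
    by (rule real_distribution_nbt)
  have "E.expectation (\<lambda>x. x ^ k) = nmom N k \<omega>" for k
    using integral_empirical[OF nbt_dim length_eigenvalues mN, of "\<lambda>x. x ^ k"] mN
    by (simp add: power_sum_eigenvalues)
  moreover have "integrable (empirical_eigenvalue_distribution (nbt N \<omega>)) (\<lambda>x. x ^ k)" for k
    by (rule integrable_empirical[OF nbt_dim length_eigenvalues mN]) simp
  ultimately show ?thesis
    using E.char_approx1[of "2 * K" t] by (simp add: power_even_abs)
qed

end

lemma integrable_nmom: "integrable M (nmom N k)"
  unfolding nmom_def[abs_def] by (intro integrable_mult_right integrable_trmom[OF m N])

text \<open>Measurability of the sorted eigenvalues in \<omega> is not evident, but their power sums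
  are polynomials in the matrix entries, and \<open>measurable_sum_list_indicator\<close> passes
  from these to the kernel that \<open>bind\<close> mixes.\<close>

lemma measurable_nbt:
  "(\<lambda>\<omega>. empirical_eigenvalue_distribution (nbt N \<omega>)) \<in> measurable M (subprob_algebra borel)"
proof (rule measurable_subprob_algebra)
  fix \<omega> assume "\<omega> \<in> space M"
  then interpret E: real_distribution "empirical_eigenvalue_distribution (nbt N \<omega>)"
    by (rule real_distribution_nbt)
  show "subprob_space (empirical_eigenvalue_distribution (nbt N \<omega>))" by unfold_locales
  show "sets (empirical_eigenvalue_distribution (nbt N \<omega>)) = sets borel" by simp
next
  fix B :: "real set" assume B: "B \<in> sets borel"
  have pw: "(\<lambda>\<omega>. \<Sum>e\<leftarrow>eigenvalue_list (nbt N \<omega>). e ^ k) \<in> borel_measurable M" for k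
  proof -
    have "(\<lambda>\<omega>. real (m * N) * nmom N k \<omega>) \<in> borel_measurable M"
      using integrable_nmom[of k] by measurable
    then show ?thesis by (rule measurable_cong[THEN iffD2, rotated]) (rule power_sum_eigenvalues)
  qed
  have "(\<lambda>\<omega>. ennreal ((\<Sum>e\<leftarrow>eigenvalue_list (nbt N \<omega>). indicator B e) / real (m * N))) \<in> borel_measurable M"
    using measurable_sum_list_indicator[OF pw B] by measurable
  then show "(\<lambda>\<omega>. emeasure (empirical_eigenvalue_distribution (nbt N \<omega>)) B) \<in> borel_measurable M"
    by (rule measurable_cong[THEN iffD2, rotated])
      (rule emeasure_empirical[OF nbt_dim length_eigenvalues mN B])
qed

lemma real_distribution_eigenvalue: "real_distribution (eigenvalue_distribution M (nbt N))"
  unfolding eigenvalue_distribution_def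
  by (rule real_distribution_bind[OF measurable_nbt real_distribution_nbt])

text \<open>The Taylor bound for each \<omega> is averaged, so the moments enter as expectations of
  trace moments rather than as integrals of powers against the mixture.\<close>

lemma char_eigenvalue_approx:
  "cmod (char (eigenvalue_distribution M (nbt N)) t -
      (\<Sum>k\<le>2 * K. ((\<i> * t) ^ k / fact k) * expectation (nmom N k))) \<le>
    2 * \<bar>t\<bar> ^ (2 * K) / fact (2 * K) * expectation (nmom N (2 * K))"
proof -
  let ?c = "\<lambda>\<omega>. char (empirical_eigenvalue_distribution (nbt N \<omega>)) t"
  let ?a = "\<lambda>k. (\<i> * t) ^ k / fact k"
  have ic: "integrable M ?c"
    by (rule integrable_char_kernel[OF measurable_nbt real_distribution_nbt])
  have ia: "integrable M (\<lambda>\<omega>. ?a k * of_real (nmom N k \<omega>))" for k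
    by (intro integrable_mult_right integrable_of_real integrable_nmom)
  have iS: "integrable M (\<lambda>\<omega>. \<Sum>k\<le>2 * K. ?a k * of_real (nmom N k \<omega>))"
    by (rule Bochner_Integration.integrable_sum) (rule ia)
  have cb: "char (eigenvalue_distribution M (nbt N)) t = (\<integral>\<omega>. ?c \<omega> \<partial>M)"
    unfolding eigenvalue_distribution_def by (rule char_bind[OF measurable_nbt real_distribution_nbt])
  have "char (eigenvalue_distribution M (nbt N)) t - (\<Sum>k\<le>2 * K. ?a k * expectation (nmom N k)) =
      (\<integral>\<omega>. ?c \<omega> - (\<Sum>k\<le>2 * K. ?a k * of_real (nmom N k \<omega>)) \<partial>M)"
    unfolding cb Bochner_Integration.integral_diff[OF ic iS] Bochner_Integration.integral_sum[OF ia]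
    by simp
  moreover have "cmod (\<integral>\<omega>. ?c \<omega> - (\<Sum>k\<le>2 * K. ?a k * of_real (nmom N k \<omega>)) \<partial>M) \<le>
      (\<integral>\<omega>. 2 * \<bar>t\<bar> ^ (2 * K) / fact (2 * K) * nmom N (2 * K) \<omega> \<partial>M)"
  proof (rule order_trans[OF integral_norm_bound integral_mono])
    show "integrable M (\<lambda>\<omega>. cmod (?c \<omega> - (\<Sum>k\<le>2 * K. ?a k * of_real (nmom N k \<omega>))))"
      by (intro integrable_norm Bochner_Integration.integrable_diff ic iS)
    show "integrable M (\<lambda>\<omega>. 2 * \<bar>t\<bar> ^ (2 * K) / fact (2 * K) * nmom N (2 * K) \<omega>)"
      by (intro integrable_mult_right integrable_nmom)
  qed (rule char_nbt_approx)
  ultimately show ?thesis by (simp only: integral_mult_right_zero)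
qed

text \<open>The normalization to the power 8k is of order b^{-4k}, against b^{4k-2} from the number
  of variables in \<open>trmom_concentration\<close>; the difference is the summable b^{-2}.\<close>

lemma nmom_concentration:
  assumes k: "1 \<le> k"
  shows "integrable M (\<lambda>\<omega>. (nmom N k \<omega> - expectation (nmom N k)) ^ 8)"
    and "expectation (\<lambda>\<omega>. (nmom N k \<omega> - expectation (nmom N k)) ^ 8) \<le>
      \<bar>centered_family.conc_const dd k (2 ^ k)\<bar> * real m ^ (4 * k) * (1 / (real (b N))\<^sup>2)"
proof -
  let ?C = "centered_family.conc_const dd k (2 ^ k)"
  let ?V = "\<lambda>\<omega>. (trmom N k \<omega> - expectation (trmom N k)) ^ 8"
  have bN: "0 < b N" using bandwidth_pos[OF N] by simp
  have e: "(nmom N k \<omega> - expectation (nmom N k)) ^ 8 = nrm N ^ (8 * k) * ?V \<omega>" for \<omega>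
    unfolding nmom_def[abs_def] integral_mult_right_zero right_diff_distrib[symmetric] power_mult_distrib
    by (simp add: power_mult[symmetric] mult.commute)
  show "integrable M (\<lambda>\<omega>. (nmom N k \<omega> - expectation (nmom N k)) ^ 8)"
    unfolding e by (intro integrable_mult_right trmom_concentration(1)[OF m N k])
  have "expectation (\<lambda>\<omega>. (nmom N k \<omega> - expectation (nmom N k)) ^ 8) = nrm N ^ (8 * k) * expectation ?V"
    unfolding e by (rule integral_mult_right_zero)
  also have "\<dots> \<le> nrm N ^ (8 * k) * (\<bar>?C\<bar> * real (2 * m\<^sup>2 * b N) ^ (4 * k - 2))"
  proof (rule mult_left_mono)
    have "expectation ?V \<le> ?C * real (card (keys N)) ^ (4 * k - 2)"
      by (rule trmom_concentration(2)[OF m N k])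
    also have "\<dots> \<le> \<bar>?C\<bar> * real (2 * m\<^sup>2 * b N) ^ (4 * k - 2)"
      by (intro mult_mono power_mono of_nat_mono card_keys_le N) auto
    finally show "expectation ?V \<le> \<bar>?C\<bar> * real (2 * m\<^sup>2 * b N) ^ (4 * k - 2)" .
  qed (use nrm_pos[OF m N] in simp)
  also have "nrm N ^ (8 * k) = ((nrm N)\<^sup>2) ^ (4 * k)"
    by (simp add: power_mult[symmetric])
  also have "\<dots> = (1 / (2 * real m * real (b N))) ^ (4 * k - 2) * (1 / (2 * real m * real (b N)))\<^sup>2"
  proof -
    have "4 * k - 2 + 2 = 4 * k" using k by simp
    then show ?thesis unfolding nrm_power2[OF m N] power_add[symmetric] by (simp only:)
  qed
  also have "\<dots> * (\<bar>?C\<bar> * real (2 * m\<^sup>2 * b N) ^ (4 * k - 2)) =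
      \<bar>?C\<bar> * (1 / (2 * real m * real (b N)) * real (2 * m\<^sup>2 * b N)) ^ (4 * k - 2) * (1 / (2 * real m * real (b N)))\<^sup>2"
    unfolding power_mult_distrib by (simp only: mult_ac)
  also have "1 / (2 * real m * real (b N)) * real (2 * m\<^sup>2 * b N) = real m"
    using m bN by (simp add: power2_eq_square)
  also have "\<bar>?C\<bar> * real m ^ (4 * k - 2) * (1 / (2 * real m * real (b N)))\<^sup>2 \<le>
      \<bar>?C\<bar> * real m ^ (4 * k) * (1 / (real (b N))\<^sup>2)"
  proof (intro mult_mono)
    show "real m ^ (4 * k - 2) \<le> real m ^ (4 * k)" using m by (intro power_increasing) auto
    have "1 * real (b N) \<le> 2 * real m * real (b N)" using m by (intro mult_right_mono) auto
    then have "real (b N) \<le> 2 * real m * real (b N)" by simp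
    then have "1 / (2 * real m * real (b N)) \<le> 1 / real (b N)"
      using bN m by (intro divide_left_mono) auto
    then have "(1 / (2 * real m * real (b N)))\<^sup>2 \<le> (1 / real (b N))\<^sup>2" by (intro power_mono) auto
    then show "(1 / (2 * real m * real (b N)))\<^sup>2 \<le> 1 / (real (b N))\<^sup>2" by (simp add: power_divide)
  qed auto
  finally show "expectation (\<lambda>\<omega>. (nmom N k \<omega> - expectation (nmom N k)) ^ 8) \<le>
      \<bar>?C\<bar> * real m ^ (4 * k) * (1 / (real (b N))\<^sup>2)" .
qed

end

lemma expectation_nmom_tendsto: "(\<lambda>N. expectation (nmom N k)) \<longlonglongrightarrow> gue_moment m k / real m"
proof -
  obtain N0 where "\<And>N. N0 \<le> N \<Longrightarrow> b N < N" using eventually_band_less by blast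
  from expectation_trmom_tendsto[OF m this] show ?thesis
    unfolding nmom_def[abs_def] by simp
qed

theorem eigenvalue_distribution_weak_conv:
  "weak_conv_m (\<lambda>N. eigenvalue_distribution M (nbt N)) (limit_distribution m)"
proof (rule weak_conv_m_Suc, rule weak_conv_limit_distribution[OF m])
  show "real_distribution (eigenvalue_distribution M (nbt (Suc n)))" for n
    by (rule real_distribution_eigenvalue) simp
  show "(\<lambda>n. expectation (nmom (Suc n) k)) \<longlonglongrightarrow> gue_moment m k / real m" for k
    by (rule LIMSEQ_Suc[OF expectation_nmom_tendsto])
  show "cmod (char (eigenvalue_distribution M (nbt (Suc n))) t -
      (\<Sum>k\<le>2 * K. ((\<i> * t) ^ k / fact k) * expectation (nmom (Suc n) k))) \<le>
    2 * \<bar>t\<bar> ^ (2 * K) / fact (2 * K) * expectation (nmom (Suc n) (2 * K))" for n K t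
    by (rule char_eigenvalue_approx) simp
qed

theorem AE_empirical_weak_conv:
  assumes "summable (\<lambda>N. 1 / (real (b (Suc N)))\<^sup>2)"
  shows "AE \<omega> in M. weak_conv_m (\<lambda>N. empirical_eigenvalue_distribution (nbt N \<omega>)) (limit_distribution m)"
proof -
  have "AE \<omega> in M. (\<lambda>n. nmom (Suc n) k \<omega> - expectation (nmom (Suc n) k)) \<longlonglongrightarrow> 0" for k
  proof (cases "1 \<le> k")
    case True
    show ?thesis
      by (rule AE_tendsto_0_of_summable_moments[where p = 8, OF nmom_concentration(1) _ _ nmom_concentration(2)])
        (use True in \<open>simp_all only: summable_mult[OF assms]\<close>, simp_all)
  next
    case False
    then have "k = 0" by simp
    then have "nmom (Suc n) k \<omega> - expectation (nmom (Suc n) k) = 0" for n \<omega>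
      by (simp add: nmom_def[abs_def] trmom_def[abs_def] prob_space)
    then show ?thesis by simp
  qed
  \<comment> \<open>There are countably many orders k, so one null set serves all of them.\<close>
  then have "AE \<omega> in M. \<forall>k. (\<lambda>n. nmom (Suc n) k \<omega> - expectation (nmom (Suc n) k)) \<longlonglongrightarrow> 0"
    by (simp add: AE_all_countable)
  then show ?thesis
  proof (rule AE_mp, intro AE_I2 impI)
    fix \<omega> assume \<omega>: "\<omega> \<in> space M"
      and lim: "\<forall>k. (\<lambda>n. nmom (Suc n) k \<omega> - expectation (nmom (Suc n) k)) \<longlonglongrightarrow> 0"
    show "weak_conv_m (\<lambda>N. empirical_eigenvalue_distribution (nbt N \<omega>)) (limit_distribution m)"
    proof (rule weak_conv_m_Suc, rule weak_conv_limit_distribution[OF m])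
      show "real_distribution (empirical_eigenvalue_distribution (nbt (Suc n) \<omega>))" for n
        by (rule real_distribution_nbt[OF _ \<omega>]) simp
      show "(\<lambda>n. nmom (Suc n) k \<omega>) \<longlonglongrightarrow> gue_moment m k / real m" for k
        using tendsto_add[OF lim[rule_format, of k] LIMSEQ_Suc[OF expectation_nmom_tendsto[of k]]] by simp
      show "cmod (char (empirical_eigenvalue_distribution (nbt (Suc n) \<omega>)) t -
          (\<Sum>k\<le>2 * K. ((\<i> * t) ^ k / fact k) * nmom (Suc n) k \<omega>)) \<le>
        2 * \<bar>t\<bar> ^ (2 * K) / fact (2 * K) * nmom (Suc n) (2 * K) \<omega>" for n K t
        by (rule char_nbt_approx[OF _ \<omega>]) simp
    qed
  qed
qed

end

end

theorem theorem1p1: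
  fixes M :: "nat \<Rightarrow> 'a measure"
    and b :: "nat \<Rightarrow> nat"
    and A :: "nat \<Rightarrow> nat \<Rightarrow> int \<Rightarrow> 'a \<Rightarrow> real mat"
    and m :: nat
  assumes model: "\<And>l. 1 \<le> l \<Longrightarrow> random_block_toeplitz_band (M l) l b (A l)"
    and uniform_moments: "\<And>k. 1 \<le> k \<Longrightarrow> (\<Squnion>l\<in>{1..}. moment_sup (M l) l (A l) k) < \<top>"
    and m_pos: "1 \<le> m"
  shows "weak_conv_m
           (\<lambda>N. eigenvalue_distribution (M m) (normalized_block_toeplitz m b (A m) N))
           (limit_distribution m) \<and>
         (summable (\<lambda>N. 1 / (real (b (Suc N)))\<^sup>2) \<longrightarrow>
          (AE \<omega> in M m. weak_conv_m
             (\<lambda>N. empirical_eigenvalue_distribution (normalized_block_toeplitz m b (A m) N \<omega>))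
             (limit_distribution m)))"
proof -
  interpret random_block_toeplitz_band "M m" m b "A m"
    by (rule model[OF m_pos])
  show ?thesis
    using m_pos eigenvalue_distribution_weak_conv AE_empirical_weak_conv by auto
qed


end
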